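(* Let $M$ be an oriented $m$-dimensional manifold with volume form $\mu$, and suppose $\nu\in\Omega^{m-1}(M)$ satisfies $d\nu=\mu$. Let $\mathcal{O}$ be a $\mathrm{Diff}_0(M)$-orbit in the space $\mathrm{Gr}^{\rm ex}_{m-2}(M)$ of exact codimension-2 submanifolds of $M$, and let $\omega^{\rm MW}\in\Omega^2(\mathcal{O})$ be the Marsden–Weinstein form $\omega^{\rm MW}_\gamma(X^u_\gamma,X^v_\gamma)=\int_\gamma\iota_v\iota_u\mu$. Then the 1-form $\eta\in\Omega^1(\mathcal{O})$ defined by $$\eta_\gamma(X^u_\gamma)=\int_\gamma\iota_u\nu,\qquad u\in\Gamma(TM),$$ satisfies $d\eta=\omega^{\rm MW}$.
   Context: $\mathrm{Gr}_k(M)=\bigsqcup_S\mathrm{Emb}(S;M)/\mathrm{Diff}^+(S)$, the union over diffeomorphism classes of compact oriented $k$-manifolds $S$, with the Fréchet $C^\infty$ manifold structure; $\mathrm{Gr}^{\rm ex}_{m-2}(M)=\partial\,\mathrm{Gr}_{m-1}(M)$. $\mathrm{Diff}_0(M)$, the identity component of the diffeomorphism group, acts by $(f,\gamma)\mapsto f\circ\gamma$, and its orbits are the connected components. For $u\in\Gamma(TM)$, $X^u\in\Gamma(T\mathcal{O})$ is the fundamental vector field $X^u_\gamma=u\circ\gamma\in T_\gamma\mathcal{O}$ (the class of $u$ along $\gamma$ modulo fields tangential to $\gamma$); every element of $T_\gamma\mathcal{O}$ is of the form $X^u_\gamma$. *)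

theory Defs
  imports "HOL-Analysis.Analysis" "Jordan_Normal_Form.Determinant"
begin

section \<open>Smooth functions on subsets of coordinate space\<close>

text \<open>
  Dimensions have to be ordinary natural numbers (including \<open>0\<close>: codimension-2 submanifolds of
  surfaces are signed points), so \<open>n\<close>-dimensional coordinate space is the carrier of the library's
  \<^const>\<open>Euclidean_space\<close>, i.e. sequences that vanish from index \<open>n\<close> on.
\<close>

definition Rn :: "nat \<Rightarrow> (nat \<Rightarrow> real) set"
  where "Rn n = topspace (Euclidean_space n)"

definition Hn :: "nat \<Rightarrow> (nat \<Rightarrow> real) set"
  where "Hn n = {x \<in> Rn n. x 0 \<le> 0}"

text \<open>
  The partial derivative is taken within \<open>A\<close>: ordinary if \<open>A\<close> is open in \<^term>\<open>Rn n\<close>, one-sided at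
  boundary points if \<open>A\<close> is open in \<^term>\<open>Hn n\<close>.
\<close>

definition pd :: "(nat \<Rightarrow> real) set \<Rightarrow> nat \<Rightarrow> ((nat \<Rightarrow> real) \<Rightarrow> real) \<Rightarrow> (nat \<Rightarrow> real) \<Rightarrow> real"
  where "pd A i f x =
    vector_derivative (\<lambda>t. f (x(i := t))) (at (x i) within {t. x(i := t) \<in> A})"

definition pds :: "(nat \<Rightarrow> real) set \<Rightarrow> nat list \<Rightarrow> ((nat \<Rightarrow> real) \<Rightarrow> real) \<Rightarrow> (nat \<Rightarrow> real) \<Rightarrow> real"
  where "pds A js f = foldr (pd A) js f"

primrec Ck :: "nat \<Rightarrow> (nat \<Rightarrow> real) set \<Rightarrow> nat \<Rightarrow> ((nat \<Rightarrow> real) \<Rightarrow> real) \<Rightarrow> bool" where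
  "Ck n A 0 f \<longleftrightarrow> continuous_on A f"
| "Ck n A (Suc r) f \<longleftrightarrow> continuous_on A f \<and>
     (\<forall>i<n. (\<forall>x\<in>A. (\<lambda>t. f (x(i := t))) differentiable (at (x i) within {t. x(i := t) \<in> A})) \<and>
            Ck n A r (pd A i f))"

definition Cinf :: "nat \<Rightarrow> (nat \<Rightarrow> real) set \<Rightarrow> ((nat \<Rightarrow> real) \<Rightarrow> real) \<Rightarrow> bool"
  where "Cinf n A f \<longleftrightarrow>
    (\<forall>x\<in>A. \<exists>V g. openin (Euclidean_space n) V \<and> x \<in> V \<and> (\<forall>r. Ck n V r g) \<and> (\<forall>y\<in>A \<inter> V. g y = f y))"


section \<open>Oriented smooth manifolds, with or without boundary\<close>

type_synonym 'a chart = "'a set \<times> ('a \<Rightarrow> nat \<Rightarrow> real)"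

text \<open>
  \<open>morient M c p\<close> is \<open>1\<close> or \<open>-1\<close> according to whether the chart \<open>c\<close> is positive at \<open>p\<close>. Giving a
  sign to every chart, instead of selecting positive charts, also covers dimension \<open>0\<close> and boundary
  charts in dimension \<open>1\<close>.
\<close>

record 'a smfd =
  mtop :: "'a topology"
  mdim :: nat
  matlas :: "'a chart set"
  morient :: "'a chart \<Rightarrow> 'a \<Rightarrow> real"

definition cinv :: "'a chart \<Rightarrow> (nat \<Rightarrow> real) \<Rightarrow> 'a"
  where "cinv c = inv_into (fst c) (snd c)"

text \<open>The local representative of \<open>f\<close> in charts \<open>c\<close> and \<open>d\<close>, its domain, and its Jacobi matrix at \<open>p\<close>.\<close>

definition lrep :: "'a chart \<Rightarrow> 'b chart \<Rightarrow> ('a \<Rightarrow> 'b) \<Rightarrow> (nat \<Rightarrow> real) \<Rightarrow> nat \<Rightarrow> real"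
  where "lrep c d f y = snd d (f (cinv c y))"

definition ldom :: "'a chart \<Rightarrow> 'b chart \<Rightarrow> ('a \<Rightarrow> 'b) \<Rightarrow> (nat \<Rightarrow> real) set"
  where "ldom c d f = snd c ` {p \<in> fst c. f p \<in> fst d}"

definition ljac :: "'a chart \<Rightarrow> 'b chart \<Rightarrow> ('a \<Rightarrow> 'b) \<Rightarrow> 'a \<Rightarrow> nat \<Rightarrow> nat \<Rightarrow> real"
  where "ljac c d f p i j = pd (ldom c d f) j (\<lambda>y. lrep c d f y i) (snd c p)"

definition jdet :: "nat \<Rightarrow> 'a chart \<Rightarrow> 'b chart \<Rightarrow> ('a \<Rightarrow> 'b) \<Rightarrow> 'a \<Rightarrow> real"
  where "jdet n c d f p = Determinant.det (Matrix.mat n n (\<lambda>(i, j). ljac c d f p i j))"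

definition lsmooth :: "nat \<Rightarrow> nat \<Rightarrow> 'a chart \<Rightarrow> 'b chart \<Rightarrow> ('a \<Rightarrow> 'b) \<Rightarrow> bool"
  where "lsmooth n m c d f \<longleftrightarrow> (\<forall>i<m. Cinf n (ldom c d f) (\<lambda>y. lrep c d f y i))"

definition is_chart :: "(nat \<Rightarrow> real) set \<Rightarrow> 'a topology \<Rightarrow> 'a chart \<Rightarrow> bool"
  where "is_chart Q X c \<longleftrightarrow> openin X (fst c) \<and> openin (top_of_set Q) (snd c ` fst c) \<and>
    homeomorphic_map (subtopology X (fst c)) (top_of_set (snd c ` fst c)) (snd c)"

definition chart_compat :: "nat \<Rightarrow> 'a chart \<Rightarrow> 'a chart \<Rightarrow> bool"
  where "chart_compat n c d \<longleftrightarrow> lsmooth n n c d (\<lambda>p. p) \<and> lsmooth n n d c (\<lambda>p. p)"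

definition max_atlas :: "(nat \<Rightarrow> real) set \<Rightarrow> 'a topology \<Rightarrow> nat \<Rightarrow> 'a chart set \<Rightarrow> 'a chart set"
  where "max_atlas Q X n A = {c. is_chart Q X c \<and> (\<forall>d\<in>A. chart_compat n c d)}"

text \<open>
  The parameter \<open>Q\<close> is \<^const>\<open>Rn\<close> for manifolds without boundary and \<^const>\<open>Hn\<close> for manifolds with
  (possibly empty) boundary. The fourth conjunct says that the atlas consists of pairwise
  compatible charts and is maximal.
\<close>

definition oriented_mfd :: "(nat \<Rightarrow> (nat \<Rightarrow> real) set) \<Rightarrow> 'a smfd \<Rightarrow> bool"
  where "oriented_mfd Q M \<longleftrightarrow>
    Hausdorff_space (mtop M) \<and> second_countable (mtop M) \<and>
    topspace (mtop M) \<subseteq> (\<Union>c\<in>matlas M. fst c) \<and>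
    matlas M = max_atlas (Q (mdim M)) (mtop M) (mdim M) (matlas M) \<and>
    (\<forall>c\<in>matlas M.
       (\<forall>p\<in>fst c. morient M c p \<in> {1, -1}) \<and>
       continuous_map (subtopology (mtop M) (fst c)) euclideanreal (morient M c)) \<and>
    (\<forall>c\<in>matlas M. \<forall>d\<in>matlas M. \<forall>p\<in>fst c \<inter> fst d.
       morient M d p = sgn (jdet (mdim M) c d (\<lambda>p. p) p) * morient M c p)"

definition smooth_map :: "'a smfd \<Rightarrow> 'b smfd \<Rightarrow> ('a \<Rightarrow> 'b) \<Rightarrow> bool"
  where "smooth_map M N f \<longleftrightarrow> continuous_map (mtop M) (mtop N) f \<and>
    (\<forall>c\<in>matlas M. \<forall>d\<in>matlas N. lsmooth (mdim M) (mdim N) c d f)"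

definition diffeo :: "'a smfd \<Rightarrow> 'b smfd \<Rightarrow> ('a \<Rightarrow> 'b) \<Rightarrow> bool"
  where "diffeo M N f \<longleftrightarrow> bij_betw f (topspace (mtop M)) (topspace (mtop N)) \<and>
    smooth_map M N f \<and> smooth_map N M (inv_into (topspace (mtop M)) f)"

definition oriented_diffeo :: "'a smfd \<Rightarrow> 'b smfd \<Rightarrow> ('a \<Rightarrow> 'b) \<Rightarrow> bool"
  where "oriented_diffeo M N f \<longleftrightarrow> diffeo M N f \<and>
    (\<forall>c\<in>matlas M. \<forall>d\<in>matlas N. \<forall>p\<in>fst c. f p \<in> fst d \<longrightarrow>
       morient M c p = sgn (jdet (mdim M) c d f p) * morient N d (f p))"

text \<open>
  The boundary is oriented by the outward-normal-first convention. As \<^const>\<open>Hn\<close> is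
  \<open>{x 0 \<le> 0}\<close>, the outward direction is the zeroth one, so the chart induced by \<open>c\<close> has the same
  sign as \<open>c\<close>.
\<close>

definition bdry :: "'a smfd \<Rightarrow> 'a set"
  where "bdry W = {p. \<exists>c\<in>matlas W. p \<in> fst c \<and> snd c p 0 = 0}"

definition bchart :: "'a smfd \<Rightarrow> 'a chart \<Rightarrow> 'a chart"
  where "bchart W c = (fst c \<inter> bdry W, \<lambda>p i. snd c p (Suc i))"

definition boundary_mfd :: "'a smfd \<Rightarrow> 'a smfd"
  where "boundary_mfd W =
    \<lparr>mtop = subtopology (mtop W) (bdry W),
     mdim = mdim W - 1,
     matlas = max_atlas (Rn (mdim W - 1)) (subtopology (mtop W) (bdry W)) (mdim W - 1)
                (bchart W ` matlas W),
     morient = (\<lambda>b p. let c = (SOME c. c \<in> matlas W \<and> p \<in> fst c)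
                in sgn (jdet (mdim W - 1) (bchart W c) b (\<lambda>p. p) p) * morient W c p)\<rparr>"


section \<open>Tangent vectors and differential forms\<close>

text \<open>
  A tangent vector at \<open>p\<close> is the family of its coordinate vectors in all charts around \<open>p\<close>, related
  by the Jacobi matrices of the transition maps (and \<open>0\<close> at all other arguments).
\<close>

type_synonym 'a tvec = "'a chart \<Rightarrow> nat \<Rightarrow> real"

definition tspace :: "'a smfd \<Rightarrow> 'a \<Rightarrow> 'a tvec set"
  where "tspace M p = {v.
    (\<forall>c. (c \<notin> matlas M \<or> p \<notin> fst c) \<longrightarrow> v c = (\<lambda>_. 0)) \<and>
    (\<forall>c\<in>matlas M. v c \<in> Rn (mdim M)) \<and>
    (\<forall>c\<in>matlas M. \<forall>d\<in>matlas M. p \<in> fst c \<inter> fst d \<longrightarrow>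
       (\<forall>i<mdim M. v d i = (\<Sum>j<mdim M. ljac c d (\<lambda>p. p) p i j * v c j)))}"

definition chart_at :: "'a smfd \<Rightarrow> 'a \<Rightarrow> 'a chart"
  where "chart_at M p = (SOME c. c \<in> matlas M \<and> p \<in> fst c)"

text \<open>The tangent map of \<open>f\<close> at \<open>x\<close>; by the chain rule the choice of chart is immaterial.\<close>

definition tmap :: "'s smfd \<Rightarrow> 'a smfd \<Rightarrow> ('s \<Rightarrow> 'a) \<Rightarrow> 's \<Rightarrow> 's tvec \<Rightarrow> 'a tvec"
  where "tmap S M f x w = (\<lambda>d. if d \<in> matlas M \<and> f x \<in> fst d
    then (\<lambda>i. \<Sum>j<mdim S. ljac (chart_at S x) d f x i j * w (chart_at S x) j)
    else (\<lambda>_. 0))"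

text \<open>\<open>cvec M c p v\<close> is the tangent vector at \<open>p\<close> with coordinate vector \<open>v\<close> in the chart \<open>c\<close>.\<close>

definition cvec :: "'a smfd \<Rightarrow> 'a chart \<Rightarrow> 'a \<Rightarrow> (nat \<Rightarrow> real) \<Rightarrow> 'a tvec"
  where "cvec M c p v = (\<lambda>d. if d \<in> matlas M \<and> p \<in> fst d
    then (\<lambda>i. \<Sum>j<mdim M. ljac c d (\<lambda>p. p) p i j * v j)
    else (\<lambda>_. 0))"

definition cbasis :: "'a smfd \<Rightarrow> 'a chart \<Rightarrow> 'a \<Rightarrow> nat \<Rightarrow> 'a tvec"
  where "cbasis M c p j = cvec M c p (\<lambda>i. if i = j then 1 else 0)"

definition velocity :: "'a smfd \<Rightarrow> (real \<Rightarrow> 'a) \<Rightarrow> 'a tvec"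
  where "velocity M \<sigma> = (\<lambda>d. if d \<in> matlas M \<and> \<sigma> 0 \<in> fst d
    then (\<lambda>i. deriv (\<lambda>t. snd d (\<sigma> t) i) 0) else (\<lambda>_. 0))"

text \<open>Smooth sections of the pullback of the tangent bundle of \<open>M\<close> along \<open>\<gamma>\<close>.\<close>

definition field_along :: "'s smfd \<Rightarrow> 'a smfd \<Rightarrow> ('s \<Rightarrow> 'a) \<Rightarrow> ('s \<Rightarrow> 'a tvec) \<Rightarrow> bool"
  where "field_along S M \<gamma> \<xi> \<longleftrightarrow>
    (\<forall>x\<in>topspace (mtop S). \<xi> x \<in> tspace M (\<gamma> x)) \<and>
    (\<forall>c\<in>matlas S. \<forall>d\<in>matlas M. \<forall>i<mdim M. Cinf (mdim S) (ldom c d \<gamma>) (\<lambda>y. \<xi> (cinv c y) d i))"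

definition vector_field :: "'a smfd \<Rightarrow> ('a \<Rightarrow> 'a tvec) \<Rightarrow> bool"
  where "vector_field M u \<longleftrightarrow> field_along M M (\<lambda>p. p) u"

type_synonym 'a form = "'a \<Rightarrow> 'a tvec list \<Rightarrow> real"

definition diff_form :: "'a smfd \<Rightarrow> nat \<Rightarrow> 'a form \<Rightarrow> bool"
  where "diff_form M k \<alpha> \<longleftrightarrow>
    (\<forall>p\<in>topspace (mtop M). \<forall>vs. set vs \<subseteq> tspace M p \<and> length vs = k \<longrightarrow>
       (\<forall>i<k. \<forall>v\<in>tspace M p. \<forall>w\<in>tspace M p. \<forall>t.
          \<alpha> p (vs[i := (\<lambda>c l. v c l + t * w c l)]) = \<alpha> p (vs[i := v]) + t * \<alpha> p (vs[i := w])) \<and>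
       (\<forall>i<k. \<forall>j<k. i \<noteq> j \<and> vs ! i = vs ! j \<longrightarrow> \<alpha> p vs = 0)) \<and>
    (\<forall>c\<in>matlas M. \<forall>js. set js \<subseteq> {..<mdim M} \<and> length js = k \<longrightarrow>
       Cinf (mdim M) (snd c ` fst c) (\<lambda>y. \<alpha> (cinv c y) (map (cbasis M c (cinv c y)) js)))"

definition volume_form :: "'a smfd \<Rightarrow> 'a form \<Rightarrow> bool"
  where "volume_form M \<mu> \<longleftrightarrow> diff_form M (mdim M) \<mu> \<and>
    (\<forall>c\<in>matlas M. \<forall>p\<in>fst c. morient M c p * \<mu> p (map (cbasis M c p) [0..<mdim M]) > 0)"

definition contract :: "('a \<Rightarrow> 'a tvec) \<Rightarrow> 'a form \<Rightarrow> 'a form"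
  where "contract u \<alpha> = (\<lambda>p vs. \<alpha> p (u p # vs))"

definition pullback :: "'s smfd \<Rightarrow> 'a smfd \<Rightarrow> ('s \<Rightarrow> 'a) \<Rightarrow> 'a form \<Rightarrow> 's form"
  where "pullback S M \<gamma> \<alpha> = (\<lambda>x ws. \<alpha> (\<gamma> x) (map (tmap S M \<gamma> x) ws))"

definition omit :: "nat \<Rightarrow> 'b list \<Rightarrow> 'b list"
  where "omit i xs = take i xs @ drop (Suc i) xs"

text \<open>
  The exterior derivative in a chart \<open>c\<close>: extend the arguments to vector fields with constant
  coefficients in \<open>c\<close> and take the alternating sum of directional derivatives.
\<close>

definition ext_deriv :: "'a smfd \<Rightarrow> 'a form \<Rightarrow> 'a form"
  where "ext_deriv M \<alpha> = (\<lambda>p vs. let c = chart_at M p in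
    \<Sum>i<length vs. (-1) ^ i * (\<Sum>j<mdim M. (vs ! i) c j *
      pd (snd c ` fst c) j
        (\<lambda>y. \<alpha> (cinv c y) (map (\<lambda>v. cvec M c (cinv c y) (v c)) (omit i vs))) (snd c p)))"


section \<open>Integration\<close>

definition partition_of_unity ::
    "'s smfd \<Rightarrow> nat \<Rightarrow> (nat \<Rightarrow> 's chart) \<Rightarrow> (nat \<Rightarrow> 's \<Rightarrow> real) \<Rightarrow> bool"
  where "partition_of_unity S N cs \<rho> \<longleftrightarrow>
    (\<forall>i<N. cs i \<in> matlas S \<and>
       (\<forall>x\<in>topspace (mtop S). 0 \<le> \<rho> i x) \<and>
       (\<forall>c\<in>matlas S. Cinf (mdim S) (snd c ` fst c) (\<lambda>y. \<rho> i (cinv c y))) \<and>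
       mtop S closure_of {x \<in> topspace (mtop S). \<rho> i x \<noteq> 0} \<subseteq> fst (cs i)) \<and>
    (\<forall>x\<in>topspace (mtop S). (\<Sum>i<N. \<rho> i x) = 1)"

text \<open>
  Lebesgue integral over \<^term>\<open>Rn n\<close>. The product measure lives on functions that are
  \<^const>\<open>undefined\<close> from index \<open>n\<close> on; for \<open>n = 0\<close> it is the unit mass at a point.
\<close>

definition Rn_integral :: "nat \<Rightarrow> (nat \<Rightarrow> real) set \<Rightarrow> ((nat \<Rightarrow> real) \<Rightarrow> real) \<Rightarrow> real"
  where "Rn_integral n A f = (\<integral>x. (let y = (\<lambda>i. if i < n then x i else 0)
    in indicator A y * f y) \<partial>(PiM {..<n} (\<lambda>_. lborel)))"

definition chart_integral :: "'s smfd \<Rightarrow> 's chart \<Rightarrow> ('s \<Rightarrow> real) \<Rightarrow> 's form \<Rightarrow> real"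
  where "chart_integral S c \<rho> \<alpha> = Rn_integral (mdim S) (snd c ` fst c)
    (\<lambda>y. let x = cinv c y
         in morient S c x * \<rho> x * \<alpha> x (map (cbasis S c x) [0..<mdim S]))"

text \<open>The integral of a top-degree form over a compact oriented manifold.\<close>

definition mfd_integral :: "'s smfd \<Rightarrow> 's form \<Rightarrow> real"
  where "mfd_integral S \<alpha> = (THE I. \<exists>N cs \<rho>. partition_of_unity S N cs \<rho> \<and>
    I = (\<Sum>i<N. chart_integral S (cs i) (\<rho> i) \<alpha>))"


section \<open>The nonlinear Grassmannian\<close>

definition compact_oriented :: "(nat \<Rightarrow> (nat \<Rightarrow> real) set) \<Rightarrow> nat \<Rightarrow> 's smfd \<Rightarrow> bool"
  where "compact_oriented Q k S \<longleftrightarrow> oriented_mfd Q S \<and> compact_space (mtop S) \<and> mdim S = k"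

definition embedding :: "'s smfd \<Rightarrow> 'a smfd \<Rightarrow> ('s \<Rightarrow> 'a) \<Rightarrow> bool"
  where "embedding S M \<gamma> \<longleftrightarrow> smooth_map S M \<gamma> \<and> embedding_map (mtop S) (mtop M) \<gamma> \<and>
    (\<forall>x\<in>topspace (mtop S). inj_on (tmap S M \<gamma> x) (tspace S x))"

text \<open>
  A point of the Grassmannian, i.e. of the disjoint union over the diffeomorphism classes of \<open>S\<close>
  of the quotients of embeddings of \<open>S\<close> by orientation preserving reparametrisations, is an
  equivalence class of pairs \<open>(S, \<gamma>)\<close>: not choosing a representative of the diffeomorphism class
  of \<open>S\<close> amounts to also identifying \<open>(S, \<gamma>)\<close> with \<open>(S', \<gamma> \<circ> f)\<close> for orientation preserving
  diffeomorphisms \<open>f\<close> from another manifold \<open>S'\<close>. Only closed \<open>S\<close> are needed here,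
  since the exact submanifolds are boundaries.
\<close>

type_synonym ('s, 'a) gr_point = "('s smfd \<times> ('s \<Rightarrow> 'a)) set"

definition gr_class :: "'a smfd \<Rightarrow> 's smfd \<Rightarrow> ('s \<Rightarrow> 'a) \<Rightarrow> ('s, 'a) gr_point"
  where "gr_class M S \<gamma> = {(S', \<gamma>').
    compact_oriented Rn (mdim S) S' \<and> embedding S' M \<gamma>' \<and>
    (\<exists>f. oriented_diffeo S' S f \<and> (\<forall>x\<in>topspace (mtop S'). \<gamma>' x = \<gamma> (f x)))}"

text \<open>
  Exact codimension-2 submanifolds: the boundaries of the compact oriented hypersurfaces (with
  boundary) \<open>[F : W \<rightarrow> M]\<close>.
\<close>

definition Gr_ex :: "'a smfd \<Rightarrow> ('s, 'a) gr_point set"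
  where "Gr_ex M = {gr_class M (boundary_mfd W) F | W F.
    compact_oriented Hn (mdim M - 1) W \<and> embedding W M F}"

definition gr_integral :: "'a smfd \<Rightarrow> 'a form \<Rightarrow> ('s, 'a) gr_point \<Rightarrow> real"
  where "gr_integral M \<alpha> G = (THE r. \<forall>(S, \<gamma>)\<in>G. r = mfd_integral S (pullback S M \<gamma> \<alpha>))"

text \<open>
  The group of diffeomorphisms of \<open>M\<close> with the topology of uniform convergence on compact sets of all
  derivatives. Its identity component and the one for the finer Whitney topology (or the compactly
  supported isotopies) have the same orbits in the Grassmannian, namely its connected components.
\<close>

definition Diff :: "'a smfd \<Rightarrow> ('a \<Rightarrow> 'a) set"
  where "Diff M = {f. diffeo M M f}"

definition Diff_topology :: "'a smfd \<Rightarrow> ('a \<Rightarrow> 'a) topology"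
  where "Diff_topology M = topology_generated_by (insert (Diff M)
    {{g \<in> Diff M. g ` K \<subseteq> fst d \<and>
        (\<forall>p\<in>K. \<bar>pds (ldom c d g) js (\<lambda>y. lrep c d g y i) (snd c p)
               - pds (ldom c d f) js (\<lambda>y. lrep c d f y i) (snd c p)\<bar> < \<epsilon>)} | f c d K js i \<epsilon>.
      f \<in> Diff M \<and> c \<in> matlas M \<and> d \<in> matlas M \<and> compactin (mtop M) K \<and> K \<subseteq> fst c \<and>
      f ` K \<subseteq> fst d \<and> set js \<subseteq> {..<mdim M} \<and> i < mdim M \<and> 0 < \<epsilon>})"

definition Diff0 :: "'a smfd \<Rightarrow> ('a \<Rightarrow> 'a) set"
  where "Diff0 M = connected_component_of_set (Diff_topology M) (\<lambda>p. p)"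

definition act :: "('a \<Rightarrow> 'a) \<Rightarrow> ('s, 'a) gr_point \<Rightarrow> ('s, 'a) gr_point"
  where "act f G = {(S, \<gamma>'). \<exists>\<gamma>. (S, \<gamma>) \<in> G \<and> (\<forall>x\<in>topspace (mtop S). \<gamma>' x = f (\<gamma> x))}"

definition Diff0_orbit :: "'a smfd \<Rightarrow> ('s, 'a) gr_point \<Rightarrow> ('s, 'a) gr_point set"
  where "Diff0_orbit M G = (\<lambda>f. act f G) ` Diff0 M"

text \<open>
  Tangent vectors of the Grassmannian: fields along \<open>\<gamma>\<close> modulo fields tangential to \<open>\<gamma>\<close>, again
  as equivalence classes that do not depend on the parametrisation.
\<close>

type_synonym ('s, 'a) gr_tangent = "('s smfd \<times> ('s \<Rightarrow> 'a) \<times> ('s \<Rightarrow> 'a tvec)) set"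

definition equal_mod_tangential ::
    "'s smfd \<Rightarrow> 'a smfd \<Rightarrow> ('s \<Rightarrow> 'a) \<Rightarrow> ('s \<Rightarrow> 'a tvec) \<Rightarrow> ('s \<Rightarrow> 'a tvec) \<Rightarrow> bool"
  where "equal_mod_tangential S M \<gamma> \<xi> \<zeta> \<longleftrightarrow> (\<forall>x\<in>topspace (mtop S). \<exists>w\<in>tspace S x.
    \<forall>d i. \<xi> x d i = \<zeta> x d i + tmap S M \<gamma> x w d i)"

definition tangent_class ::
    "'a smfd \<Rightarrow> 's smfd \<Rightarrow> ('s \<Rightarrow> 'a) \<Rightarrow> ('s \<Rightarrow> 'a tvec) \<Rightarrow> ('s, 'a) gr_tangent"
  where "tangent_class M S \<gamma> \<xi> = {(S', \<gamma>', \<xi>').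
    compact_oriented Rn (mdim S) S' \<and> embedding S' M \<gamma>' \<and> field_along S' M \<gamma>' \<xi>' \<and>
    (\<exists>f. oriented_diffeo S' S f \<and> (\<forall>x\<in>topspace (mtop S'). \<gamma>' x = \<gamma> (f x)) \<and>
         equal_mod_tangential S' M \<gamma>' \<xi>' (\<lambda>x. \<xi> (f x)))}"

definition fundamental :: "'a smfd \<Rightarrow> ('a \<Rightarrow> 'a tvec) \<Rightarrow> ('s, 'a) gr_point \<Rightarrow> ('s, 'a) gr_tangent"
  where "fundamental M u G = {(S, \<gamma>, \<xi>). (S, \<gamma>) \<in> G \<and> field_along S M \<gamma> \<xi> \<and>
    equal_mod_tangential S M \<gamma> \<xi> (\<lambda>x. u (\<gamma> x))}"


section \<open>The Frechet manifold structure\<close>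

text \<open>
  The charts of the Grassmannian come from tubular neighbourhoods. A tubular neighbourhood of
  \<open>\<gamma> : S \<rightarrow> M\<close> is an open neighbourhood of \<open>\<gamma>(S)\<close> that is a smooth vector bundle \<open>\<pi>\<close> over \<open>S\<close> with
  zero section \<open>\<gamma>\<close>; the charts obtained in this way for all embeddings \<open>\<gamma>\<close> form an atlas.
  A tubular neighbourhood is given by a cover \<open>T\<close> of the neighbourhood by bundle charts \<open>(b, d)\<close>,
  where \<open>d\<close> is the chart of \<open>M\<close> on the preimage of the domain of \<open>b\<close> whose first
  \<^term>\<open>mdim S\<close> coordinates are the base coordinates \<open>b \<circ> \<pi>\<close> and whose remaining ones
  are the fibre coordinates, running through the whole fibre.
\<close>

definition tubular ::
    "'a smfd \<Rightarrow> 's smfd \<Rightarrow> ('s \<Rightarrow> 'a) \<Rightarrow> ('a \<Rightarrow> 's) \<Rightarrow> ('s chart \<times> 'a chart) set \<Rightarrow> bool"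
  where "tubular M S \<gamma> \<pi> T \<longleftrightarrow>
    topspace (mtop S) = (\<Union>(b, d)\<in>T. fst b) \<and>
    (\<forall>(b, d)\<in>T. b \<in> matlas S \<and> d \<in> matlas M \<and>
       fst d = {y \<in> (\<Union>(b', d')\<in>T. fst d'). \<pi> y \<in> fst b} \<and>
       snd d ` fst d =
         {z \<in> Rn (mdim M). (\<lambda>i. if i < mdim S then z i else 0) \<in> snd b ` fst b} \<and>
       (\<forall>y\<in>fst d. \<forall>i<mdim S. snd d y i = snd b (\<pi> y) i) \<and>
       (\<forall>x\<in>fst b. \<gamma> x \<in> fst d \<and> snd d (\<gamma> x) = snd b x)) \<and>
    (\<forall>(b, d)\<in>T. \<forall>(b', d')\<in>T. \<forall>x\<in>fst b \<inter> fst b'. \<exists>A :: nat \<Rightarrow> nat \<Rightarrow> real.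
       \<forall>y\<in>fst d. \<pi> y = x \<longrightarrow> (\<forall>i\<in>{mdim S..<mdim M}.
         snd d' y i = (\<Sum>j\<in>{mdim S..<mdim M}. A i j * snd d y j)))"

text \<open>The smooth sections of the bundle; these are maps into \<open>M\<close>.\<close>

definition bundle_sections ::
    "'a smfd \<Rightarrow> 's smfd \<Rightarrow> ('a \<Rightarrow> 's) \<Rightarrow> ('s chart \<times> 'a chart) set \<Rightarrow> ('s \<Rightarrow> 'a) set"
  where "bundle_sections M S \<pi> T = {s \<in> extensional (topspace (mtop S)). smooth_map S M s \<and>
    (\<forall>x\<in>topspace (mtop S). s x \<in> (\<Union>(b, d)\<in>T. fst d) \<and> \<pi> (s x) = x)}"

text \<open>\<open>line S T s t a\<close> is the section \<open>s + t a\<close>, formed in the fibres of the bundle.\<close>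

definition line ::
    "'s smfd \<Rightarrow> ('s chart \<times> 'a chart) set \<Rightarrow> ('s \<Rightarrow> 'a) \<Rightarrow> real \<Rightarrow> ('s \<Rightarrow> 'a) \<Rightarrow> ('s \<Rightarrow> 'a)"
  where "line S T s t a = (\<lambda>x\<in>topspace (mtop S). THE y. \<forall>(b, d)\<in>T. x \<in> fst b \<longrightarrow> y \<in> fst d \<and>
    snd d y = (\<lambda>i. if i < mdim S then snd b x i else snd d (s x) i + t * snd d (a x) i))"

text \<open>The Frechet topology: uniform convergence on compact sets of all derivatives of the fibre coordinates.\<close>

definition section_topology ::
    "'a smfd \<Rightarrow> 's smfd \<Rightarrow> ('a \<Rightarrow> 's) \<Rightarrow> ('s chart \<times> 'a chart) set \<Rightarrow> ('s \<Rightarrow> 'a) topology"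
  where "section_topology M S \<pi> T = topology_generated_by (insert (bundle_sections M S \<pi> T)
    {{h \<in> bundle_sections M S \<pi> T. \<forall>x\<in>K.
        \<bar>pds (snd b ` fst b) js (\<lambda>y. lrep b d h y i) (snd b x)
         - pds (snd b ` fst b) js (\<lambda>y. lrep b d g y i) (snd b x)\<bar> < \<epsilon>} | g b d K js i \<epsilon>.
      g \<in> bundle_sections M S \<pi> T \<and> (b, d) \<in> T \<and> compactin (mtop S) K \<and> K \<subseteq> fst b \<and>
      set js \<subseteq> {..<mdim S} \<and> i \<in> {mdim S..<mdim M} \<and> 0 < \<epsilon>})"

text \<open>
  The chart \<open>U \<ni> s \<mapsto> [s]\<close> of the open subset \<open>\<O>\<close> of the Grassmannian, parametrised by an open set
  \<open>U\<close> of sections. Restricting the charts of the Grassmannian to those with values in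
  the union of components \<open>\<O>\<close> yields an atlas of \<open>\<O>\<close>.
\<close>

definition frechet_chart ::
    "'a smfd \<Rightarrow> ('s, 'a) gr_point set \<Rightarrow> 's smfd \<Rightarrow> ('s \<Rightarrow> 'a) \<Rightarrow> ('a \<Rightarrow> 's) \<Rightarrow>
     ('s chart \<times> 'a chart) set \<Rightarrow> ('s \<Rightarrow> 'a) set \<Rightarrow> bool"
  where "frechet_chart M \<O> S \<gamma> \<pi> T U \<longleftrightarrow>
    compact_oriented Rn (mdim S) S \<and> embedding S M \<gamma> \<and> tubular M S \<gamma> \<pi> T \<and>
    openin (section_topology M S \<pi> T) U \<and> (\<forall>s\<in>U. gr_class M S s \<in> \<O>)"

text \<open>The differential of the chart at \<open>s\<close>, applied to the section \<open>a\<close> of the model space.\<close>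

definition chart_tangent ::
    "'a smfd \<Rightarrow> 's smfd \<Rightarrow> ('s chart \<times> 'a chart) set \<Rightarrow> ('s \<Rightarrow> 'a) \<Rightarrow> ('s \<Rightarrow> 'a) \<Rightarrow> ('s, 'a) gr_tangent"
  where "chart_tangent M S T s a = tangent_class M S s (\<lambda>x. velocity M (\<lambda>t. line S T s t a x))"

type_synonym ('s, 'a) gr_form = "('s, 'a) gr_point \<Rightarrow> ('s, 'a) gr_tangent list \<Rightarrow> real"

definition chart_rep ::
    "'a smfd \<Rightarrow> 's smfd \<Rightarrow> ('s chart \<times> 'a chart) set \<Rightarrow> ('s, 'a) gr_form \<Rightarrow>
     ('s \<Rightarrow> 'a) \<Rightarrow> ('s \<Rightarrow> 'a) list \<Rightarrow> real"
  where "chart_rep M S T \<Theta> s as = \<Theta> (gr_class M S s) (map (chart_tangent M S T s) as)"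

text \<open>
  The directional derivative of \<open>\<phi>\<close> in its base point, the direction being prepended to
  the list of arguments.
\<close>

definition dirderiv ::
    "'s smfd \<Rightarrow> ('s chart \<times> 'a chart) set \<Rightarrow>
     (('s \<Rightarrow> 'a) \<Rightarrow> ('s \<Rightarrow> 'a) list \<Rightarrow> real) \<Rightarrow> (('s \<Rightarrow> 'a) \<Rightarrow> ('s \<Rightarrow> 'a) list \<Rightarrow> real)"
  where "dirderiv S T \<phi> s as =
    (case as of [] \<Rightarrow> 0 | a # bs \<Rightarrow> deriv (\<lambda>t. \<phi> (line S T s t a) bs) 0)"

text \<open>
  Smooth differential \<open>k\<close>-forms on \<open>\<O>\<close>. Smoothness is that of calculus in Frechet spaces: all iterated
  directional derivatives of the local representatives exist and are jointly continuous.
\<close>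

definition gr_diff_form :: "'a smfd \<Rightarrow> ('s, 'a) gr_point set \<Rightarrow> nat \<Rightarrow> ('s, 'a) gr_form \<Rightarrow> bool"
  where "gr_diff_form M \<O> k \<Theta> \<longleftrightarrow>
    (\<forall>S \<gamma> \<pi> T U. frechet_chart M \<O> S \<gamma> \<pi> T U \<longrightarrow>
      (let \<E> = bundle_sections M S \<pi> T; \<tau> = section_topology M S \<pi> T; \<theta> = chart_rep M S T \<Theta> in
       (\<forall>s\<in>U. \<forall>as. set as \<subseteq> \<E> \<and> length as = k \<longrightarrow>
          (\<forall>i<k. \<forall>a\<in>\<E>. \<forall>b\<in>\<E>. \<forall>t.
             \<theta> s (as[i := line S T a t b]) = \<theta> s (as[i := a]) + t * \<theta> s (as[i := b])) \<and>
          (\<forall>i<k. \<forall>j<k. i \<noteq> j \<and> as ! i = as ! j \<longrightarrow> \<theta> s as = 0)) \<and>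
       (\<forall>r.
          (\<forall>s\<in>U. \<forall>a\<in>\<E>. \<forall>as. set as \<subseteq> \<E> \<and> length as = r + k \<longrightarrow>
             (\<lambda>t. (dirderiv S T ^^ r) \<theta> (line S T s t a) as) differentiable (at 0)) \<and>
          continuous_map
            (prod_topology (subtopology \<tau> U) (product_topology (\<lambda>_. \<tau>) {..<r + k})) euclideanreal
            (\<lambda>(s, x). (dirderiv S T ^^ r) \<theta> s (map x [0..<r + k])))))"

text \<open>
  \<open>\<Xi>\<close> is the exterior derivative of the \<open>k\<close>-form \<open>\<Theta>\<close> on \<open>\<O>\<close>: in every chart of \<open>\<O>\<close> the coordinate formula
  for the exterior derivative holds. For \<open>k = 1\<close> it reads
  \<open>\<Xi>\<^sub>s(a, b) = D\<^sub>a \<Theta>\<^sub>s(b) - D\<^sub>b \<Theta>\<^sub>s(a)\<close>.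
\<close>

definition gr_ext_deriv ::
    "'a smfd \<Rightarrow> ('s, 'a) gr_point set \<Rightarrow> nat \<Rightarrow> ('s, 'a) gr_form \<Rightarrow> ('s, 'a) gr_form \<Rightarrow> bool"
  where "gr_ext_deriv M \<O> k \<Theta> \<Xi> \<longleftrightarrow>
    (\<forall>S \<gamma> \<pi> T U. frechet_chart M \<O> S \<gamma> \<pi> T U \<longrightarrow>
      (\<forall>s\<in>U. \<forall>as. set as \<subseteq> bundle_sections M S \<pi> T \<and> length as = Suc k \<longrightarrow>
        chart_rep M S T \<Xi> s as =
          (\<Sum>i<Suc k. (-1) ^ i * dirderiv S T (chart_rep M S T \<Theta>) s (as ! i # omit i as))))"

end

theory Submission
 imports Defs
begin

text \<open>In the chart of the Grassmannian given by a tubular neighbourhood, the local representative of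
\<open>\<eta>\<close> at a section \<open>s\<close> is an integral over \<open>S\<close> whose integrand depends on the first derivatives of the
sections only; differentiating under the integral sign gives its smoothness. For two directions
\<open>a\<close> and \<open>b\<close> pull \<open>\<nu>\<close> back along \<open>(t, r, x) \<mapsto> (s + t a + r b) x\<close>. As pulling back commutes with the exterior
derivative, \<open>D\<^sub>a \<eta>(b) - D\<^sub>b \<eta>(a)\<close> differs from the Marsden-Weinstein form by the integral of an exact form
over the closed manifold \<open>S\<close>, which vanishes by Stokes' theorem.\<close>

text \<open>Tangent vectors in a chart are velocities of lines of sections, whereas
  \<open>\<eta>\<close> and \<open>\<omega>\<close> are prescribed on fundamental fields only. The
  bridge is an extension of every vertical field along a section to a vector field on
  \<open>M\<close>; conversely, two fields with the same fundamental field differ by a tangential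
  one, which \<open>\<nu>\<close> does not see, having one argument more than \<open>S\<close> has
  dimensions. Hence \<open>\<eta>\<close> exists. The integral over \<open>S\<close> is a definite
  description over all partitions of unity. Making it usable takes the change of variables formula
  on coordinate space, obtained by factoring a diffeomorphism into maps that alter a single
  coordinate. Stokes' theorem is proved only for the divergence that occurs: it is integrated by
  parts against a partition of unity, whose differentials add up to 0, so no exterior derivative on
  \<open>S\<close> has to be globalised. The exterior derivative on \<open>M\<close> is tied to one
  selected chart at each point; the computation in bundle coordinates is carried into that chart,
  instead of proving independence of charts.\<close>

abbreviation (input) pts :: "'a smfd => 'a set"
 where "pts S \<equiv> topspace (mtop S)"

abbreviation (input) omfd :: "'a smfd => bool"
 where "omfd \<equiv> oriented_mfd Rn"

section \<open>Topology of coordinate space\<close>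

abbreviation opn :: "nat => (nat => real) set => bool"
 where "opn n A \<equiv> openin (top_of_set (Rn n)) A"

lemma Rn_iff: "x \<in> Rn n \<longleftrightarrow> (\<forall>i\<ge>n. x i = 0)"
 by (simp add: Rn_def topspace_Euclidean_space)

lemma Euclidean_space_eq: "Euclidean_space n = top_of_set (Rn n)"
 by (simp add: Euclidean_space_def Rn_def topspace_Euclidean_space euclidean_product_topology)

lemma Rn_upd: "x \<in> Rn n ==> i < n ==> x(i := t) \<in> Rn n"
 by (auto simp: Rn_iff)

lemma opn_subset: "opn n A ==> A <= Rn n"
 by (simp add: openin_imp_subset)

lemma Rn_eqI: "x \<in> Rn n ==> y \<in> Rn n ==> (!!i. i < n ==> x i = y i) ==> x = y"
 by (metis Rn_iff ext linorder_not_le)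

lemma tendsto_fun_iff:
 fixes l :: "nat => real"
 shows "(f \<longlongrightarrow> l) F \<longleftrightarrow> (\<forall>i. ((%x. f x i) \<longlongrightarrow> l i) F)"
proof -
 have "(f \<longlongrightarrow> l) F \<longleftrightarrow> limitin (product_topology (%i. euclideanreal) UNIV) f l F"
  by (metis euclidean_product_topology limitin_canonical_iff)
 then show ?thesis by (simp add: limitin_componentwise)
qed

lemma continuous_on_apply: "continuous_on A (%x::nat => real. x i)"
 by (rule continuous_on_subset[OF continuous_on_product_coordinates]) auto

lemma continuous_on_fun_upd: "continuous_on A (%t::real. x(i := t))" for x :: "nat => real"
proof (rule continuous_on_coordinatewise_then_product)
 show "continuous_on A (%t. (x(i := t)) j)" for j by (cases "j = i") auto
qed

text \<open>Coordinates from index \<open>m\<close> on are constantly 0, so only finitely many of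
  them have to be examined.\<close>

lemma continuous_on_Rn_valued:
 assumes "!!x. x \<in> A ==> f x \<in> Rn m" "!!j. j < m ==> continuous_on A (%x. f x j)"
 shows "continuous_on A (f :: _ => nat => real)"
proof (rule continuous_on_coordinatewise_then_product)
 fix j
 show "continuous_on A (%x. f x j)"
 proof (cases "j < m")
  case False
  then have "continuous_on A (%x. f x j) = continuous_on A (%x. 0::real)"
   by (intro continuous_on_cong) (use assms(1) in \<open>auto simp: Rn_iff\<close>)
  then show ?thesis by simp
 qed (use assms(2) in auto)
qed

text \<open>Boxes rather than metric balls: a point can be moved to the centre one coordinate at a
  time without leaving the box, and this is how the mean value theorem is applied below.\<close>

definition boxn :: "nat => (nat => real) => real => (nat => real) set"
 where "boxn n x d = {y \<in> Rn n. \<forall>i<n. \<bar>y i - x i\<bar> < d}"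

lemma opn_boxn: "opn n (boxn n x d)"
proof -
 have "open {y::nat => real. \<bar>y i - x i\<bar> < d}" for i
  by (intro open_Collect_less continuous_intros continuous_on_apply)
 then have "open (\<Inter>i\<in>{..<n}. {y::nat => real. \<bar>y i - x i\<bar> < d})"
  by (intro open_INT) auto
 moreover have "boxn n x d = Rn n \<inter> (\<Inter>i\<in>{..<n}. {y::nat => real. \<bar>y i - x i\<bar> < d})"
  by (auto simp: boxn_def)
 ultimately show ?thesis unfolding openin_open by blast
qed

lemma boxn_self: "x \<in> Rn n ==> 0 < d ==> x \<in> boxn n x d"
 by (simp add: boxn_def)

text \<open>A basic open set of the product topology constrains each coordinate separately. On
  \<open>Rn n\<close> only the first \<open>n\<close> constraints can fail, since the others compare
  0 with 0.\<close>

lemma opn_contains_boxn: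
 assumes "opn n A" "x \<in> A"
 obtains d where "0 < d" "boxn n x d <= A"
proof -
 obtain W where W: "open W" "A = Rn n \<inter> W" using assms(1) by (metis openin_open)
 then have "openin (product_topology (%i. euclideanreal) UNIV) W"
  by (simp add: euclidean_product_topology)
 then obtain X where X: "x \<in> Pi\<^sub>E UNIV X" "!!i. openin euclideanreal (X i)"
   "finite {i. X i ~= topspace euclideanreal}" "Pi\<^sub>E UNIV X <= W"
  using product_topology_open_contains_basis[of _ UNIV W x] W assms(2) by blast
 have "\<exists>d>0. \<forall>y. \<bar>y - x i\<bar> < d --> y \<in> X i" for i
  using X(1) X(2)[of i] by (auto simp: open_dist PiE_iff dist_real_def)
 then obtain D where D: "!!i. D i > 0" "!!i y. \<bar>y - x i\<bar> < D i ==> y \<in> X i" by metis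
 \<comment> \<open>The extra 1 keeps the minimum meaningful for \<open>n = 0\<close>, when the box
   is the whole one-point space.\<close>
 define d where "d = Min (insert 1 (D ` {..<n}))"
 have "d > 0" using D(1) by (auto simp: d_def)
 moreover have "boxn n x d <= A"
 proof
  fix y assume y: "y \<in> boxn n x d"
  have "y i \<in> X i" for i
  proof (cases "i < n")
   case True
   then have "d <= D i" by (auto simp: d_def)
   then show ?thesis using y True by (intro D(2)) (auto simp: boxn_def)
  next
   case False
   then show ?thesis using y W(2) assms(2) D(1)[of i] by (intro D(2)) (auto simp: boxn_def Rn_iff)
  qed
  then show "y \<in> A" using X(4) W(2) y by (auto simp: boxn_def)
 qed
 ultimately show ?thesis using that by blast
qed

lemma opn_Rn: "opn n (Rn n)"
 by simp

lemma open_slice: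
 assumes "opn n A" "i < n" "x \<in> Rn n" shows "open {t. x(i := t) \<in> A}"
proof -
 obtain W where W: "open W" "A = Rn n \<inter> W" using assms(1) by (metis openin_open)
 have "{t. x(i := t) \<in> A} = (%t. x(i := t)) -` W" using W Rn_upd assms by auto
 then show ?thesis using W(1) continuous_on_fun_upd by (metis open_vimage)
qed

subsection \<open>Partial derivatives\<close>

text \<open>Slices of a relatively open set are open in the real line, so the derivative within the
  slice that \<open>pd\<close> refers to is an ordinary one. Existence and value are stated
  together, because \<open>pd\<close> also has a value where there is no derivative.\<close>

abbreviation hpd :: "((nat => real) => real) => nat => real => (nat => real) => bool"
 where "hpd f i D x \<equiv> ((%t. f (x(i := t))) has_real_derivative D) (at (x i))"

lemma pd_eq:
 assumes "opn n A" "x \<in> A" "i < n" "hpd f i D x" shows "pd A i f x = D"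
proof -
 have "x \<in> Rn n" using assms opn_subset by blast
 then have "open {t. x(i := t) \<in> A}" using open_slice assms by blast
 moreover have "x i \<in> {t. x(i := t) \<in> A}" using assms by simp
 ultimately have "at (x i) within {t. x(i := t) \<in> A} = at (x i)" by (rule at_within_open[rotated])
 then show ?thesis using assms(4)
  by (simp add: pd_def vector_derivative_at has_real_derivative_iff_has_vector_derivative)
qed

lemma hpd_cong:
 assumes "opn n A" "x \<in> A" "i < n" "hpd f i D x" "!!y. y \<in> A ==> f y = g y" shows "hpd g i D x"
proof -
 have "x \<in> Rn n" using assms opn_subset by blast
 then have "open {t. x(i := t) \<in> A}" using open_slice assms by blast
 then show ?thesis
  by (rule has_field_derivative_transform_within_open[OF assms(4)]) (use assms in auto)
qed

lemma Ck_Suc_opn: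
 assumes "opn n A"
 shows "Ck n A (Suc r) f \<longleftrightarrow> continuous_on A f &
  (\<forall>i<n. (\<forall>x\<in>A. hpd f i (pd A i f x) x) & Ck n A r (pd A i f))"
proof -
 have "(%t. f (x(i := t))) differentiable (at (x i) within {t. x(i := t) \<in> A}) \<longleftrightarrow> hpd f i (pd A i f x) x"
  if "x \<in> A" "i < n" for x i
 proof -
  have "x \<in> Rn n" using assms that opn_subset by blast
  then have "open {t. x(i := t) \<in> A}" using open_slice assms that by blast
  moreover have "x i \<in> {t. x(i := t) \<in> A}" using that by simp
  ultimately have "at (x i) within {t. x(i := t) \<in> A} = at (x i)" by (rule at_within_open[rotated])
  then show ?thesis
   by (simp add: pd_def has_real_derivative_iff_has_vector_derivative vector_derivative_works)
 qed
 then show ?thesis by auto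
qed

lemma Ck_continuous: "Ck n A r f ==> continuous_on A f"
 by (cases r) auto

lemma Ck_hpd: "Ck n A (Suc r) f ==> opn n A ==> i < n ==> x \<in> A ==> hpd f i (pd A i f x) x"
 by (simp add: Ck_Suc_opn del: Ck.simps)

lemma pd_cong:
 assumes "opn n A" "i < n" "x \<in> A" "!!y. y \<in> A ==> f y = g y"
 shows "pd A i f x = pd A i g x"
proof -
 have "x \<in> Rn n" using assms opn_subset by blast
 then have o: "open {t. x(i := t) \<in> A}" using open_slice assms by blast
 have "at (x i) within {t. x(i := t) \<in> A} = at (x i)"
  using o assms by (intro at_within_open) auto
 moreover have "eventually (%t. x(i := t) \<in> A) (nhds (x i))"
  using o assms by (auto simp: eventually_nhds intro!: exI[of _ "{t. x(i := t) \<in> A}"])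
 then have "eventually (%t. f (x(i := t)) = g (x(i := t))) (nhds (x i))"
  by (rule eventually_mono) (use assms in auto)
 ultimately show ?thesis unfolding pd_def
  by (intro vector_derivative_cong_eq) (auto simp: eventually_nhds_conv_at assms(3) elim: eventually_mono)
qed

lemma pd_opn_subset:
 assumes "opn n A" "opn n B" "x \<in> A" "x \<in> B" "i < n"
 shows "pd A i f x = pd B i f x"
proof -
 have "x \<in> Rn n" using assms opn_subset by blast
 then have o: "open {t. x(i := t) \<in> A}" "open {t. x(i := t) \<in> B}" using open_slice assms by blast+
 have "at (x i) within {t. x(i := t) \<in> A} = at (x i)" "at (x i) within {t. x(i := t) \<in> B} = at (x i)"
  using o assms by (auto intro!: at_within_open)
 then show ?thesis unfolding pd_def by simp
qed

lemma Ck_cong: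
 assumes "opn n A" "!!x. x \<in> A ==> f x = g x" "Ck n A r f"
 shows "Ck n A r g"
 using assms(2,3)
proof (induction r arbitrary: f g)
 case 0
 then show ?case using continuous_on_cong by (metis Ck.simps(1))
next
 case (Suc r)
 have c: "continuous_on A g" using Suc.prems continuous_on_cong by (metis Ck_continuous)
 have p: "pd A i f x = pd A i g x" if "i < n" "x \<in> A" for i x
  using pd_cong[OF assms(1) that] Suc.prems by blast
 have "hpd g i (pd A i g x) x" if "i < n" "x \<in> A" for i x
  using hpd_cong[OF assms(1) that(2,1) Ck_hpd[OF Suc.prems(2) assms(1) that]] Suc.prems(1) p[OF that]
  by auto
 moreover have "Ck n A r (pd A i g)" if "i < n" for i
  using Suc.IH[of "pd A i f" "pd A i g"] p that Suc.prems(2) by auto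
 ultimately show ?case using c by (simp add: Ck_Suc_opn[OF assms(1)] del: Ck.simps)
qed

text \<open>Candidates \<open>f'\<close> take the place of \<open>pd A i f\<close>, so that a
  derivative given by a formula never has to be computed through \<open>pd\<close>.\<close>

lemma Ck_SucI:
 assumes "opn n A" "continuous_on A f" "!!i x. i < n ==> x \<in> A ==> hpd f i (f' i x) x"
  "!!i. i < n ==> Ck n A r (f' i)"
 shows "Ck n A (Suc r) f"
proof -
 have p: "pd A i f x = f' i x" if "i < n" "x \<in> A" for i x
  using pd_eq[OF assms(1) that(2,1) assms(3)] that by blast
 have "Ck n A r (pd A i f)" if "i < n" for i
  by (rule Ck_cong[OF assms(1) _ assms(4)]) (use p that in auto)
 then show ?thesis using assms p by (simp add: Ck_Suc_opn[OF assms(1)] del: Ck.simps)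
qed

lemma Ck_Suc_imp: "Ck n A (Suc r) f ==> Ck n A r f"
 by (induction r arbitrary: f) auto

lemma Ck_pd: "Ck n A (Suc r) f ==> i < n ==> Ck n A r (pd A i f)"
 by simp

declare Ck.simps(2) [simp del]

text \<open>Continuity and partial derivatives at a point depend on the germ only. The induction
  over \<open>r\<close> needs the local function \<open>g\<close> on an open subset of
  \<open>A\<close>, where its derivatives are those of \<open>f\<close>.\<close>

lemma Ck_local:
 assumes "opn n A"
  "!!x. x \<in> A ==> \<exists>V g. opn n V & x \<in> V & Ck n V r g & (\<forall>y\<in>A \<inter> V. g y = f y)"
 shows "Ck n A r f"
 using assms(2)
proof (induction r arbitrary: f)
 case 0
 show ?case unfolding Ck.simps
 proof (subst continuous_on_eq_continuous_within, intro ballI)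
  fix x assume "x \<in> A"
  then obtain V g where V: "opn n V" "x \<in> V" "Ck n V 0 g" "\<forall>y\<in>A \<inter> V. g y = f y" using 0[OF \<open>x \<in> A\<close>] by metis
  obtain W where W: "open W" "V = Rn n \<inter> W" using V(1) by (metis openin_open)
  have AV: "A \<inter> W = A \<inter> V" using W opn_subset[OF assms(1)] by auto
  have "continuous_on (A \<inter> V) g" using V(3) by (auto intro: continuous_on_subset)
  then have "continuous_on (A \<inter> W) f" using V(4) AV continuous_on_cong by metis
  then have "continuous (at x within A \<inter> W) f"
   using \<open>x \<in> A\<close> V(2) W by (auto simp: continuous_on_eq_continuous_within)
  then show "continuous (at x within A) f"
   using at_within_nhd[of x W "A \<inter> W" A] W V(2) by auto
 qed
next
 case (Suc r)
 have key: "\<exists>V g. opn n V & x \<in> V & V <= A & Ck n V (Suc r) g & (\<forall>y\<in>V. g y = f y)" if x: "x \<in> A" for x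
 proof -
  obtain V g where V: "opn n V" "x \<in> V" "Ck n V (Suc r) g" "\<forall>y\<in>A \<inter> V. g y = f y" using Suc.prems[OF x] by metis
  have AV: "opn n (A \<inter> V)" using assms(1) V(1) by blast
  \<comment> \<open>Restriction to a smaller open set is proved on the spot:
    \<open>Ck_subset\<close> is itself a consequence of the present lemma.\<close>
  have "Ck n (A \<inter> V) (Suc r) g"
   using V(1,3)
  proof (induction r arbitrary: g)
   case (0 g)
   show ?case
   proof (rule Ck_SucI[OF AV, where f' = "%i. pd V i g"])
    show "continuous_on (A \<inter> V) g" using 0 Ck_continuous by (metis Int_lower2 continuous_on_subset)
    show "hpd g i (pd V i g x) x" if "i < n" "x \<in> A \<inter> V" for i x
     using Ck_hpd[OF 0(2,1)] that by blast
    show "Ck n (A \<inter> V) 0 (pd V i g)" if "i < n" for i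
     using Ck_pd[OF 0(2) that] by (auto intro: continuous_on_subset)
   qed
  next
   case (Suc r g)
   show ?case
   proof (rule Ck_SucI[OF AV, where f' = "%i. pd V i g"])
    show "continuous_on (A \<inter> V) g" using Suc Ck_continuous by (metis Int_lower2 continuous_on_subset)
    show "hpd g i (pd V i g x) x" if "i < n" "x \<in> A \<inter> V" for i x
     using Ck_hpd[OF Suc(3,2)] that by blast
    show "Ck n (A \<inter> V) (Suc r) (pd V i g)" if "i < n" for i
     using Suc.IH[of "pd V i g"] Suc.prems Ck_pd that by blast
   qed
  qed
  then show ?thesis using V AV x by (intro exI[of _ "A \<inter> V"] exI[of _ g]) auto
 qed
 have h: "hpd f i (pd A i f x) x" if i: "i < n" and x: "x \<in> A" for i x
 proof -
  obtain V g where V: "opn n V" "x \<in> V" "V <= A" "Ck n V (Suc r) g" "\<forall>y\<in>V. g y = f y" using key[OF x] by metis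
  have "hpd f i (pd V i g x) x"
   using hpd_cong[OF V(1,2) i Ck_hpd[OF V(4,1) i V(2)]] V(5) by blast
  then show ?thesis using pd_eq[OF assms(1) x i] by simp
 qed
 have "continuous_on A f"
 proof -
  have "\<exists>V g. opn n V & x \<in> V & Ck n V r g & (\<forall>y\<in>A \<inter> V. g y = f y)" if "x \<in> A" for x
   using key[OF that] by (elim ex_forward) (auto dest: Ck_Suc_imp)
  then show ?thesis using Ck_continuous[OF Suc.IH[of f]] by simp
 qed
 moreover have "Ck n A r (pd A i f)" if i: "i < n" for i
 proof (rule Suc.IH)
  fix x assume x: "x \<in> A"
  obtain V g where V: "opn n V" "x \<in> V" "V <= A" "Ck n V (Suc r) g" "\<forall>y\<in>V. g y = f y" using key[OF x] by metis
  have "pd V i g y = pd A i f y" if "y \<in> A \<inter> V" for y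
  proof -
   have "pd V i g y = pd V i f y" using pd_cong[OF V(1) i] V(5) that by blast
   then show ?thesis using pd_opn_subset[OF V(1) assms(1)] that i by auto
  qed
  then show "\<exists>V g. opn n V & x \<in> V & Ck n V r g & (\<forall>y\<in>A \<inter> V. g y = pd A i f y)"
   using V i by (intro exI[of _ V] exI[of _ "pd V i g"]) (auto intro: Ck_pd)
 qed
 ultimately show ?case using h by (simp add: Ck_Suc_opn[OF assms(1)] del: Ck.simps)
qed

lemma Ck_subset: "Ck n V r g ==> opn n V ==> opn n A ==> A <= V ==> Ck n A r g"
 by (rule Ck_local) blast+

text \<open>\<open>Cinf\<close> asks for local extensions that are smooth on open sets of
  \<open>Rn n\<close>. On an open set the extensions can be restricted again, and the notion
  collapses to all orders of \<open>Ck\<close>.\<close>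

lemma Cinf_opn:
 assumes "opn n A" shows "Cinf n A f \<longleftrightarrow> (\<forall>r. Ck n A r f)"
proof
 assume "Cinf n A f"
 then have "\<exists>V g. opn n V & x \<in> V & (\<forall>r. Ck n V r g) & (\<forall>y\<in>A \<inter> V. g y = f y)" if "x \<in> A" for x
  using that by (auto simp: Cinf_def Euclidean_space_eq)
 then show "\<forall>r. Ck n A r f" by (intro allI Ck_local[OF assms]) metis
next
 assume "\<forall>r. Ck n A r f"
 then show "Cinf n A f" using assms by (auto simp: Cinf_def Euclidean_space_eq)
qed

text \<open>The path from \<open>z\<close> to \<open>y\<close> changes one coordinate at a time, and
  the mean value theorem in one variable applies to each leg. The intermediate points stay in the
  box spanned by \<open>y\<close> and \<open>z\<close>. This replaces the total derivative
  throughout.\<close>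

lemma mean_value_coords:
 assumes A: "opn n A" and d: "!!i x. i < n ==> x \<in> A ==> hpd f i (f' i x) x"
  and yz: "y \<in> Rn n" "z \<in> Rn n"
  and box: "!!w. w \<in> Rn n ==> (!!j. j < n ==> \<bar>w j - z j\<bar> <= \<bar>y j - z j\<bar>) ==> w \<in> A"
 obtains ze where "!!i. i < n ==> ze i \<in> Rn n" "!!i j. i < n ==> \<bar>ze i j - z j\<bar> <= \<bar>y j - z j\<bar>"
  "f y - f z = (\<Sum>i<n. f' i (ze i) * (y i - z i))"
proof -
 define w where "w k = (%j. if j < k then y j else z j)" for k :: nat
 have wR: "w k \<in> Rn n" for k using yz by (auto simp: w_def Rn_iff)
 have w0: "w 0 = z" by (simp add: w_def)
 have wn: "w n = y" using yz by (auto simp: w_def Rn_iff)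
 have ws: "w (Suc k) = (w k)(k := y k)" for k by (auto simp: w_def)
 have wk: "(w k)(k := z k) = w k" for k by (auto simp: w_def)
 have "\<exists>ze. ze \<in> Rn n & (\<forall>j. \<bar>ze j - z j\<bar> <= \<bar>y j - z j\<bar>) & f (w (Suc k)) - f (w k) = f' k ze * (y k - z k)"
  if k: "k < n" for k
 proof -
  let ?g = "%t. f ((w k)(k := t))"
  have inA: "(w k)(k := t) \<in> A" if "\<bar>t - z k\<bar> <= \<bar>y k - z k\<bar>" for t
   using that Rn_upd[OF wR k] by (intro box) (auto simp: w_def)
  have D: "(?g has_real_derivative f' k ((w k)(k := t))) (at t)" if "\<bar>t - z k\<bar> <= \<bar>y k - z k\<bar>" for t
   using d[OF k inA[OF that]] by simp
  have "\<exists>t. \<bar>t - z k\<bar> <= \<bar>y k - z k\<bar> & ?g (y k) - ?g (z k) = f' k ((w k)(k := t)) * (y k - z k)"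
  proof (cases "y k" "z k" rule: linorder_cases)
   case less
   obtain t where "t > y k" "t < z k" "?g (z k) - ?g (y k) = (z k - y k) * f' k ((w k)(k := t))"
    using MVT2[OF less, of ?g "%t. f' k ((w k)(k := t))"] D by fastforce
   then show ?thesis by (intro exI[of _ t]) (auto simp: algebra_simps)
  next
   case equal then show ?thesis by auto
  next
   case greater
   obtain t where "t > z k" "t < y k" "?g (y k) - ?g (z k) = (y k - z k) * f' k ((w k)(k := t))"
    using MVT2[OF greater, of ?g "%t. f' k ((w k)(k := t))"] D by fastforce
   then show ?thesis by (intro exI[of _ t]) (auto simp: algebra_simps)
  qed
  then obtain t where t: "\<bar>t - z k\<bar> <= \<bar>y k - z k\<bar>" "?g (y k) - ?g (z k) = f' k ((w k)(k := t)) * (y k - z k)" by blast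
  show ?thesis
   using t Rn_upd[OF wR k] by (intro exI[of _ "(w k)(k := t)"]) (auto simp: ws wk, auto simp: w_def)
 qed
 then obtain ze where ze: "!!k. k < n ==> ze k \<in> Rn n & (\<forall>j. \<bar>ze k j - z j\<bar> <= \<bar>y j - z j\<bar>) &
   f (w (Suc k)) - f (w k) = f' k (ze k) * (y k - z k)" by metis
 have "f y - f z = (\<Sum>k<n. f (w (Suc k)) - f (w k))"
  by (subst sum_lessThan_telescope) (simp add: w0 wn)
 also have "\<dots> = (\<Sum>k<n. f' k (ze k) * (y k - z k))" using ze by (intro sum.cong) auto
 finally show ?thesis using that[of ze] ze by blast
qed

text \<open>The increment of \<open>f\<close> along the curve is a sum of partial derivatives at
  intermediate points times coordinate increments; the intermediate points are forced to
  \<open>gm t0\<close>, and continuity of the partial derivatives gives the limit.\<close>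

lemma chain_rule_curve:
 assumes A: "opn n A" and d: "!!i x. i < n ==> x \<in> A ==> hpd f i (f' i x) x"
  and c: "!!i. i < n ==> continuous_on A (f' i)"
  and gm: "gm t0 \<in> A" "eventually (%t. gm t \<in> Rn n) (at t0)"
  and g: "!!i. i < n ==> ((%t. gm t i) has_real_derivative g i) (at t0)"
 shows "((%t. f (gm t)) has_real_derivative (\<Sum>i<n. f' i (gm t0) * g i)) (at t0)"
proof -
 obtain e where e: "e > 0" "boxn n (gm t0) e <= A" using opn_contains_boxn[OF A gm(1)] by blast
 have z: "gm t0 \<in> Rn n" using A gm(1) opn_subset by blast
 have lim: "((%t. gm t i) \<longlongrightarrow> gm t0 i) (at t0)" if "i < n" for i
  using DERIV_isCont[OF g[OF that]] by (simp add: isCont_def)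
 have "eventually (%t. \<forall>i\<in>{..<n}. \<bar>gm t i - gm t0 i\<bar> < e) (at t0)"
  using e(1) tendstoD[OF lim] by (intro eventually_ball_finite) (auto simp: dist_real_def)
 then have ev: "eventually (%t. gm t \<in> boxn n (gm t0) e) (at t0)"
  using gm(2) by eventually_elim (auto simp: boxn_def)
 have "\<exists>ze. (\<forall>i<n. ze i \<in> Rn n) & (\<forall>i<n. \<forall>j. \<bar>ze i j - gm t0 j\<bar> <= \<bar>gm t j - gm t0 j\<bar>) &
   f (gm t) - f (gm t0) = (\<Sum>i<n. f' i (ze i) * (gm t i - gm t0 i))"
  if t: "gm t \<in> boxn n (gm t0) e" for t
 proof (rule mean_value_coords[OF A d, of "gm t" "gm t0"])
  show "gm t \<in> Rn n" using t by (simp add: boxn_def)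
  show "gm t0 \<in> Rn n" by (rule z)
  show "w \<in> A" if "w \<in> Rn n" "!!j. j < n ==> \<bar>w j - gm t0 j\<bar> <= \<bar>gm t j - gm t0 j\<bar>" for w
   using e(2) that t by (force simp: boxn_def)
 qed blast+
 then have "\<forall>t. \<exists>ze. gm t \<in> boxn n (gm t0) e --> (\<forall>i<n. ze i \<in> Rn n) &
   (\<forall>i<n. \<forall>j. \<bar>ze i j - gm t0 j\<bar> <= \<bar>gm t j - gm t0 j\<bar>) &
   f (gm t) - f (gm t0) = (\<Sum>i<n. f' i (ze i) * (gm t i - gm t0 i))"
  by blast
 from choice[OF this] obtain ze where ze: "!!t. gm t \<in> boxn n (gm t0) e ==> (\<forall>i<n. ze t i \<in> Rn n) &
   (\<forall>i<n. \<forall>j. \<bar>ze t i j - gm t0 j\<bar> <= \<bar>gm t j - gm t0 j\<bar>) &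
   f (gm t) - f (gm t0) = (\<Sum>i<n. f' i (ze t i) * (gm t i - gm t0 i))"
  by blast
 \<comment> \<open>Each coordinate of the intermediate points is at most as far from
   \<open>gm t0\<close> as that of \<open>gm t\<close>, so the points converge.\<close>
 have zl: "((%t. f' i (ze t i)) \<longlongrightarrow> f' i (gm t0)) (at t0)" if i: "i < n" for i
 proof (rule continuous_on_tendsto_compose[OF c[OF i] _ gm(1)])
  show "((%t. ze t i) \<longlongrightarrow> gm t0) (at t0)" unfolding tendsto_fun_iff
  proof
   fix j
   show "((%t. ze t i j) \<longlongrightarrow> gm t0 j) (at t0)"
   proof (cases "j < n")
    case True
    have "((%t. ze t i j - gm t0 j) \<longlongrightarrow> 0) (at t0)"
    proof (rule Lim_null_comparison)
     show "eventually (%t. norm (ze t i j - gm t0 j) <= \<bar>gm t j - gm t0 j\<bar>) (at t0)"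
      using ev by (rule eventually_mono) (use ze i in auto)
     show "((%t. \<bar>gm t j - gm t0 j\<bar>) \<longlongrightarrow> 0) (at t0)"
      using lim[OF True] by (simp add: LIM_zero tendsto_rabs_zero)
    qed
    then show ?thesis by (simp add: LIM_zero_iff)
   next
    case False
    have "eventually (%t. ze t i j = gm t0 j) (at t0)"
     using ev by (rule eventually_mono) (use ze i False z in \<open>auto simp: Rn_iff\<close>)
    then show ?thesis by (rule tendsto_eventually)
   qed
  qed
  show "eventually (%t. ze t i \<in> A) (at t0)"
   using ev
  proof (rule eventually_mono)
   fix t assume t: "gm t \<in> boxn n (gm t0) e"
   then have "ze t i \<in> boxn n (gm t0) e"
   proof -
    have "\<bar>ze t i j - gm t0 j\<bar> < e" if "j < n" for j
    proof (rule le_less_trans)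
     show "\<bar>ze t i j - gm t0 j\<bar> <= \<bar>gm t j - gm t0 j\<bar>" using ze[OF t] i by simp
     show "\<bar>gm t j - gm t0 j\<bar> < e" using t that by (simp add: boxn_def)
    qed
    then show ?thesis using ze[OF t] i by (simp add: boxn_def)
   qed
   then show "ze t i \<in> A" using e(2) by (rule subsetD[rotated])
  qed
 qed
 have "((%t. \<Sum>i<n. f' i (ze t i) * ((gm t i - gm t0 i) / (t - t0))) \<longlongrightarrow> (\<Sum>i<n. f' i (gm t0) * g i)) (at t0)"
  by (intro tendsto_sum tendsto_mult zl) (use g in \<open>auto simp: has_field_derivative_iff\<close>)
 moreover have "eventually (%t. (\<Sum>i<n. f' i (ze t i) * ((gm t i - gm t0 i) / (t - t0))) = (f (gm t) - f (gm t0)) / (t - t0)) (at t0)"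
  using ev by (rule eventually_mono) (use ze in \<open>auto simp: sum_divide_distrib\<close>)
 ultimately show ?thesis unfolding has_field_derivative_iff by (rule Lim_transform_eventually)
qed

subsection \<open>Calculus of \<open>C\<^sup>r\<close> functions\<close>

lemma Ck_const: "opn n A ==> Ck n A r (%x. c)"
proof (induction r arbitrary: c)
 case (Suc r)
 show ?case by (rule Ck_SucI[OF Suc.prems, where f' = "%i x. 0"]) (use Suc in auto)
qed auto

lemma Ck_coord: assumes "opn n A" shows "Ck n A r (%x. x j)"
proof (cases r)
 case 0 then show ?thesis by (simp add: continuous_on_apply)
next
 case (Suc q)
 show ?thesis unfolding Suc
  by (rule Ck_SucI[OF assms continuous_on_apply, where f' = "%i x. if i = j then 1 else 0"])
   (auto intro!: derivative_eq_intros Ck_const assms)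
qed

lemma Ck_add: "opn n A ==> Ck n A r f ==> Ck n A r g ==> Ck n A r (%x. f x + g x)"
proof (induction r arbitrary: f g)
 case 0 then show ?case by (auto intro: continuous_intros)
next
 case (Suc r)
 show ?case
 proof (rule Ck_SucI[OF Suc.prems(1), where f' = "%i x. pd A i f x + pd A i g x"])
  show "continuous_on A (%x. f x + g x)" using Suc.prems Ck_continuous by (intro continuous_intros) auto
  show "hpd (%x. f x + g x) i (pd A i f x + pd A i g x) x" if "i < n" "x \<in> A" for i x
   by (rule DERIV_add[of "%t. f (x(i := t))" _ _ _ "%t. g (x(i := t))",
      OF Ck_hpd[OF Suc.prems(2,1) that] Ck_hpd[OF Suc.prems(3,1) that]])
  show "Ck n A r (%x. pd A i f x + pd A i g x)" if "i < n" for i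
   using Suc.prems that Ck_pd by (intro Suc.IH) auto
 qed
qed

lemma Ck_mult: "opn n A ==> Ck n A r f ==> Ck n A r g ==> Ck n A r (%x. f x * g x)"
proof (induction r arbitrary: f g)
 case 0 then show ?case by (auto intro: continuous_intros)
next
 case (Suc r)
 have fg: "Ck n A r f" "Ck n A r g" using Suc.prems Ck_Suc_imp by auto
 have p: "Ck n A r (pd A i f)" "Ck n A r (pd A i g)" if "i < n" for i using Suc.prems that Ck_pd by auto
 show ?case
 proof (rule Ck_SucI[OF Suc.prems(1), where f' = "%i x. pd A i f x * g x + pd A i g x * f x"])
  show "continuous_on A (%x. f x * g x)" using fg Ck_continuous by (intro continuous_intros) auto
  show "hpd (%x. f x * g x) i (pd A i f x * g x + pd A i g x * f x) x" if "i < n" "x \<in> A" for i x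
   using DERIV_mult[of "%t. f (x(i := t))" _ _ _ "%t. g (x(i := t))",
     OF Ck_hpd[OF Suc.prems(2,1) that] Ck_hpd[OF Suc.prems(3,1) that]] by simp
  show "Ck n A r (%x. pd A i f x * g x + pd A i g x * f x)" if "i < n" for i
   using p[OF that] fg Suc.prems(1) by (intro Ck_add Suc.IH) auto
 qed
qed

lemma Ck_sum: "opn n A ==> (!!i. i \<in> I ==> Ck n A r (f i)) ==> Ck n A r (%x. \<Sum>i\<in>I. f i x)"
 by (induction I rule: infinite_finite_induct) (auto intro!: Ck_add Ck_const)

lemma Ck_prod: "opn n A ==> (!!i. i \<in> I ==> Ck n A r (f i)) ==> Ck n A r (%x. \<Prod>i\<in>I. f i x)"
 by (induction I rule: infinite_finite_induct) (auto intro!: Ck_mult Ck_const)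

lemma Ck_minus: "opn n A ==> Ck n A r f ==> Ck n A r (%x. - f x)"
 using Ck_mult[of n A r "%x. -1" f] Ck_const by auto

lemma Ck_diff: "opn n A ==> Ck n A r f ==> Ck n A r g ==> Ck n A r (%x. f x - g x)"
 using Ck_add[of n A r f "%x. - g x"] Ck_minus by auto

lemma hpd_compose:
 assumes AB: "opn n A" "opn m B" and f: "Ck m B (Suc r) f"
  and \<phi>: "!!j. j < m ==> Ck n A (Suc r) (%x. \<phi> x j)" "\<phi> ` A <= B" and i: "i < n" and x: "x \<in> A"
 shows "hpd (%x. f (\<phi> x)) i (\<Sum>j<m. pd B j f (\<phi> x) * pd A i (%x. \<phi> x j) x) x"
proof -
 have "x \<in> Rn n" using AB x opn_subset by blast
 then have o: "open {t. x(i := t) \<in> A}" using open_slice AB i by blast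
 have "((%t. f (\<phi> (x(i := t)))) has_real_derivative
   (\<Sum>j<m. pd B j f (\<phi> (x(i := x i))) * pd A i (%x. \<phi> x j) x)) (at (x i))"
 proof (rule chain_rule_curve[OF AB(2)])
  show "hpd f i (pd B i f x) x" if "i < m" "x \<in> B" for i x
   using that f AB by (simp add: Ck_Suc_opn del: Ck.simps)
  show "continuous_on B (pd B i f)" if "i < m" for i using that f Ck_continuous Ck_pd by blast
  show "\<phi> (x(i := x i)) \<in> B" using x \<phi>(2) by auto
  have "eventually (%t. x(i := t) \<in> A) (at (x i))"
   using o x eventually_at_topological[of "%t. x(i := t) \<in> A" "x i" UNIV] by auto
  then show "eventually (%t. \<phi> (x(i := t)) \<in> Rn m) (at (x i))"
   by (rule eventually_mono) (use \<phi>(2) opn_subset[OF AB(2)] in auto)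
  show "hpd (%x. \<phi> x j) i (pd A i (%x. \<phi> x j) x) x" if "j < m" for j
   using Ck_hpd[OF \<phi>(1)[OF that] AB(1) i x] .
 qed
 then show ?thesis by simp
qed

lemma Ck_compose:
 assumes "opn n A" "opn m B" "Ck m B r f" "!!j. j < m ==> Ck n A r (%x. \<phi> x j)" "\<phi> ` A <= B"
 shows "Ck n A r (%x. f (\<phi> x))"
 using assms(3,4)
proof (induction r arbitrary: f)
 case 0
 have "continuous_on A \<phi>"
  using opn_subset[OF assms(2)] assms(5) 0 by (intro continuous_on_Rn_valued[of _ _ m]) auto
 then show ?case using 0 assms(5) continuous_on_compose2[of B f A \<phi>] by simp
next
 case (Suc r)
 have \<phi>: "Ck n A r (%x. \<phi> x j)" if "j < m" for j using Suc.prems(2)[OF that] by (rule Ck_Suc_imp)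
 show ?case
 proof (rule Ck_SucI[OF assms(1), where f' = "%i x. \<Sum>j<m. pd B j f (\<phi> x) * pd A i (%x. \<phi> x j) x"])
  show "continuous_on A (%x. f (\<phi> x))"
   using Suc.IH[of f] Suc.prems(1) \<phi> by (metis Ck_Suc_imp Ck_continuous)
  show "hpd (%x. f (\<phi> x)) i (\<Sum>j<m. pd B j f (\<phi> x) * pd A i (%x. \<phi> x j) x) x" if "i < n" "x \<in> A" for i x
   using hpd_compose[OF assms(1,2) Suc.prems assms(5) that] by simp
  show "Ck n A r (%x. \<Sum>j<m. pd B j f (\<phi> x) * pd A i (%x. \<phi> x j) x)" if "i < n" for i
  proof (intro Ck_sum assms(1) Ck_mult)
   fix j assume "j \<in> {..<m}"
   then have j: "j < m" by simp
   show "Ck n A r (%x. pd B j f (\<phi> x))" by (rule Suc.IH[OF Ck_pd[OF Suc.prems(1) j] \<phi>])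
   show "Ck n A r (%x. pd A i (%x. \<phi> x j) x)" using Ck_pd[OF Suc.prems(2)[OF j] that] by simp
  qed
 qed
qed

lemma pd_compose:
 assumes "opn n A" "opn m B" "Ck m B (Suc r) f"
  "!!j. j < m ==> Ck n A (Suc r) (%x. \<phi> x j)" "\<phi> ` A <= B" "i < n" "x \<in> A"
 shows "pd A i (%x. f (\<phi> x)) x = (\<Sum>j<m. pd B j f (\<phi> x) * pd A i (%x. \<phi> x j) x)"
 by (rule pd_eq[where f = "%x. f (\<phi> x)", OF assms(1,7,6) hpd_compose[OF assms]])

lemma Ck_inverse:
 "opn n A ==> Ck n A r f ==> (!!x. x \<in> A ==> f x ~= 0) ==> Ck n A r (%x. inverse (f x))"
proof (induction r)
 case 0 then show ?case by (auto intro: continuous_intros)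
next
 case (Suc r)
 have f: "Ck n A r f" using Suc.prems Ck_Suc_imp by auto
 show ?case
 proof (rule Ck_SucI[OF Suc.prems(1), where f' = "%i x. - (inverse (f x) * pd A i f x * inverse (f x))"])
  show "continuous_on A (%x. inverse (f x))" using Suc.prems by (intro continuous_intros) (auto dest: Ck_continuous)
  show "hpd (%x. inverse (f x)) i (- (inverse (f x) * pd A i f x * inverse (f x))) x" if "i < n" "x \<in> A" for i x
   using DERIV_inverse'[of "%t. f (x(i := t))", OF Ck_hpd[OF Suc.prems(2,1) that]] Suc.prems(3) that by simp
  show "Ck n A r (%x. - (inverse (f x) * pd A i f x * inverse (f x)))" if "i < n" for i
   using Suc.prems that f Ck_pd by (intro Ck_minus Ck_mult Suc.IH) auto
 qed
qed

text \<open>The second difference over an \<open>h\<close> by \<open>h\<close> square equals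
  \<open>h * h\<close> times either mixed derivative at some point of a small box, by applying the
  mean value theorem in the two possible orders. Continuity of both mixed derivatives then compares
  them at \<open>x\<close>.\<close>

lemma pd_commute:
 assumes A: "opn n A" and f: "Ck n A (Suc (Suc r)) f" and ij: "i < n" "j < n" and x: "x \<in> A"
 shows "pd A i (pd A j f) x = pd A j (pd A i f) x"
proof (cases "i = j")
 case False
 have xR: "x \<in> Rn n" using A x opn_subset by blast
 have D2: "\<exists>ze\<in>boxn n x (2*h). f (x(i := x i + h, j := x j + h)) - f (x(i := x i + h)) - f (x(j := x j + h)) + f x
   = h * h * pd A j (pd A i f) ze"
  if h: "0 < h" "boxn n x (2*h) <= A" and ij: "i < n" "j < n" "i ~= j" for h i j
 proof -
  have inb: "x(i := s, j := t) \<in> boxn n x (2*h)" if "\<bar>s - x i\<bar> <= h" "\<bar>t - x j\<bar> <= h" for s t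
   using that xR ij h(1) unfolding boxn_def by (auto simp: Rn_iff)
  let ?u = "%s. f (x(i := s, j := x j + h)) - f (x(i := s, j := x j))"
  have Du: "(?u has_real_derivative
    (pd A i f (x(i := s, j := x j + h)) - pd A i f (x(i := s, j := x j)))) (at s)"
   if "\<bar>s - x i\<bar> <= h" for s
  proof -
   have *: "((%s. f (x(i := s, j := t))) has_real_derivative pd A i f (x(i := s, j := t))) (at s)"
    if "\<bar>t - x j\<bar> <= h" for t
   proof -
    have "x(i := s, j := t) \<in> A" using inb[OF \<open>\<bar>s - x i\<bar> <= h\<close> that] h by blast
    from Ck_hpd[OF f A ij(1) this] show ?thesis using ij(3) by (simp add: fun_upd_twist)
   qed
   show ?thesis using h by (intro DERIV_diff *) auto
  qed
  obtain s where s: "s > x i" "s < x i + h"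
   "?u (x i + h) - ?u (x i) = (x i + h - x i) * (pd A i f (x(i := s, j := x j + h)) - pd A i f (x(i := s, j := x j)))"
   using MVT2[of "x i" "x i + h" ?u, OF _ Du] h by auto
  have Dv: "((%t. pd A i f (x(i := s, j := t))) has_real_derivative pd A j (pd A i f) (x(i := s, j := t))) (at t)"
   if "\<bar>t - x j\<bar> <= h" for t
  proof -
   have "x(i := s, j := t) \<in> A" using inb[of s t] s that h by auto
   moreover have "Ck n A (Suc r) (pd A i f)" using f ij Ck_pd by blast
   ultimately show ?thesis using Ck_hpd[of n A r "pd A i f" j "x(i := s, j := t)"] A ij by simp
  qed
  obtain t where t: "t > x j" "t < x j + h"
   "pd A i f (x(i := s, j := x j + h)) - pd A i f (x(i := s, j := x j)) = (x j + h - x j) * pd A j (pd A i f) (x(i := s, j := t))"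
   using MVT2[of "x j" "x j + h" "%t. pd A i f (x(i := s, j := t))", OF _ Dv] h by auto
  have "x(i := s, j := t) \<in> boxn n x (2*h)" using s t by (intro inb) auto
  moreover have "x(i := x i + h, j := x j) = x(i := x i + h)" "x(i := x i, j := x j) = x"
   using ij by (auto simp: fun_upd_def)
  ultimately show ?thesis using s(3) t(3) by (intro bexI[of _ "x(i := s, j := t)"]) (auto simp: algebra_simps)
 qed
 have "\<bar>pd A i (pd A j f) x - pd A j (pd A i f) x\<bar> <= e" if e: "e > 0" for e
 proof -
  have "\<exists>d>0. boxn n x d <= A & (\<forall>y\<in>boxn n x d. \<bar>g y - g x\<bar> < e/2)" if g: "continuous_on A g" for g :: "_ => real"
  proof -
   have "opn n (A \<inter> g -` ball (g x) (e/2))"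
    using A g continuous_on_open_gen[of g A UNIV]
    by (metis continuous_openin_preimage_gen open_ball openin_trans)
   moreover have "x \<in> A \<inter> g -` ball (g x) (e/2)" using x e by auto
   ultimately obtain d where "d > 0" "boxn n x d <= A \<inter> g -` ball (g x) (e/2)" by (rule opn_contains_boxn)
   then show ?thesis by (intro exI[of _ d]) (auto simp: dist_real_def subset_iff abs_minus_commute)
  qed
  moreover have "continuous_on A (pd A i (pd A j f))" "continuous_on A (pd A j (pd A i f))"
   using f ij Ck_continuous Ck_pd by meson+
  ultimately obtain d1 d2 where d: "d1 > 0" "d2 > 0" "boxn n x d1 <= A"
   "\<forall>y\<in>boxn n x d1. \<bar>pd A i (pd A j f) y - pd A i (pd A j f) x\<bar> < e/2"
   "\<forall>y\<in>boxn n x d2. \<bar>pd A j (pd A i f) y - pd A j (pd A i f) x\<bar> < e/2" by metis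
  define h where "h = min d1 d2 / 2"
  have h: "h > 0" "boxn n x (2*h) <= boxn n x d1" "boxn n x (2*h) <= boxn n x d2"
   using d by (auto simp: h_def boxn_def)
  obtain ze1 where 1: "ze1 \<in> boxn n x (2*h)"
   "f (x(i := x i + h, j := x j + h)) - f (x(i := x i + h)) - f (x(j := x j + h)) + f x = h * h * pd A j (pd A i f) ze1"
   using D2[of h i j] h d ij False by auto
  obtain ze2 where 2: "ze2 \<in> boxn n x (2*h)"
   "f (x(j := x j + h, i := x i + h)) - f (x(j := x j + h)) - f (x(i := x i + h)) + f x = h * h * pd A i (pd A j f) ze2"
   using D2[of h j i] h d ij False by auto
  have "h * h * pd A j (pd A i f) ze1 = h * h * pd A i (pd A j f) ze2"
   using 1(2)[unfolded fun_upd_twist[OF False, of x "x i + h" "x j + h"]] 2(2) by linarith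
  then have "pd A j (pd A i f) ze1 = pd A i (pd A j f) ze2" using h by simp
  moreover have "\<bar>pd A i (pd A j f) ze2 - pd A i (pd A j f) x\<bar> < e/2" using d(4) subsetD[OF h(2) 2(1)] by (rule bspec)
  moreover have "\<bar>pd A j (pd A i f) ze1 - pd A j (pd A i f) x\<bar> < e/2" using d(5) subsetD[OF h(3) 1(1)] by (rule bspec)
  ultimately show ?thesis by linarith
 qed
 then have "\<bar>pd A i (pd A j f) x - pd A j (pd A i f) x\<bar> <= 0" by (rule field_le_epsilon) simp
 then show ?thesis by simp
qed simp

section \<open>Smooth bump functions on coordinate space\<close>

lemma power_le_fact_exp: "0 <= (u::real) ==> u ^ n <= fact n * exp u"
proof -
 assume u: "0 <= u"
 have s: "summable (%n. u ^ n /\<^sub>R fact n)" by (rule summable_exp_generic)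
 have "(\<Sum>i\<in>{n}. u ^ i /\<^sub>R fact i) <= exp u"
  unfolding exp_def by (rule sum_le_suminf[OF s]) (use u in auto)
 then show ?thesis by (simp add: field_simps)
qed

text \<open>The functions \<^term>\<open>flat k\<close> are closed under differentiation up to linear combinations.\<close>

definition flat :: "nat => real => real"
 where "flat k t = (if 0 < t then exp (- (1 / t)) / t ^ k else 0)"

lemma flat_nonneg: "0 <= flat k t"
 by (simp add: flat_def)

lemma flat_pos_iff: "0 < flat k t \<longleftrightarrow> 0 < t"
 by (simp add: flat_def)

text \<open>The exponential beats the power \<open>k + 2\<close> of \<open>1 / t\<close>. The
  surplus \<open>t\<^sup>2\<close> is one order more than continuity at 0 would take, and yields the
  derivative there.\<close>

lemma flat_bound: "\<bar>flat k t\<bar> <= fact (k + 2) * t\<^sup>2"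
proof (cases "0 < t")
 case True
 have "(1 / t) ^ (k + 2) <= fact (k + 2) * exp (1 / t)"
  using True by (intro power_le_fact_exp) simp
 then have "(1 / t) ^ (k + 2) * exp (- (1 / t)) <= fact (k + 2) * exp (1 / t) * exp (- (1 / t))"
  by (intro mult_right_mono) auto
 also have "\<dots> = fact (k + 2)" by (simp add: exp_minus)
 finally have "exp (- (1 / t)) / t ^ k / t\<^sup>2 <= fact (k + 2)"
  using True by (simp add: power_add power_divide field_simps power2_eq_square)
 then have "exp (- (1 / t)) / t ^ k <= fact (k + 2) * t\<^sup>2"
  using True by (subst (asm) pos_divide_le_eq) auto
 then show ?thesis using True by (simp add: flat_def)
qed (simp add: flat_def)

lemma DERIV_flat: "(flat k has_real_derivative (- real k * flat (k + 1) t + flat (k + 2) t)) (at t)"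
proof (cases t "0::real" rule: linorder_cases)
 case less
 have "(flat k has_real_derivative 0) (at t)"
  by (rule has_field_derivative_transform_within_open[OF DERIV_const, of "{..<0}" _ 0])
   (use less in \<open>auto simp: flat_def\<close>)
 then show ?thesis using less by (simp add: flat_def)
next
 case greater
 have "((%t. exp (- (1 / t)) / t ^ k) has_real_derivative
   (exp (- (1 / t)) * (1 / t\<^sup>2) * t ^ k - exp (- (1 / t)) * (real k * t ^ (k - 1))) / (t ^ k * t ^ k)) (at t)"
  using greater by (auto intro!: derivative_eq_intros simp: power2_eq_square)
 moreover have "(exp (- (1 / t)) * (1 / t\<^sup>2) * t ^ k - exp (- (1 / t)) * (real k * t ^ (k - 1))) / (t ^ k * t ^ k)
   = - real k * flat (k + 1) t + flat (k + 2) t"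
  using greater by (cases k) (simp_all add: flat_def field_simps power2_eq_square)
 ultimately have "((%t. exp (- (1 / t)) / t ^ k) has_real_derivative - real k * flat (k + 1) t + flat (k + 2) t) (at t)"
  by simp
 then show ?thesis
  by (rule has_field_derivative_transform_within_open[of _ _ _ "{0<..}"])
   (use greater in \<open>auto simp: flat_def\<close>)
next
 case equal
 \<comment> \<open>At the origin the difference quotient is at most a constant times the absolute
   value of \<open>h\<close>, by \<open>flat_bound\<close>.\<close>
 have "((%h. (flat k (0 + h) - flat k 0) / h) \<longlongrightarrow> 0) (at 0)"
 proof (rule Lim_null_comparison)
  show "eventually (%h. norm ((flat k (0 + h) - flat k 0) / h) <= fact (k + 2) * \<bar>h\<bar>) (at (0::real))"
  proof (rule eventually_at_filter[THEN iffD2], rule always_eventually, intro allI impI)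
   fix h :: real assume "h ~= 0"
   show "norm ((flat k (0 + h) - flat k 0) / h) <= fact (k + 2) * \<bar>h\<bar>"
   proof -
    have "flat k 0 = 0" by (simp add: flat_def)
    then have "norm ((flat k (0 + h) - flat k 0) / h) = \<bar>flat k h\<bar> / \<bar>h\<bar>" by simp
    also have "\<dots> <= (fact (k + 2) * \<bar>h\<bar>\<^sup>2) / \<bar>h\<bar>"
     using flat_bound[of k h] by (intro divide_right_mono) auto
    also have "\<dots> = fact (k + 2) * \<bar>h\<bar>"
    proof -
     have "(c * x\<^sup>2) / x = c * x" if "x ~= 0" for c x :: real using that by (simp add: power2_eq_square)
     then show ?thesis using \<open>h ~= 0\<close> by (metis abs_eq_0)
    qed
    finally show ?thesis .
   qed
  qed
  show "((%h. fact (k + 2) * \<bar>h\<bar>) \<longlongrightarrow> 0) (at (0::real))"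
   by (auto intro!: tendsto_eq_intros)
 qed
 then show ?thesis using equal by (simp add: DERIV_def flat_def)
qed

lemma Ck_flat: "opn n A ==> Ck n A r f ==> Ck n A r (%x. flat k (f x))"
proof (induction r arbitrary: k)
 case 0
 have "continuous_on UNIV (flat k)"
  by (rule DERIV_continuous_on) (rule DERIV_flat[THEN DERIV_subset], simp)
 then show ?case using 0 by (auto intro: continuous_on_compose2)
next
 case (Suc r)
 have f: "Ck n A r f" using Suc.prems Ck_Suc_imp by blast
 show ?case
 proof (rule Ck_SucI[OF Suc.prems(1), where f' = "%i x. (- real k * flat (k + 1) (f x) + flat (k + 2) (f x)) * pd A i f x"])
  show "continuous_on A (%x. flat k (f x))"
   by (rule Ck_continuous[OF Suc.IH[OF Suc.prems(1) f]])
  show "hpd (%x. flat k (f x)) i ((- real k * flat (k + 1) (f x) + flat (k + 2) (f x)) * pd A i f x) x"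
   if "i < n" "x \<in> A" for i x
   using DERIV_chain2[of "flat k" _ "%t. f (x(i := t))", OF DERIV_flat[of k "f (x(i := x i))"] Ck_hpd[OF Suc.prems(2,1) that]]
   by simp
  show "Ck n A r (%x. (- real k * flat (k + 1) (f x) + flat (k + 2) (f x)) * pd A i f x)" if "i < n" for i
   by (intro Ck_mult Ck_add Ck_const Suc.IH Suc.prems(1) f Ck_pd[OF Suc.prems(2) that])
 qed
qed

text \<open>The difference of squares, instead of an absolute value, keeps the argument of
  \<open>flat 0\<close> polynomial and hence smooth; it is positive exactly on the open interval of
  radius \<open>d\<close>.\<close>

definition bumpn :: "nat => (nat => real) => real => (nat => real) => real"
 where "bumpn n a d y = (\<Prod>i<n. flat 0 (d\<^sup>2 - (y i - a i)\<^sup>2))"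

lemma Ck_bumpn: "opn n A ==> Ck n A r (bumpn n a d)"
 unfolding bumpn_def power2_eq_square
 by (intro Ck_prod Ck_flat Ck_diff Ck_mult Ck_const Ck_coord) auto

lemma bumpn_nonneg: "0 <= bumpn n a d y"
 unfolding bumpn_def by (intro prod_nonneg) (simp add: flat_nonneg)

lemma bumpn_pos: "0 < d ==> 0 < bumpn n a d a"
 unfolding bumpn_def by (intro prod_pos) (simp add: flat_pos_iff)

lemma bumpn_zero:
 assumes "0 < d" "y \<in> Rn n" "y \<notin> boxn n a d" shows "bumpn n a d y = 0"
proof -
 obtain i where i: "i < n" "d <= \<bar>y i - a i\<bar>" using assms by (auto simp: boxn_def not_less)
 then have "d\<^sup>2 <= (y i - a i)\<^sup>2" using assms(1) by (simp add: abs_le_square_iff[symmetric])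
 then have "flat 0 (d\<^sup>2 - (y i - a i)\<^sup>2) = 0" by (simp add: flat_def)
 then show ?thesis unfolding bumpn_def using i by (intro prod_zero) auto
qed

section \<open>Compact boxes, compactly supported functions and the Lebesgue integral\<close>

definition cboxn :: "nat => (nat => real) => real => (nat => real) set"
 where "cboxn n x d = {y \<in> Rn n. \<forall>i<n. \<bar>y i - x i\<bar> <= d}"

text \<open>A closed box is a product of intervals and, from index \<open>n\<close> on, of
  singletons, so Tychonoff's theorem applies.\<close>

lemma compact_cboxn: "compact (cboxn n x d)"
proof -
 have eq: "cboxn n x d = Pi\<^sub>E UNIV (%i. if i < n then {x i - d..x i + d} else {0})"
  (is "_ = Pi\<^sub>E UNIV ?S")
 proof (intro subset_antisym subsetI)
  fix y assume y: "y \<in> cboxn n x d"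
  have "y i \<in> ?S i" for i
  proof (cases "i < n")
   case True
   then have "\<bar>y i - x i\<bar> <= d" using y by (simp add: cboxn_def)
   then show ?thesis using True by (auto simp: abs_le_iff)
  qed (use y in \<open>auto simp: cboxn_def Rn_iff\<close>)
  then show "y \<in> Pi\<^sub>E UNIV ?S" by (auto simp: PiE_iff)
 next
  fix y assume "y \<in> Pi\<^sub>E UNIV ?S"
  then have y: "y i \<in> ?S i" for i by (auto simp: PiE_iff)
  have "y i = 0" if "n <= i" for i using y[of i] that by simp
  moreover have "\<bar>y i - x i\<bar> <= d" if "i < n" for i using y[of i] that by (simp add: abs_le_iff)
  ultimately show "y \<in> cboxn n x d" by (simp add: cboxn_def Rn_iff)
 qed
 have "compactin (product_topology (%i. euclideanreal) UNIV) (Pi\<^sub>E UNIV ?S)"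
  by (subst compactin_PiE) auto
 then show ?thesis unfolding eq by (simp add: euclidean_product_topology)
qed

lemma cboxn_subset_boxn: "d < e ==> cboxn n x d <= boxn n x e"
 by (force simp: cboxn_def boxn_def)

lemma boxn_subset_cboxn: "boxn n x d <= cboxn n x d"
 by (force simp: cboxn_def boxn_def)

lemma opn_contains_cboxn:
 assumes "opn n A" "x \<in> A"
 obtains d where "0 < d" "cboxn n x d <= A"
proof -
 obtain e where e: "0 < e" "boxn n x e <= A" using opn_contains_boxn[OF assms] .
 then have "cboxn n x (e / 2) <= A" using cboxn_subset_boxn[of "e / 2" e n x] by auto
 then show ?thesis using e(1) by (intro that[of "e / 2"]) auto
qed

lemma compact_Rn_bounded:
 assumes "compact K" "K <= Rn n"
 obtains R where "0 < R" "!!y i. y \<in> K ==> \<bar>y i\<bar> < R"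
proof -
 have "\<exists>B. \<forall>y\<in>K. \<bar>y i\<bar> < B" for i
 proof -
  have "compact ((%y. y i) ` K)"
   by (rule compact_continuous_image[OF continuous_on_apply assms(1)])
  then have "bounded ((%y. y i) ` K)" by (rule compact_imp_bounded)
  then obtain B where "\<forall>y\<in>K. \<bar>y i\<bar> <= B" by (auto simp: bounded_iff)
  then show ?thesis by (intro exI[of _ "B + 1"]) force
 qed
 then obtain B where B: "!!i y. y \<in> K ==> \<bar>y i\<bar> < B i" by metis
 define R where "R = Max (insert 1 (B ` {..<n}))"
 have R: "1 <= R" by (simp add: R_def)
 have "\<bar>y i\<bar> < R" if y: "y \<in> K" for y i
 proof (cases "i < n")
  case True
  then have "B i <= R" by (simp add: R_def)
  then show ?thesis using B[OF y, of i] by simp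
 next
  case False
  then have "y i = 0" using y assms(2) by (auto simp: Rn_iff)
  then show ?thesis using R by simp
 qed
 then show ?thesis using R by (intro that[of R]) auto
qed

definition csupp :: "nat => ((nat => real) => real) => bool"
 where "csupp n F \<longleftrightarrow> continuous_on (Rn n) F &
  (\<exists>K. compact K & K <= Rn n & (\<forall>y\<in>Rn n - K. F y = 0))"

definition exn :: "nat => (nat => real) => nat => real"
 where "exn n x = (%i. if i < n then x i else 0)"

abbreviation Leb :: "nat => (nat => real) measure"
 where "Leb n \<equiv> Pi\<^sub>M {..<n} (%_. lborel)"

definition RInt :: "nat => ((nat => real) => real) => real"
 where "RInt n F = (\<integral>x. F (exn n x) \<partial>Leb n)"

lemma exn_Rn: "exn n x \<in> Rn n"
 by (simp add: exn_def Rn_iff)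

lemma Rn_integral_RInt: "Rn_integral n A f = RInt n (%y. if y \<in> A then f y else 0)"
 unfolding Rn_integral_def RInt_def exn_def Let_def
 by (intro Bochner_Integration.integral_cong) (auto simp: indicator_def)

lemma RInt_cong: "(!!y. y \<in> Rn n ==> F y = G y) ==> RInt n F = RInt n G"
 unfolding RInt_def by (intro Bochner_Integration.integral_cong) (auto simp: exn_Rn)

lemma measurable_csupp:
 assumes "continuous_on (Rn n) F" shows "(%x. F (exn n x)) \<in> borel_measurable (Leb n)"
proof -
 have "continuous_on UNIV (exn n)"
 proof (rule continuous_on_Rn_valued[of _ _ n])
  show "continuous_on UNIV (%x. exn n x j)" if "j < n" for j
   using that continuous_on_apply by (simp add: exn_def)
 qed (rule exn_Rn)
 then have "continuous_on UNIV (%x. F (exn n x))"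
  by (rule continuous_on_compose2[OF assms]) (auto simp: exn_Rn)
 then have F: "(%x. F (exn n x)) \<in> borel_measurable borel" by (rule borel_measurable_continuous_onI)
 have "exn n \<in> borel_measurable (Leb n)"
 proof (rule measurable_coordinatewise_then_product)
  fix i show "(%x. exn n x i) \<in> borel_measurable (Leb n)"
   by (cases "i < n") (auto simp: exn_def)
 qed
 from measurable_compose[OF this F]
 show ?thesis by (simp add: exn_def if_distrib cong: if_cong)
qed

text \<open>The function is bounded, by compactness, and vanishes outside a cube of finite
  measure.\<close>

lemma integrable_csupp:
 assumes "csupp n F" shows "integrable (Leb n) (%x. F (exn n x))"
proof -
 interpret product_sigma_finite "%_::nat. lborel :: real measure"
  by (simp add: product_sigma_finite_def sigma_finite_lborel)
 obtain K where F: "continuous_on (Rn n) F" and K: "compact K" "K <= Rn n" "!!y. y \<in> Rn n - K ==> F y = 0"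
  using assms by (auto simp: csupp_def)
 obtain R where R: "0 < R" "!!y i. y \<in> K ==> \<bar>y i\<bar> < R" using compact_Rn_bounded[OF K(1,2)] by metis
 have "compact (F ` K)" using F K by (intro compact_continuous_image continuous_on_subset[OF F]) auto
 then obtain B where B: "!!y. y \<in> K ==> \<bar>F y\<bar> <= B"
  using compact_imp_bounded by (fastforce simp: bounded_iff)
 have B': "\<bar>F y\<bar> <= max B 0" if "y \<in> Rn n" for y
  using B[of y] K(3)[of y] that by (cases "y \<in> K") auto
 show ?thesis
 proof (rule integrableI_bounded_set[where A = "Pi\<^sub>E {..<n} (%_. {-R..R})" and B = "max B 0"])
  show "Pi\<^sub>E {..<n} (%_. {-R..R}) \<in> sets (Leb n)" by (intro sets_PiM_I_finite) auto
  show "(%x. F (exn n x)) \<in> borel_measurable (Leb n)" by (rule measurable_csupp[OF F])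
  show "emeasure (Leb n) (Pi\<^sub>E {..<n} (%_. {-R..R})) < \<infinity>"
   using R(1) by (subst emeasure_PiM) (auto simp: power_less_top_ennreal)
  show "AE x in Leb n. x \<in> Pi\<^sub>E {..<n} (%_. {-R..R}) --> norm (F (exn n x)) <= max B 0"
   using B'[OF exn_Rn] by simp
  show "AE x in Leb n. x \<notin> Pi\<^sub>E {..<n} (%_. {-R..R}) --> F (exn n x) = 0"
  proof (rule AE_I2, intro impI)
   fix x assume x: "x \<in> space (Leb n)" "x \<notin> Pi\<^sub>E {..<n} (%_. {-R..R})"
   then obtain i where i: "i < n" "x i \<notin> {-R..R}" by (auto simp: space_PiM PiE_iff)
   have "exn n x \<notin> K" using R(2)[of "exn n x" i] i by (auto simp: exn_def)
   then show "F (exn n x) = 0" using K(3) exn_Rn by blast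
  qed
 qed
qed

lemma RInt_add: "csupp n F ==> csupp n G ==> RInt n (%y. F y + G y) = RInt n F + RInt n G"
 unfolding RInt_def by (intro Bochner_Integration.integral_add integrable_csupp)

lemma RInt_cmult: "RInt n (%y. c * F y) = c * RInt n F"
 unfolding RInt_def by simp

lemma RInt_sum: "(!!i. i \<in> I ==> csupp n (F i)) ==> RInt n (%y. \<Sum>i\<in>I. F i y) = (\<Sum>i\<in>I. RInt n (F i))"
 unfolding RInt_def by (intro Bochner_Integration.integral_sum integrable_csupp)

lemma RInt_zero: "RInt n (%y. 0) = 0"
 by (simp add: RInt_def)

text \<open>\<open>A\<close> and the complement of \<open>K\<close> are relatively open and cover
  \<open>Rn n\<close>. The given function and 0 agree on the overlap, so they glue to a continuous
  function.\<close>

lemma csupp_extend: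
 assumes "opn n A" "continuous_on A f" "compact K" "K <= A" "!!y. y \<in> A - K ==> f y = 0"
 shows "csupp n (%y. if y \<in> A then f y else 0)"
proof -
 have AR: "A <= Rn n" using assms(1) by (rule opn_subset)
 have "continuous_on (A \<union> (Rn n - K)) (%y. if y \<in> A then f y else 0)"
 proof (rule continuous_on_cases_local_open)
  have eq: "A \<union> (Rn n - K) = Rn n" using AR assms(4) by blast
  show "openin (top_of_set (A \<union> (Rn n - K))) A" unfolding eq by (rule assms(1))
  show "openin (top_of_set (A \<union> (Rn n - K))) (Rn n - K)" unfolding eq
   using compact_imp_closed[OF assms(3)] unfolding openin_open by (intro exI[of _ "- K"]) auto
  show "continuous_on A f" by (rule assms(2))
  show "continuous_on (Rn n - K) (%y. 0)" by simp
  show "f x = 0" if "x \<in> A & x \<notin> A \<or> x \<in> Rn n - K & x \<in> A" for x using that assms(5) by blast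
 qed
 moreover have "A \<union> (Rn n - K) = Rn n" using AR assms(4) by blast
 ultimately have "continuous_on (Rn n) (%y. if y \<in> A then f y else 0)" by simp
 then show ?thesis unfolding csupp_def using assms AR by (intro conjI exI[of _ K]) auto
qed

lemma RInt_Fubini:
 assumes "csupp n F" "j < n"
 shows "RInt n F = (\<integral>x. (\<integral>t. F ((exn n x)(j := t)) \<partial>lborel) \<partial>Pi\<^sub>M ({..<n} - {j}) (%_. lborel))"
proof -
 interpret product_sigma_finite "%_::nat. lborel :: real measure"
  by (simp add: product_sigma_finite_def sigma_finite_lborel)
 have e: "insert j ({..<n} - {j}) = {..<n}" using assms(2) by auto
 have u: "exn n (x(j := t)) = (exn n x)(j := t)" for x t using assms(2) by (auto simp: exn_def)
 show ?thesis
  using product_integral_insert[of "{..<n} - {j}" j "%x. F (exn n x)", unfolded e] integrable_csupp[OF assms(1)]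
  by (simp add: RInt_def u)
qed

text \<open>By Fubini an identity of integrals over \<open>Rn n\<close> reduces to one real
  variable, once for the fundamental theorem of calculus and once for the substitution rule.\<close>

lemma RInt_slice_cong:
 assumes "csupp n F" "csupp n G" "j < n"
  "!!z. z \<in> Rn n ==> (\<integral>t. F (z(j := t)) \<partial>lborel) = (\<integral>t. G (z(j := t)) \<partial>lborel)"
 shows "RInt n F = RInt n G"
 unfolding RInt_Fubini[OF assms(1,3)] RInt_Fubini[OF assms(2,3)]
 by (intro Bochner_Integration.integral_cong refl assms(4) exn_Rn)

text \<open>On a line in direction \<open>j\<close> the fundamental theorem of calculus leaves the
  values of \<open>F\<close> at two points outside its support. This is the local core of Stokes'
  theorem.\<close>

lemma RInt_partial_derivative:
 assumes "compact K" "K <= Rn n" "!!y. y \<in> Rn n - K ==> F y = 0" "!!y. y \<in> Rn n - K ==> F' y = 0"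
  "continuous_on (Rn n) F'" "j < n" "!!z. z \<in> Rn n ==> hpd F j (F' z) z"
 shows "RInt n F' = 0"
proof -
 have cs: "csupp n F'" unfolding csupp_def using assms by blast
 have cs0: "csupp n (%y. 0)" unfolding csupp_def by (auto intro!: exI[of _ "{}"])
 have "RInt n F' = RInt n (%y. 0)"
 proof (rule RInt_slice_cong[OF cs cs0 assms(6)])
  fix z assume z: "z \<in> Rn n"
  obtain R where R: "0 < R" "!!y i. y \<in> K ==> \<bar>y i\<bar> < R" using compact_Rn_bounded[OF assms(1,2)] by metis
  have zR: "z(j := t) \<in> Rn n" for t using Rn_upd[OF z assms(6)] .
  have out: "F (z(j := t)) = 0" "F' (z(j := t)) = 0" if "R <= \<bar>t\<bar>" for t
  proof -
   have "z(j := t) \<notin> K" using R(2)[of "z(j := t)" j] that by auto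
   then show "F (z(j := t)) = 0" "F' (z(j := t)) = 0" using assms(3,4) zR by auto
  qed
  have "(LBINT t. indicat_real {-R..R} t *\<^sub>R F' (z(j := t))) = F (z(j := R)) - F (z(j := -R))"
  proof (rule integral_FTC_Icc)
   show "((%t. F (z(j := t))) has_vector_derivative F' (z(j := t))) (at t within {-R..R})" for t
    using assms(7)[OF zR[of t]]
    by (simp add: has_real_derivative_iff_has_vector_derivative has_vector_derivative_at_within)
   show "continuous_on {-R..R} (%t. F' (z(j := t)))"
    by (rule continuous_on_compose2[OF assms(5) continuous_on_fun_upd]) (auto simp: zR)
  qed (use R in simp)
  also have "\<dots> = 0" using out(1)[of R] out(1)[of "-R"] R by simp
  also have "(LBINT t. indicat_real {-R..R} t *\<^sub>R F' (z(j := t))) = (\<integral>t. F' (z(j := t)) \<partial>lborel)"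
  proof (intro Bochner_Integration.integral_cong refl)
   show "indicat_real {-R..R} t *\<^sub>R F' (z(j := t)) = F' (z(j := t))" for t
    using out(2)[of t] by (cases "t \<in> {-R..R}") auto
  qed
  finally show "(\<integral>t. F' (z(j := t)) \<partial>lborel) = (\<integral>t. 0 \<partial>lborel)" by simp
 qed
 then show ?thesis by (simp add: RInt_zero)
qed

subsection \<open>Change of variables\<close>

text \<open>The decreasing case is reduced to the increasing one by reflecting \<open>h\<close> and
  the integrand; the absolute value in the statement merges the two.\<close>

lemma substitution_1D:
 fixes f h :: "real => real"
 assumes ab: "a < b" and h: "!!t. t \<in> {a..b} ==> (h has_real_derivative h' t) (at t)"
  and c: "continuous_on {a..b} h'" and s: "(\<forall>t\<in>{a..b}. 0 < h' t) \<or> (\<forall>t\<in>{a..b}. h' t < 0)"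
  and f: "continuous_on UNIV f" "!!u. f u ~= 0 ==> u \<in> h ` {a<..<b}"
 shows "(\<integral>u. f u \<partial>lborel) = (\<integral>t. (if t \<in> {a<..<b} then f (h t) * \<bar>h' t\<bar> else 0) \<partial>lborel)"
proof -
 have pos: "(\<integral>u. f u \<partial>lborel) = (\<integral>t. (if t \<in> {a<..<b} then f (h t) * h' t else 0) \<partial>lborel)"
  if h: "!!t. t \<in> {a..b} ==> (h has_real_derivative h' t) (at t)"
   and c: "continuous_on {a..b} h'" and s: "\<forall>t\<in>{a..b}. 0 < h' t"
   and f: "continuous_on UNIV f" "!!u. f u ~= 0 ==> u \<in> h ` {a<..<b}" for f h h' :: "real => real"
 proof -
  have mono: "h s < h t" if "a <= s" "s < t" "t <= b" for s t
  proof (rule DERIV_pos_imp_increasing[OF that(2)])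
   fix r assume "s <= r" "r <= t"
   then have "r \<in> {a..b}" using that by auto
   then show "\<exists>y. DERIV h r :> y & 0 < y" using h s by blast
  qed
  have "(LBINT u. f u * indicat_real {h a..h b} u) = (LBINT t. f (h t) * h' t * indicat_real {a..b} t)"
  proof (rule integral_substitution)
   show "set_integrable lborel {h a..h b} f"
    by (rule borel_integrable_atLeastAtMost'[OF continuous_on_subset[OF f(1)]]) simp
   show "0 <= h' t" if "t \<in> {a..b}" for t using s that by (simp add: less_imp_le)
  qed (use ab c h in simp_all)
  moreover have "(LBINT u. f u * indicat_real {h a..h b} u) = (\<integral>u. f u \<partial>lborel)"
  proof (intro Bochner_Integration.integral_cong refl)
   fix u show "f u * indicat_real {h a..h b} u = f u"
   proof (cases "f u = 0")
    case False
    then obtain t where "u = h t" "a < t" "t < b" using f(2)[OF False] by auto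
    then have "u \<in> {h a..h b}" using mono[of a t] mono[of t b] by auto
    then show ?thesis by simp
   qed simp
  qed
  moreover have "f (h t) * h' t * indicat_real {a..b} t = (if t \<in> {a<..<b} then f (h t) * h' t else 0)" for t
  proof -
   \<comment> \<open>By strict monotonicity the images of the end points are not attained inside the
     interval, so \<open>f\<close> vanishes there and the integrands over the open and the closed
     interval agree pointwise.\<close>
   have "f (h e) = 0" if "e = a \<or> e = b" for e
   proof (rule ccontr)
    assume "f (h e) ~= 0"
    from f(2)[OF this] obtain t where "h e = h t" "t \<in> {a<..<b}" by (rule imageE)
    then have "h e = h t" "a < t" "t < b" by auto
    then show False using mono[of a t] mono[of t b] that by auto
   qed
   then show ?thesis by (cases "t = a \<or> t = b") (auto simp: indicator_def)
  qed
  ultimately show ?thesis by simp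
 qed
 show ?thesis using s
 proof
  assume s: "\<forall>t\<in>{a..b}. 0 < h' t"
  have "(if t \<in> {a<..<b} then f (h t) * \<bar>h' t\<bar> else 0) = (if t \<in> {a<..<b} then f (h t) * h' t else 0)" for t
   using s by (auto simp: abs_of_pos)
  then show ?thesis using pos[OF h c s f] by simp
 next
  assume s: "\<forall>t\<in>{a..b}. h' t < 0"
  have "(\<integral>u. f u \<partial>lborel) = (\<integral>u. f (- u) \<partial>lborel)"
   using lborel_integral_real_affine[of "-1" f 0] by simp
  also have "\<dots> = (\<integral>t. (if t \<in> {a<..<b} then f (- (- h t)) * - h' t else 0) \<partial>lborel)"
  proof (rule pos[of "%t. - h t" "%t. - h' t" "%u. f (- u)"])
   show "((%t. - h t) has_real_derivative - h' t) (at t)" if "t \<in> {a..b}" for t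
    using h[OF that] by (rule DERIV_minus)
   show "continuous_on UNIV (%u. f (- u))"
    by (rule continuous_on_compose2[OF f(1)]) (auto intro: continuous_intros)
   show "u \<in> (%t. - h t) ` {a<..<b}" if nz: "f (- u) ~= 0" for u
   proof -
    obtain t where t: "- u = h t" "t \<in> {a<..<b}" using f(2)[OF nz] by blast
    have "u = - h t" using t(1) by simp
    then show ?thesis using t(2) by (rule image_eqI)
   qed
  qed (use c s in \<open>auto intro: continuous_intros\<close>)
  also have "\<dots> = (\<integral>t. (if t \<in> {a<..<b} then f (h t) * \<bar>h' t\<bar> else 0) \<partial>lborel)"
   by (intro Bochner_Integration.integral_cong) (use s in \<open>auto simp: abs_of_neg\<close>)
  finally show ?thesis .
 qed
qed

text \<open>The change of variables formula on \<open>W\<close> with volume factor \<open>J\<close>,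
  tested on continuous functions with compact support in the image. Such test functions stay
  continuous under extension by zero and can be pulled back through a composition.\<close>

definition covl :: "nat => (nat => real) set => ((nat => real) => nat => real) => ((nat => real) => real) => bool"
 where "covl n W ta J \<longleftrightarrow> (\<forall>F K. continuous_on (Rn n) F & compact K & K <= ta ` W & (\<forall>y\<in>Rn n - K. F y = 0) -->
  RInt n F = RInt n (%y. if y \<in> W then F (ta y) * J y else 0))"

lemma covl_cong:
 assumes "covl n W ta J" "!!y. y \<in> W ==> ta y = ta' y" "!!y. y \<in> W ==> J y = J' y"
 shows "covl n W ta' J'"
proof -
 have "ta ` W = ta' ` W" using assms(2) by (rule image_cong[OF refl])
 moreover have "(if y \<in> W then F (ta y) * J y else 0) = (if y \<in> W then F (ta' y) * J' y else 0)" for F :: "(nat => real) => real" and y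
  using assms(2,3) by auto
 ultimately show ?thesis using assms(1) unfolding covl_def by simp
qed

text \<open>By injectivity a test function supported in the image of \<open>W'\<close> pulls back to
  0 on the rest of \<open>W\<close>.\<close>

lemma covl_subset:
 assumes "covl n W ta J" "W' <= W" "inj_on ta W" "opn n W" "ta ` W <= Rn n"
 shows "covl n W' ta J"
 unfolding covl_def
proof (intro allI impI, elim conjE)
 fix F :: "(nat => real) => real" and K assume F: "continuous_on (Rn n) F" "compact K" "K <= ta ` W'" "\<forall>y\<in>Rn n - K. F y = 0"
 have "K <= ta ` W" using F(3) assms(2) by blast
 then have "RInt n F = RInt n (%y. if y \<in> W then F (ta y) * J y else 0)"
  using assms(1) F unfolding covl_def by blast
 also have "(%y. if y \<in> W then F (ta y) * J y else 0) = (%y. if y \<in> W' then F (ta y) * J y else 0)"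
 proof
  fix y
  have "F (ta y) = 0" if y: "y \<in> W" "y \<notin> W'"
  proof -
   have "ta y \<notin> ta ` W'" using y assms(2,3) by (auto simp: inj_on_def)
   then have "ta y \<in> Rn n - K" using F(3) y(1) assms(5) by blast
   then show ?thesis using F(4) by blast
  qed
  then show "(if y \<in> W then F (ta y) * J y else 0) = (if y \<in> W' then F (ta y) * J y else 0)"
   using assms(2) by auto
 qed
 finally show "RInt n F = RInt n (%y. if y \<in> W' then F (ta y) * J y else 0)" .
qed

text \<open>The pulled back test function must have compact support again: its support is the image
  of \<open>K\<close> under the continuous inverse \<open>\<sigma>2\<close>.\<close>

lemma covl_comp:
 assumes 1: "covl n U ta1 J1" and 2: "covl n V ta2 J2" and UV: "ta1 ` U = V" "opn n V"
  and \<sigma>: "continuous_on (ta2 ` V) \<sigma>2" "!!y. y \<in> V ==> \<sigma>2 (ta2 y) = y"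
  and c: "continuous_on V ta2" "continuous_on V J2" "ta2 ` V <= Rn n"
 shows "covl n U (%y. ta2 (ta1 y)) (%y. J2 (ta1 y) * J1 y)"
 unfolding covl_def
proof (intro allI impI, elim conjE)
 fix F :: "(nat => real) => real" and K assume F: "continuous_on (Rn n) F" "compact K" "K <= (%y. ta2 (ta1 y)) ` U" "\<forall>y\<in>Rn n - K. F y = 0"
 have KV: "K <= ta2 ` V" using F(3) unfolding UV(1)[symmetric] by (simp add: image_image)
 define F2 where "F2 = (%y. if y \<in> V then F (ta2 y) * J2 y else 0)"
 define K2 where "K2 = \<sigma>2 ` K"
 have K2: "compact K2" "K2 <= V"
  unfolding K2_def using \<sigma> KV by (auto intro!: compact_continuous_image[OF continuous_on_subset[OF \<sigma>(1)] F(2)])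
 have z: "F (ta2 y) * J2 y = 0" if "y \<in> V - K2" for y
 proof -
  have "ta2 y \<notin> K" using that \<sigma>(2) unfolding K2_def by force
  then have "F (ta2 y) = 0" using F(4) c(3) that by blast
  then show ?thesis by simp
 qed
 have cs: "csupp n F2" unfolding F2_def
  by (rule csupp_extend[OF UV(2) _ K2 z])
   (use c in \<open>auto intro!: continuous_intros continuous_on_compose2[OF F(1) c(1)]\<close>)
 have zz: "\<forall>y\<in>Rn n - K2. F2 y = 0" using z by (auto simp: F2_def)
 have "RInt n F = RInt n F2" unfolding F2_def using 2 F(1,2,4) KV unfolding covl_def by blast
 also have "\<dots> = RInt n (%y. if y \<in> U then F2 (ta1 y) * J1 y else 0)"
  using 1 cs K2 zz UV(1) unfolding covl_def csupp_def by blast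
 also have "(%y. if y \<in> U then F2 (ta1 y) * J1 y else 0) = (%y. if y \<in> U then F (ta2 (ta1 y)) * (J2 (ta1 y) * J1 y) else 0)"
  using UV(1) by (auto simp: F2_def fun_eq_iff)
 finally show "RInt n F = RInt n (%y. if y \<in> U then F (ta2 (ta1 y)) * (J2 (ta1 y) * J1 y) else 0)" .
qed

lemma opn_preimage:
 assumes "opn n V" "continuous_on V f" "f ` V <= Rn m" "opn m W"
 shows "opn n (V \<inter> f -` W)"
proof -
 obtain T where T: "open T" "W = Rn m \<inter> T" using assms(4) by (metis openin_open)
 have "V \<inter> f -` W = V \<inter> f -` T" using T(2) assms(3) by auto
 moreover have "openin (top_of_set V) (V \<inter> f -` T)" by (rule continuous_openin_preimage_gen[OF assms(2) T(1)])
 ultimately show ?thesis using openin_trans[OF _ assms(1)] by simp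
qed

lemma opn_less:
 assumes "opn n V" "continuous_on V f" "continuous_on V (g :: _ => real)"
 shows "opn n {x \<in> V. f x < g x}"
proof -
 have "openin (top_of_set V) (V \<inter> (%x. g x - f x) -` {0<..})"
  by (intro continuous_openin_preimage_gen continuous_intros assms)
 moreover have "V \<inter> (%x. g x - f x) -` {0<..} = {x \<in> V. f x < g x}" by auto
 ultimately show ?thesis using openin_trans[OF _ assms(1)] by simp
qed

lemma opn_nbhd_continuous:
 assumes "!!x e. x \<in> A ==> 0 < e ==> \<exists>N. opn n N & x \<in> N & (\<forall>y\<in>A \<inter> N. \<bar>f y - f x\<bar> < (e::real))" "A <= Rn n"
 shows "continuous_on A f"
 unfolding continuous_on_topological
proof (intro ballI allI impI)
 fix x B assume x: "x \<in> A" "open B" "f x \<in> B"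
 then obtain e where e: "e > 0" "ball (f x) e <= B" by (auto simp: open_contains_ball)
 obtain N where N: "opn n N" "x \<in> N" "\<forall>y\<in>A \<inter> N. \<bar>f y - f x\<bar> < e" using assms(1)[OF x(1) e(1)] by metis
 obtain T where T: "open T" "N = Rn n \<inter> T" using N(1) by (metis openin_open)
 show "\<exists>T. open T & x \<in> T & (\<forall>y\<in>A. y \<in> T --> f y \<in> B)"
 proof (intro exI[of _ T] conjI ballI impI)
  fix y assume "y \<in> A" "y \<in> T"
  then have "\<bar>f y - f x\<bar> < e" using N(3) T(2) assms(2) by auto
  then have "f y \<in> ball (f x) e" by (simp add: dist_real_def)
  then show "f y \<in> B" using e(2) by blast
 qed (use T N(2) in auto)
qed

text \<open>A diffeomorphism of class C^1 that carries its inverse along, which makes symmetry,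
  composition and restriction immediate.\<close>

definition ldiff :: "nat => ((nat => real) => nat => real) => ((nat => real) => nat => real) =>
  (nat => real) set => (nat => real) set => bool"
 where "ldiff n ta \<sigma> U V \<longleftrightarrow> opn n U & opn n V & (\<forall>x\<in>U. ta x \<in> V & \<sigma> (ta x) = x) &
  (\<forall>y\<in>V. \<sigma> y \<in> U & ta (\<sigma> y) = y) &
  (\<forall>i<n. Ck n U (Suc 0) (%x. ta x i)) & (\<forall>i<n. Ck n V (Suc 0) (%y. \<sigma> y i))"

definition jacd :: "nat => (nat => real) set => ((nat => real) => nat => real) => (nat => real) => real"
 where "jacd n U ta x = Determinant.det (Matrix.mat n n (%(i, j). pd U j (%y. ta y i) x))"

lemma ldiffD:
 assumes "ldiff n ta \<sigma> U V"
 shows "opn n U" "opn n V" "!!x. x \<in> U ==> ta x \<in> V" "!!x. x \<in> U ==> \<sigma> (ta x) = x"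
  "!!x. x \<in> V ==> \<sigma> x \<in> U" "!!x. x \<in> V ==> ta (\<sigma> x) = x"
  "!!i. i < n ==> Ck n U (Suc 0) (%x. ta x i)" "!!i. i < n ==> Ck n V (Suc 0) (%x. \<sigma> x i)"
  "U <= Rn n" "V <= Rn n" "ta ` U = V" "inj_on ta U" "continuous_on U ta" "continuous_on V \<sigma>"
proof -
 show 1: "opn n U" and 2: "opn n V" and 3: "!!x. x \<in> U ==> ta x \<in> V" and 4: "!!x. x \<in> U ==> \<sigma> (ta x) = x"
  and 5: "!!x. x \<in> V ==> \<sigma> x \<in> U" and 6: "!!x. x \<in> V ==> ta (\<sigma> x) = x"
  and 7: "!!i. i < n ==> Ck n U (Suc 0) (%x. ta x i)" and 8: "!!i. i < n ==> Ck n V (Suc 0) (%x. \<sigma> x i)"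
  using assms unfolding ldiff_def by auto
 show 9: "U <= Rn n" and 10: "V <= Rn n" using 1 2 opn_subset by auto
 show "ta ` U = V" using 3 5 6 by force
 show "inj_on ta U" using 4 by (metis inj_on_inverseI)
 show "continuous_on U ta" using 3 10 by (intro continuous_on_Rn_valued[of _ _ n] Ck_continuous[OF 7]) auto
 show "continuous_on V \<sigma>" using 5 9 by (intro continuous_on_Rn_valued[of _ _ n] Ck_continuous[OF 8]) auto
qed

lemma ldiff_image_opn:
 assumes "ldiff n ta \<sigma> U V" "opn n W" "W <= U" shows "opn n (ta ` W)"
proof -
 note l = ldiffD[OF assms(1)]
 have "ta ` W = V \<inter> \<sigma> -` W" using l assms(3) by force
 moreover have "\<sigma> ` V <= Rn n" using l(5,9) by blast
 ultimately show ?thesis using opn_preimage[OF l(2,14) _ assms(2)] by simp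
qed

lemma ldiff_restrict:
 assumes "ldiff n ta \<sigma> U V" "opn n W" "W <= U" shows "ldiff n ta \<sigma> W (ta ` W)"
proof -
 note l = ldiffD[OF assms(1)]
 have o: "opn n (ta ` W)" by (rule ldiff_image_opn[OF assms])
 have s: "ta ` W <= V" using l(3) assms(3) by auto
 show ?thesis unfolding ldiff_def
  using assms(2,3) o s l Ck_subset[OF l(7) l(1) assms(2,3)] Ck_subset[OF l(8) l(2) o s] by auto
qed

lemma ldiff_comp:
 assumes "ldiff n ta1 \<sigma>1 U V" "ldiff n ta2 \<sigma>2 V Z"
 shows "ldiff n (%x. ta2 (ta1 x)) (%y. \<sigma>1 (\<sigma>2 y)) U Z"
proof -
 note a = ldiffD[OF assms(1)] and b = ldiffD[OF assms(2)]
 have "Ck n U (Suc 0) (%x. ta2 (ta1 x) i)" if "i < n" for i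
  by (rule Ck_compose[OF a(1,2) b(7)[OF that] a(7)]) (use a(3) in auto)
 moreover have "Ck n Z (Suc 0) (%x. \<sigma>1 (\<sigma>2 x) i)" if "i < n" for i
  by (rule Ck_compose[OF b(2,1) a(8)[OF that] b(8)]) (use b(5) in auto)
 ultimately show ?thesis unfolding ldiff_def using a b by auto
qed

lemma ldiff_sym: "ldiff n ta \<sigma> U V ==> ldiff n \<sigma> ta V U"
 unfolding ldiff_def by auto

lemma jacd_comp:
 assumes 1: "ldiff n ta1 \<sigma>1 U V" and 2: "ldiff n ta2 \<sigma>2 V Z" and x: "x \<in> U"
 shows "jacd n U (%x. ta2 (ta1 x)) x = jacd n V ta2 (ta1 x) * jacd n U ta1 x"
proof -
 note a = ldiffD[OF 1] and b = ldiffD[OF 2]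
 let ?A = "Matrix.mat n n (%(i, j). pd V j (%y. ta2 y i) (ta1 x))"
 let ?B = "Matrix.mat n n (%(i, j). pd U j (%y. ta1 y i) x)"
 have "Matrix.mat n n (%(i, j). pd U j (%y. ta2 (ta1 y) i) x) = ?A * ?B"
 proof (rule eq_matI)
  fix i j assume "i < dim_row (?A * ?B)" "j < dim_col (?A * ?B)"
  then have ij: "i < n" "j < n" by auto
  have "pd U j (%y. ta2 (ta1 y) i) x = (\<Sum>k<n. pd V k (%y. ta2 y i) (ta1 x) * pd U j (%y. ta1 y k) x)"
   by (rule pd_compose[OF a(1,2) b(7)[OF ij(1)] a(7) _ ij(2) x]) (use a(3) in auto)
  then show "Matrix.mat n n (%(i, j). pd U j (%y. ta2 (ta1 y) i) x) $$ (i, j) = (?A * ?B) $$ (i, j)"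
   using ij by (simp add: scalar_prod_def atLeast0LessThan)
 qed auto
 then show ?thesis unfolding jacd_def by (simp add: det_mult[of _ n])
qed

lemma jacd_cong:
 assumes "opn n U" "opn n W" "x \<in> W" "W <= U" "!!y. y \<in> W ==> ta y = ta' y"
 shows "jacd n U ta x = jacd n W ta' x"
proof -
 have "pd U j (%y. ta y i) x = pd W j (%y. ta' y i) x" if "j < n" for i j
 proof -
  have "pd U j (%y. ta y i) x = pd W j (%y. ta y i) x"
   using assms that by (intro pd_opn_subset[of n]) auto
  also have "\<dots> = pd W j (%y. ta' y i) x" using assms that by (intro pd_cong[of n]) auto
  finally show ?thesis .
 qed
 then show ?thesis unfolding jacd_def by (intro arg_cong[of _ _ Determinant.det]) (auto intro!: eq_matI)
qed

lemma continuous_jacd: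
 assumes "ldiff n ta \<sigma> U V" shows "continuous_on U (jacd n U ta)"
proof -
 note a = ldiffD[OF assms]
 have c: "continuous_on U (pd U j (%y. ta y i))" if "i < n" "j < n" for i j
  using Ck_pd[OF a(7)[OF that(1)] that(2)] Ck_continuous by blast
 have "jacd n U ta = (%x. \<Sum>p\<in>{p. p permutes {0..<n}}. signof p * (\<Prod>i=0..<n. pd U (p i) (%y. ta y i) x))"
 proof
  fix x
  show "jacd n U ta x = (\<Sum>p\<in>{p. p permutes {0..<n}}. signof p * (\<Prod>i=0..<n. pd U (p i) (%y. ta y i) x))"
   unfolding jacd_def det_def'[OF mat_carrier]
   by (intro sum.cong refl arg_cong2[of _ _ _ _ "(*)"] prod.cong) (auto simp: permutes_in_image)
 qed
 moreover have "continuous_on U \<dots>"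
  by (intro continuous_intros c) (auto simp: permutes_in_image)
 ultimately show ?thesis by simp
qed

text \<open>All rows except row \<open>m\<close> are unit vectors. A permutation other than the
  identity moves some index different from \<open>m\<close>, so only the identity survives in the
  Leibniz formula.\<close>

lemma jacd_primitive:
 assumes U: "opn n U" "x \<in> U" and m: "m < n"
 shows "jacd n U (%y. y(m := g y)) x = pd U m g x"
proof -
 have xR: "x \<in> Rn n" using U opn_subset by blast
 have *: "pd U j (%y. (y(m := g y)) i) x = (if i = j then 1 else 0)" if "i < n" "j < n" "i ~= m" for i j
  using that by (intro pd_eq[OF U]) (auto intro!: derivative_eq_intros)
 have "(\<Prod>i=0..<n. pd U (p i) (%y. (y(m := g y)) i) x) = 0" if p: "p permutes {0..<n}" "p ~= id" for p
 proof -
  have "\<exists>i. i < n & i ~= m & p i ~= i"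
  proof (rule ccontr)
   assume a: "\<not> ?thesis"
   have "p i = i" if "i ~= m" for i using a that p(1) by (cases "i < n") (auto simp: permutes_def)
   moreover have "p m = m"
    using calculation permutes_inj[OF p(1)] by (metis injD)
   ultimately have "p x = x" for x by (cases "x = m") auto
   then have "p = id" by (simp add: fun_eq_iff)
   then show False using p by simp
  qed
  then obtain i where i: "i < n" "i ~= m" "p i ~= i" by blast
  have "p i < n" using p(1) i(1) permutes_in_image[OF p(1), of i] by simp
  then have "pd U (p i) (%y. (y(m := g y)) i) x = 0" using *[of i "p i"] i by simp
  then show ?thesis using i(1) by (intro prod_zero) auto
 qed
 then have "(\<Sum>p\<in>{p. p permutes {0..<n}}. signof p * (\<Prod>i=0..<n. pd U (p i) (%y. (y(m := g y)) i) x))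
   = (\<Sum>p\<in>{id}. signof p * (\<Prod>i=0..<n. pd U (p i) (%y. (y(m := g y)) i) x))"
  by (intro sum.mono_neutral_right) (auto simp: finite_permutations permutes_id)
 also have "\<dots> = (\<Prod>i=0..<n. if i = m then pd U m g x else 1)"
 proof -
  have "(\<Prod>i=0..<n. pd U i (%y. (y(m := g y)) i) x) = (\<Prod>i=0..<n. if i = m then pd U m g x else 1)"
  proof (rule prod.cong[OF refl])
   fix i assume i: "i \<in> {0..<n}"
   show "pd U i (%y. (y(m := g y)) i) x = (if i = m then pd U m g x else 1)"
   proof (cases "i = m")
    case False
    then show ?thesis using *[of i i] i by auto
   qed simp
  qed
  moreover have "(\<Sum>p\<in>{id}. real_of_int (sign p) * h p) = h id" for h :: "(nat => nat) => real"
   by (simp add: sign_id)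
  ultimately show ?thesis by (simp only: id_apply)
 qed
 also have "\<dots> = pd U m g x" using m by simp
 finally show ?thesis
  unfolding jacd_def det_def'[OF mat_carrier]
  by (subst (asm) sum.cong[OF refl, of _ _ "%p. signof p * (\<Prod>i=0..<n. Matrix.mat n n (%(i, j). pd U j (%y. (y(m := g y)) i) x) $$ (i, p i))"])
   (auto intro!: prod.cong simp: permutes_in_image)
qed

text \<open>A map that changes coordinate \<open>m\<close> only is strictly monotone along that
  coordinate near \<open>x\<close>. The intermediate value theorem inverts it, and the substitution
  rule in one variable gives the integral formula slice by slice.\<close>

lemma primitive_map:
 assumes U: "opn n U" "x \<in> U" and m: "m < n" and g: "Ck n U (Suc 0) g" and nz: "pd U m g x ~= 0"
 obtains W V gm where "opn n W" "x \<in> W" "W <= U" "ldiff n (%y. y(m := g y)) gm W V"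
  "covl n W (%y. y(m := g y)) (%y. \<bar>pd U m g y\<bar>)"
proof -
 define p where "p = pd U m g"
 \<comment> \<open>Multiplying by the value \<open>s\<close> at \<open>x\<close> treats increasing
   and decreasing behaviour alike: \<open>p y * s\<close> is positive near \<open>x\<close> in both
   cases.\<close>
 define s where "s = p x"
 define G where "G = (%y. y(m := g y))"
 have xR: "x \<in> Rn n" using U opn_subset by blast
 have cp: "continuous_on U (pd U i g)" if "i < n" for i using Ck_pd[OF g that] Ck_continuous by blast
 have cg: "continuous_on U g" using g Ck_continuous by blast
 have hp: "hpd g i (pd U i g y) y" if "i < n" "y \<in> U" for i y using Ck_hpd[OF g U(1) that] .
 have "opn n {y \<in> U. 0 < p y * s}"
  by (rule opn_less[OF U(1)]) (auto intro!: continuous_intros cp m simp: p_def)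
 moreover have "x \<in> {y \<in> U. 0 < p y * s}" using nz U(2) by (auto simp: s_def p_def zero_less_mult_iff linorder_neq_iff)
 ultimately obtain de where de: "0 < de" "cboxn n x de <= {y \<in> U. 0 < p y * s}" by (rule opn_contains_cboxn)
 define W where "W = boxn n x de"
 define C where "C = cboxn n x de"
 have CU: "C <= U" and Cs: "!!y. y \<in> C ==> 0 < p y * s" and WC: "W <= C"
  using de boxn_subset_cboxn by (auto simp: C_def W_def)
 have WR: "W <= Rn n" and Wo: "opn n W" and xW: "x \<in> W"
  using opn_boxn boxn_self[OF xR de(1)] by (auto simp: W_def boxn_def)
 have WU: "W <= U" using WC CU by blast
 have mono: "0 < (g (z(m := t2)) - g (z(m := t1))) * s"
  if t: "t1 < t2" and z: "z(m := t1) \<in> C" "z(m := t2) \<in> C" for z t1 t2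
 proof -
  have zt: "z(m := t) \<in> C" if t: "t1 <= t" "t <= t2" for t
   unfolding C_def cboxn_def
  proof (intro CollectI conjI allI impI)
   show "z(m := t) \<in> Rn n" using z(1) m by (auto simp: C_def cboxn_def Rn_iff)
   fix i assume i: "i < n"
   have "\<bar>(z(m := t1)) i - x i\<bar> <= de" "\<bar>(z(m := t2)) i - x i\<bar> <= de" using z i by (auto simp: C_def cboxn_def)
   then show "\<bar>(z(m := t)) i - x i\<bar> <= de" using t by (cases "i = m") auto
  qed
  have "\<exists>t. t > t1 & t < t2 & g (z(m := t2)) - g (z(m := t1)) = (t2 - t1) * p (z(m := t))"
  proof (rule MVT2[OF t])
   fix t assume "t1 <= t" "t <= t2"
   then show "DERIV (%t. g (z(m := t))) t :> p (z(m := t))"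
    using hp[OF m, of "z(m := t)"] zt CU by (auto simp: p_def)
  qed
  then obtain t where t': "t > t1" "t < t2" "g (z(m := t2)) - g (z(m := t1)) = (t2 - t1) * p (z(m := t))" by blast
  have "0 < p (z(m := t)) * s" using Cs zt t' by simp
  then show ?thesis using t' t by (simp add: mult.assoc)
 qed
 have inj: "y = y'" if G: "G y = G y'" and C: "y \<in> C" "y' \<in> C" for y y'
 proof -
  have e: "y i = y' i" if "i ~= m" for i using fun_cong[OF G, of i] that by (simp add: G_def)
  have y': "y' = y(m := y' m)" using e by auto
  have gg: "g y = g y'" using fun_cong[OF G, of m] by (simp add: G_def)
  have "\<not> y m < y' m" using mono[of "y m" "y' m" y] C gg y' by auto
  moreover have "\<not> y' m < y m" using mono[of "y' m" "y m" y] C gg y' by auto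
  ultimately have "y' m = y m" by simp
  then show ?thesis using y' by simp
 qed
 \<comment> \<open>One statement for two purposes, openness of the image and continuity of the
   inverse: values strictly between those at the two ends of a short segment in direction
   \<open>m\<close> are attained on that segment.\<close>
 have near: "\<exists>N. opn n N & G z0 \<in> N & (\<forall>y\<in>N. \<exists>z\<in>W. G z = y & \<bar>z m - z0 m\<bar> < e)"
  if z0: "z0 \<in> W" and e: "0 < e" for z0 e
 proof -
  have z0m: "\<bar>z0 m - x m\<bar> < de" using z0 m by (simp add: W_def boxn_def)
  define e' where "e' = min (e / 2) ((de - \<bar>z0 m - x m\<bar>) / 2)"
  have e': "0 < e'" "e' < e" "\<bar>z0 m - x m\<bar> + e' < de" using e z0m by (auto simp: e'_def min_def field_simps)
  define a where "a = z0 m - e'"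
  define b where "b = z0 m + e'"
  have ab: "a < z0 m" "z0 m < b" "\<bar>a - x m\<bar> < de" "\<bar>b - x m\<bar> < de"
   using e' by (auto simp: a_def b_def)
  have zc: "z0(m := c) \<in> W" if "\<bar>c - x m\<bar> < de" for c
   using z0 that m by (auto simp: W_def boxn_def Rn_iff)
  define N0 where "N0 = Rn n \<inter> (%y. y(m := a)) -` W \<inter> (Rn n \<inter> (%y. y(m := b)) -` W)"
  have cu: "continuous_on A (%y::nat => real. y(m := c))" for A c
  proof (rule continuous_on_coordinatewise_then_product)
   show "continuous_on A (%y. (y(m := c)) i)" for i
    by (cases "i = m") (auto intro: continuous_on_apply)
  qed
  have "opn n (Rn n \<inter> (%y. y(m := c)) -` W)" for c
   by (rule opn_preimage[OF opn_Rn cu _ Wo]) (auto intro: Rn_upd m)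
  then have N0: "opn n N0" unfolding N0_def by blast
  have cgu: "continuous_on N0 (%y. g (y(m := c)))" if "c = a \<or> c = b" for c
   by (rule continuous_on_compose2[OF cg cu]) (use that WU in \<open>auto simp: N0_def\<close>)
  define N where "N = {y \<in> N0. g (y(m := a)) * s < y m * s} \<inter> {y \<in> N0. y m * s < g (y(m := b)) * s}"
  have "opn n N" unfolding N_def
   by (intro openin_Int opn_less[OF N0] continuous_intros cgu continuous_on_apply) auto
  moreover have "G z0 \<in> N"
  proof -
   have "0 < (g (z0(m := z0 m)) - g (z0(m := a))) * s"
    using ab zc[of a] zc[of "z0 m"] z0m WC by (intro mono) auto
   moreover have "0 < (g (z0(m := b)) - g (z0(m := z0 m))) * s"
    using ab zc[of b] zc[of "z0 m"] z0m WC by (intro mono) auto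
   moreover have "G z0 \<in> N0"
    using zc[of a] zc[of b] ab z0 WR m by (auto simp: N0_def G_def Rn_iff)
   ultimately show ?thesis by (auto simp: N_def G_def algebra_simps)
  qed
  moreover have "\<exists>z\<in>W. G z = y & \<bar>z m - z0 m\<bar> < e" if y: "y \<in> N" for y
  proof -
   have yW: "y(m := a) \<in> W" "y(m := b) \<in> W" and yR: "y \<in> Rn n" using y by (auto simp: N_def N0_def)
   have yt: "y(m := t) \<in> W" if t: "a <= t" "t <= b" for t
    unfolding W_def boxn_def
   proof (intro CollectI conjI allI impI)
    show "y(m := t) \<in> Rn n" using yR m by (auto simp: Rn_iff)
    fix i assume i: "i < n"
    have "\<bar>(y(m := a)) i - x i\<bar> < de" "\<bar>(y(m := b)) i - x i\<bar> < de" using yW i by (auto simp: W_def boxn_def)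
    then show "\<bar>(y(m := t)) i - x i\<bar> < de" using t by (cases "i = m") auto
   qed
   have "continuous_on {a..b} (%t. g (y(m := t)) * s)"
    by (intro continuous_intros continuous_on_compose2[OF cg continuous_on_fun_upd]) (use yt WU in auto)
   moreover have "g (y(m := a)) * s <= y m * s" "y m * s <= g (y(m := b)) * s" using y by (auto simp: N_def)
   ultimately obtain t where t: "a <= t" "t <= b" "g (y(m := t)) * s = y m * s"
    using IVT'[of "%t. g (y(m := t)) * s" a "y m * s" b] ab by auto
   have "s ~= 0" using nz by (simp add: s_def p_def)
   then have "G (y(m := t)) = y" using t(3) by (simp add: G_def)
   moreover have "\<bar>(y(m := t)) m - z0 m\<bar> < e" using t e' by (auto simp: a_def b_def)
   ultimately show ?thesis using yt t by blast
  qed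
  ultimately show ?thesis by blast
 qed
 define V where "V = G ` W"
 define gm where "gm = inv_into W G"
 have injW: "inj_on G W" using inj WC by (meson inj_onI subsetD)
 have gmG: "gm (G z) = z" if "z \<in> W" for z using that injW by (simp add: gm_def)
 have gmW: "gm y \<in> W" and Ggm: "G (gm y) = y" if "y \<in> V" for y
  using that by (auto simp: gm_def V_def inv_into_into f_inv_into_f)
 have GR: "G z \<in> Rn n" if "z \<in> W" for z using that WR m by (auto simp: G_def Rn_iff)
 have VR: "V <= Rn n" using GR by (auto simp: V_def)
 have Vo: "opn n V"
 proof (subst openin_subopen, intro ballI)
  fix y assume "y \<in> V"
  then obtain z0 where z0: "z0 \<in> W" "y = G z0" by (auto simp: V_def)
  obtain N where N: "opn n N" "G z0 \<in> N" "\<forall>y\<in>N. \<exists>z\<in>W. G z = y & \<bar>z m - z0 m\<bar> < 1"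
   using near[OF z0(1), of 1] by auto
  then have "N <= V" by (auto simp: V_def)
  then show "\<exists>T. opn n T & y \<in> T & T <= V" using N z0 by blast
 qed
 have gmi: "gm y i = y i" if "y \<in> V" "i ~= m" for y i
  using fun_cong[OF Ggm[OF that(1)], of i] that(2) by (simp add: G_def)
 have ggm: "g (gm y) = y m" if "y \<in> V" for y
  using fun_cong[OF Ggm[OF that], of m] by (simp add: G_def)
 have cgmm: "continuous_on V (%y. gm y m)"
 proof (rule opn_nbhd_continuous[OF _ VR])
  fix y e assume y: "y \<in> V" and e: "(0::real) < e"
  obtain N where N: "opn n N" "G (gm y) \<in> N" "\<forall>y'\<in>N. \<exists>z\<in>W. G z = y' & \<bar>z m - gm y m\<bar> < e"
   using near[OF gmW[OF y] e] by metis
  have "\<bar>gm y' m - gm y m\<bar> < e" if "y' \<in> V \<inter> N" for y'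
   using N(3) that gmG by (metis IntD2)
  then show "\<exists>N. opn n N & y \<in> N & (\<forall>y'\<in>V \<inter> N. \<bar>gm y' m - gm y m\<bar> < e)"
   using N(1,2) Ggm[OF y] by metis
 qed
 have cgm: "continuous_on V gm"
 proof (rule continuous_on_Rn_valued[of _ _ n])
  show "gm y \<in> Rn n" if "y \<in> V" for y using gmW[OF that] WR by blast
  show "continuous_on V (%y. gm y i)" if "i < n" for i
  proof (cases "i = m")
   case False
   then have "continuous_on V (%y. gm y i) = continuous_on V (%y. y i)"
    using gmi by (intro continuous_on_cong) auto
   then show ?thesis by (simp add: continuous_on_apply)
  qed (use cgmm in simp)
 qed
 \<comment> \<open>Obtained by differentiating \<open>g (gm y) = y m\<close> implicitly, where
   \<open>gm y\<close> differs from \<open>y\<close> in coordinate \<open>m\<close> only.\<close>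
 define D where "D i y = (if i = m then 1 else - pd U i g (gm y)) / p (gm y)" for i y
 have pn: "p z ~= 0" if "z \<in> C" for z using Cs[OF that] by auto
 have hD: "hpd (%y. gm y m) i (D i y) y" if i: "i < n" and y: "y \<in> V" for i y
 proof -
  have yR: "y \<in> Rn n" using y VR by blast
  define z where "z t = gm (y(i := t))" for t
  have zy: "z (y i) = gm y" by (simp add: z_def)
  obtain r where r: "0 < r" "boxn n (gm y) r <= W" using opn_contains_boxn[OF Wo gmW[OF y]] .
  have oS: "open {t. y(i := t) \<in> V}" by (rule open_slice[OF Vo i yR])
  have evV: "eventually (%t. y(i := t) \<in> V) (at (y i))"
   using oS y eventually_at_topological[of "%t. y(i := t) \<in> V" "y i" UNIV] by auto
  have "isCont z (y i)"
  proof -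
   have "continuous_on {t. y(i := t) \<in> V} z" unfolding z_def
    by (rule continuous_on_compose2[OF cgm continuous_on_fun_upd]) auto
   then show ?thesis using oS y by (simp add: continuous_on_eq_continuous_at)
  qed
  then have lz: "(z \<longlongrightarrow> gm y) (at (y i))" by (simp add: isCont_def zy)
  then have lzj: "((%t. z t j) \<longlongrightarrow> gm y j) (at (y i))" for j by (simp add: tendsto_fun_iff)
  have "eventually (%t. \<forall>j\<in>{..<n}. \<bar>z t j - gm y j\<bar> < r) (at (y i))"
   using r(1) tendstoD[OF lzj] by (intro eventually_ball_finite) (auto simp: dist_real_def)
  with evV have ev: "eventually (%t. y(i := t) \<in> V & z t \<in> boxn n (gm y) r) (at (y i))"
  proof eventually_elim
   case (elim t)
   then show ?case using gmW WR by (auto simp: boxn_def z_def)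
  qed
  have "\<exists>ze. (\<forall>k<n. ze k \<in> Rn n) & (\<forall>k<n. \<forall>j. \<bar>ze k j - gm y j\<bar> <= \<bar>z t j - gm y j\<bar>) &
    g (z t) - g (gm y) = (\<Sum>k<n. pd U k g (ze k) * (z t k - gm y k))"
   if t: "z t \<in> boxn n (gm y) r" for t
  proof (rule mean_value_coords[OF U(1) hp, of "z t" "gm y"])
   show "z t \<in> Rn n" using t by (simp add: boxn_def)
   show "gm y \<in> Rn n" using gmW[OF y] WR by blast
   show "w \<in> U" if "w \<in> Rn n" "!!j. j < n ==> \<bar>w j - gm y j\<bar> <= \<bar>z t j - gm y j\<bar>" for w
   proof -
    have "w \<in> boxn n (gm y) r" using that t by (force simp: boxn_def)
    then show ?thesis using r(2) WU by blast
   qed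
  qed blast+
  then have "\<forall>t. \<exists>ze. z t \<in> boxn n (gm y) r --> (\<forall>k<n. ze k \<in> Rn n) &
    (\<forall>k<n. \<forall>j. \<bar>ze k j - gm y j\<bar> <= \<bar>z t j - gm y j\<bar>) &
    g (z t) - g (gm y) = (\<Sum>k<n. pd U k g (ze k) * (z t k - gm y k))"
   by blast
  from choice[OF this] obtain ze where ze: "!!t. z t \<in> boxn n (gm y) r ==> (\<forall>k<n. ze t k \<in> Rn n) &
    (\<forall>k<n. \<forall>j. \<bar>ze t k j - gm y j\<bar> <= \<bar>z t j - gm y j\<bar>) &
    g (z t) - g (gm y) = (\<Sum>k<n. pd U k g (ze t k) * (z t k - gm y k))"
   by blast
  have zeb: "ze t k \<in> boxn n (gm y) r" if "z t \<in> boxn n (gm y) r" "k < n" for t k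
  proof -
   have "\<bar>ze t k j - gm y j\<bar> < r" if "j < n" for j
   proof (rule le_less_trans)
    show "\<bar>ze t k j - gm y j\<bar> <= \<bar>z t j - gm y j\<bar>" using ze \<open>z t \<in> boxn n (gm y) r\<close> \<open>k < n\<close> by simp
    show "\<bar>z t j - gm y j\<bar> < r" using \<open>z t \<in> boxn n (gm y) r\<close> that by (simp add: boxn_def)
   qed
   then show ?thesis using ze that by (simp add: boxn_def)
  qed
  have lze: "((%t. pd U k g (ze t k)) \<longlongrightarrow> pd U k g (gm y)) (at (y i))" if k: "k < n" for k
  proof (rule continuous_on_tendsto_compose[OF cp[OF k]])
   show "((%t. ze t k) \<longlongrightarrow> gm y) (at (y i))" unfolding tendsto_fun_iff
   proof
    fix j
    have "((%t. ze t k j - gm y j) \<longlongrightarrow> 0) (at (y i))"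
    proof (rule Lim_null_comparison)
     show "eventually (%t. norm (ze t k j - gm y j) <= \<bar>z t j - gm y j\<bar>) (at (y i))"
      using ev by (rule eventually_mono) (use ze k in auto)
     show "((%t. \<bar>z t j - gm y j\<bar>) \<longlongrightarrow> 0) (at (y i))"
      using lzj[of j] by (simp add: LIM_zero tendsto_rabs_zero)
    qed
    then show "((%t. ze t k j) \<longlongrightarrow> gm y j) (at (y i))" by (simp add: LIM_zero_iff)
   qed
   show "gm y \<in> U" using gmW[OF y] WU by blast
   show "eventually (%t. ze t k \<in> U) (at (y i))"
    using ev
   proof (rule eventually_mono)
    fix t assume "y(i := t) \<in> V & z t \<in> boxn n (gm y) r"
    then have "ze t k \<in> boxn n (gm y) r" using zeb k by blast
    then show "ze t k \<in> U" using r(2) WU by blast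
   qed
  qed
  have lq: "((%t. (if i = m then 1 else - pd U i g (ze t i)) / p (ze t m)) \<longlongrightarrow> D i y) (at (y i))"
   unfolding D_def p_def
   using lze[OF m] lze[OF i] pn[of "gm y"] gmW[OF y] WC
   by (intro tendsto_divide) (auto simp: p_def intro!: tendsto_minus)
  have "eventually (%t. (if i = m then 1 else - pd U i g (ze t i)) / p (ze t m) = (z t m - gm y m) / (t - y i)) (at (y i))"
  proof -
   have "eventually (%t. t ~= y i) (at (y i))" by (rule eventually_neq_at_within)
   with ev show ?thesis
   proof eventually_elim
    case (elim t)
    then have tV: "y(i := t) \<in> V" and tz: "z t \<in> boxn n (gm y) r" and ne: "t ~= y i" by auto
    have zk: "z t k = (if k = i then t else y k)" if "k ~= m" for k using gmi[OF tV that] by (simp add: z_def)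
    have p0: "p (ze t m) ~= 0" using pn zeb[OF tz m] r(2) WC by blast
    have "g (z t) - g (gm y) = (y(i := t)) m - y m" using ggm[OF tV] ggm[OF y] by (simp add: z_def)
    moreover have "g (z t) - g (gm y) = (\<Sum>k<n. pd U k g (ze t k) * (z t k - gm y k))" using ze[OF tz] by blast
    \<comment> \<open>A change of coordinate \<open>i\<close> of \<open>y\<close> affects no
      coordinates of \<open>gm y\<close> other than \<open>i\<close> and \<open>m\<close>.\<close>
    moreover have "\<dots> = (\<Sum>k\<in>{i, m}. pd U k g (ze t k) * (z t k - gm y k))"
     by (rule sum.mono_neutral_right) (use i m zk gmi[OF y] in auto)
    ultimately have eq: "(y(i := t)) m - y m = (\<Sum>k\<in>{i, m}. pd U k g (ze t k) * (z t k - gm y k))" by simp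
    show ?case
    proof (cases "i = m")
     case True
     then have "t - y m = p (ze t m) * (z t m - gm y m)" using eq by (simp add: p_def)
     then show ?thesis using True p0 ne by (simp add: field_simps)
    next
     case False
     then have "0 = pd U i g (ze t i) * (t - y i) + p (ze t m) * (z t m - gm y m)"
      using eq zk[OF False] gmi[OF y False] by (simp add: p_def)
     then have "p (ze t m) * (z t m - gm y m) = - pd U i g (ze t i) * (t - y i)" by linarith
     then show ?thesis using False p0 ne by (simp add: field_simps)
    qed
   qed
  qed
  with lq have "((%t. (z t m - gm y m) / (t - y i)) \<longlongrightarrow> D i y) (at (y i))"
   by (rule Lim_transform_eventually)
  then show ?thesis by (simp add: has_field_derivative_iff z_def)
 qed
 have ld: "ldiff n G gm W V"
  unfolding ldiff_def
 proof (intro conjI ballI allI impI)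
  fix i assume i: "i < n"
  show "Ck n W (Suc 0) (%x. G x i)"
  proof (cases "i = m")
   case True
   then show ?thesis using Ck_subset[OF g U(1) Wo WU] by (simp add: G_def)
  qed (simp add: G_def Ck_coord Wo)
  show "Ck n V (Suc 0) (%y. gm y i)"
  proof (cases "i = m")
   case True
   show ?thesis unfolding True
   proof (rule Ck_SucI[OF Vo cgmm, where f' = D])
    show "Ck n V 0 (D j)" if "j < n" for j
    proof -
     have "continuous_on V (%y. pd U k g (gm y))" if "k < n" for k
      by (rule continuous_on_compose2[OF cp[OF that] cgm]) (use gmW WU in auto)
     then show ?thesis unfolding D_def p_def
      using that m pn gmW WC by (cases "j = m") (auto intro!: continuous_intros simp: p_def)
    qed
   qed (use hD in auto)
  next
   case False
   show ?thesis by (rule Ck_cong[OF Vo _ Ck_coord[OF Vo]]) (use gmi False in auto)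
  qed
 qed (use Wo Vo gmG gmW Ggm in \<open>auto simp: V_def\<close>)
 have cov: "covl n W G (%y. \<bar>p y\<bar>)"
  unfolding covl_def
 proof (intro allI impI, elim conjE)
  fix F :: "(nat => real) => real" and K
  assume F: "continuous_on (Rn n) F" "compact K" "K <= G ` W" "\<forall>y\<in>Rn n - K. F y = 0"
  let ?F' = "%y. if y \<in> W then F (G y) * \<bar>p y\<bar> else 0"
  have KV: "K <= V" using F(3) by (simp add: V_def)
  have cs1: "csupp n F" using F KV VR unfolding csupp_def by blast
  have cs2: "csupp n ?F'"
  proof (rule csupp_extend[OF Wo, where K = "gm ` K"])
   show "continuous_on W (%y. F (G y) * \<bar>p y\<bar>)"
   proof (intro continuous_on_mult continuous_on_rabs)
    show "continuous_on W (%y. F (G y))"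
     by (rule continuous_on_compose2[OF F(1) ldiffD(13)[OF ld]]) (use GR in auto)
    show "continuous_on W p" using continuous_on_subset[OF cp[OF m] WU] by (simp add: p_def)
   qed
   show "compact (gm ` K)" using F(2) KV cgm by (intro compact_continuous_image continuous_on_subset[OF cgm]) auto
   show "gm ` K <= W" using KV gmW by blast
   show "F (G y) * \<bar>p y\<bar> = 0" if "y \<in> W - gm ` K" for y
   proof -
    have "G y \<notin> K" using that gmG by force
    then have "F (G y) = 0" using F(4) GR that by blast
    then show ?thesis by simp
   qed
  qed
  \<comment> \<open>On each line in direction \<open>m\<close> the map is a monotone function of one
    variable. A line that misses the box contributes 0 to both sides.\<close>
  show "RInt n F = RInt n ?F'"
  proof (rule RInt_slice_cong[OF cs1 cs2 m])
   fix z assume z: "z \<in> Rn n"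
   have zR: "z(m := t) \<in> Rn n" for t using Rn_upd[OF z m] .
   have Fnz: "\<exists>w\<in>W. z(m := u) = G w" if "F (z(m := u)) ~= 0" for u
    using F(3,4) zR that by blast
   let ?a = "x m - de" and ?b = "x m + de"
   show "(\<integral>t. F (z(m := t)) \<partial>lborel) = (\<integral>t. ?F' (z(m := t)) \<partial>lborel)"
   proof (cases "\<forall>i<n. i ~= m --> \<bar>z i - x i\<bar> < de")
    case True
    have zC: "z(m := t) \<in> C" if "t \<in> {?a..?b}" for t
     using True that zR[of t] by (auto simp: C_def cboxn_def abs_le_iff less_imp_le)
    have zW: "z(m := t) \<in> W \<longleftrightarrow> t \<in> {?a<..<?b}" for t
     using True zR[of t] m by (auto simp: W_def boxn_def abs_less_iff)
    have "(\<integral>t. F (z(m := t)) \<partial>lborel) =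
     (\<integral>t. (if t \<in> {?a<..<?b} then F (z(m := g (z(m := t)))) * \<bar>p (z(m := t))\<bar> else 0) \<partial>lborel)"
    proof (rule substitution_1D)
     show "?a < ?b" using de(1) by simp
     show "((%t. g (z(m := t))) has_real_derivative p (z(m := t))) (at t)" if "t \<in> {?a..?b}" for t
      using hp[OF m, of "z(m := t)"] zC[OF that] CU by (auto simp: p_def)
     show "continuous_on {?a..?b} (%t. p (z(m := t)))" unfolding p_def
      by (rule continuous_on_compose2[OF cp[OF m] continuous_on_fun_upd]) (use zC CU in auto)
     show "(\<forall>t\<in>{?a..?b}. 0 < p (z(m := t))) \<or> (\<forall>t\<in>{?a..?b}. p (z(m := t)) < 0)"
      using Cs[OF zC] by (cases "0 < s") (auto simp: zero_less_mult_iff)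
     show "continuous_on UNIV (%t. F (z(m := t)))"
      by (rule continuous_on_compose2[OF F(1) continuous_on_fun_upd]) (use zR in auto)
     show "u \<in> (%t. g (z(m := t))) ` {?a<..<?b}" if nz: "F (z(m := u)) ~= 0" for u
     proof -
      obtain w where w: "w \<in> W" "z(m := u) = G w" using Fnz[OF nz] by blast
      have "w i = z i" if "i ~= m" for i using fun_cong[OF w(2), of i] that by (simp add: G_def)
      then have wz: "w = z(m := w m)" by auto
      have "u = g w" using fun_cong[OF w(2), of m] by (simp add: G_def)
      then have "u = g (z(m := w m))" using wz by simp
      moreover have "w m \<in> {?a<..<?b}" using zW wz w(1) by metis
      ultimately show ?thesis by (rule image_eqI)
     qed
    qed
    also have "\<dots> = (\<integral>t. ?F' (z(m := t)) \<partial>lborel)"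
     by (intro Bochner_Integration.integral_cong refl) (simp add: zW G_def)
    finally show ?thesis .
   next
    case False
    then obtain i where i: "i < n" "i ~= m" "\<not> \<bar>z i - x i\<bar> < de" by blast
    have "z(m := t) \<notin> W" for t using i by (auto simp: W_def boxn_def)
    moreover have "F (z(m := t)) = 0" for t
    proof (rule ccontr)
     assume "F (z(m := t)) ~= 0"
     then obtain w where w: "w \<in> W" "z(m := t) = G w" using Fnz by blast
     have "w i = z i" using fun_cong[OF w(2), of i] i by (simp add: G_def)
     moreover have "\<bar>w i - x i\<bar> < de" using w(1) i(1) by (simp add: W_def boxn_def)
     ultimately show False using i(3) by simp
    qed
    ultimately show ?thesis by simp
   qed
  qed
 qed
 show ?thesis by (rule that[OF Wo xW WU ld[unfolded G_def] cov[unfolded G_def p_def]])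
qed

lemma primitive_map_ex:
 assumes "opn n U" "x \<in> U" "m < n" "Ck n U (Suc 0) g" "pd U m g x ~= 0"
 shows "\<exists>W V gm. opn n W & x \<in> W & W <= U & ldiff n (%y. y(m := g y)) gm W V &
  covl n W (%y. y(m := g y)) (%y. \<bar>pd U m g y\<bar>)"
 by (rule primitive_map[OF assms]) blast

lemma jacd_id: "opn n U ==> x \<in> U ==> jacd n U (%y. y) x = 1"
proof -
 assume a: "opn n U" "x \<in> U"
 have "Matrix.mat n n (%(i, j). pd U j (%y. y i) x) = 1\<^sub>m n"
 proof (rule eq_matI)
  fix i j assume "i < dim_row (1\<^sub>m n)" "j < dim_col (1\<^sub>m n)"
  then have ij: "i < n" "j < n" by auto
  have "pd U j (%y. y i) x = (if i = j then 1 else 0)"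
   by (rule pd_eq[OF a ij(2)]) (auto intro!: derivative_eq_intros)
  then show "Matrix.mat n n (%(i, j). pd U j (%y. y i) x) $$ (i, j) = 1\<^sub>m n $$ (i, j)" using ij by simp
 qed auto
 then show ?thesis by (simp add: jacd_def)
qed

text \<open>Induction on the number of coordinates that \<open>ta\<close> may change: a map changing the first \<open>m + 1\<close>
  coordinates with \<open>\<partial>\<^sub>m ta\<^sub>m \<noteq> 0\<close> factors through the primitive map replacing the coordinate \<open>m\<close> by \<open>ta\<^sub>m\<close>;
  a shear reduces the general case to this one.\<close>

lemma change_of_variables_aux:
 "m <= n ==> ldiff n ta \<sigma> U V ==> x \<in> U ==> (!!y i. y \<in> U ==> m <= i ==> i < n ==> ta y i = y i) ==>
 \<exists>W. opn n W & x \<in> W & W <= U & covl n W ta (%y. \<bar>jacd n U ta y\<bar>)"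
proof (induction m arbitrary: ta \<sigma> U V x)
 case 0
 note l = ldiffD[OF 0(2)]
 have id: "ta y = y" if "y \<in> U" for y
  by (rule Rn_eqI[of _ n]) (use 0(4) l that in auto)
 have J: "jacd n U ta y = 1" if "y \<in> U" for y
  using jacd_cong[OF l(1,1) that _ id] jacd_id[OF l(1) that] by simp
 have "covl n U (%y. y) (%y. 1)" unfolding covl_def
 proof (intro allI impI, elim conjE)
  fix F :: "(nat => real) => real" and K
  assume F: "K <= (%y. y) ` U" "\<forall>y\<in>Rn n - K. F y = 0"
  show "RInt n F = RInt n (%y. if y \<in> U then F y * 1 else 0)"
   by (rule RInt_cong) (use F in auto)
 qed
 then have "covl n U ta (%y. \<bar>jacd n U ta y\<bar>)" by (rule covl_cong) (use id J in auto)
 then show ?case using l(1) 0(3) by blast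
next
 case (Suc m)
 then have m: "m < n" by simp
 have A: "\<exists>W. opn n W & x \<in> W & W <= U & covl n W ta (%y. \<bar>jacd n U ta y\<bar>)"
  if ld: "ldiff n ta \<sigma> U V" and x: "x \<in> U" and fx: "!!y i. y \<in> U ==> Suc m <= i ==> i < n ==> ta y i = y i"
   and nz: "pd U m (%y. ta y m) x ~= 0" for ta \<sigma> U V x
 proof -
  note l = ldiffD[OF ld]
  define g where "g = (%y. ta y m)"
  define G where "G = (%y. y(m := g y))"
  obtain W0 V0 gm where W0: "opn n W0" "x \<in> W0" "W0 <= U" and lG: "ldiff n G gm W0 V0"
   and cG: "covl n W0 G (%y. \<bar>pd U m g y\<bar>)"
  proof -
   have "\<exists>W V gm. opn n W & x \<in> W & W <= U & ldiff n G gm W V & covl n W G (%y. \<bar>pd U m g y\<bar>)"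
    using primitive_map_ex[OF l(1) x m l(7)[OF m] nz] unfolding G_def g_def .
   then show ?thesis using that by blast
  qed
  note k = ldiffD[OF lG]
  \<comment> \<open>\<open>ta'\<close> undoes \<open>G\<close> before applying \<open>ta\<close>. As
    \<open>G\<close> has already produced coordinate \<open>m\<close> of \<open>ta\<close>, the new
    map fixes this coordinate too, and the induction hypothesis applies.\<close>
  define ta' where "ta' = (%y. ta (gm y))"
  have l': "ldiff n ta' (%y. G (\<sigma> y)) V0 (ta ` W0)" unfolding ta'_def
   by (rule ldiff_comp[OF ldiff_sym[OF lG] ldiff_restrict[OF ld W0(1,3)]])
  note k' = ldiffD[OF l']
  have fx': "ta' y i = y i" if y: "y \<in> V0" and i: "m <= i" "i < n" for y i
  proof -
   have gmU: "gm y \<in> U" using k(5)[OF y] W0(3) by blast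
   have e: "G (gm y) i = y i" using k(6)[OF y] by simp
   show ?thesis
   proof (cases "i = m")
    case True
    then show ?thesis using e by (simp add: ta'_def G_def g_def)
   next
    case False
    then show ?thesis using fx[OF gmU, of i] e i by (simp add: ta'_def G_def)
   qed
  qed
  obtain W1 where W1: "opn n W1" "G x \<in> W1" "W1 <= V0" and c1: "covl n W1 ta' (%y. \<bar>jacd n V0 ta' y\<bar>)"
   using Suc.IH[OF _ l' k(3)[OF W0(2)] fx'] m by auto
  define W where "W = gm ` W1"
  have Wo: "opn n W" unfolding W_def by (rule ldiff_image_opn[OF ldiff_sym[OF lG] W1(1,3)])
  have xW: "x \<in> W" unfolding W_def using W1(2) k(4)[OF W0(2)] by force
  have WW0: "W <= W0" unfolding W_def using W1(3) k(5) by blast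
  have GW: "G ` W = W1"
  proof
   show "G ` W <= W1" unfolding W_def using k(6) W1(3) by auto
   show "W1 <= G ` W"
   proof
    fix y assume y: "y \<in> W1"
    then have "G (gm y) = y" using k(6) W1(3) by blast
    then show "y \<in> G ` W" unfolding W_def using y by force
   qed
  qed
  have cW: "covl n W G (%y. \<bar>pd U m g y\<bar>)"
   by (rule covl_subset[OF cG WW0 k(12) W0(1)]) (use k in auto)
  have taW1: "ta' ` W1 <= ta ` W0" unfolding ta'_def using k(5) W1(3) by auto
  have "covl n W (%y. ta' (G y)) (%y. \<bar>jacd n V0 ta' (G y)\<bar> * \<bar>pd U m g y\<bar>)"
  proof (rule covl_comp[OF cW c1 GW W1(1)])
   show "continuous_on (ta' ` W1) (%y. G (\<sigma> y))" by (rule continuous_on_subset[OF k'(14) taW1])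
   show "G (\<sigma> (ta' y)) = y" if "y \<in> W1" for y using k'(4) that W1(3) by blast
   show "continuous_on W1 ta'" by (rule continuous_on_subset[OF k'(13) W1(3)])
   show "continuous_on W1 (%y. \<bar>jacd n V0 ta' y\<bar>)"
    by (intro continuous_on_rabs continuous_on_subset[OF continuous_jacd[OF l'] W1(3)])
   show "ta' ` W1 <= Rn n" using taW1 k'(10) by blast
  qed
  then have "covl n W ta (%y. \<bar>jacd n U ta y\<bar>)"
  proof (rule covl_cong)
   fix y assume y: "y \<in> W"
   then have y0: "y \<in> W0" using WW0 by blast
   have e: "ta' (G y) = ta y" if "y \<in> W0" for y using k(4)[OF that] by (simp add: ta'_def)
   show "ta' (G y) = ta y" by (rule e[OF y0])
   have "jacd n U ta y = jacd n W0 (%y. ta' (G y)) y"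
    by (rule jacd_cong[OF l(1) W0(1) y0 W0(3)]) (use e in simp)
   also have "\<dots> = jacd n V0 ta' (G y) * jacd n W0 G y" by (rule jacd_comp[OF lG l' y0])
   also have "jacd n W0 G y = pd U m g y"
    unfolding G_def jacd_primitive[OF W0(1) y0 m]
    using y0 W0 by (intro pd_opn_subset[OF W0(1) l(1)]) (auto simp: m)
   finally show "\<bar>jacd n V0 ta' (G y)\<bar> * \<bar>pd U m g y\<bar> = \<bar>jacd n U ta y\<bar>" by (simp add: abs_mult)
  qed
  then show ?thesis using Wo xW WW0 W0(3) by blast
 qed
 show ?case
 proof (cases "pd U m (%y. ta y m) x = 0")
  case False
  then show ?thesis using A[OF Suc.prems(2,3) Suc.prems(4)] by blast
 next
  case True
  note l = ldiffD[OF Suc.prems(2)]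
  have xU: "x \<in> U" by (rule Suc.prems(3))
  have xR: "x \<in> Rn n" using xU l(9) by blast
  have \<sigma>fx: "\<sigma> y i = y i" if "y \<in> V" "Suc m <= i" "i < n" for y i
   using Suc.prems(4)[OF l(5)[OF that(1)] that(2,3)] l(6)[OF that(1)] by simp
  have taxV: "ta x \<in> V" using l(3) xU by blast
  have "pd V m (%y. ta (\<sigma> y) m) (ta x) = 1"
  proof -
   have "pd V m (%y. ta (\<sigma> y) m) (ta x) = pd V m (%y. y m) (ta x)"
    by (rule pd_cong[OF l(2) m taxV]) (use l(6) in simp)
   also have "\<dots> = 1" by (rule pd_eq[OF l(2) taxV m]) (auto intro!: derivative_eq_intros)
   finally show ?thesis .
  qed
  moreover have "pd V m (%y. ta (\<sigma> y) m) (ta x)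
    = (\<Sum>k<n. pd U k (%y. ta y m) (\<sigma> (ta x)) * pd V m (%y. \<sigma> y k) (ta x))"
   by (rule pd_compose[OF l(2,1) l(7)[OF m] l(8) _ m taxV]) (use l(5) in auto)
  ultimately have s1: "(\<Sum>k<n. pd U k (%y. ta y m) x * pd V m (%y. \<sigma> y k) (ta x)) = 1"
   using l(4)[OF xU] by simp
  \<comment> \<open>Row \<open>m\<close> of the Jacobi matrix of \<open>ta\<close> pairs to 1 with a
    column of that of \<open>\<sigma>\<close>. The entries beyond \<open>m\<close> contribute 0
    because \<open>\<sigma>\<close> fixes those coordinates, and entry \<open>m\<close> is 0 in this
    case, so some earlier entry is nonzero.\<close>
  have "\<exists>j<m. pd U j (%y. ta y m) x ~= 0"
  proof (rule ccontr)
   assume a: "\<not> ?thesis"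
   have "pd U k (%y. ta y m) x * pd V m (%y. \<sigma> y k) (ta x) = 0" if k: "k < n" for k
   proof (cases k m rule: linorder_cases)
    case greater
    have "pd V m (%y. \<sigma> y k) (ta x) = pd V m (%y. y k) (ta x)"
     by (rule pd_cong[OF l(2) m taxV]) (use \<sigma>fx greater k in auto)
    also have "\<dots> = 0" by (rule pd_eq[OF l(2) taxV m]) (use greater in \<open>auto intro!: derivative_eq_intros\<close>)
    finally show ?thesis by simp
   qed (use a True in auto)
   then have "(\<Sum>k<n. pd U k (%y. ta y m) x * pd V m (%y. \<sigma> y k) (ta x)) = 0"
    by (intro sum.neutral) blast
   then show False using s1 by linarith
  qed
  then obtain j where j: "j < m" "pd U j (%y. ta y m) x ~= 0" by blast
  have jn: "j < n" and jm: "j ~= m" using j m by auto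
  \<comment> \<open>After this shear the derivative of \<open>ta (Q y) m\<close> in direction
    \<open>m\<close> is the sum of the old derivatives in directions \<open>j\<close> and
    \<open>m\<close>, hence nonzero.\<close>
  define Q where "Q = (%y::nat => real. y(j := y j + y m))"
  define g where "g = (%y::nat => real. y j - y m)"
  define P where "P = (%y::nat => real. y(j := g y))"
  have PQ: "P (Q y) = y" "Q (P y) = y" for y using jm by (auto simp: P_def Q_def g_def)
  have QR: "Q y \<in> Rn n" and PR: "P y \<in> Rn n" if "y \<in> Rn n" for y
   using Rn_upd[OF that jn] by (auto simp: Q_def P_def)
  have QC: "Ck n A r (%y. Q y i)" if "opn n A" for A r i
   by (cases "i = j") (auto simp: Q_def intro!: Ck_add Ck_coord that)
  have gC: "Ck n A r g" if "opn n A" for A r unfolding g_def by (intro Ck_diff Ck_coord that)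
  have PC: "Ck n A r (%y. P y i)" if "opn n A" for A r i
   by (cases "i = j") (auto simp: P_def intro!: gC Ck_coord that)
  define U' where "U' = Rn n \<inter> Q -` U"
  have U'o: "opn n U'" unfolding U'_def
  proof (rule opn_preimage[OF opn_Rn _ _ l(1)])
   show "continuous_on (Rn n) Q"
    using QR Ck_continuous[OF QC[OF opn_Rn, of 0]] by (intro continuous_on_Rn_valued[of _ _ n]) blast+
  qed (use QR in auto)
  have lQ: "ldiff n Q P U' U" unfolding ldiff_def
   using U'o l(1,9) QC[OF U'o] PC[OF l(1)] PQ PR by (auto simp: U'_def)
  have l1: "ldiff n (%y. ta (Q y)) (%y. P (\<sigma> y)) U' V" by (rule ldiff_comp[OF lQ Suc.prems(2)])
  note k1 = ldiffD[OF l1]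
  have x'U: "P x \<in> U'" using xU xR PR PQ by (auto simp: U'_def)
  have fx1: "ta (Q y) i = y i" if "y \<in> U'" "Suc m <= i" "i < n" for y i
  proof -
   have "Q y \<in> U" using that by (auto simp: U'_def)
   moreover have "Q y i = y i" using that j by (simp add: Q_def)
   ultimately show ?thesis using Suc.prems(4)[of "Q y" i] that by simp
  qed
  have nz1: "pd U' m (%y. ta (Q y) m) (P x) ~= 0"
  proof -
   have "pd U' m (%y. ta (Q y) m) (P x)
     = (\<Sum>k<n. pd U k (%y. ta y m) (Q (P x)) * pd U' m (%y. Q y k) (P x))"
    by (rule pd_compose[OF U'o l(1) l(7)[OF m] QC[OF U'o] _ m x'U]) (auto simp: U'_def)
   also have "\<dots> = (\<Sum>k<n. pd U k (%y. ta y m) x * (if k = j \<or> k = m then 1 else 0))"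
   proof (intro sum.cong refl arg_cong2[of _ _ _ _ "(*)"])
    fix k
    show "pd U k (%y. ta y m) (Q (P x)) = pd U k (%y. ta y m) x" by (simp add: PQ)
    show "pd U' m (%y. Q y k) (P x) = (if k = j \<or> k = m then 1 else 0)"
     by (rule pd_eq[OF U'o x'U m]) (use jm in \<open>auto simp: Q_def intro!: derivative_eq_intros\<close>)
   qed
   also have "\<dots> = (\<Sum>k\<in>{j, m}. pd U k (%y. ta y m) x * (if k = j \<or> k = m then 1 else 0))"
    by (rule sum.mono_neutral_right) (use jn m in auto)
   also have "\<dots> = pd U j (%y. ta y m) x" using jm True by simp
   finally show ?thesis using j by simp
  qed
  obtain W1 where W1: "opn n W1" "P x \<in> W1" "W1 <= U'"
   and c1: "covl n W1 (%y. ta (Q y)) (%y. \<bar>jacd n U' (%y. ta (Q y)) y\<bar>)"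
   using A[OF l1 x'U fx1 nz1] by blast
  \<comment> \<open>The inverse shear \<open>P\<close> changes coordinate \<open>j\<close> alone, so
    its own integral formula is that of a primitive map; then \<open>ta\<close> is recovered as
    \<open>ta\<close> after \<open>Q\<close> after \<open>P\<close>.\<close>
  have pg: "pd U j g y = 1" if "y \<in> U" for y
   by (rule pd_eq[OF l(1) that jn]) (use jm in \<open>auto simp: g_def intro!: derivative_eq_intros\<close>)
  obtain W2 V2 gm2 where W2: "opn n W2" "x \<in> W2" "W2 <= U" and l2: "ldiff n P gm2 W2 V2"
   and c2: "covl n W2 P (%y. \<bar>pd U j g y\<bar>)"
  proof -
   have "pd U j g x ~= 0" using pg[OF xU] by simp
   from primitive_map_ex[OF l(1) xU jn gC[OF l(1)] this]
   show ?thesis using that unfolding P_def by blast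
  qed
  note k2 = ldiffD[OF l2]
  define W where "W = W2 \<inter> Q ` W1"
  have Wo: "opn n W" unfolding W_def by (intro openin_Int W2(1) ldiff_image_opn[OF lQ W1(1,3)])
  have xW: "x \<in> W" unfolding W_def using W2(2) W1(2) PQ(2)[of x] by force
  have WW2: "W <= W2" by (auto simp: W_def)
  have PW: "P ` W <= W1" unfolding W_def using PQ by auto
  have PWo: "opn n (P ` W)" by (rule ldiff_image_opn[OF l2 Wo WW2])
  have "covl n W (%y. ta (Q (P y))) (%y. \<bar>jacd n U' (%y. ta (Q y)) (P y)\<bar> * \<bar>pd U j g y\<bar>)"
  proof (rule covl_comp[OF _ _ refl PWo])
   show "covl n W P (%y. \<bar>pd U j g y\<bar>)"
    by (rule covl_subset[OF c2 WW2 k2(12) W2(1)]) (use k2 in auto)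
   show "covl n (P ` W) (%y. ta (Q y)) (%y. \<bar>jacd n U' (%y. ta (Q y)) y\<bar>)"
    by (rule covl_subset[OF c1 PW inj_on_subset[OF k1(12) W1(3)] W1(1)]) (use k1(3,10) W1(3) in blast)
   have s: "P ` W <= U'" using PW W1(3) by blast
   show "continuous_on ((%y. ta (Q y)) ` P ` W) (%y. P (\<sigma> y))"
    by (rule continuous_on_subset[OF k1(14)]) (use s k1(3) in blast)
   show "P (\<sigma> (ta (Q y))) = y" if "y \<in> P ` W" for y using k1(4) that s by blast
   show "continuous_on (P ` W) (%y. ta (Q y))" by (rule continuous_on_subset[OF k1(13) s])
   show "continuous_on (P ` W) (%y. \<bar>jacd n U' (%y. ta (Q y)) y\<bar>)"
    by (intro continuous_on_rabs continuous_on_subset[OF continuous_jacd[OF l1] s])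
   show "(%y. ta (Q y)) ` P ` W <= Rn n" using s k1(3,10) by blast
  qed
  then have "covl n W ta (%y. \<bar>jacd n U ta y\<bar>)"
  proof (rule covl_cong)
   fix y assume y: "y \<in> W"
   then have yU: "y \<in> U" using WW2 W2(3) by blast
   show "ta (Q (P y)) = ta y" by (simp add: PQ)
   have "jacd n U ta y = jacd n U (%y. ta (Q (P y))) y" by (simp add: PQ)
   also have "\<dots> = jacd n U' (%y. ta (Q y)) (P y) * jacd n U P y"
    by (rule jacd_comp[OF ldiff_sym[OF lQ] l1 yU])
   also have "jacd n U P y = pd U j g y" unfolding P_def by (rule jacd_primitive[OF l(1) yU jn])
   finally show "\<bar>jacd n U' (%y. ta (Q y)) (P y)\<bar> * \<bar>pd U j g y\<bar> = \<bar>jacd n U ta y\<bar>" by (simp add: abs_mult)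
  qed
  then show ?thesis using Wo xW WW2 W2(3) by blast
 qed
qed

text \<open>The factorisation into primitive maps exists only near a point. Passing from small sets
  to whole chart domains is left to partitions of unity on the manifold.\<close>

lemma local_change_of_variables:
 assumes "ldiff n ta \<sigma> U V" "x \<in> U"
 obtains W where "opn n W" "x \<in> W" "W <= U" "covl n W ta (%y. \<bar>jacd n U ta y\<bar>)"
proof -
 have "\<exists>W. opn n W & x \<in> W & W <= U & covl n W ta (%y. \<bar>jacd n U ta y\<bar>)"
  by (rule change_of_variables_aux[OF le_refl assms]) auto
 then show ?thesis using that by blast
qed

section \<open>Alternating multilinear forms on coordinate space\<close>

definition idx :: "nat => nat => nat list set"
 where "idx n k = {js. set js <= {..<n} & length js = k}"

lemma finite_idx: "finite (idx n k)"
 unfolding idx_def by (rule finite_lists_length_eq) simp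

text \<open>The multilinear form with coefficients \<open>N\<close>, evaluated at \<open>vs\<close>.
  The sum runs over all index lists, not only increasing ones, so that it can be differentiated as a
  polynomial in coefficients and arguments; alternation is a separate property.\<close>

definition AM :: "nat => nat => (nat list => real) => (nat => real) list => real"
 where "AM n k N vs = (\<Sum>js\<in>idx n k. (\<Prod>i<k. (vs ! i) (js ! i)) * N js)"

definition unitv :: "nat => nat => real"
 where "unitv j = (%i. if i = j then 1 else 0)"

lemma unitv_Rn: "j < n ==> unitv j \<in> Rn n"
 by (auto simp: unitv_def Rn_iff)

definition altform :: "nat => nat => ((nat => real) list => real) => bool"
 where "altform n k A \<longleftrightarrow> (\<forall>vs. set vs <= Rn n & length vs = k -->
  (\<forall>i<k. \<forall>v\<in>Rn n. \<forall>w\<in>Rn n. \<forall>t. A (vs[i := (%l. v l + t * w l)]) = A (vs[i := v]) + t * A (vs[i := w])) &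
  (\<forall>i<k. \<forall>j<k. i ~= j & vs ! i = vs ! j --> A vs = 0))"

lemma altform_lin:
 assumes "altform n k A" "set vs <= Rn n" "length vs = k" "i < k" "v \<in> Rn n" "w \<in> Rn n"
 shows "A (vs[i := (%l. v l + t * w l)]) = A (vs[i := v]) + t * A (vs[i := w])"
 using assms unfolding altform_def by blast

lemma altform_eq:
 assumes "altform n k A" "set vs <= Rn n" "length vs = k" "i < k" "j < k" "i ~= j" "vs ! i = vs ! j"
 shows "A vs = 0"
 using assms unfolding altform_def by blast

lemma Rn_lin: "v \<in> Rn n ==> w \<in> Rn n ==> (%l. v l + t * w l) \<in> Rn n"
 by (simp add: Rn_iff)

lemma set_list_update_subset: "set vs <= S ==> v \<in> S ==> set (vs[i := v]) <= S"
 using set_update_subset_insert[of vs i v] by blast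

lemma altform_Cons: 
 assumes "altform n (Suc k) A" "x \<in> Rn n" shows "altform n k (%ws. A (x # ws))"
 unfolding altform_def
proof (intro allI impI conjI ballI, goal_cases)
 case (1 vs i v w t)
 then show ?case using altform_lin[OF assms(1), of "x # vs" "Suc i" v w t] assms(2) by simp
next
 case (2 vs i j)
 then show ?case using altform_eq[OF assms(1), of "x # vs" "Suc i" "Suc j"] assms(2) by simp
qed

text \<open>The head is built up from its first \<open>r\<close> coordinates, each step adding a
  multiple of one unit vector.\<close>

lemma altform_expand_head:
 assumes A: "altform n (Suc k) A" and vs: "v \<in> Rn n" "set vs <= Rn n" "length vs = k"
 shows "A (v # vs) = (\<Sum>j<n. v j * A (unitv j # vs))"
proof -
 have lin: "A ((%l. x l + t * y l) # vs) = A (x # vs) + t * A (y # vs)" if "x \<in> Rn n" "y \<in> Rn n" for x y t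
  using altform_lin[OF A, of "v # vs" 0 x y t] that vs by simp
 have zR: "(%l. 0) \<in> Rn n" by (simp add: Rn_iff)
 have z: "A ((%l. 0) # vs) = 0" using lin[OF zR zR, of 1] by simp
 have "A ((%l. if l < r then v l else 0) # vs) = (\<Sum>j<r. v j * A (unitv j # vs))" if "r <= n" for r
  using that
 proof (induction r)
  case (Suc r)
  have "(%l. if l < Suc r then v l else 0) = (%l. (if l < r then v l else 0) + v r * unitv r l)"
   by (auto simp: unitv_def fun_eq_iff less_Suc_eq)
  moreover have "(%l. if l < r then v l else 0) \<in> Rn n" using Suc.prems by (auto simp: Rn_iff)
  ultimately show ?case using lin[of _ "unitv r" "v r"] unitv_Rn[of r n] Suc by simp
 qed (simp add: z)
 from this[of n] have "A ((%l. if l < n then v l else 0) # vs) = (\<Sum>j<n. v j * A (unitv j # vs))" by simp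
 moreover have "(%l. if l < n then v l else 0) = v" using vs(1) by (auto simp: Rn_iff fun_eq_iff)
 ultimately show ?thesis by simp
qed

lemma idx_Suc: "idx n (Suc k) = (%(j, js). j # js) ` ({..<n} \<times> idx n k)"
proof (intro subset_antisym subsetI)
 fix js assume "js \<in> idx n (Suc k)"
 then show "js \<in> (%(j, js). j # js) ` ({..<n} \<times> idx n k)" by (cases js) (auto simp: idx_def)
qed (auto simp: idx_def)

lemma altform_expand:
 assumes "altform n k A" "set vs <= Rn n" "length vs = k"
 shows "A vs = AM n k (%js. A (map unitv js)) vs"
 using assms
proof (induction k arbitrary: A vs)
 case 0
 moreover have "idx n 0 = {[]}" by (auto simp: idx_def)
 ultimately show ?case by (simp add: AM_def)
next
 case (Suc k)
 then obtain v ws where vs: "vs = v # ws" "length ws = k" "v \<in> Rn n" "set ws <= Rn n" by (cases vs) auto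
 have "A vs = (\<Sum>j<n. v j * A (unitv j # ws))" unfolding vs(1)
  by (rule altform_expand_head[OF Suc.prems(1) vs(3,4,2)])
 also have "\<dots> = (\<Sum>j<n. v j * AM n k (%js. A (unitv j # map unitv js)) ws)"
  using Suc.IH[OF altform_Cons[OF Suc.prems(1) unitv_Rn] vs(4,2)] by (intro sum.cong) auto
 also have "\<dots> = (\<Sum>(j, js)\<in>{..<n} \<times> idx n k. v j * ((\<Prod>i<k. (ws ! i) (js ! i)) * A (unitv j # map unitv js)))"
  unfolding AM_def sum_distrib_left by (subst sum.cartesian_product) simp
 also have "\<dots> = AM n (Suc k) (%js. A (map unitv js)) vs"
  unfolding AM_def idx_Suc
  by (subst sum.reindex)
   (auto simp: inj_on_def vs(1) prod.lessThan_Suc_shift mult.assoc intro!: sum.cong split: prod.splits simp del: prod.lessThan_Suc)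
 finally show ?case .
qed

text \<open>With the sum of both vectors in both slots the form vanishes; expanding leaves the two
  mixed terms.\<close>

lemma altform_swap:
 assumes A: "altform n k A" and vs: "set vs <= Rn n" "length vs = k" and ij: "i < k" "j < k" "i ~= j"
 shows "A (vs[i := vs ! j, j := vs ! i]) = - A vs"
proof -
 let ?f = "%x y. A (vs[i := x, j := y])"
 have sub: "set (vs[i := x, j := y]) <= Rn n" if "x \<in> Rn n" "y \<in> Rn n" for x y
  using that vs by (intro set_list_update_subset) auto
 have e: "?f x x = 0" if "x \<in> Rn n" for x
  using altform_eq[OF A sub[OF that that], of i j] vs ij by simp
 have l1: "?f (%l. x l + 1 * y l) z = ?f x z + 1 * ?f y z" if "x \<in> Rn n" "y \<in> Rn n" "z \<in> Rn n" for x y z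
  using altform_lin[OF A, of "vs[j := z]" i x y 1] that vs ij set_list_update_subset[of vs "Rn n" z j]
  by (simp add: list_update_swap[OF ij(3)])
 have l2: "?f z (%l. x l + 1 * y l) = ?f z x + 1 * ?f z y" if "x \<in> Rn n" "y \<in> Rn n" "z \<in> Rn n" for x y z
  using altform_lin[OF A, of "vs[i := z]" j x y 1] that vs ij set_list_update_subset[of vs "Rn n" z i] by simp
 let ?a = "vs ! i" and ?b = "vs ! j"
 have ab: "?a \<in> Rn n" "?b \<in> Rn n" using vs ij by auto
 have s: "(%l. ?a l + 1 * ?b l) \<in> Rn n" by (rule Rn_lin[OF ab])
 have "0 = ?f (%l. ?a l + 1 * ?b l) (%l. ?a l + 1 * ?b l)" using e[OF s] by simp
 also have "\<dots> = ?f ?a (%l. ?a l + 1 * ?b l) + 1 * ?f ?b (%l. ?a l + 1 * ?b l)" by (rule l1[OF ab s])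
 also have "?f ?a (%l. ?a l + 1 * ?b l) = ?f ?a ?a + 1 * ?f ?a ?b" by (rule l2) (use ab in auto)
 also have "?f ?b (%l. ?a l + 1 * ?b l) = ?f ?b ?a + 1 * ?f ?b ?b" by (rule l2) (use ab in auto)
 finally have "?f ?b ?a = - ?f ?a ?b" using e[OF ab(1)] e[OF ab(2)] by simp
 moreover have "vs[i := ?a, j := ?b] = vs" by simp
 ultimately show ?thesis by metis
qed

lemma altform_move:
 assumes A: "altform n k A"
 shows "set (xs @ v # ys @ zs) <= Rn n ==> length (xs @ v # ys @ zs) = k ==>
  A (xs @ v # ys @ zs) = (-1) ^ length ys * A (xs @ ys @ v # zs)"
proof (induction ys arbitrary: xs)
 case (Cons y ys)
 let ?L = "xs @ v # y # ys @ zs"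
 have "A (?L[length xs := ?L ! Suc (length xs), Suc (length xs) := ?L ! length xs]) = - A ?L"
  by (rule altform_swap[OF A]) (use Cons.prems in auto)
 moreover have "?L[length xs := ?L ! Suc (length xs), Suc (length xs) := ?L ! length xs] = (xs @ [y]) @ v # ys @ zs"
  by (simp add: list_update_append nth_append)
 moreover have "A ((xs @ [y]) @ v # ys @ zs) = (-1) ^ length ys * A ((xs @ [y]) @ ys @ v # zs)"
  using Cons.prems by (intro Cons.IH) auto
 ultimately show ?case by simp
qed simp

lemma altform_permute:
 assumes A: "altform n k A" and p: "p permutes {..<k}"
 shows "set vs <= Rn n ==> length vs = k ==> A (map (%i. vs ! p i) [0..<k]) = real_of_int (sign p) * A vs"
 using p finite_lessThan[of k]
proof (induction p arbitrary: vs rule: permutes_induct)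
 case id
 have "map (%i. vs ! id i) [0..<k] = vs" using id(2) using map_nth[of vs] by simp
 then show ?case by simp
next
 case (swap a b p vs)
 let ?vs = "vs[a := vs ! b, b := vs ! a]"
 have v: "set ?vs <= Rn n" "length ?vs = k"
  using swap by (auto intro!: set_list_update_subset)
 have 1: "map (%i. vs ! (Transposition.transpose a b \<circ> p) i) [0..<k] = map (%i. ?vs ! p i) [0..<k]"
 proof (rule map_cong[OF refl])
  fix i assume "i \<in> set [0..<k]"
  then have "p i < k" using permutes_in_image[OF swap.hyps(4), of i] by simp
  then show "vs ! (Transposition.transpose a b \<circ> p) i = ?vs ! p i"
   using swap by (auto simp: Transposition.transpose_def nth_list_update)
 qed
 have 2: "A (map (%i. ?vs ! p i) [0..<k]) = real_of_int (sign p) * A ?vs" by (rule swap.IH[OF v])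
 have 3: "A ?vs = - A vs" by (rule altform_swap[OF A]) (use swap in auto)
 have 4: "sign (Transposition.transpose a b \<circ> p) = - sign p"
  using swap.hyps(3,4) permutation_permutes by (subst sign_compose) (auto simp: permutation_swap_id sign_swap_id)
 show ?case unfolding 1 2 3 4 by simp
qed

text \<open>In the expansion over unit vectors the lists with repetitions vanish and the others are
  permutations, which is the Leibniz formula. This is the transformation law of top-degree forms
  under a change of chart.\<close>

lemma altform_det:
 assumes A: "altform n n A" and vs: "set vs <= Rn n" "length vs = n"
 shows "A vs = Determinant.det (Matrix.mat n n (%(i, j). (vs ! j) i)) * A (map unitv [0..<n])"
proof -
 let ?E = "map unitv [0..<n]"
 let ?B = "Matrix.mat n n (%(i, j). (vs ! i) j)"
 have E: "set ?E <= Rn n" "length ?E = n" using unitv_Rn by auto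
 define P where "P = {p. p permutes {..<n}}"
 define h where "h p = map p [0..<n]" for p :: "nat => nat"
 have dist: "A (map unitv js) = 0" if js: "js \<in> idx n n" and d: "js \<notin> h ` P" for js
 proof (cases "distinct js")
  case True
  have len: "length js = n" and s: "set js <= {..<n}" using js by (auto simp: idx_def)
  have "card (set js) = n" using True len distinct_card by metis
  then have sj: "set js = {..<n}" using card_subset_eq[OF finite_lessThan s] by simp
  define p where "p i = (if i < n then js ! i else i)" for i
  have "inj_on p {..<n}" using True len by (auto simp: inj_on_def p_def nth_eq_iff_index_eq)
  moreover have "p ` {..<n} = {..<n}" using sj len by (auto simp: p_def set_conv_nth image_def)
  ultimately have "p permutes {..<n}" by (intro bij_imp_permutes) (auto simp: bij_betw_def p_def)
  moreover have "h p = js" using len by (auto simp: h_def p_def intro!: nth_equalityI)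
  ultimately show ?thesis using d by (auto simp: P_def)
 next
  case False
  then obtain i j where ij: "i < n" "j < n" "i ~= j" "js ! i = js ! j"
   using js by (auto simp: distinct_conv_nth idx_def)
  show ?thesis
   by (rule altform_eq[OF A _ _ ij(1,2,3)]) (use js ij unitv_Rn in \<open>auto simp: idx_def\<close>)
 qed
 have hP: "h ` P <= idx n n"
  using permutes_in_image by (fastforce simp: h_def P_def idx_def)
 have inj: "inj_on h P"
 proof (rule inj_onI)
  fix p q assume pq: "p \<in> P" "q \<in> P" "h p = h q"
  have "p i = q i" for i
  proof (cases "i < n")
   case True
   then show ?thesis using arg_cong[OF pq(3), of "%l. l ! i"] by (simp add: h_def)
  next
   case False
   then show ?thesis using pq(1,2) by (auto simp: P_def permutes_def)
  qed
  then show "p = q" by auto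
 qed
 have "A vs = AM n n (%js. A (map unitv js)) vs" by (rule altform_expand[OF A vs])
 also have "\<dots> = (\<Sum>js\<in>h ` P. (\<Prod>i<n. (vs ! i) (js ! i)) * A (map unitv js))"
  unfolding AM_def by (rule sum.mono_neutral_right[OF finite_idx hP]) (use dist in auto)
 also have "\<dots> = (\<Sum>p\<in>P. (\<Prod>i<n. (vs ! i) (h p ! i)) * A (map unitv (h p)))"
  by (rule sum.reindex_cong[OF inj]) auto
 also have "\<dots> = (\<Sum>p\<in>P. real_of_int (sign p) * (\<Prod>i=0..<n. ?B $$ (i, p i)) * A ?E)"
 proof (rule sum.cong[OF refl])
  fix p assume p: "p \<in> P"
  then have pp: "p permutes {..<n}" by (simp add: P_def)
  have "map unitv (h p) = map (%i. ?E ! p i) [0..<n]"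
   using permutes_in_image[OF pp] by (auto simp: h_def)
  then have "A (map unitv (h p)) = real_of_int (sign p) * A ?E" using altform_permute[OF A pp E] by simp
  moreover have "(\<Prod>i<n. (vs ! i) (h p ! i)) = (\<Prod>i=0..<n. ?B $$ (i, p i))"
   using permutes_in_image[OF pp] by (auto simp: h_def atLeast0LessThan intro!: prod.cong)
  ultimately show "(\<Prod>i<n. (vs ! i) (h p ! i)) * A (map unitv (h p)) = real_of_int (sign p) * (\<Prod>i=0..<n. ?B $$ (i, p i)) * A ?E"
   by simp
 qed
 also have "\<dots> = Determinant.det ?B * A ?E"
  by (simp add: det_def'[of _ n] P_def sum_distrib_right atLeast0LessThan)
 also have "Determinant.det ?B = Determinant.det (transpose_mat ?B)" by (simp add: Determinant.det_transpose[of _ n])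
 also have "transpose_mat ?B = Matrix.mat n n (%(i, j). (vs ! j) i)" by (auto intro!: eq_matI)
 finally show ?thesis .
qed

text \<open>With more arguments than dimensions, each term of the expansion repeats a unit vector.
  Later this kills the contributions of tangential fields.\<close>

lemma altform_zero_degree: 
 assumes A: "altform n k A" "n < k" and vs: "set vs <= Rn n" "length vs = k"
 shows "A vs = 0"
proof -
 have "A (map unitv js) = 0" if js: "js \<in> idx n k" for js
 proof -
  have "\<not> distinct js"
  proof
   assume "distinct js"
   then have "card (set js) = k" using js distinct_card by (fastforce simp: idx_def)
   moreover have "card (set js) <= n" using js card_mono[of "{..<n}" "set js"] by (simp add: idx_def)
   ultimately show False using A(2) by simp
  qed
  then obtain i j where ij: "i < k" "j < k" "i ~= j" "js ! i = js ! j"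
   using js by (auto simp: distinct_conv_nth idx_def)
  show ?thesis
   by (rule altform_eq[OF A(1) _ _ ij(1,2,3)]) (use js ij unitv_Rn in \<open>auto simp: idx_def\<close>)
 qed
 then show ?thesis unfolding altform_expand[OF A(1) vs] AM_def by (intro sum.neutral) auto
qed

lemma length_omit: "i < length vs ==> length (omit i vs) = length vs - 1"
 by (simp add: omit_def)

lemma set_omit: "set (omit i vs) <= set vs"
 unfolding omit_def using set_take_subset set_drop_subset by fastforce

lemma nth_omit: "i < length vs ==> j < length vs - 1 ==> omit i vs ! j = vs ! (if j < i then j else Suc j)"
 by (auto simp: omit_def nth_append min_def)

lemma omit_update_same: "omit i (vs[i := x]) = omit i vs"
 by (simp add: omit_def)

lemma omit_update:
 assumes "i < length vs" "j < length vs" "i ~= j"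
 shows "omit i (vs[j := x]) = (omit i vs)[(if j < i then j else j - 1) := x]"
proof (rule nth_equalityI)
 show "length (omit i (vs[j := x])) = length ((omit i vs)[(if j < i then j else j - 1) := x])"
  using assms by (simp add: length_omit)
 fix l assume "l < length (omit i (vs[j := x]))"
 then have l: "l < length vs - 1" using assms by (simp add: length_omit)
 show "omit i (vs[j := x]) ! l = (omit i vs)[(if j < i then j else j - 1) := x] ! l"
  using assms l by (auto simp: nth_omit length_omit nth_list_update)
qed

text \<open>The two argument lists differ by moving \<open>b\<close> across the
  \<open>j - i - 1\<close> entries between positions \<open>i\<close> and \<open>j\<close>; together
  with the signs of the omitted positions one minus sign remains.\<close>

lemma altform_omit_update:
 assumes A: "altform n q A" and vs: "set vs <= Rn n" "length vs = Suc q" and b: "b \<in> Rn n" and ij: "i < j" "j < Suc q"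
 shows "(-1) ^ i * A ((omit i vs)[j - 1 := b]) = - ((-1) ^ j * A ((omit j vs)[i := b]))"
proof -
 define xs where "xs = take i vs"
 define ys where "ys = take (j - Suc i) (drop (Suc i) vs)"
 define zs where "zs = drop (Suc j) vs"
 have lx: "length xs = i" "length ys = j - Suc i" using ij vs by (auto simp: xs_def ys_def)
 have dr: "drop (Suc i) vs = ys @ vs ! j # zs"
 proof -
  have "drop (Suc i) vs = ys @ drop (j - Suc i) (drop (Suc i) vs)" unfolding ys_def by (rule append_take_drop_id[symmetric])
  also have "drop (j - Suc i) (drop (Suc i) vs) = drop j vs" using ij by simp
  also have "\<dots> = vs ! j # zs" using ij vs by (simp add: zs_def Cons_nth_drop_Suc)
  finally show ?thesis .
 qed
 have v: "vs = xs @ vs ! i # ys @ vs ! j # zs"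
  using id_take_nth_drop[of i vs] ij vs dr by (simp add: xs_def)
 have o1: "(omit i vs)[j - 1 := b] = xs @ ys @ b # zs"
 proof -
  have "omit i vs = xs @ ys @ vs ! j # zs" by (simp add: omit_def dr xs_def)
  moreover have "j - 1 = length (xs @ ys)" using lx ij by simp
  ultimately show ?thesis by (simp add: list_update_append)
 qed
 have o2: "(omit j vs)[i := b] = xs @ b # ys @ zs"
 proof -
  have j: "j = length (xs @ vs ! i # ys)" using lx ij by simp
  have "vs = (xs @ vs ! i # ys) @ vs ! j # zs" using v by simp
  then have "take j vs = xs @ vs ! i # ys" unfolding j by (metis append_eq_conv_conj)
  then have "omit j vs = xs @ vs ! i # ys @ zs" by (simp add: omit_def zs_def)
  then show ?thesis using lx by (simp add: list_update_append)
 qed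
 have "set xs <= Rn n" "set ys <= Rn n" "set zs <= Rn n"
  using vs(1) arg_cong[OF v, of set] by auto
 then have "A (xs @ b # ys @ zs) = (-1) ^ length ys * A (xs @ ys @ b # zs)"
  using altform_move[OF A, of xs b ys zs] b vs(2) arg_cong[OF v, of length] by simp
 moreover have "(-1::real) ^ j = (-1) ^ i * (-1) * (-1) ^ length ys"
 proof -
  have "j = Suc (i + length ys)" using lx ij by simp
  then show ?thesis by (simp add: power_add)
 qed
 moreover have "(-1::real) ^ length ys * (-1) ^ length ys = 1" by (simp flip: power_mult_distrib)
 ultimately show ?thesis unfolding o1 o2 by (simp add: mult.assoc)
qed

text \<open>Indexing the replaced slot by its original position \<open>j\<close> turns the sum into
  one over pairs with an antisymmetric summand. It is applied with \<open>B\<close> the second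
  derivatives of a map, the reason why exterior derivatives involve first derivatives only.\<close>

lemma altform_symmetric_cancel:
 assumes A: "altform n q A" and vs: "set vs <= Rn n" "length vs = Suc q"
  and B: "!!i j. i < Suc q ==> j < Suc q ==> B i j \<in> Rn n" "!!i j. i < Suc q ==> j < Suc q ==> B i j = B j i"
 shows "(\<Sum>i<Suc q. (-1) ^ i * (\<Sum>l<q. A ((omit i vs)[l := B i (if l < i then l else Suc l)]))) = 0"
proof -
 define h where "h i j = (if i = j then 0 else (-1) ^ i * A ((omit i vs)[(if j < i then j else j - 1) := B i j]))" for i j
 have "(-1) ^ i * (\<Sum>l<q. A ((omit i vs)[l := B i (if l < i then l else Suc l)])) = (\<Sum>j<Suc q. h i j)" if i: "i < Suc q" for i
 proof -
  define f where "f l = (if l < i then l else Suc l)" for l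
  have f: "f ` {..<q} = {..<Suc q} - {i}"
  proof (intro subset_antisym subsetI)
   fix j assume j: "j \<in> {..<Suc q} - {i}"
   show "j \<in> f ` {..<q}"
    by (rule image_eqI[of _ _ "if j < i then j else j - 1"]) (use j i in \<open>auto simp: f_def\<close>)
  qed (use i in \<open>auto simp: f_def split: if_splits\<close>)
  have inj: "inj_on f {..<q}" by (auto simp: inj_on_def f_def split: if_splits)
  have "(\<Sum>j<Suc q. h i j) = (\<Sum>j\<in>{..<Suc q} - {i}. h i j)"
   by (rule sum.mono_neutral_right) (auto simp: h_def)
  also have "\<dots> = (\<Sum>l<q. h i (f l))" by (subst f[symmetric], subst sum.reindex[OF inj]) simp
  also have "\<dots> = (\<Sum>l<q. (-1) ^ i * A ((omit i vs)[l := B i (f l)]))"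
   by (rule sum.cong[OF refl]) (auto simp: h_def f_def)
  finally show ?thesis by (simp add: sum_distrib_left f_def)
 qed
 then have eq: "(\<Sum>i<Suc q. (-1) ^ i * (\<Sum>l<q. A ((omit i vs)[l := B i (if l < i then l else Suc l)])))
   = (\<Sum>i<Suc q. \<Sum>j<Suc q. h i j)" by (intro sum.cong) auto
 have anti: "h i j = - h j i" if ij: "i < Suc q" "j < Suc q" for i j
 proof (cases i j rule: linorder_cases)
  case less
  then show ?thesis using altform_omit_update[OF A vs B(1)[OF ij] less ij(2)] B(2)[OF ij] by (simp add: h_def)
 next
  case greater
  then show ?thesis using altform_omit_update[OF A vs B(1)[OF ij] greater ij(1)] B(2)[OF ij] by (simp add: h_def)
 qed (simp add: h_def)
 have "(\<Sum>i<Suc q. \<Sum>j<Suc q. h i j) = (\<Sum>i<Suc q. \<Sum>j<Suc q. - h j i)"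
  by (intro sum.cong refl anti) auto
 also have "\<dots> = - (\<Sum>i<Suc q. \<Sum>j<Suc q. h j i)" by (simp only: sum_negf)
 also have "(\<Sum>i<Suc q. \<Sum>j<Suc q. h j i) = (\<Sum>i<Suc q. \<Sum>j<Suc q. h i j)" by (rule sum.swap)
 finally show ?thesis unfolding eq by simp
qed

text \<open>If entries \<open>i\<close> and \<open>j\<close> coincide, only the terms that omit one
  of them survive, and these cancel by \<open>altform_omit_update\<close>.\<close>

lemma altform_wedge:
 assumes B: "altform n q B" and L: "!!v w t. v \<in> Rn n ==> w \<in> Rn n ==> L (%l. v l + t * w l) = L v + t * (L w :: real)"
 shows "altform n (Suc q) (%vs. \<Sum>i<Suc q. (-1) ^ i * (L (vs ! i) * B (omit i vs)))"
 unfolding altform_def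
proof (intro allI impI conjI ballI, elim conjE)
 fix vs i v w t
 assume vs: "set vs <= Rn n" "length vs = Suc q" and i: "i < Suc q" and vw: "v \<in> Rn n" "w \<in> Rn n"
 let ?x = "%l. v l + t * w l"
 have "(-1) ^ l * (L (vs[i := ?x] ! l) * B (omit l (vs[i := ?x]))) =
   (-1) ^ l * (L (vs[i := v] ! l) * B (omit l (vs[i := v]))) +
   t * ((-1) ^ l * (L (vs[i := w] ! l) * B (omit l (vs[i := w]))))" if l: "l < Suc q" for l
 proof (cases "l = i")
  case True
  then show ?thesis using L[OF vw, of t] vs l by (simp add: omit_update_same algebra_simps)
 next
  case False
  let ?i = "if i < l then i else i - 1"
  have "B ((omit l vs)[?i := ?x]) = B ((omit l vs)[?i := v]) + t * B ((omit l vs)[?i := w])"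
   by (rule altform_lin[OF B _ _ _ vw]) (use vs l i False set_omit[of l vs] in \<open>auto simp: length_omit\<close>)
  then show ?thesis using False vs l i by (simp add: omit_update algebra_simps)
 qed
 then show "(\<Sum>l<Suc q. (-1) ^ l * (L (vs[i := ?x] ! l) * B (omit l (vs[i := ?x])))) =
   (\<Sum>l<Suc q. (-1) ^ l * (L (vs[i := v] ! l) * B (omit l (vs[i := v])))) +
   t * (\<Sum>l<Suc q. (-1) ^ l * (L (vs[i := w] ! l) * B (omit l (vs[i := w]))))"
  unfolding sum_distrib_left sum.distrib[symmetric] by (intro sum.cong refl) simp
next
 fix vs i j
 assume vs: "set vs <= Rn n & length vs = Suc q" and ij: "i < Suc q" "j < Suc q" and e: "i ~= j & vs ! i = vs ! j"
 have main: "(\<Sum>l<Suc q. (-1) ^ l * (L (vs ! l) * B (omit l vs))) = 0"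
  if ij: "i < j" "j < Suc q" and e: "vs ! i = vs ! j" for i j
 proof -
  have z: "B (omit l vs) = 0" if l: "l < Suc q" "l ~= i" "l ~= j" for l
  proof (rule altform_eq[OF B])
   show "set (omit l vs) <= Rn n" using set_omit[of l vs] vs by blast
   show "length (omit l vs) = q" using vs l by (simp add: length_omit)
   show "(if i < l then i else i - 1) < q" "(if j < l then j else j - 1) < q" using ij l by auto
   show "(if i < l then i else i - 1) ~= (if j < l then j else j - 1)" using ij l by auto
   show "omit l vs ! (if i < l then i else i - 1) = omit l vs ! (if j < l then j else j - 1)"
    using ij l e vs by (auto simp: nth_omit)
  qed
  have "(\<Sum>l<Suc q. (-1) ^ l * (L (vs ! l) * B (omit l vs))) = (\<Sum>l\<in>{i, j}. (-1) ^ l * (L (vs ! l) * B (omit l vs)))"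
   by (rule sum.mono_neutral_right) (use ij z in auto)
  also have "\<dots> = L (vs ! j) * ((-1) ^ i * B (omit i vs) + (-1) ^ j * B (omit j vs))"
   using ij e by (simp add: algebra_simps)
  also have "(-1) ^ i * B (omit i vs) + (-1) ^ j * B (omit j vs) = 0"
  proof -
   have "(omit i vs)[j - 1 := vs ! j] = omit i vs"
    using ij vs by (intro list_update_same_conv[THEN iffD2]) (auto simp: length_omit nth_omit)
   moreover have "(omit j vs)[i := vs ! j] = omit j vs"
    using ij vs e by (intro list_update_same_conv[THEN iffD2]) (auto simp: length_omit nth_omit)
   moreover have "vs ! j \<in> Rn n" using vs ij by auto
   ultimately show ?thesis using altform_omit_update[OF B _ _ _ ij, of vs "vs ! j"] vs by simp
  qed
  finally show ?thesis by simp
 qed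
 show "(\<Sum>l<Suc q. (-1) ^ l * (L (vs ! l) * B (omit l vs))) = 0"
  using main[of i j] main[of j i] ij e by (cases i j rule: linorder_cases) auto
qed

lemma DERIV_AM:
 assumes N: "!!js. js \<in> idx n k ==> ((%t. N t js) has_real_derivative N' js) (at t0)"
  and V: "!!i a. i < k ==> a < n ==> ((%t. (V t ! i) a) has_real_derivative V' i a) (at t0)"
  and len: "length (V t0) = k"
 shows "((%t. AM n k (N t) (V t)) has_real_derivative
  AM n k N' (V t0) + (\<Sum>l<k. AM n k (N t0) ((V t0)[l := V' l]))) (at t0)"
proof -
 have "((%t. \<Sum>js\<in>idx n k. (\<Prod>i<k. (V t ! i) (js ! i)) * N t js) has_real_derivative
   (\<Sum>js\<in>idx n k. (\<Sum>l<k. V' l (js ! l) * (\<Prod>i\<in>{..<k} - {l}. (V t0 ! i) (js ! i))) * N t0 js +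
    N' js * (\<Prod>i<k. (V t0 ! i) (js ! i)))) (at t0)"
 proof (intro DERIV_sum DERIV_mult has_field_derivative_prod N V)
  fix js i assume "js \<in> idx n k" "i \<in> {..<k}"
  then show "i < k" by simp
  have "js ! i \<in> set js" using \<open>js \<in> idx n k\<close> \<open>i < k\<close> by (simp add: idx_def)
  then show "js ! i < n" using \<open>js \<in> idx n k\<close> by (auto simp: idx_def)
 qed
 moreover have "(\<Prod>i<k. ((V t0)[l := V' l] ! i) (js ! i)) = V' l (js ! l) * (\<Prod>i\<in>{..<k} - {l}. (V t0 ! i) (js ! i))"
  if "l < k" for l js
  using that len by (subst prod.remove[of _ l]) (auto intro!: prod.cong)
 then have "(\<Sum>l<k. AM n k (N t0) ((V t0)[l := V' l])) =
   (\<Sum>js\<in>idx n k. (\<Sum>l<k. V' l (js ! l) * (\<Prod>i\<in>{..<k} - {l}. (V t0 ! i) (js ! i))) * N t0 js)"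
  unfolding AM_def by (subst sum.swap) (simp add: sum_distrib_right)
 ultimately show ?thesis unfolding AM_def by (simp add: sum.distrib add.commute mult.commute)
qed

lemma AM_sum: "AM n k (%js. \<Sum>j\<in>J. c j * N j js) vs = (\<Sum>j\<in>J. c j * AM n k (N j) vs)"
 unfolding AM_def sum_distrib_left by (subst sum.swap) (simp add: algebra_simps)

section \<open>Charts, tangent vectors and tangent maps\<close>

abbreviation cim :: "'a chart => (nat => real) set"
 where "cim c \<equiv> snd c ` fst c"

lemma chart_facts:
 assumes M: "omfd M" and c: "c \<in> matlas M"
 shows chart_open: "openin (mtop M) (fst c)"
  and cim_opn: "opn (mdim M) (cim c)"
  and chart_inj: "inj_on (snd c) (fst c)"
  and cinv_snd: "!!p. p \<in> fst c ==> cinv c (snd c p) = p"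
  and cinv_in: "!!y. y \<in> cim c ==> cinv c y \<in> fst c"
  and snd_cinv: "!!y. y \<in> cim c ==> snd c (cinv c y) = y"
  and chart_subset: "fst c <= pts M"
  and chart_cont: "continuous_map (subtopology (mtop M) (fst c)) (top_of_set (cim c)) (snd c)"
  and cinv_cont: "continuous_map (top_of_set (cim c)) (mtop M) (cinv c)"
  and snd_Rn: "!!p. p \<in> fst c ==> snd c p \<in> Rn (mdim M)"
proof -
 have "c \<in> max_atlas (Rn (mdim M)) (mtop M) (mdim M) (matlas M)"
  using M c by (simp add: oriented_mfd_def)
 then have ch: "is_chart (Rn (mdim M)) (mtop M) c" by (simp add: max_atlas_def)
 show o: "openin (mtop M) (fst c)" and i: "opn (mdim M) (cim c)"
  using ch by (auto simp: is_chart_def)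
 show s: "fst c <= pts M" using o by (rule openin_subset)
 have h: "homeomorphic_map (subtopology (mtop M) (fst c)) (top_of_set (cim c)) (snd c)"
  using ch by (simp add: is_chart_def)
 have ts: "topspace (subtopology (mtop M) (fst c)) = fst c" using s by auto
 show inj: "inj_on (snd c) (fst c)" using homeomorphic_imp_injective_map[OF h] unfolding ts .
 show 1: "cinv c (snd c p) = p" if "p \<in> fst c" for p using that inj by (simp add: cinv_def)
 show 2: "cinv c y \<in> fst c" if "y \<in> cim c" for y using that 1 by auto
 show 3: "snd c (cinv c y) = y" if "y \<in> cim c" for y using that 1 by auto
 show "continuous_map (subtopology (mtop M) (fst c)) (top_of_set (cim c)) (snd c)"
  using h by (rule homeomorphic_imp_continuous_map)
 obtain g where g: "homeomorphic_maps (subtopology (mtop M) (fst c)) (top_of_set (cim c)) (snd c) g"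
  using h homeomorphic_map_maps by blast
 have "continuous_map (top_of_set (cim c)) (subtopology (mtop M) (fst c)) (cinv c)"
 proof (rule continuous_map_eq)
  show "continuous_map (top_of_set (cim c)) (subtopology (mtop M) (fst c)) g"
   using g by (simp add: homeomorphic_maps_def)
  show "g y = cinv c y" if "y \<in> topspace (top_of_set (cim c))" for y
  proof -
   obtain p where "p \<in> fst c" "y = snd c p" using \<open>y \<in> topspace (top_of_set (cim c))\<close> by auto
   moreover have "\<forall>x\<in>fst c. g (snd c x) = x" using g unfolding homeomorphic_maps_def ts by blast
   ultimately show ?thesis using 1 by simp
  qed
 qed
 then show "continuous_map (top_of_set (cim c)) (mtop M) (cinv c)"
  by (simp add: continuous_map_in_subtopology)
 show "snd c p \<in> Rn (mdim M)" if "p \<in> fst c" for p using that opn_subset[OF i] by auto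
qed

lemma ex_chart:
 assumes "omfd M" "p \<in> pts M"
 shows "\<exists>c. c \<in> matlas M & p \<in> fst c"
proof -
 have "pts M <= (\<Union>c\<in>matlas M. fst c)" using assms(1) by (simp add: oriented_mfd_def)
 then have "p \<in> (\<Union>c\<in>matlas M. fst c)" using assms(2) by (rule subsetD)
 then show ?thesis by (elim UN_E) blast
qed

lemma chart_at:
 assumes "omfd M" "p \<in> pts M"
 shows "chart_at M p \<in> matlas M" "p \<in> fst (chart_at M p)"
proof -
 have "chart_at M p \<in> matlas M & p \<in> fst (chart_at M p)"
  unfolding chart_at_def by (rule someI_ex[OF ex_chart[OF assms]])
 then show "chart_at M p \<in> matlas M" "p \<in> fst (chart_at M p)" by auto
qed

lemma ldom_eq:
 assumes "omfd S" "c \<in> matlas S"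
 shows "ldom c d f = {y \<in> cim c. f (cinv c y) \<in> fst d}"
 using cinv_snd[OF assms] by (auto simp: ldom_def)

lemma opn_chart_preimage:
 assumes S: "omfd S" "c \<in> matlas S" and X: "openin (mtop S) X"
 shows "opn (mdim S) {y \<in> cim c. cinv c y \<in> X}"
proof -
 have "openin (top_of_set (cim c)) {y \<in> topspace (top_of_set (cim c)). cinv c y \<in> X}"
  using cinv_cont[OF S] X by (rule openin_continuous_map_preimage)
 then show ?thesis using openin_trans[OF _ cim_opn[OF S]] by simp
qed

lemma ldom_opn:
 assumes S: "omfd S" "c \<in> matlas S" and M: "omfd M" "d \<in> matlas M"
  and f: "continuous_map (mtop S) (mtop M) f"
 shows "opn (mdim S) (ldom c d f)"
proof -
 have X: "openin (mtop S) {x \<in> pts S. f x \<in> fst d}"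
  by (rule openin_continuous_map_preimage[OF f chart_open[OF M]])
 have "{y \<in> cim c. cinv c y \<in> {x \<in> pts S. f x \<in> fst d}} = ldom c d f"
  unfolding ldom_eq[OF S] using cinv_in[OF S] chart_subset[OF S] by auto
 then show ?thesis using opn_chart_preimage[OF S X] by simp
qed

lemma lrep_Ck:
 assumes S: "omfd S" "c \<in> matlas S" and M: "omfd M" "d \<in> matlas M"
  and f: "smooth_map S M f"
 shows "Ck (mdim S) (ldom c d f) r (%y. lrep c d f y i)"
proof -
 have o: "opn (mdim S) (ldom c d f)" using ldom_opn[OF S M] f by (simp add: smooth_map_def)
 show ?thesis
 proof (cases "i < mdim M")
  case True
  then have "Cinf (mdim S) (ldom c d f) (%y. lrep c d f y i)"
   using f S(2) M(2) by (auto simp: smooth_map_def lsmooth_def)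
  then show ?thesis using Cinf_opn[OF o] by blast
 next
  case False
  show ?thesis
  proof (rule Ck_cong[OF o _ Ck_const[OF o]])
   show "0 = lrep c d f y i" if "y \<in> ldom c d f" for y
    using that snd_Rn[OF M] False unfolding ldom_eq[OF S] by (simp add: lrep_def Rn_iff)
  qed
 qed
qed

lemma smooth_id: "omfd M ==> smooth_map M M (%p. p)"
 unfolding smooth_map_def oriented_mfd_def max_atlas_def chart_compat_def
 by (auto simp: continuous_map_id[unfolded id_def])

lemma lrep_snd: "omfd S ==> c \<in> matlas S ==> x \<in> fst c ==> lrep c d f (snd c x) = snd d (f x)"
 by (simp add: lrep_def cinv_snd)

lemma snd_in_ldom: "x \<in> fst c ==> f x \<in> fst d ==> snd c x \<in> ldom c d f"
 by (auto simp: ldom_def)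

text \<open>The chain rule holds on the intersection of the domains of the two local
  representatives; each \<open>ljac\<close> refers to its own domain, which near the point makes no
  difference.\<close>

lemma ljac_chain:
 assumes S: "omfd S" "c \<in> matlas S" and M: "omfd M" "d \<in> matlas M"
  and N: "omfd N" "e \<in> matlas N"
  and f: "smooth_map S M f" and g: "smooth_map M N g"
  and x: "x \<in> fst c" "f x \<in> fst d" "g (f x) \<in> fst e" and j: "j < mdim S"
 shows "ljac c e (%x. g (f x)) x i j = (\<Sum>l<mdim M. ljac d e g (f x) i l * ljac c d f x l j)"
proof -
 have cf: "continuous_map (mtop S) (mtop M) f" and cg: "continuous_map (mtop M) (mtop N) g"
  using f g by (auto simp: smooth_map_def)
 have cgf: "continuous_map (mtop S) (mtop N) (%x. g (f x))"
  using continuous_map_compose[OF cf cg] by (simp add: o_def)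
 let ?A = "ldom c d f \<inter> ldom c e (%x. g (f x))" and ?B = "ldom d e g"
 have o1: "opn (mdim S) (ldom c d f)" and o2: "opn (mdim S) (ldom c e (%x. g (f x)))" and oB: "opn (mdim M) ?B"
  using ldom_opn S M N cf cg cgf by blast+
 have oA: "opn (mdim S) ?A" using o1 o2 by (rule openin_Int)
 have xA: "snd c x \<in> ?A" using x by (auto intro: snd_in_ldom)
 have "ljac c e (%x. g (f x)) x i j = pd ?A j (%y. lrep c e (%x. g (f x)) y i) (snd c x)"
  unfolding ljac_def using xA j by (intro pd_opn_subset[OF o2 oA]) auto
 also have "\<dots> = pd ?A j (%y. lrep d e g (lrep c d f y) i) (snd c x)"
 proof (rule pd_cong[OF oA j xA])
  fix y assume "y \<in> ?A"
  then have "f (cinv c y) \<in> fst d" unfolding ldom_eq[OF S] by simp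
  then show "lrep c e (%x. g (f x)) y i = lrep d e g (lrep c d f y) i"
   by (simp add: lrep_def cinv_snd[OF M])
 qed
 also have "\<dots> = (\<Sum>l<mdim M. pd ?B l (%z. lrep d e g z i) (lrep c d f (snd c x)) * pd ?A j (%y. lrep c d f y l) (snd c x))"
 proof (rule pd_compose[where f = "%z. lrep d e g z i" and r = 0, OF oA oB lrep_Ck[OF M N g] _ _ j xA])
  show "Ck (mdim S) ?A (Suc 0) (%y. lrep c d f y l)" for l
   by (rule Ck_subset[OF lrep_Ck[OF S M f] o1 oA]) simp
  show "lrep c d f ` ?A <= ?B"
  proof clarify
   fix y assume "y \<in> ldom c d f" "y \<in> ldom c e (%x. g (f x))"
   then have "f (cinv c y) \<in> fst d" "g (f (cinv c y)) \<in> fst e" unfolding ldom_eq[OF S] by auto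
   then show "lrep c d f y \<in> ldom d e g" unfolding lrep_def by (intro snd_in_ldom)
  qed
 qed
 also have "\<dots> = (\<Sum>l<mdim M. ljac d e g (f x) i l * ljac c d f x l j)"
  unfolding ljac_def lrep_snd[OF S x(1)]
  using xA j by (intro sum.cong refl arg_cong2[of _ _ _ _ "(*)"] pd_opn_subset[OF oA o1]) auto
 finally show ?thesis .
qed

text \<open>Coordinates from \<open>mdim M\<close> on vanish identically in every chart, hence so do
  their derivatives. The columns of a Jacobi matrix are therefore elements of
  \<open>Rn (mdim M)\<close>.\<close>

lemma ljac_zero:
 assumes S: "omfd S" "c \<in> matlas S" and M: "omfd M" "d \<in> matlas M"
  and f: "smooth_map S M f" and x: "x \<in> fst c" "f x \<in> fst d" and j: "j < mdim S" and i: "mdim M <= i"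
 shows "ljac c d f x i j = 0"
proof -
 have o: "opn (mdim S) (ldom c d f)" using ldom_opn[OF S M] f by (simp add: smooth_map_def)
 have "ljac c d f x i j = pd (ldom c d f) j (%y. 0) (snd c x)" unfolding ljac_def
 proof (rule pd_cong[OF o j snd_in_ldom[of x c f d, OF x]])
  show "lrep c d f y i = 0" if "y \<in> ldom c d f" for y
   using that snd_Rn[OF M] i unfolding ldom_eq[OF S] by (simp add: lrep_def Rn_iff)
 qed
 also have "\<dots> = 0" by (rule pd_eq[OF o snd_in_ldom[of x c f d, OF x] j]) auto
 finally show ?thesis .
qed

lemma ljac_id:
 assumes M: "omfd M" "c \<in> matlas M" and p: "p \<in> fst c" and j: "j < mdim M"
 shows "ljac c c (%p. p) p i j = (if i = j then 1 else 0)"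
proof -
 have o: "opn (mdim M) (ldom c c (%p. p))" using ldom_opn[OF M M] by (simp add: continuous_map_id[unfolded id_def])
 have i: "snd c p \<in> ldom c c (%p. p)" by (rule snd_in_ldom) (use p in auto)
 have "ljac c c (%p. p) p i j = pd (ldom c c (%p. p)) j (%y. y i) (snd c p)" unfolding ljac_def
 proof (rule pd_cong[OF o j i])
  show "lrep c c (%p. p) y i = y i" if "y \<in> ldom c c (%p. p)" for y
   using that unfolding ldom_eq[OF M] by (simp add: lrep_def snd_cinv[OF M])
 qed
 also have "\<dots> = (if i = j then 1 else 0)"
  by (rule pd_eq[OF o i j]) (auto intro!: derivative_eq_intros)
 finally show ?thesis .
qed

lemma sum_delta_mult: "finite A ==> j \<in> A ==> (\<Sum>i\<in>A. (if i = j then 1 else 0) * f i) = (f j :: real)"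
 "finite A ==> j \<in> A ==> (\<Sum>i\<in>A. (if j = i then 1 else 0) * f i) = f j"
 "finite A ==> j \<in> A ==> (\<Sum>i\<in>A. f i * (if i = j then 1 else 0)) = f j"
 "finite A ==> j \<in> A ==> (\<Sum>i\<in>A. f i * (if j = i then 1 else 0)) = f j"
 by (auto simp: if_distrib[of "%x. x * _"] if_distrib[of "%x. _ * x"] cong: if_cong)

lemma cvec_chart:
 assumes M: "omfd M" "c \<in> matlas M" and p: "p \<in> fst c" and v: "v \<in> Rn (mdim M)"
 shows "cvec M c p v c = v"
proof
 fix i
 show "cvec M c p v c i = v i"
 proof (cases "i < mdim M")
  case True
  have "cvec M c p v c i = (\<Sum>j<mdim M. (if i = j then 1 else 0) * v j)"
   using M p by (simp add: cvec_def ljac_id[OF M p])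
  then show ?thesis using True by (simp add: sum_delta_mult)
 next
  case False
  then show ?thesis using v M p by (simp add: cvec_def ljac_id[OF M p] Rn_iff)
 qed
qed

lemma cvec_tspace:
 assumes M: "omfd M" "c \<in> matlas M" and p: "p \<in> fst c"
 shows "cvec M c p v \<in> tspace M p"
 unfolding tspace_def
proof (intro CollectI conjI allI impI ballI)
 show "cvec M c p v d = (%_. 0)" if "d \<notin> matlas M \<or> p \<notin> fst d" for d using that by (auto simp: cvec_def)
 show "cvec M c p v d \<in> Rn (mdim M)" if d: "d \<in> matlas M" for d
  using ljac_zero[OF M M(1) d smooth_id[OF M(1)] p] by (auto simp: cvec_def Rn_iff)
 fix d e i assume d: "d \<in> matlas M" and e: "e \<in> matlas M" and pde: "p \<in> fst d \<inter> fst e" and i: "i < mdim M"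
 have "(\<Sum>j<mdim M. ljac d e (%p. p) p i j * cvec M c p v d j)
   = (\<Sum>j<mdim M. \<Sum>l<mdim M. ljac d e (%p. p) p i j * ljac c d (%p. p) p j l * v l)"
  using d pde by (simp add: cvec_def sum_distrib_left mult.assoc)
 also have "\<dots> = (\<Sum>l<mdim M. (\<Sum>j<mdim M. ljac d e (%p. p) p i j * ljac c d (%p. p) p j l) * v l)"
  by (subst sum.swap) (simp add: sum_distrib_right)
 also have "\<dots> = (\<Sum>l<mdim M. ljac c e (%p. p) p i l * v l)"
  using ljac_chain[OF M M(1) d M(1) e smooth_id[OF M(1)] smooth_id[OF M(1)] p] pde
  by (intro sum.cong refl) simp
 finally show "cvec M c p v e i = (\<Sum>j<mdim M. ljac d e (%p. p) p i j * cvec M c p v d j)"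
  using e pde by (simp add: cvec_def)
qed

lemma tspaceD:
 assumes "v \<in> tspace M p"
 shows "c \<notin> matlas M \<or> p \<notin> fst c ==> v c = (%_. 0)" "c \<in> matlas M ==> v c \<in> Rn (mdim M)"
  "c \<in> matlas M ==> d \<in> matlas M ==> p \<in> fst c ==> p \<in> fst d ==> i < mdim M ==>
   v d i = (\<Sum>j<mdim M. ljac c d (%p. p) p i j * v c j)"
 using assms unfolding tspace_def by blast+

lemma tspace_eqI:
 assumes M: "omfd M" "c \<in> matlas M" and p: "p \<in> fst c" and v: "v \<in> tspace M p" "w \<in> tspace M p"
  and e: "!!i. i < mdim M ==> v c i = w c i"
 shows "v = w"
proof
 fix d
 show "v d = w d"
 proof (cases "d \<in> matlas M & p \<in> fst d")
  case True
  show ?thesis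
  proof (rule Rn_eqI)
   show "v d \<in> Rn (mdim M)" "w d \<in> Rn (mdim M)" using tspaceD(2)[OF v(1)] tspaceD(2)[OF v(2)] True by auto
   show "v d i = w d i" if "i < mdim M" for i
    using tspaceD(3)[OF v(1) M(2) _ p _ that, of d] tspaceD(3)[OF v(2) M(2) _ p _ that, of d] True e by simp
  qed
 next
  case False
  then show ?thesis using tspaceD(1)[OF v(1)] tspaceD(1)[OF v(2)] by simp
 qed
qed

lemma tspace_cvec:
 assumes M: "omfd M" "c \<in> matlas M" and p: "p \<in> fst c" and v: "v \<in> tspace M p"
 shows "cvec M c p (v c) = v"
 by (rule tspace_eqI[OF M p cvec_tspace[OF M p] v])
  (simp add: cvec_chart[OF M p tspaceD(2)[OF v M(2)]])

lemma tmap_chart: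
 assumes S: "omfd S" "c \<in> matlas S" and M: "omfd M" "d \<in> matlas M"
  and f: "smooth_map S M f" and x: "x \<in> fst c" "f x \<in> fst d" and w: "w \<in> tspace S x"
 shows "tmap S M f x w d i = (\<Sum>j<mdim S. ljac c d f x i j * w c j)"
proof -
 have xS: "x \<in> pts S" using chart_subset[OF S] x by blast
 define c' where "c' = chart_at S x"
 have c': "c' \<in> matlas S" "x \<in> fst c'" using chart_at[OF S(1) xS] by (auto simp: c'_def)
 have "(\<Sum>j<mdim S. ljac c d f x i j * w c j) = (\<Sum>j<mdim S. \<Sum>l<mdim S. ljac c d f x i j * ljac c' c (%p. p) x j l * w c' l)"
  by (intro sum.cong refl)
   (simp add: tspaceD(3)[OF w c'(1) S(2) c'(2) x(1)] sum_distrib_left mult.assoc)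
 also have "\<dots> = (\<Sum>l<mdim S. (\<Sum>j<mdim S. ljac c d f x i j * ljac c' c (%p. p) x j l) * w c' l)"
  by (subst sum.swap) (simp add: sum_distrib_right)
 also have "\<dots> = (\<Sum>l<mdim S. ljac c' d f x i l * w c' l)"
  using ljac_chain[OF S(1) c'(1) S M smooth_id[OF S(1)] f c'(2) x(1,2)]
  by (intro sum.cong refl) simp
 finally show ?thesis using M x by (simp add: tmap_def c'_def)
qed

lemma tmap_tspace:
 assumes S: "omfd S" and M: "omfd M" and f: "smooth_map S M f" 
  and x: "x \<in> pts S"
 shows "tmap S M f x w \<in> tspace M (f x)"
proof -
 define c where "c = chart_at S x"
 have c: "c \<in> matlas S" "x \<in> fst c" using chart_at[OF S x] by (auto simp: c_def)
 show ?thesis unfolding tspace_def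
 proof (intro CollectI conjI allI impI ballI)
  show "tmap S M f x w d = (%_. 0)" if "d \<notin> matlas M \<or> f x \<notin> fst d" for d using that by (auto simp: tmap_def)
  show "tmap S M f x w d \<in> Rn (mdim M)" if d: "d \<in> matlas M" for d
   using ljac_zero[OF S c(1) M d f c(2)] by (auto simp: tmap_def Rn_iff c_def)
  fix d e i assume d: "d \<in> matlas M" and e: "e \<in> matlas M" and pde: "f x \<in> fst d \<inter> fst e" and i: "i < mdim M"
  have "(\<Sum>j<mdim M. ljac d e (%p. p) (f x) i j * tmap S M f x w d j)
    = (\<Sum>j<mdim M. \<Sum>l<mdim S. ljac d e (%p. p) (f x) i j * ljac c d f x j l * w c l)"
   using d pde by (simp add: tmap_def c_def sum_distrib_left mult.assoc)
  also have "\<dots> = (\<Sum>l<mdim S. (\<Sum>j<mdim M. ljac d e (%p. p) (f x) i j * ljac c d f x j l) * w c l)"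
   by (subst sum.swap) (simp add: sum_distrib_right)
  also have "\<dots> = (\<Sum>l<mdim S. ljac c e f x i l * w c l)"
   using ljac_chain[OF S c(1) M d M e f smooth_id[OF M] c(2)] pde by (intro sum.cong refl) simp
  finally show "tmap S M f x w e i = (\<Sum>j<mdim M. ljac d e (%p. p) (f x) i j * tmap S M f x w d j)"
   using e pde by (simp add: tmap_def c_def)
 qed
qed

lemma cbasis_unitv: "cbasis M c p j = cvec M c p (unitv j)"
 by (simp add: cbasis_def unitv_def)

lemma tmap_cbasis:
 assumes S: "omfd S" "c \<in> matlas S" and M: "omfd M" "d \<in> matlas M"
  and f: "smooth_map S M f" and x: "x \<in> fst c" "f x \<in> fst d" and j: "j < mdim S"
 shows "tmap S M f x (cbasis S c x j) = cvec M d (f x) (%i. ljac c d f x i j)"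
  and "(%i. ljac c d f x i j) \<in> Rn (mdim M)"
proof -
 have xS: "x \<in> pts S" using chart_subset[OF S] x by blast
 show R: "(%i. ljac c d f x i j) \<in> Rn (mdim M)" using ljac_zero[OF S M f x j] by (simp add: Rn_iff)
 show "tmap S M f x (cbasis S c x j) = cvec M d (f x) (%i. ljac c d f x i j)"
 proof (rule tspace_eqI[OF M x(2) tmap_tspace[OF S(1) M(1) f xS] cvec_tspace[OF M x(2)]])
  fix i
  have "tmap S M f x (cbasis S c x j) d i = (\<Sum>l<mdim S. ljac c d f x i l * unitv j l)"
   unfolding cbasis_unitv tmap_chart[OF S M f x cvec_tspace[OF S x(1)]]
   by (simp add: cvec_chart[OF S x(1) unitv_Rn[OF j]])
  also have "\<dots> = ljac c d f x i j" using j by (simp add: unitv_def sum_delta_mult)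
  finally show "tmap S M f x (cbasis S c x j) d i = cvec M d (f x) (%i. ljac c d f x i j) d i"
   by (simp add: cvec_chart[OF M x(2) R])
 qed
qed

lemma cbasis_transition:
 assumes S: "omfd S" "c \<in> matlas S" "d \<in> matlas S" and x: "x \<in> fst c" "x \<in> fst d" and j: "j < mdim S"
 shows "cbasis S c x j = cvec S d x (%i. ljac c d (%p. p) x i j)"
  and "(%i. ljac c d (%p. p) x i j) \<in> Rn (mdim S)"
proof -
 note t = tmap_cbasis[OF S(1,2) S(1,3) smooth_id[OF S(1)] x j]
 show R: "(%i. ljac c d (%p. p) x i j) \<in> Rn (mdim S)" by (rule t(2))
 show "cbasis S c x j = cvec S d x (%i. ljac c d (%p. p) x i j)"
 proof (rule tspace_eqI[OF S(1,3) x(2)])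
  show "cbasis S c x j \<in> tspace S x" unfolding cbasis_unitv by (rule cvec_tspace[OF S(1,2) x(1)])
  show "cvec S d x (%i. ljac c d (%p. p) x i j) \<in> tspace S x" by (rule cvec_tspace[OF S(1,3) x(2)])
  show "cbasis S c x j d i = cvec S d x (%i. ljac c d (%p. p) x i j) d i" for i
   unfolding cvec_chart[OF S(1,3) x(2) R] using S x j by (simp add: cbasis_unitv cvec_def unitv_def sum_delta_mult)
 qed
qed

lemma cvec_lin: "cvec M c p (%l. v l + t * w l) = (%d l. cvec M c p v d l + t * cvec M c p w d l)"
 by (auto simp: cvec_def fun_eq_iff sum.distrib sum_distrib_left algebra_simps)

lemma tmap_lin: "tmap S M f x (%d l. v d l + t * w d l) = (%d l. tmap S M f x v d l + t * tmap S M f x w d l)"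
 by (auto simp: tmap_def fun_eq_iff sum.distrib sum_distrib_left algebra_simps)

subsection \<open>Multilinear forms on tangent spaces\<close>

text \<open>The algebraic half of \<open>diff_form\<close> at a single point, so that forms with
  some arguments filled in can be treated without referring to smoothness.\<close>

definition tform :: "'a smfd => 'a => nat => ('a tvec list => real) => bool"
 where "tform M p k A \<longleftrightarrow> (\<forall>vs. set vs <= tspace M p & length vs = k -->
   (\<forall>i<k. \<forall>v\<in>tspace M p. \<forall>w\<in>tspace M p. \<forall>t.
     A (vs[i := (%c l. v c l + t * w c l)]) = A (vs[i := v]) + t * A (vs[i := w])) &
   (\<forall>i<k. \<forall>j<k. i ~= j & vs ! i = vs ! j --> A vs = 0))"

lemma diff_form_tform: "diff_form M k al ==> p \<in> pts M ==> tform M p k (al p)"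
 unfolding diff_form_def tform_def by blast

lemma tform_Cons:
 assumes "tform M p (Suc k) A" "x \<in> tspace M p" shows "tform M p k (%ws. A (x # ws))"
 unfolding tform_def
proof (intro allI impI conjI ballI, goal_cases)
 case (1 vs i v w t)
 then have "A ((x # vs)[Suc i := (%c l. v c l + t * w c l)]) = A ((x # vs)[Suc i := v]) + t * A ((x # vs)[Suc i := w])"
  using assms unfolding tform_def by (intro assms(1)[unfolded tform_def, rule_format, THEN conjunct1, rule_format]) auto
 then show ?case by simp
next
 case (2 vs i j)
 then show ?case
  using assms(1)[unfolded tform_def, rule_format, of "x # vs", THEN conjunct2, rule_format, of "Suc i" "Suc j"] assms(2)
  by simp
qed

lemma tform_append:
 assumes "tform M p (length xs + k) A" "set xs <= tspace M p" shows "tform M p k (%ws. A (xs @ ws))"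
 using assms
proof (induction xs arbitrary: A)
 case (Cons x xs)
 then show ?case using Cons.IH[of "%ws. A (x # ws)"] tform_Cons[of M p "length xs + k" A x] by simp
qed simp

lemma tform_altform:
 assumes A: "tform M p k A" and T: "!!v. v \<in> Rn n ==> T v \<in> tspace M p"
  "!!v w t. v \<in> Rn n ==> w \<in> Rn n ==> T (%l. v l + t * w l) = (%d l. T v d l + t * T w d l)"
 shows "altform n k (%vs. A (map T vs))"
 unfolding altform_def
proof (intro allI impI conjI ballI, goal_cases)
 case (1 vs i v w t)
 have "A ((map T vs)[i := (%d l. T v d l + t * T w d l)]) = A ((map T vs)[i := T v]) + t * A ((map T vs)[i := T w])"
  using A[unfolded tform_def, rule_format, of "map T vs", THEN conjunct1, rule_format, of i "T v" "T w" t] 1 T(1)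
  by auto
 then show ?case using 1 T(2) by (simp add: map_update)
next
 case (2 vs i j)
 then show ?case
  using A[unfolded tform_def, rule_format, of "map T vs", THEN conjunct2, rule_format, of i j] T(1) by auto
qed

lemma tform_cvec:
 assumes M: "omfd M" "d \<in> matlas M" "p \<in> fst d" and A: "tform M p k A"
 shows "altform (mdim M) k (%vs. A (map (cvec M d p) vs))"
 by (rule tform_altform[OF A cvec_tspace[OF M] cvec_lin])

lemma tform_pull:
 assumes S: "omfd S" "c \<in> matlas S" and M: "omfd M" 
  and f: "smooth_map S M f" and x: "x \<in> fst c" and A: "tform M (f x) k A"
 shows "altform (mdim S) k (%vs. A (map (tmap S M f x) (map (cvec S c x) vs)))"
proof -
 have xS: "x \<in> pts S" using chart_subset[OF S] x by blast
 have "altform (mdim S) k (%vs. A (map (%v. tmap S M f x (cvec S c x v)) vs))"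
  by (rule tform_altform[OF A tmap_tspace[OF S(1) M f xS]]) (simp add: cvec_lin tmap_lin)
 then show ?thesis by (simp add: o_def)
qed

section \<open>Coordinate expressions of forms and fields\<close>

definition coef :: "'a smfd => 'a chart => 'a form => (nat => real) => nat list => real"
 where "coef M d al z js = al (cinv d z) (map (cbasis M d (cinv d z)) js)"

lemma coef_Ck:
 assumes M: "omfd M" "d \<in> matlas M" and al: "diff_form M k al" and js: "js \<in> idx (mdim M) k"
 shows "Ck (mdim M) (cim d) r (%z. coef M d al z js)"
proof -
 have "Cinf (mdim M) (cim d) (%z. coef M d al z js)"
  using al M(2) js unfolding diff_form_def idx_def coef_def by blast
 then show ?thesis using Cinf_opn[OF cim_opn[OF M]] by blast
qed

lemma form_AM:
 assumes M: "omfd M" "d \<in> matlas M" and al: "diff_form M k al" and p: "p \<in> fst d"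
  and vs: "set vs <= Rn (mdim M)" "length vs = k"
 shows "al p (map (cvec M d p) vs) = AM (mdim M) k (coef M d al (snd d p)) vs"
proof -
 have pM: "p \<in> pts M" using chart_subset[OF M] p by blast
 have "al p (map (cvec M d p) vs) = AM (mdim M) k (%js. al p (map (cvec M d p) (map unitv js))) vs"
  by (rule altform_expand[OF tform_cvec[OF M p diff_form_tform[OF al pM]] vs])
 moreover have "coef M d al (snd d p) = (%js. al p (map (cvec M d p) (map unitv js)))"
  by (simp add: fun_eq_iff coef_def cinv_snd[OF M p] cbasis_unitv[abs_def] o_def)
 ultimately show ?thesis by simp
qed

lemma AM_Ck:
 assumes "opn q A" "!!js. js \<in> idx n k ==> Ck q A r (%y. N y js)"
  "!!i a. i < k ==> a < n ==> Ck q A r (%y. (V y ! i) a)"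
 shows "Ck q A r (%y. AM n k (N y) (V y))"
 unfolding AM_def
proof (intro Ck_sum Ck_mult Ck_prod assms(1))
 fix js i assume a: "js \<in> idx n k" "i \<in> {..<k}"
 then have "js ! i \<in> set js" by (simp add: idx_def)
 then have "js ! i < n" using a(1) unfolding idx_def by blast
 then show "Ck q A r (%y. (V y ! i) (js ! i))" using assms(3) a by simp
qed (use assms(2) in auto)

lemma field_along_coord:
 assumes S: "omfd S" "c \<in> matlas S" and M: "omfd M" "d \<in> matlas M"
  and f: "continuous_map (mtop S) (mtop M) f" and u: "field_along S M f u" and i: "i < mdim M"
 shows "Ck (mdim S) (ldom c d f) r (%y. u (cinv c y) d i)"
 using u S(2) M(2) i Cinf_opn[OF ldom_opn[OF S M f]] unfolding field_along_def by blast

lemma Ck_lrep_compose: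
 assumes S: "omfd S" "c \<in> matlas S" and M: "omfd M" "d \<in> matlas M"
  and f: "smooth_map S M f" and B: "opn (mdim M) B" "lrep c d f ` ldom c d f <= B" and h: "Ck (mdim M) B r h"
 shows "Ck (mdim S) (ldom c d f) r (%y. h (lrep c d f y))"
 by (rule Ck_compose[OF _ B(1) h lrep_Ck[OF S M f] B(2)])
  (use ldom_opn[OF S M] f in \<open>simp add: smooth_map_def\<close>)

lemma lrep_in: "omfd S ==> c \<in> matlas S ==> y \<in> ldom c d f ==> lrep c d f y \<in> cim d"
 by (auto simp: ldom_eq lrep_def)

lemma vector_field_along:
 assumes S: "omfd S" and M: "omfd M" and f: "smooth_map S M f" and u: "vector_field M u"
 shows "field_along S M f (%x. u (f x))"
 unfolding field_along_def
proof (intro conjI ballI allI impI)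
 have fc: "continuous_map (mtop S) (mtop M) f" using f by (simp add: smooth_map_def)
 show "u (f x) \<in> tspace M (f x)" if "x \<in> pts S" for x
 proof -
  have "f x \<in> pts M" using fc that by (auto simp: continuous_map_def)
  then show ?thesis using u by (simp add: vector_field_def field_along_def)
 qed
 fix c d i assume c: "c \<in> matlas S" and d: "d \<in> matlas M" and i: "i < mdim M"
 have id: "continuous_map (mtop M) (mtop M) (%p. p)" by (simp add: continuous_map_id[unfolded id_def])
 have l: "ldom d d (%p. p) = cim d" by (auto simp: ldom_def)
 show "Cinf (mdim S) (ldom c d f) (%y. u (f (cinv c y)) d i)"
  unfolding Cinf_opn[OF ldom_opn[OF S c M d fc]]
 proof
  fix r
  have "Ck (mdim M) (cim d) r (%z. u (cinv d z) d i)"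
   using field_along_coord[OF M d M d id u[unfolded vector_field_def] i] unfolding l .
  then have "Ck (mdim S) (ldom c d f) r (%y. u (cinv d (lrep c d f y)) d i)"
   using Ck_lrep_compose[OF S c M d f cim_opn[OF M d], of r "%z. u (cinv d z) d i"] lrep_in[OF S c, of _ d f]
   by (simp add: image_subset_iff)
  then show "Ck (mdim S) (ldom c d f) r (%y. u (f (cinv c y)) d i)"
   by (rule Ck_cong[OF ldom_opn[OF S c M d fc], rotated]) (simp add: ldom_eq[OF S c] lrep_def cinv_snd[OF M d])
 qed
qed

text \<open>Pullbacks and their contractions with fields along \<open>f\<close> are handled
  together: the first slots hold the fields \<open>us\<close>, the others images of frame vectors.
  Near each point a chart of \<open>M\<close> turns the value into a polynomial in coefficients of
  the form, coordinates of the fields and entries of the Jacobi matrix.\<close>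

lemma pull_coef_Ck:
 assumes S: "omfd S" "c \<in> matlas S" and M: "omfd M"
  and f: "smooth_map S M f" and al: "diff_form M (length us + k) al"
  and us: "!!u. u \<in> set us ==> field_along S M f u" and js: "js \<in> idx (mdim S) k"
 shows "Ck (mdim S) (cim c) r (%y. al (f (cinv c y))
  (map (%u. u (cinv c y)) us @ map (tmap S M f (cinv c y)) (map (cbasis S c (cinv c y)) js)))"
proof (rule Ck_local[OF cim_opn[OF S]])
 have fc: "continuous_map (mtop S) (mtop M) f" using f by (simp add: smooth_map_def)
 fix y0 assume y0: "y0 \<in> cim c"
 have x0: "cinv c y0 \<in> pts S" using cinv_in[OF S y0] chart_subset[OF S] by blast
 have "f (cinv c y0) \<in> pts M" using fc x0 by (auto simp: continuous_map_def)
 then obtain d where d: "d \<in> matlas M" "f (cinv c y0) \<in> fst d" using ex_chart[OF M] by blast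
 let ?V = "ldom c d f"
 let ?vs = "%y. map (%u. u (cinv c y) d) us @ map (%j i. ljac c d f (cinv c y) i j) js"
 have oV: "opn (mdim S) ?V" by (rule ldom_opn[OF S M d(1) fc])
 have lj: "length js = k" "!!i. i < k ==> js ! i < mdim S" using js nth_mem by (fastforce simp: idx_def)+
 have eq: "al (f (cinv c y)) (map (%u. u (cinv c y)) us @ map (tmap S M f (cinv c y)) (map (cbasis S c (cinv c y)) js))
   = AM (mdim M) (length us + k) (coef M d al (lrep c d f y)) (?vs y)" if y: "y \<in> ?V" for y
 proof -
  define x where "x = cinv c y"
  have x: "x \<in> fst c" "f x \<in> fst d" using y cinv_in[OF S] unfolding ldom_eq[OF S] x_def by auto
  have xS: "x \<in> pts S" using chart_subset[OF S] x by blast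
  have uT: "u x \<in> tspace M (f x)" if "u \<in> set us" for u using us[OF that] xS by (simp add: field_along_def)
  have e1: "map (%u. u x) us @ map (tmap S M f x) (map (cbasis S c x) js) = map (cvec M d (f x)) (?vs y)"
  proof -
   have "map (%u. u x) us = map (cvec M d (f x)) (map (%u. u (cinv c y) d) us)"
    using tspace_cvec[OF M d(1) x(2) uT] by (simp add: x_def)
   moreover have "map (tmap S M f x) (map (cbasis S c x) js) = map (cvec M d (f x)) (map (%j i. ljac c d f (cinv c y) i j) js)"
    using tmap_cbasis(1)[OF S M d(1) f x] js by (auto simp: x_def idx_def)
   ultimately show ?thesis by simp
  qed
  have e2: "set (?vs y) <= Rn (mdim M)"
  proof -
   have "u (cinv c y) d \<in> Rn (mdim M)" if "u \<in> set us" for u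
    using tspaceD(2)[OF uT[OF that] d(1)] by (simp add: x_def)
   moreover have "(%i. ljac c d f (cinv c y) i j) \<in> Rn (mdim M)" if "j \<in> set js" for j
   proof -
    have "j < mdim S" using js that unfolding idx_def by blast
    then show ?thesis using tmap_cbasis(2)[OF S M d(1) f x] by (simp add: x_def)
   qed
   ultimately show ?thesis by (simp add: image_subset_iff)
  qed
  have e3: "length (?vs y) = length us + k" using lj(1) by simp
  have e4: "snd d (f x) = lrep c d f y" by (simp add: lrep_def x_def)
  show ?thesis
   using form_AM[OF M d(1) al x(2) e2 e3] unfolding e4 e1[symmetric] by (simp only: x_def)
 qed
 have "Ck (mdim S) ?V r (%y. AM (mdim M) (length us + k) (coef M d al (lrep c d f y)) (?vs y))"
 proof (rule AM_Ck[OF oV])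
  show "Ck (mdim S) ?V r (%y. coef M d al (lrep c d f y) js')" if "js' \<in> idx (mdim M) (length us + k)" for js'
   using Ck_lrep_compose[OF S M d(1) f cim_opn[OF M d(1)], of r "%z. coef M d al z js'"]
    lrep_in[OF S, of _ d f] coef_Ck[OF M d(1) al that]
   by (simp add: image_subset_iff)
  fix i a assume i: "i < length us + k" and a: "a < mdim M"
  show "Ck (mdim S) ?V r (%y. (?vs y ! i) a)"
  proof (cases "i < length us")
   case True
   then show ?thesis using field_along_coord[OF S M d(1) fc us[OF nth_mem[OF True]] a] by (simp add: nth_append)
  next
   case False
   let ?j = "js ! (i - length us)"
   have j: "?j < mdim S" using False i lj by simp
   have "Ck (mdim S) ?V r (pd ?V ?j (%y. lrep c d f y a))"
    by (rule Ck_pd[OF lrep_Ck[OF S M d(1) f] j])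
   then have "Ck (mdim S) ?V r (%y. ljac c d f (cinv c y) a ?j)"
    by (rule Ck_cong[OF oV, rotated]) (simp add: ljac_def ldom_eq[OF S] snd_cinv[OF S])
   then show ?thesis using False i lj by (simp add: nth_append)
  qed
 qed
 moreover have "y0 \<in> ?V" using y0 d by (simp add: ldom_eq[OF S])
 ultimately show "\<exists>V g. opn (mdim S) V & y0 \<in> V & Ck (mdim S) V r g & (\<forall>y\<in>cim c \<inter> V. g y =
   al (f (cinv c y)) (map (%u. u (cinv c y)) us @ map (tmap S M f (cinv c y)) (map (cbasis S c (cinv c y)) js)))"
  using oV eq by (intro exI[of _ ?V] exI[of _ "%y. AM (mdim M) (length us + k) (coef M d al (lrep c d f y)) (?vs y)"]) auto
qed

section \<open>Bump functions and partitions of unity on manifolds\<close>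

lemma chart_preimage_open:
 assumes M: "omfd M" "c \<in> matlas M" and W: "opn (mdim M) W" "W <= cim c"
 shows "openin (mtop M) {x \<in> fst c. snd c x \<in> W}"
proof -
 have "openin (top_of_set (cim c)) W" using W cim_opn[OF M]
  by (meson openin_subset_trans opn_subset)
 then have "openin (subtopology (mtop M) (fst c)) {x \<in> topspace (subtopology (mtop M) (fst c)). snd c x \<in> W}"
  by (rule openin_continuous_map_preimage[OF chart_cont[OF M]])
 moreover have "{x \<in> topspace (subtopology (mtop M) (fst c)). snd c x \<in> W} = {x \<in> fst c. snd c x \<in> W}"
  using chart_subset[OF M] by auto
 ultimately show ?thesis using openin_trans_full[OF _ chart_open[OF M]] by simp
qed

lemma cinv_compact:
 assumes M: "omfd M" "c \<in> matlas M" and K: "compact K" "K <= cim c"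
 shows "compactin (mtop M) (cinv c ` K)"
 by (rule image_compactin[OF _ cinv_cont[OF M]]) (use K in \<open>simp add: compactin_subtopology\<close>)

lemma snd_compact:
 assumes M: "omfd M" "c \<in> matlas M" and K: "compactin (mtop M) K" "K <= fst c"
 shows "compact (snd c ` K)"
proof -
 have "compactin (top_of_set (cim c)) (snd c ` K)"
  by (rule image_compactin[OF _ chart_cont[OF M]]) (use K in \<open>simp add: compactin_subtopology\<close>)
 then show ?thesis by (simp add: compactin_subtopology)
qed

lemma compact_closed:
 assumes "omfd M" "compactin (mtop M) K" shows "closedin (mtop M) K"
 using assms by (intro compactin_imp_closedin) (auto simp: oriented_mfd_def)

text \<open>A point in the domain of \<open>d\<close> is covered by the assumption; every other
  point has a neighbourhood off the closed set \<open>K\<close>, where \<open>h\<close> is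
  0.\<close>

lemma extend_zero_Ck:
 assumes M: "omfd M" and c: "c \<in> matlas M" and d: "d \<in> matlas M" and K: "closedin (mtop M) K" "K <= fst d"
  and z: "!!x. x \<in> pts M - K ==> h x = 0"
  and s: "Ck (mdim M) {y \<in> cim c. cinv c y \<in> fst d} r (%y. h (cinv c y))"
 shows "Ck (mdim M) (cim c) r (%y. h (cinv c y))"
proof (rule Ck_local[OF cim_opn[OF M c]])
 fix y assume y: "y \<in> cim c"
 show "\<exists>V g. opn (mdim M) V & y \<in> V & Ck (mdim M) V r g & (\<forall>y\<in>cim c \<inter> V. g y = h (cinv c y))"
 proof (cases "cinv c y \<in> fst d")
  case True
  then show ?thesis using s y opn_chart_preimage[OF M c chart_open[OF M d]]
   by (intro exI[of _ "{y \<in> cim c. cinv c y \<in> fst d}"] exI[of _ "%y. h (cinv c y)"]) simp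
 next
  case False
  let ?V = "{y \<in> cim c. cinv c y \<in> pts M - K}"
  have o: "opn (mdim M) ?V" using K(1) by (intro opn_chart_preimage[OF M c]) (simp add: closedin_def)
  have "y \<in> ?V" using False y K cinv_in[OF M c y] chart_subset[OF M c] by auto
  then show ?thesis using o z Ck_const[OF o, of r 0]
   by (intro exI[of _ ?V] exI[of _ "%y. 0"]) auto
 qed
qed

definition msm :: "'a smfd => ('a => real) => bool"
 where "msm M f \<longleftrightarrow> (\<forall>c\<in>matlas M. \<forall>r. Ck (mdim M) (cim c) r (%y. f (cinv c y)))"

lemma msm_Ck: "msm M f ==> c \<in> matlas M ==> Ck (mdim M) (cim c) r (%y. f (cinv c y))"
 by (simp add: msm_def)

lemma msm_compose:
 assumes S: "omfd S" and M: "omfd M" and f: "smooth_map S M f" and h: "msm M h"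
 shows "msm S (%x. h (f x))"
 unfolding msm_def
proof (intro ballI allI)
 fix c r assume c: "c \<in> matlas S"
 have fc: "continuous_map (mtop S) (mtop M) f" using f by (simp add: smooth_map_def)
 show "Ck (mdim S) (cim c) r (%y. h (f (cinv c y)))"
 proof (rule Ck_local[OF cim_opn[OF S c]])
  fix y assume y: "y \<in> cim c"
  have "cinv c y \<in> pts S" using cinv_in[OF S c y] chart_subset[OF S c] by blast
  then have "f (cinv c y) \<in> pts M" using fc by (auto simp: continuous_map_def)
  then obtain d where d: "d \<in> matlas M" "f (cinv c y) \<in> fst d" using ex_chart[OF M] by blast
  have "Ck (mdim S) (ldom c d f) r (%y. h (cinv d (lrep c d f y)))"
   using Ck_lrep_compose[OF S c M d(1) f cim_opn[OF M d(1)], of r "%z. h (cinv d z)"]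
    lrep_in[OF S c, of _ d f] msm_Ck[OF h d(1)] by (simp add: image_subset_iff)
  moreover have "h (cinv d (lrep c d f y)) = h (f (cinv c y))" if "y \<in> ldom c d f" for y
   using that by (simp add: ldom_eq[OF S c] lrep_def cinv_snd[OF M d(1)])
  moreover have "y \<in> ldom c d f" using y d by (simp add: ldom_eq[OF S c])
  ultimately show "\<exists>V g. opn (mdim S) V & y \<in> V & Ck (mdim S) V r g & (\<forall>y\<in>cim c \<inter> V. g y = h (f (cinv c y)))"
   using ldom_opn[OF S c M d(1) fc]
   by (intro exI[of _ "ldom c d f"] exI[of _ "%y. h (cinv d (lrep c d f y))"]) simp
 qed
qed

lemma ldom_id: "omfd M ==> c \<in> matlas M ==> {y \<in> cim c. cinv c y \<in> fst d} = ldom c d (%p. p)"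
 by (simp add: ldom_eq)

text \<open>A box bump is transported by a chart. Its support is compact, hence closed as
  \<open>M\<close> is Hausdorff, so the extension by zero is smooth.\<close>

lemma bump_function:
 assumes M: "omfd M" and X: "openin (mtop M) X" "p \<in> X"
 shows "\<exists>e K. msm M e & (\<forall>x. 0 <= e x) & 0 < e p & compactin (mtop M) K & K <= X & (\<forall>x. x \<notin> K --> e x = 0)"
proof -
 have "p \<in> pts M" using X openin_subset by blast
 then obtain d where d: "d \<in> matlas M" "p \<in> fst d" using ex_chart[OF M] by blast
 let ?N = "{z \<in> cim d. cinv d z \<in> X}"
 have "opn (mdim M) ?N" by (rule opn_chart_preimage[OF M d(1) X(1)])
 moreover have "snd d p \<in> ?N" using d X cinv_snd[OF M d] by simp
 ultimately obtain de where de: "0 < de" "cboxn (mdim M) (snd d p) de <= ?N" by (rule opn_contains_cboxn)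
 let ?C = "cboxn (mdim M) (snd d p) de" and ?b = "bumpn (mdim M) (snd d p) de"
 define e where "e x = (if x \<in> fst d then ?b (snd d x) else 0)" for x
 define K where "K = cinv d ` ?C"
 have K: "compactin (mtop M) K" unfolding K_def by (rule cinv_compact[OF M d(1) compact_cboxn]) (use de in auto)
 have KX: "K <= X" "K <= fst d" using de(2) cinv_in[OF M d(1)] by (auto simp: K_def)
 have z: "e x = 0" if x: "x \<notin> K" for x
 proof (cases "x \<in> fst d")
  case True
  have "snd d x \<notin> ?C" using x cinv_snd[OF M d(1) True] unfolding K_def by (metis image_eqI)
  then have "snd d x \<notin> boxn (mdim M) (snd d p) de" using boxn_subset_cboxn by blast
  then show ?thesis using bumpn_zero[OF de(1) snd_Rn[OF M d(1) True]] True by (simp add: e_def)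
 qed (simp add: e_def)
 have "msm M e" unfolding msm_def
 proof (intro ballI allI)
  fix c r assume c: "c \<in> matlas M"
  show "Ck (mdim M) (cim c) r (%y. e (cinv c y))"
  proof (rule extend_zero_Ck[OF M c d(1) compact_closed[OF M K] KX(2)])
   show "e x = 0" if "x \<in> pts M - K" for x using z that by simp
   have "Ck (mdim M) (ldom c d (%p. p)) r (%y. ?b (lrep c d (%p. p) y))"
    using Ck_lrep_compose[OF M c M d(1) smooth_id[OF M] cim_opn[OF M d(1)], of r ?b]
     lrep_in[OF M c, of _ d "%p. p"] Ck_bumpn[OF cim_opn[OF M d(1)]] by (simp add: image_subset_iff)
   moreover have "opn (mdim M) (ldom c d (%p. p))"
    by (rule ldom_opn[OF M c M d(1)]) (simp add: continuous_map_id[unfolded id_def])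
   moreover have "?b (lrep c d (%p. p) y) = e (cinv c y)" if "y \<in> ldom c d (%p. p)" for y
    using that by (simp add: ldom_eq[OF M c] lrep_def e_def)
   ultimately show "Ck (mdim M) {y \<in> cim c. cinv c y \<in> fst d} r (%y. e (cinv c y))"
    unfolding ldom_id[OF M c]
    using Ck_cong[of "mdim M" "ldom c d (%p. p)" "%y. ?b (lrep c d (%p. p) y)" "%y. e (cinv c y)" r] by simp
  qed
 qed
 moreover have "0 < e p" using bumpn_pos[OF de(1)] d by (simp add: e_def)
 moreover have "0 <= e x" for x by (simp add: e_def bumpn_nonneg)
 ultimately show ?thesis using K KX(1) z by blast
qed

lemma msm_pos_open:
 assumes M: "omfd M" and e: "msm M e"
 shows "openin (mtop M) {x \<in> pts M. 0 < e x}"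
proof (subst openin_subopen, intro ballI)
 fix x assume x: "x \<in> {x \<in> pts M. 0 < e x}"
 then obtain c where c: "c \<in> matlas M" "x \<in> fst c" using ex_chart[OF M] by blast
 let ?W = "{y \<in> cim c. 0 < e (cinv c y)}"
 have "opn (mdim M) ?W"
  by (rule opn_less[OF cim_opn[OF M c(1)]]) (use Ck_continuous[OF msm_Ck[OF e c(1), of 0]] in auto)
 then have "openin (mtop M) {x \<in> fst c. snd c x \<in> ?W}" by (rule chart_preimage_open[OF M c(1)]) auto
 moreover have "{x \<in> fst c. snd c x \<in> ?W} <= {x \<in> pts M. 0 < e x}"
 proof
  fix x assume "x \<in> {x \<in> fst c. snd c x \<in> ?W}"
  then have "x \<in> fst c" "0 < e (cinv c (snd c x))" by auto
  then show "x \<in> {x \<in> pts M. 0 < e x}"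
   using chart_subset[OF M c(1)] cinv_snd[OF M c(1)] by auto
 qed
 moreover have "x \<in> {x \<in> fst c. snd c x \<in> ?W}" using x c cinv_snd[OF M c] by auto
 ultimately show "\<exists>T. openin (mtop M) T & x \<in> T & T <= {x \<in> pts M. 0 < e x}" by blast
qed

text \<open>Finitely many bumps are divided by their positive sum. The cover is an arbitrary family
  \<open>\<U>\<close>: besides chart domains it may consist of sets on which some local statement is
  known.\<close>

lemma pou_exists:
 assumes S: "omfd S" and comp: "compact_space (mtop S)"
  and cov: "\<forall>x\<in>pts S. \<exists>X\<in>\<U>. openin (mtop S) X & x \<in> X"
 shows "\<exists>(N::nat) rh X. (\<forall>i<N. X i \<in> \<U> & msm S (rh i) & (\<forall>x\<in>pts S. 0 <= rh i x) &
   (\<exists>K. closedin (mtop S) K & K <= X i & (\<forall>x. x \<notin> K --> rh i x = 0))) &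
  (\<forall>x\<in>pts S. (\<Sum>i<N. rh i x) = (1::real))"
proof -
 have "\<exists>e K X. X \<in> \<U> & msm S e & (\<forall>x. 0 <= e x) & 0 < e p & compactin (mtop S) K & K <= X & (\<forall>x. x \<notin> K --> e x = 0)"
  if p: "p \<in> pts S" for p
 proof -
  obtain X where X: "X \<in> \<U>" "openin (mtop S) X" "p \<in> X" using bspec[OF cov p] by blast
  show ?thesis using bump_function[OF S X(2,3)] X(1) by blast
 qed
 then obtain e K X where e: "!!p. p \<in> pts S ==> X p \<in> \<U> & msm S (e p) & (\<forall>x. 0 <= e p x) &
   0 < e p p & compactin (mtop S) (K p) & K p <= X p & (\<forall>x. x \<notin> K p --> e p x = 0)"
  by metis
 define P where "P p = {x \<in> pts S. 0 < e p x}" for p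
 have "\<forall>U\<in>P ` pts S. openin (mtop S) U"
  using msm_pos_open[OF S] e by (auto simp: P_def)
 moreover have "pts S <= \<Union>(P ` pts S)" using e by (auto simp: P_def)
 moreover have "compactin (mtop S) (pts S)" using comp by (simp add: compact_space_def)
 ultimately obtain F where F: "finite F" "F <= P ` pts S" "pts S <= \<Union>F"
  unfolding compactin_def by (metis (no_types, lifting))
 obtain C where C: "C <= pts S" "finite C" "F = P ` C" using finite_subset_image[OF F(1,2)] by blast
 obtain h where h: "bij_betw h {0..<card C} C" using ex_bij_betw_nat_finite[OF C(2)] by blast
 define N where "N = card C"
 have hC: "h i \<in> pts S" if "i < N" for i
  using h that C(1) by (auto simp: bij_betw_def N_def)
 have hN: "h ` {..<N} = C" using h by (auto simp: bij_betw_def N_def atLeast0LessThan)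
 define E where "E x = (\<Sum>i<N. e (h i) x)" for x
 have E: "0 < E x" if x: "x \<in> pts S" for x
 proof -
  obtain p where "p \<in> C" "x \<in> P p" using F(3) C(3) x by auto
  then obtain i where i: "i < N" "x \<in> P (h i)" using hN by auto
  show ?thesis unfolding E_def
   by (rule sum_pos2[of _ i]) (use i e hC in \<open>auto simp: P_def\<close>)
 qed
 define rh where "rh i x = e (h i) x * inverse (E x)" for i x
 have r1: "msm S (rh i)" if i: "i < N" for i
  unfolding msm_def rh_def
 proof (intro ballI allI Ck_mult Ck_inverse cim_opn[OF S])
  fix c r assume c: "c \<in> matlas S"
  show "Ck (mdim S) (cim c) r (%y. e (h i) (cinv c y))" using e[OF hC[OF i]] c by (simp add: msm_def)
  show "Ck (mdim S) (cim c) r (%y. E (cinv c y))" unfolding E_def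
   by (intro Ck_sum cim_opn[OF S c]) (use e hC c in \<open>simp add: msm_def\<close>)
  show "E (cinv c y) ~= 0" if "y \<in> cim c" for y
   using E[of "cinv c y"] cinv_in[OF S c that] chart_subset[OF S c] by auto
 qed
 have r2: "0 <= rh i x" if "i < N" "x \<in> pts S" for i x
  using e[OF hC[OF that(1)]] E[OF that(2)] by (simp add: rh_def)
 have r3: "\<exists>K. closedin (mtop S) K & K <= X (h i) & (\<forall>x. x \<notin> K --> rh i x = 0)" if "i < N" for i
  using e[OF hC[OF that]] compact_closed[OF S] by (intro exI[of _ "K (h i)"]) (simp add: rh_def)
 have r4: "(\<Sum>i<N. rh i x) = 1" if "x \<in> pts S" for x
  using E[OF that] by (simp add: rh_def E_def flip: sum_distrib_right)
 show ?thesis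
 proof (intro exI[of _ N] exI[of _ rh] exI[of _ "%i. X (h i)"] conjI allI impI ballI)
  show "X (h i) \<in> \<U>" if "i < N" for i using e[OF hC[OF that]] by blast
 qed (fact r1 r2 r3 r4)+
qed

lemma partition_of_unity_exists:
 assumes S: "omfd S" and comp: "compact_space (mtop S)"
  and C: "C <= matlas S" "pts S <= (\<Union>c\<in>C. fst c)"
 shows "\<exists>N cs rh. partition_of_unity S N cs rh & (\<forall>i<N. cs i \<in> C)"
proof -
 have "\<forall>x\<in>pts S. \<exists>X\<in>fst ` C. openin (mtop S) X & x \<in> X"
 proof
  fix x assume x: "x \<in> pts S"
  obtain c where c: "c \<in> C" "x \<in> fst c" using subsetD[OF C(2) x] by blast
  have "openin (mtop S) (fst c)" using c C(1) by (intro chart_open[OF S]) auto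
  then show "\<exists>X\<in>fst ` C. openin (mtop S) X & x \<in> X" using c by (intro bexI[of _ "fst c"]) auto
 qed
 from pou_exists[OF S comp this] obtain N :: nat and rh X where
  1: "\<forall>i<N. X i \<in> fst ` C & msm S (rh i) & (\<forall>x\<in>pts S. 0 <= rh i x) &
   (\<exists>K. closedin (mtop S) K & K <= X i & (\<forall>x. x \<notin> K --> rh i x = 0))"
  and 2: "\<forall>x\<in>pts S. (\<Sum>i<N. rh i x) = 1" by blast
 have P: "X i \<in> fst ` C" "msm S (rh i)" "\<forall>x\<in>pts S. 0 <= rh i x"
  "\<exists>K. closedin (mtop S) K & K <= X i & (\<forall>x. x \<notin> K --> rh i x = 0)" if "i < N" for i
  using spec[OF 1, of i] that by simp_all
 have "\<forall>i. \<exists>c. i < N --> c \<in> C & X i = fst c" using P(1) by blast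
 from choice[OF this] obtain cs where cs: "!!i. i < N ==> cs i \<in> C & X i = fst (cs i)" by blast
 have "partition_of_unity S N cs rh" unfolding partition_of_unity_def
 proof (intro conjI allI impI)
  fix i assume i: "i < N"
  show "cs i \<in> matlas S" using cs[OF i] C(1) by blast
  show "\<forall>x\<in>pts S. 0 <= rh i x" by (rule P(3)[OF i])
  show "\<forall>c\<in>matlas S. Cinf (mdim S) (cim c) (%y. rh i (cinv c y))"
  proof
   fix c assume c: "c \<in> matlas S"
   have "msm S (rh i)" by (rule P(2)[OF i])
   then show "Cinf (mdim S) (cim c) (%y. rh i (cinv c y))"
    unfolding Cinf_opn[OF cim_opn[OF S c]] msm_def using c by blast
  qed
  obtain K where K: "closedin (mtop S) K" "K <= X i" "\<forall>x. x \<notin> K --> rh i x = 0" using P(4)[OF i] by blast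
  have "mtop S closure_of {x \<in> pts S. rh i x ~= 0} <= K"
   by (rule closure_of_minimal[OF _ K(1)]) (use K(3) in blast)
  then show "mtop S closure_of {x \<in> pts S. rh i x ~= 0} <= fst (cs i)" using K(2) cs[OF i] by blast
 qed (use 2 in blast)
 then show ?thesis using cs by blast
qed

subsection \<open>The integral does not depend on the charts\<close>

definition cf :: "'s smfd => 's form => 's chart => 's => real"
 where "cf S al c x = al x (map (cbasis S c x) [0..<mdim S])"

text \<open>What integration uses of a top-degree form: alternation at each point and continuous
  coefficients in every chart. Contracted pullbacks and wedge products with a differential are
  covered as well.\<close>

definition density :: "'s smfd => 's form => bool"
 where "density S al \<longleftrightarrow> (\<forall>c\<in>matlas S.
  (\<forall>x\<in>fst c. altform (mdim S) (mdim S) (%vs. al x (map (cvec S c x) vs))) &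
  continuous_on (cim c) (%y. cf S al c (cinv c y)))"

definition mcont :: "'s smfd => ('s => real) => bool"
 where "mcont S f \<longleftrightarrow> (\<forall>c\<in>matlas S. continuous_on (cim c) (%y. f (cinv c y)))"

lemma msm_mcont: "msm S f ==> mcont S f"
 unfolding mcont_def using Ck_continuous msm_Ck by blast

lemma density_transition:
 assumes S: "omfd S" and al: "density S al" and c: "c \<in> matlas S" "x \<in> fst c" and d: "d \<in> matlas S" "x \<in> fst d"
 shows "cf S al c x = jdet (mdim S) c d (%p. p) x * cf S al d x"
proof -
 let ?n = "mdim S"
 let ?J = "%j i. ljac c d (%p. p) x i j"
 have A: "altform ?n ?n (%vs. al x (map (cvec S d x) vs))" using al d by (simp add: density_def)
 have "map (cbasis S c x) [0..<?n] = map (cvec S d x) (map ?J [0..<?n])"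
  using cbasis_transition(1)[OF S c(1) d(1) c(2) d(2)] by simp
 then have "cf S al c x = al x (map (cvec S d x) (map ?J [0..<?n]))" by (simp only: cf_def)
 also have "\<dots> = Determinant.det (Matrix.mat ?n ?n (%(i, j). (map ?J [0..<?n] ! j) i)) * al x (map (cvec S d x) (map unitv [0..<?n]))"
  by (rule altform_det[OF A]) (use cbasis_transition(2)[OF S c(1) d(1) c(2) d(2)] in auto)
 also have "Matrix.mat ?n ?n (%(i, j). (map ?J [0..<?n] ! j) i) = Matrix.mat ?n ?n (%(i, j). ljac c d (%p. p) x i j)"
  by (auto intro!: eq_matI)
 also have "map (cvec S d x) (map unitv [0..<?n]) = map (cbasis S d x) [0..<?n]"
  by (simp add: cbasis_unitv)
 finally show ?thesis by (simp add: jdet_def cf_def)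
qed

definition cint :: "'s smfd => 's chart => ('s => real) => 's form => (nat => real) => real"
 where "cint S c ka al y = (if y \<in> cim c then morient S c (cinv c y) * ka (cinv c y) * cf S al c (cinv c y) else 0)"

lemma chart_integral_RInt: "chart_integral S c ka al = RInt (mdim S) (cint S c ka al)"
 unfolding chart_integral_def Rn_integral_RInt cint_def[abs_def] cf_def Let_def by simp

lemma morient_cont:
 assumes S: "omfd S" "c \<in> matlas S"
 shows "continuous_on (cim c) (%y. morient S c (cinv c y))"
proof -
 have m: "continuous_map (subtopology (mtop S) (fst c)) euclideanreal (morient S c)"
  using S by (simp add: oriented_mfd_def)
 have "continuous_map (top_of_set (cim c)) (subtopology (mtop S) (fst c)) (cinv c)"
  using cinv_cont[OF S] cinv_in[OF S] by (auto simp: continuous_map_in_subtopology)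
 from continuous_map_compose[OF this m] show ?thesis by (simp add: o_def)
qed

lemma csupp_cint:
 assumes S: "omfd S" "c \<in> matlas S" and comp: "compact_space (mtop S)" and al: "density S al" and ka: "mcont S ka"
  and K: "closedin (mtop S) K" "K <= fst c" "!!x. x \<in> fst c - K ==> ka x * cf S al c x = 0"
 shows "csupp (mdim S) (cint S c ka al)"
 unfolding cint_def[abs_def]
proof (rule csupp_extend[OF cim_opn[OF S], where K = "snd c ` K"])
 show "continuous_on (cim c) (%y. morient S c (cinv c y) * ka (cinv c y) * cf S al c (cinv c y))"
  using morient_cont[OF S] al ka S(2) by (intro continuous_intros) (auto simp: density_def mcont_def)
 show "compact (snd c ` K)" by (rule snd_compact[OF S closedin_compact_space[OF comp K(1)] K(2)])
 show "snd c ` K <= cim c" using K(2) by blast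
 fix y assume y: "y \<in> cim c - snd c ` K"
 then have "cinv c y \<in> fst c - K" using cinv_in[OF S] snd_cinv[OF S] by (metis DiffD1 DiffD2 DiffI image_eqI)
 from K(3)[OF this] show "morient S c (cinv c y) * ka (cinv c y) * cf S al c (cinv c y) = 0" by (simp add: mult.assoc)
qed

text \<open>The condition concerns the product of weight and form. The vanishing may therefore come
  from the weight, as for a partition of unity, or from the form, as for the constant weight in
  Stokes' theorem.\<close>

definition vanish :: "'s smfd => 's form => ('s => real) => 's set => bool"
 where "vanish S al ka K \<longleftrightarrow> (\<forall>x\<in>pts S - K. \<forall>e\<in>matlas S. x \<in> fst e --> ka x * cf S al e x = 0)"

lemma vanishD: "omfd S ==> vanish S al ka K ==> c \<in> matlas S ==> x \<in> fst c - K ==> ka x * cf S al c x = 0"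
 unfolding vanish_def using chart_subset by blast

lemma transition_ldiff:
 assumes S: "omfd S" and c: "c \<in> matlas S" and d: "d \<in> matlas S"
 shows "ldiff (mdim S) (lrep c d (%p. p)) (lrep d c (%p. p)) (ldom c d (%p. p)) (ldom d c (%p. p))"
proof -
 have id: "continuous_map (mtop S) (mtop S) (%p. p)" by (simp add: continuous_map_id[unfolded id_def])
 have "lrep a b (%p. p) y \<in> ldom b a (%p. p) & lrep b a (%p. p) (lrep a b (%p. p) y) = y"
  if a: "a \<in> matlas S" and b: "b \<in> matlas S" and y: "y \<in> ldom a b (%p. p)" for a b y
 proof -
  have y': "y \<in> cim a" "cinv a y \<in> fst b" using y by (auto simp: ldom_eq[OF S a])
  have "cinv b (snd b (cinv a y)) = cinv a y" by (rule cinv_snd[OF S b y'(2)])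
  then show ?thesis using y' snd_cinv[OF S a y'(1)] cinv_in[OF S a y'(1)]
   by (auto simp: ldom_eq[OF S b] lrep_def)
 qed
 then show ?thesis unfolding ldiff_def
  using c d ldom_opn[OF S c S d id] ldom_opn[OF S d S c id]
   lrep_Ck[OF S c S d smooth_id[OF S]] lrep_Ck[OF S d S c smooth_id[OF S]] by blast
qed

lemma jdet_jacd:
 "omfd S ==> c \<in> matlas S ==> x \<in> fst c ==>
  jdet n c d f x = jacd n (ldom c d f) (lrep c d f) (snd c x)"
 by (simp add: jdet_def jacd_def ljac_def)

text \<open>The change of variables formula is available near a point only, so equality is obtained
  for integrands supported in a small set \<open>X\<close>. Weight and support are quantified after
  \<open>X\<close>, ready to be cut down by a partition of unity.\<close>

lemma chart_integral_local:
 assumes S: "omfd S" and comp: "compact_space (mtop S)" and al: "density S al"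
  and c: "c \<in> matlas S" "x0 \<in> fst c" and d: "d \<in> matlas S" "x0 \<in> fst d"
 shows "\<exists>X. openin (mtop S) X & x0 \<in> X & (\<forall>ka K. mcont S ka & closedin (mtop S) K & K <= X & vanish S al ka K -->
  chart_integral S c ka al = chart_integral S d ka al)"
proof -
 let ?n = "mdim S" and ?ta = "lrep c d (%p. p)" and ?U = "ldom c d (%p. p)"
 have ld: "ldiff ?n ?ta (lrep d c (%p. p)) ?U (ldom d c (%p. p))" by (rule transition_ldiff[OF S c(1) d(1)])
 have "snd c x0 \<in> ?U" by (rule snd_in_ldom) (use c d in auto)
 from local_change_of_variables[OF ld this] obtain W where
  W: "opn ?n W" "snd c x0 \<in> W" "W <= ?U" "covl ?n W ?ta (%y. \<bar>jacd ?n ?U ?ta y\<bar>)" by blast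
 have Wc: "W <= cim c" and Wd: "!!y. y \<in> W ==> cinv c y \<in> fst d" using W(3) by (auto simp: ldom_eq[OF S c(1)])
 let ?X = "{x \<in> fst c. snd c x \<in> W}"
 have "openin (mtop S) ?X" by (rule chart_preimage_open[OF S c(1) W(1) Wc])
 moreover have "chart_integral S c ka al = chart_integral S d ka al"
  if ka: "mcont S ka" and K: "closedin (mtop S) K" "K <= ?X" and v: "vanish S al ka K" for ka K
 proof -
  have Kd: "K <= fst d" using K(2) Wd cinv_snd[OF S c(1)] by fastforce
  have cs: "csupp ?n (cint S d ka al)"
   by (rule csupp_cint[OF S d(1) comp al ka K(1) Kd]) (rule vanishD[OF S v d(1)])
  have "compact (snd d ` K)" by (rule snd_compact[OF S d(1) closedin_compact_space[OF comp K(1)] Kd])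
  moreover have "snd d ` K <= ?ta ` W"
  proof
   fix z assume "z \<in> snd d ` K"
   then obtain x where x: "x \<in> K" "z = snd d x" by blast
   have "x \<in> fst c" "snd c x \<in> W" using x K(2) by auto
   then show "z \<in> ?ta ` W" using x lrep_snd[OF S c(1), of x d "%p. p"] by (intro image_eqI[of _ _ "snd c x"]) auto
  qed
  moreover have "\<forall>z\<in>Rn ?n - snd d ` K. cint S d ka al z = 0"
  proof
   fix z assume z: "z \<in> Rn ?n - snd d ` K"
   show "cint S d ka al z = 0"
   proof (cases "z \<in> cim d")
    case True
    then have "cinv d z \<in> fst d - K" using z cinv_in[OF S d(1)] snd_cinv[OF S d(1)] by (metis DiffD2 DiffI image_eqI)
    from vanishD[OF S v d(1) this] show ?thesis by (simp add: cint_def mult.assoc)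
   qed (simp add: cint_def)
  qed
  ultimately have "RInt ?n (cint S d ka al) = RInt ?n (%y. if y \<in> W then cint S d ka al (?ta y) * \<bar>jacd ?n ?U ?ta y\<bar> else 0)"
   using W(4) cs unfolding covl_def csupp_def by blast
  also have "(%y. if y \<in> W then cint S d ka al (?ta y) * \<bar>jacd ?n ?U ?ta y\<bar> else 0) = cint S c ka al"
  proof
   fix y
   show "(if y \<in> W then cint S d ka al (?ta y) * \<bar>jacd ?n ?U ?ta y\<bar> else 0) = cint S c ka al y"
   proof (cases "y \<in> W")
    case True
    define x where "x = cinv c y"
    have x: "x \<in> fst c" "x \<in> fst d" "y = snd c x"
     using True Wc Wd cinv_in[OF S c(1)] snd_cinv[OF S c(1)] by (auto simp: x_def)
    have t: "?ta y = snd d x" by (simp add: lrep_def x_def)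
    have J: "jacd ?n ?U ?ta y = jdet ?n c d (%p. p) x" unfolding x(3) by (rule jdet_jacd[OF S c(1) x(1), symmetric])
    have o: "morient S d x = sgn (jdet ?n c d (%p. p) x) * morient S c x"
     using S c(1) d(1) x(1,2) unfolding oriented_mfd_def by blast
    \<comment> \<open>The orientation signs of the two charts differ by the sign of the Jacobi
      determinant, which turns the absolute value from the change of variables into the determinant
      of \<open>density_transition\<close>.\<close>
    have e: "sgn a * m * k * b * \<bar>a\<bar> = m * k * (a * b)" for a m k b :: real
     by (simp add: abs_sgn[of a] sgn_if)
    have "cint S d ka al (?ta y) * \<bar>jacd ?n ?U ?ta y\<bar>
      = morient S d x * ka x * cf S al d x * \<bar>jdet ?n c d (%p. p) x\<bar>"
     using x(2) unfolding t J by (simp add: cint_def cinv_snd[OF S d(1)])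
    also have "\<dots> = morient S c x * ka x * cf S al c x"
     unfolding o density_transition[OF S al c(1) x(1) d(1) x(2)] by (rule e)
    also have "\<dots> = cint S c ka al y" using True Wc by (auto simp: cint_def x_def)
    finally show ?thesis using True by simp
   next
    case False
    have "cint S c ka al y = 0"
    proof (cases "y \<in> cim c")
     case True
     have "cinv c y \<in> fst c - K" using False K(2) True cinv_in[OF S c(1)] snd_cinv[OF S c(1)] by auto
     from vanishD[OF S v c(1) this] show ?thesis by (simp add: cint_def mult.assoc)
    qed (simp add: cint_def)
    then show ?thesis using False by simp
   qed
  qed
  finally show ?thesis by (simp add: chart_integral_RInt)
 qed
 ultimately show ?thesis using W(2) c(2) by (intro exI[of _ ?X]) blast
qed

lemma chart_integral_zero:
 assumes S: "omfd S" and c: "c \<in> matlas S" and v: "vanish S al ka {}"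
 shows "chart_integral S c ka al = 0"
proof -
 have "cint S c ka al y = 0" for y
 proof (cases "y \<in> cim c")
  case True
  then have "cinv c y \<in> fst c - {}" using cinv_in[OF S c] by simp
  from vanishD[OF S v c this] show ?thesis by (simp add: cint_def mult.assoc)
 qed (simp add: cint_def)
 then show ?thesis by (simp add: chart_integral_RInt RInt_zero cong: RInt_cong)
qed

lemma mcont_mult: "mcont S f ==> mcont S g ==> mcont S (%x. f x * g x)"
 unfolding mcont_def by (auto intro: continuous_intros)

lemma chart_integral_split:
 assumes S: "omfd S" "c \<in> matlas S" and comp: "compact_space (mtop S)" and al: "density S al" and ka: "mcont S ka"
  and K: "closedin (mtop S) K" "K <= fst c" "vanish S al ka K"
  and rh: "!!i. i < N ==> mcont S (rh i)" "!!x. x \<in> pts S ==> (\<Sum>i<(N::nat). rh i x) = 1"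
 shows "chart_integral S c ka al = (\<Sum>i<N. chart_integral S c (%x. ka x * rh i x) al)"
proof -
 have "(\<Sum>i<N. chart_integral S c (%x. ka x * rh i x) al) = RInt (mdim S) (%y. \<Sum>i<N. cint S c (%x. ka x * rh i x) al y)"
  unfolding chart_integral_RInt
 proof (rule RInt_sum[symmetric])
  fix i assume "i \<in> {..<N}"
  then have "mcont S (%x. ka x * rh i x)" using ka rh(1) by (intro mcont_mult) auto
  moreover have "ka x * rh i x * cf S al c x = 0" if "x \<in> fst c - K" for x
   using vanishD[OF S(1) K(3) S(2) that] by auto
  ultimately show "csupp (mdim S) (cint S c (%x. ka x * rh i x) al)" using csupp_cint[OF S comp al _ K(1,2)] by blast
 qed
 also have "(%y. \<Sum>i<N. cint S c (%x. ka x * rh i x) al y) = cint S c ka al"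
 proof
  fix y
  show "(\<Sum>i<N. cint S c (%x. ka x * rh i x) al y) = cint S c ka al y"
  proof (cases "y \<in> cim c")
   case True
   have "cinv c y \<in> pts S" using cinv_in[OF S True] chart_subset[OF S] by blast
   from rh(2)[OF this] show ?thesis using True
    by (simp add: cint_def flip: sum_distrib_left sum_distrib_right mult.assoc)
  qed (simp add: cint_def)
 qed
 finally show ?thesis by (simp add: chart_integral_RInt)
qed

text \<open>The local statement is globalised by a partition of unity whose members live on sets
  where it holds, or on sets that miss \<open>K\<close>, where both integrals are 0.\<close>

lemma chart_integral_independent:
 assumes S: "omfd S" and comp: "compact_space (mtop S)" and al: "density S al" and ka: "mcont S ka"
  and c: "c \<in> matlas S" and d: "d \<in> matlas S"
  and K: "closedin (mtop S) K" "K <= fst c" "K <= fst d" "vanish S al ka K"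
 shows "chart_integral S c ka al = chart_integral S d ka al"
proof -
 define good where "good X \<longleftrightarrow> (\<forall>ka K. mcont S ka & closedin (mtop S) K & K <= X & vanish S al ka K -->
  chart_integral S c ka al = chart_integral S d ka al)" for X
 let ?\<U> = "{X. good X \<or> X \<inter> K = {}}"
 have "\<forall>x\<in>pts S. \<exists>X\<in>?\<U>. openin (mtop S) X & x \<in> X"
 proof
  fix x assume x: "x \<in> pts S"
  show "\<exists>X\<in>?\<U>. openin (mtop S) X & x \<in> X"
 proof (cases "x \<in> K")
  case True
  then have "x \<in> fst c" "x \<in> fst d" using K by auto
  from chart_integral_local[OF S comp al c this(1) d this(2)] show ?thesis unfolding good_def by blast
 next
  case False
  then show ?thesis using x K(1) by (intro bexI[of _ "pts S - K"]) (auto simp: closedin_def)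
 qed
 qed
 from pou_exists[OF S comp this] obtain N :: nat and rh X where
  1: "\<forall>i<N. X i \<in> ?\<U> & msm S (rh i) & (\<forall>x\<in>pts S. 0 <= rh i x) &
   (\<exists>K. closedin (mtop S) K & K <= X i & (\<forall>x. x \<notin> K --> rh i x = 0))"
  and 2: "\<forall>x\<in>pts S. (\<Sum>i<N. rh i x) = 1" by blast
 have P: "X i \<in> ?\<U>" "msm S (rh i)"
  "\<exists>K. closedin (mtop S) K & K <= X i & (\<forall>x. x \<notin> K --> rh i x = 0)" if "i < N" for i
  using spec[OF 1, of i] that by simp_all
 have mc: "mcont S (rh i)" if "i < N" for i by (rule msm_mcont[OF P(2)[OF that]])
 have "chart_integral S c (%x. ka x * rh i x) al = chart_integral S d (%x. ka x * rh i x) al" if i: "i < N" for i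
 proof -
  obtain L where L: "closedin (mtop S) L" "L <= X i" "\<forall>x. x \<notin> L --> rh i x = 0" using P(3)[OF i] by blast
  have v: "vanish S al (%x. ka x * rh i x) (K \<inter> L)"
   using K(4) L(3) unfolding vanish_def by auto
  have "good (X i) \<or> X i \<inter> K = {}" using P(1)[OF i] by simp
  then show ?thesis
  proof
   assume "good (X i)"
   moreover have "closedin (mtop S) (K \<inter> L)" using K(1) L(1) by (rule closedin_Int)
   moreover have "K \<inter> L <= X i" using L(2) by blast
   ultimately show ?thesis using v mcont_mult[OF ka mc[OF i]] unfolding good_def by blast
  next
   assume "X i \<inter> K = {}"
   then have "K \<inter> L = {}" using L(2) by blast
   then show ?thesis using v chart_integral_zero[OF S c] chart_integral_zero[OF S d] by simp
  qed
 qed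
 then show ?thesis
  using chart_integral_split[OF S c comp al ka K(1,2,4) mc] chart_integral_split[OF S d comp al ka K(1,3,4) mc] 2
  by simp
qed

lemma partition_of_unityD:
 assumes S: "omfd S" and p: "partition_of_unity S N cs rh" and i: "i < N"
 shows "cs i \<in> matlas S" "msm S (rh i)"
  "\<exists>K. closedin (mtop S) K & K <= fst (cs i) & (\<forall>x\<in>pts S - K. rh i x = 0)"
proof -
 show "cs i \<in> matlas S" using p i by (simp add: partition_of_unity_def)
 show "msm S (rh i)" unfolding msm_def
  using p i Cinf_opn[OF cim_opn[OF S]] unfolding partition_of_unity_def by blast
 let ?K = "mtop S closure_of {x \<in> pts S. rh i x ~= 0}"
 have "{x \<in> pts S. rh i x ~= 0} <= ?K" by (rule closure_of_subset) auto
 then have "\<forall>x\<in>pts S - ?K. rh i x = 0" by blast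
 moreover have "?K <= fst (cs i)" using p i by (simp add: partition_of_unity_def)
 ultimately show "\<exists>K. closedin (mtop S) K & K <= fst (cs i) & (\<forall>x\<in>pts S - K. rh i x = 0)"
  by (intro exI[of _ ?K]) simp
qed

text \<open>Both sums equal the double sum over products of one member of each partition. Such a
  product is supported in two chart domains, where the integral may be computed in either
  chart.\<close>

lemma partition_of_unity_integral_eq:
 assumes S: "omfd S" and comp: "compact_space (mtop S)" and al: "density S al"
  and p: "partition_of_unity S N cs rh" and q: "partition_of_unity S N' cs' rh'"
 shows "(\<Sum>i<N. chart_integral S (cs i) (rh i) al) = (\<Sum>j<N'. chart_integral S (cs' j) (rh' j) al)"
proof -
 note P = partition_of_unityD[OF S p] and Q = partition_of_unityD[OF S q]
 have v: "\<exists>K. closedin (mtop S) K & K <= fst (cs i) & vanish S al (rh i) K" if "i < N" for i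
  using P(3)[OF that] by (elim ex_forward) (auto simp: vanish_def)
 have v': "\<exists>K. closedin (mtop S) K & K <= fst (cs' j) & vanish S al (rh' j) K" if "j < N'" for j
  using Q(3)[OF that] by (elim ex_forward) (auto simp: vanish_def)
 have s: "(\<Sum>i<N. rh i x) = 1" "(\<Sum>j<N'. rh' j x) = 1" if "x \<in> pts S" for x
  using p q that by (auto simp: partition_of_unity_def)
 have "(\<Sum>i<N. chart_integral S (cs i) (rh i) al) = (\<Sum>i<N. \<Sum>j<N'. chart_integral S (cs i) (%x. rh i x * rh' j x) al)"
 proof (intro sum.cong refl)
  fix i assume "i \<in> {..<N}"
  then have i: "i < N" by simp
  obtain K where K: "closedin (mtop S) K" "K <= fst (cs i)" "vanish S al (rh i) K" using v[OF i] by blast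
  show "chart_integral S (cs i) (rh i) al = (\<Sum>j<N'. chart_integral S (cs i) (%x. rh i x * rh' j x) al)"
   by (rule chart_integral_split[OF S P(1)[OF i] comp al msm_mcont[OF P(2)[OF i]] K msm_mcont[OF Q(2)] s(2)])
 qed
 also have "\<dots> = (\<Sum>j<N'. \<Sum>i<N. chart_integral S (cs i) (%x. rh i x * rh' j x) al)" by (rule sum.swap)
 also have "\<dots> = (\<Sum>j<N'. \<Sum>i<N. chart_integral S (cs' j) (%x. rh' j x * rh i x) al)"
 proof (intro sum.cong refl)
  fix i j assume "i \<in> {..<N}" "j \<in> {..<N'}"
  then have i: "i < N" and j: "j < N'" by auto
  obtain K where K: "closedin (mtop S) K" "K <= fst (cs i)" "\<forall>x\<in>pts S - K. rh i x = 0" using P(3)[OF i] by blast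
  obtain L where L: "closedin (mtop S) L" "L <= fst (cs' j)" "\<forall>x\<in>pts S - L. rh' j x = 0" using Q(3)[OF j] by blast
  have "chart_integral S (cs i) (%x. rh i x * rh' j x) al = chart_integral S (cs' j) (%x. rh i x * rh' j x) al"
  proof (rule chart_integral_independent[OF S comp al _ P(1)[OF i] Q(1)[OF j], where K = "K \<inter> L"])
   show "mcont S (%x. rh i x * rh' j x)" by (intro mcont_mult msm_mcont P(2)[OF i] Q(2)[OF j])
   show "closedin (mtop S) (K \<inter> L)" using K(1) L(1) by (rule closedin_Int)
   show "vanish S al (%x. rh i x * rh' j x) (K \<inter> L)" using K(3) L(3) by (auto simp: vanish_def)
  qed (use K(2) L(2) in blast)+
  then show "chart_integral S (cs i) (%x. rh i x * rh' j x) al = chart_integral S (cs' j) (%x. rh' j x * rh i x) al"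
   by (simp add: mult.commute)
 qed
 also have "\<dots> = (\<Sum>j<N'. chart_integral S (cs' j) (rh' j) al)"
 proof (intro sum.cong refl)
  fix j assume "j \<in> {..<N'}"
  then have j: "j < N'" by simp
  obtain K where K: "closedin (mtop S) K" "K <= fst (cs' j)" "vanish S al (rh' j) K" using v'[OF j] by blast
  show "(\<Sum>i<N. chart_integral S (cs' j) (%x. rh' j x * rh i x) al) = chart_integral S (cs' j) (rh' j) al"
   by (rule chart_integral_split[OF S Q(1)[OF j] comp al msm_mcont[OF Q(2)[OF j]] K msm_mcont[OF P(2)] s(1), symmetric])
 qed
 finally show ?thesis .
qed

text \<open>All partitions give the same sum, so the definite description in
  \<open>mfd_integral\<close> is satisfied by exactly one value once one partition is given.\<close>

lemma mfd_integral_eq: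
 assumes S: "omfd S" and comp: "compact_space (mtop S)" and al: "density S al"
  and p: "partition_of_unity S N cs rh"
 shows "mfd_integral S al = (\<Sum>i<N. chart_integral S (cs i) (rh i) al)"
 unfolding mfd_integral_def
proof (rule the_equality)
 show "\<exists>N' cs' rh'. partition_of_unity S N' cs' rh' &
  (\<Sum>i<N. chart_integral S (cs i) (rh i) al) = (\<Sum>i<N'. chart_integral S (cs' i) (rh' i) al)" using p by blast
 show "I = (\<Sum>i<N. chart_integral S (cs i) (rh i) al)"
  if "\<exists>N cs rh. partition_of_unity S N cs rh & I = (\<Sum>i<N. chart_integral S (cs i) (rh i) al)" for I
  using that partition_of_unity_integral_eq[OF S comp al _ p] by blast
qed

section \<open>Smooth maps and densities obtained by pulling back\<close>

lemma smooth_map_compose: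
 assumes S: "omfd S" and M: "omfd M" and N: "omfd N"
  and f: "smooth_map S M f" and g: "smooth_map M N g"
 shows "smooth_map S N (%x. g (f x))"
proof -
 have fc: "continuous_map (mtop S) (mtop M) f" and gc: "continuous_map (mtop M) (mtop N) g"
  using f g by (simp_all add: smooth_map_def)
 have gf: "continuous_map (mtop S) (mtop N) (%x. g (f x))"
  using continuous_map_compose[OF fc gc] by (simp add: o_def)
 have "Ck (mdim S) (ldom c d (%x. g (f x))) r (%y. lrep c d (%x. g (f x)) y i)"
  if c: "c \<in> matlas S" and d: "d \<in> matlas N" for c d r i
 proof (rule Ck_local[OF ldom_opn[OF S c N d gf]])
  fix y assume y: "y \<in> ldom c d (%x. g (f x))"
  then have yc: "y \<in> cim c" by (simp add: ldom_eq[OF S c])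
  have "cinv c y \<in> pts S" using cinv_in[OF S c yc] chart_subset[OF S c] by blast
  then have "f (cinv c y) \<in> pts M" using fc by (auto simp: continuous_map_def)
  then obtain e where e: "e \<in> matlas M" "f (cinv c y) \<in> fst e" using ex_chart[OF M] by blast
  let ?V = "ldom c d (%x. g (f x)) \<inter> ldom c e f"
  note oe = ldom_opn[OF S c M e(1) fc]
  have V: "opn (mdim S) ?V" by (intro openin_Int ldom_opn[OF S c N d gf] oe)
  have yV: "y \<in> ?V" using y yc e by (simp add: ldom_eq[OF S c])
  have fe: "cinv e (lrep c e f y') = f (cinv c y')" if "y' \<in> ?V" for y'
   using that by (simp add: lrep_def ldom_eq[OF S c] cinv_snd[OF M e(1)])
  have "Ck (mdim S) ?V r (%y. lrep e d g (lrep c e f y) i)"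
  proof (rule Ck_compose[where f = "%z. lrep e d g z i" and \<phi> = "lrep c e f",
     OF V ldom_opn[OF M e(1) N d gc] lrep_Ck[OF M e(1) N d g]])
   show "Ck (mdim S) ?V r (%y. lrep c e f y j)" for j
    by (rule Ck_subset[OF lrep_Ck[OF S c M e(1) f] oe V]) simp
   show "lrep c e f ` ?V <= ldom e d g"
    using fe lrep_in[OF S c, of _ e f] by (auto simp: ldom_eq[OF M e(1)] ldom_eq[OF S c, of d] simp del: split_paired_All)
  qed
  moreover have "lrep e d g (lrep c e f y') i = lrep c d (%x. g (f x)) y' i" if "y' \<in> ?V" for y'
   using fe[OF that] by (simp add: lrep_def[of e] lrep_def[of c d])
  ultimately show "\<exists>V h. opn (mdim S) V & y \<in> V & Ck (mdim S) V r h &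
    (\<forall>y\<in>ldom c d (%x. g (f x)) \<inter> V. h y = lrep c d (%x. g (f x)) y i)"
   using V yV by (intro exI[of _ ?V] exI[of _ "%y. lrep e d g (lrep c e f y) i"]) auto
 qed
 then show ?thesis using gf Cinf_opn[OF ldom_opn[OF S _ N _ gf]] by (simp add: smooth_map_def lsmooth_def)
qed

text \<open>Only the values on the points of \<open>S\<close> count. Reparametrisations and
  diffeomorphism actions identify maps on points only.\<close>

lemma smooth_map_cong:
 assumes S: "omfd S" and f: "smooth_map S M f" and e: "!!x. x \<in> pts S ==> f x = g x"
 shows "smooth_map S M g"
 unfolding smooth_map_def
proof (intro conjI ballI)
 show "continuous_map (mtop S) (mtop M) g"
  using f e unfolding smooth_map_def by (metis continuous_map_eq)
 fix c d assume c: "c \<in> matlas S" and d: "d \<in> matlas M"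
 have fg: "f x = g x" if "x \<in> fst c" for x using e chart_subset[OF S c] that by blast
 have l: "ldom c d g = ldom c d f" using fg unfolding ldom_def by (metis (mono_tags, lifting))
 have r: "lrep c d f y = lrep c d g y" if "y \<in> ldom c d f" for y
  using that fg cinv_in[OF S c] by (simp add: ldom_eq[OF S c] lrep_def)
 have "Cinf (mdim S) (ldom c d f) (%y. lrep c d g y i)" if "i < mdim M" for i
 proof -
  have "Cinf (mdim S) (ldom c d f) (%y. lrep c d f y i)"
   using f c d that by (simp add: smooth_map_def lsmooth_def)
  then show ?thesis unfolding Cinf_def using r by (metis IntD1)
 qed
 then show "lsmooth (mdim S) (mdim M) c d g" by (simp add: lsmooth_def l)
qed

lemma density_pull:
 assumes S: "omfd S" and M: "omfd M" and f: "smooth_map S M f"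
  and al: "diff_form M (length us + mdim S) al" and us: "!!u. u \<in> set us ==> field_along S M f u"
 shows "density S (%x ws. al (f x) (map (%u. u x) us @ map (tmap S M f x) ws))"
 unfolding density_def
proof (intro ballI conjI)
 fix c assume c: "c \<in> matlas S"
 show "altform (mdim S) (mdim S) (%vs. al (f x) (map (%u. u x) us @ map (tmap S M f x) (map (cvec S c x) vs)))"
  if x: "x \<in> fst c" for x
 proof (rule tform_pull[OF S c M f x])
  have xS: "x \<in> pts S" using chart_subset[OF S c] x by blast
  have fx: "f x \<in> pts M" using f xS by (auto simp: smooth_map_def continuous_map_def)
  have "tform M (f x) (length (map (%u. u x) us) + mdim S) (al (f x))"
   using diff_form_tform[OF al fx] by simp
  moreover have "set (map (%u. u x) us) <= tspace M (f x)"
   using us xS by (auto simp: field_along_def)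
  ultimately show "tform M (f x) (mdim S) (%ws. al (f x) (map (%u. u x) us @ ws))"
   by (rule tform_append)
 qed
 have "[0..<mdim S] \<in> idx (mdim S) (mdim S)" by (auto simp: idx_def)
 from Ck_continuous[OF pull_coef_Ck[OF S c M f al us this, of 0]]
 show "continuous_on (cim c) (%y. cf S (%x ws. al (f x) (map (%u. u x) us @ map (tmap S M f x) ws)) c (cinv c y))"
  by (simp add: cf_def)
qed

lemma chart_integral_cong:
 assumes S: "omfd S" "c \<in> matlas S" and e: "!!x. x \<in> fst c ==> cf S al c x = cf S \<beta> c x"
 shows "chart_integral S c ka al = chart_integral S c ka \<beta>"
proof -
 have "cint S c ka al = cint S c ka \<beta>"
  using e cinv_in[OF S] by (simp add: cint_def[abs_def] cong: if_cong)
 then show ?thesis by (simp add: chart_integral_RInt)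
qed

lemma mfd_integral_cong:
 assumes S: "omfd S" and e: "!!c x. c \<in> matlas S ==> x \<in> fst c ==> cf S al c x = cf S \<beta> c x"
 shows "mfd_integral S al = mfd_integral S \<beta>"
proof -
 have "(\<Sum>i<N. chart_integral S (cs i) (rh i) al) = (\<Sum>i<N. chart_integral S (cs i) (rh i) \<beta>)"
  if "partition_of_unity S N cs rh" for N cs rh
  using that by (intro sum.cong refl chart_integral_cong[OF S _ e]) (auto simp: partition_of_unity_def)
 then have "(%I. \<exists>N cs rh. partition_of_unity S N cs rh & I = (\<Sum>i<N. chart_integral S (cs i) (rh i) al)) =
   (%I. \<exists>N cs rh. partition_of_unity S N cs rh & I = (\<Sum>i<N. chart_integral S (cs i) (rh i) \<beta>))"
  by (intro ext) (simp cong: conj_cong)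
 then show ?thesis unfolding mfd_integral_def by simp
qed

section \<open>Invariance of the integral under orientation preserving diffeomorphisms\<close>

lemma jdet_id:
 assumes S: "opn n (ldom c d f)" and x: "x \<in> fst c" "f x \<in> fst d" and e: "!!y. y \<in> ldom c d f ==> lrep c d f y = y"
 shows "jdet n c d f x = 1"
proof -
 have i: "snd c x \<in> ldom c d f" using x by (auto simp: ldom_def)
 have "ljac c d f x i j = (if i = j then 1 else 0)" if j: "j < n" for i j
 proof -
  have "ljac c d f x i j = pd (ldom c d f) j (%y. y i) (snd c x)" unfolding ljac_def
   by (rule pd_cong[OF S j i]) (simp add: e)
  also have "\<dots> = (if i = j then 1 else 0)" by (rule pd_eq[OF S i j]) (auto intro!: derivative_eq_intros)
  finally show ?thesis .
 qed
 then have "Matrix.mat n n (%(i, j). ljac c d f x i j) = 1\<^sub>m n" by (auto intro!: eq_matI)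
 then show ?thesis by (simp add: jdet_def)
qed

lemma oriented_diffeo_id:
 assumes S: "omfd S" shows "oriented_diffeo S S (%x. x)"
 unfolding oriented_diffeo_def diffeo_def
proof (intro conjI ballI impI)
 show "bij_betw (%x. x) (pts S) (pts S)" by (simp add: bij_betw_def)
 show "smooth_map S S (%x. x)" by (rule smooth_id[OF S])
 show "smooth_map S S (inv_into (pts S) (%x. x))"
  by (rule smooth_map_cong[OF S smooth_id[OF S]]) (simp add: inv_into_f_eq)
 fix c d p assume c: "c \<in> matlas S" and d: "d \<in> matlas S" and p: "p \<in> fst c" "p \<in> fst d"
 let ?j = "jdet (mdim S) c d (%x. x) p"
 have "morient S d p = sgn ?j * morient S c p" using S c d p unfolding oriented_mfd_def by blast
 moreover have "morient S d p \<in> {1, -1}" "morient S c p \<in> {1, -1}" using S c d p unfolding oriented_mfd_def by blast+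
 ultimately show "morient S c p = sgn ?j * morient S d p" by (auto simp: sgn_if split: if_splits)
qed

definition tchart :: "'b smfd => ('b => 'a) => 'a chart => 'b chart"
 where "tchart S' f c = ({x \<in> pts S'. f x \<in> fst c}, %x. snd c (f x))"

locale diffeo_transport =
 fixes S' :: "'b smfd" and S :: "'a smfd" and f
 assumes S': "omfd S'" and S: "omfd S" and dim: "mdim S' = mdim S"
  and od: "oriented_diffeo S' S f"
begin

definition g where "g = inv_into (pts S') f"

lemma fsm: "smooth_map S' S f" and gsm: "smooth_map S S' g"
 and gf: "!!x. x \<in> pts S' ==> g (f x) = x"
 and fg: "!!x. x \<in> pts S ==> f (g x) = x"
 and fS: "!!x. x \<in> pts S' ==> f x \<in> pts S"
 and gS: "!!x. x \<in> pts S ==> g x \<in> pts S'"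
proof -
 have b: "bij_betw f (pts S') (pts S)" and s: "smooth_map S' S f" and s': "smooth_map S S' g"
  using od unfolding oriented_diffeo_def diffeo_def g_def by blast+
 show "smooth_map S' S f" "smooth_map S S' g" by (rule s, rule s')
 show "g (f x) = x" if "x \<in> pts S'" for x using b that by (simp add: g_def bij_betw_inv_into_left)
 show "f (g x) = x" if "x \<in> pts S" for x using b that by (simp add: g_def bij_betw_inv_into_right)
 show "f x \<in> pts S" if "x \<in> pts S'" for x using b that by (auto simp: bij_betw_def)
 show "g x \<in> pts S'" if "x \<in> pts S" for x
  using bij_betw_inv_into[OF b] that by (auto simp: g_def bij_betw_def)
qed

lemma fcont: "continuous_map (mtop S') (mtop S) f" and gcont: "continuous_map (mtop S) (mtop S') g"
 using fsm gsm by (auto simp: smooth_map_def)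

lemma fst_tchart: "fst (tchart S' f c) = {x \<in> pts S'. f x \<in> fst c}"
 and snd_tchart: "snd (tchart S' f c) x = snd c (f x)"
 by (simp_all add: tchart_def)

lemma g_in: "c \<in> matlas S ==> x \<in> fst c ==> g x \<in> fst (tchart S' f c)" "c \<in> matlas S ==> x \<in> fst c ==> f (g x) = x"
proof -
 assume c: "c \<in> matlas S" and x: "x \<in> fst c"
 then have "x \<in> pts S" using chart_subset[OF S c] by blast
 then show "g x \<in> fst (tchart S' f c)" "f (g x) = x" using x gS fg by (auto simp: fst_tchart)
qed

lemma cim_tchart:
 assumes c: "c \<in> matlas S" shows "cim (tchart S' f c) = cim c"
proof (intro subset_antisym subsetI)
 fix y assume "y \<in> cim c"
 then obtain x where x: "x \<in> fst c" "y = snd c x" by blast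
 show "y \<in> cim (tchart S' f c)"
  by (rule image_eqI[of _ _ "g x"]) (use g_in[OF c x(1)] x in \<open>auto simp: snd_tchart\<close>)
qed (auto simp: fst_tchart snd_tchart)

lemma cinv_tchart:
 assumes c: "c \<in> matlas S" and y: "y \<in> cim c" shows "cinv (tchart S' f c) y = g (cinv c y)"
 unfolding cinv_def[of "tchart S' f c"]
proof (rule inv_into_f_eq)
 show "inj_on (snd (tchart S' f c)) (fst (tchart S' f c))"
 proof (rule inj_onI)
  fix a b assume a: "a \<in> fst (tchart S' f c)" and b: "b \<in> fst (tchart S' f c)"
   and e: "snd (tchart S' f c) a = snd (tchart S' f c) b"
  have "f a = f b" using inj_onD[OF chart_inj[OF S c]] a b e by (simp add: fst_tchart snd_tchart)
  then show "a = b" using gf a b by (metis (mono_tags, lifting) fst_tchart mem_Collect_eq)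
 qed
 show "g (cinv c y) \<in> fst (tchart S' f c)" by (rule g_in(1)[OF c cinv_in[OF S c y]])
 show "snd (tchart S' f c) (g (cinv c y)) = y"
  by (simp add: snd_tchart g_in(2)[OF c cinv_in[OF S c y]] snd_cinv[OF S c y])
qed

text \<open>Maximality of the atlas reduces the claim to compatibility with the charts of
  \<open>S'\<close>, and the transition maps are coordinate expressions of \<open>f\<close> and its
  inverse \<open>g\<close>.\<close>

lemma tchart_atlas:
 assumes c: "c \<in> matlas S" shows "tchart S' f c \<in> matlas S'"
proof -
 let ?c = "tchart S' f c"
 have "matlas S' = max_atlas (Rn (mdim S')) (mtop S') (mdim S') (matlas S')"
  using S' by (simp add: oriented_mfd_def)
 moreover have "is_chart (Rn (mdim S')) (mtop S') ?c"
  unfolding is_chart_def cim_tchart[OF c]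
 proof (intro conjI)
  show o: "openin (mtop S') (fst ?c)" unfolding fst_tchart
   by (rule openin_continuous_map_preimage[OF fcont chart_open[OF S c]])
  show "opn (mdim S') (cim c)" using cim_opn[OF S c] by (simp add: dim)
  have ts: "topspace (subtopology (mtop S') (fst ?c)) = fst ?c" using openin_subset[OF o] by auto
  have "homeomorphic_maps (subtopology (mtop S') (fst ?c)) (top_of_set (cim c)) (snd ?c) (%y. g (cinv c y))"
   unfolding homeomorphic_maps_def ts
  proof (intro conjI ballI)
   have "continuous_map (subtopology (mtop S') (fst ?c)) (subtopology (mtop S) (fst c)) f"
    using fcont by (auto simp: continuous_map_in_subtopology fst_tchart continuous_map_from_subtopology)
   from continuous_map_compose[OF this chart_cont[OF S c]]
   show "continuous_map (subtopology (mtop S') (fst ?c)) (top_of_set (cim c)) (snd ?c)"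
    by (simp add: o_def tchart_def)
   have "continuous_map (top_of_set (cim c)) (mtop S') (%y. g (cinv c y))"
    using continuous_map_compose[OF cinv_cont[OF S c] gcont] by (simp add: o_def)
   then show "continuous_map (top_of_set (cim c)) (subtopology (mtop S') (fst ?c)) (%y. g (cinv c y))"
    using g_in(1)[OF c] cinv_in[OF S c] by (auto simp: continuous_map_in_subtopology)
   show "g (cinv c (snd ?c x)) = x" if "x \<in> fst ?c" for x
    using that cinv_snd[OF S c] gf by (simp add: fst_tchart snd_tchart)
   show "snd ?c (g (cinv c y)) = y" if "y \<in> topspace (top_of_set (cim c))" for y
   proof -
    have y: "y \<in> cim c" using that by simp
    show ?thesis by (simp add: snd_tchart g_in(2)[OF c cinv_in[OF S c y]] snd_cinv[OF S c y])
   qed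
  qed
  then show "homeomorphic_map (subtopology (mtop S') (fst ?c)) (top_of_set (cim c)) (snd ?c)"
   by (rule homeomorphic_maps_imp_map)
 qed
 moreover have "chart_compat (mdim S') ?c d" if d: "d \<in> matlas S'" for d
  unfolding chart_compat_def
 proof
  have l: "ldom ?c d (%p. p) = ldom c d g"
  proof (intro subset_antisym subsetI)
   fix y assume "y \<in> ldom ?c d (%p. p)"
   then obtain x where x: "x \<in> fst ?c" "x \<in> fst d" "y = snd c (f x)" unfolding ldom_def snd_tchart by blast
   then show "y \<in> ldom c d g" unfolding ldom_def using gf by (auto simp: fst_tchart intro!: image_eqI[of _ _ "f x"])
  next
   fix y assume "y \<in> ldom c d g"
   then obtain x where x: "x \<in> fst c" "g x \<in> fst d" "y = snd c x" unfolding ldom_def by blast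
   then show "y \<in> ldom ?c d (%p. p)" unfolding ldom_def
    using g_in[OF c x(1)] by (auto simp: snd_tchart intro!: image_eqI[of _ _ "g x"])
  qed
  have o: "opn (mdim S) (ldom c d g)" by (rule ldom_opn[OF S c S' d gcont])
  have e: "lrep c d g y = lrep ?c d (%p. p) y" if "y \<in> ldom c d g" for y
   using that by (simp add: lrep_def cinv_tchart[OF c] ldom_eq[OF S c])
  show "lsmooth (mdim S') (mdim S') ?c d (%p. p)"
   unfolding lsmooth_def l dim Cinf_opn[OF o]
  proof (intro allI impI)
   fix i r
   show "Ck (mdim S) (ldom c d g) r (%y. lrep ?c d (%p. p) y i)"
    by (rule Ck_cong[OF o _ lrep_Ck[OF S c S' d gsm, of r i]]) (simp add: e)
  qed
  have l': "ldom d ?c (%p. p) = ldom d c f" using chart_subset[OF S' d] by (auto simp: ldom_def fst_tchart)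
  have "lsmooth (mdim S') (mdim S) d c f" using fsm c d by (simp add: smooth_map_def)
  then show "lsmooth (mdim S') (mdim S') d ?c (%p. p)"
   unfolding lsmooth_def l' dim by (simp add: lrep_def snd_tchart)
 qed
 ultimately show ?thesis unfolding max_atlas_def by blast
qed

text \<open>Between a chart and its transport the map \<open>f\<close> is the identity in
  coordinates, with Jacobi determinant 1, so preservation of orientation means equality of
  signs.\<close>

lemma morient_tchart:
 assumes c: "c \<in> matlas S" and x: "x \<in> fst c"
 shows "morient S' (tchart S' f c) (g x) = morient S c x"
proof -
 let ?c = "tchart S' f c"
 have fx: "f (g x) \<in> fst c" using g_in[OF c x] x by simp
 have "morient S' ?c (g x) = sgn (jdet (mdim S') ?c c f (g x)) * morient S c (f (g x))"
  using od tchart_atlas[OF c] c g_in(1)[OF c x] fx unfolding oriented_diffeo_def by blast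
 moreover have "jdet (mdim S') ?c c f (g x) = 1"
 proof (rule jdet_id[OF ldom_opn[OF S' tchart_atlas[OF c] S c fcont] g_in(1)[OF c x] fx])
  fix y assume "y \<in> ldom ?c c f"
  then have "y \<in> cim ?c" unfolding ldom_eq[OF S' tchart_atlas[OF c]] by blast
  then have y: "y \<in> cim c" unfolding cim_tchart[OF c] .
  show "lrep ?c c f y = y"
   by (simp add: lrep_def cinv_tchart[OF c y] g_in(2)[OF c cinv_in[OF S c y]] snd_cinv[OF S c y])
 qed
 ultimately show ?thesis using g_in(2)[OF c x] by simp
qed

lemma tmap_tchart:
 assumes c: "c \<in> matlas S" and x: "x \<in> fst c" and M: "omfd M"
  and s: "smooth_map S M s" and s': "smooth_map S' M s'" and e: "!!x. x \<in> pts S' ==> s' x = s (f x)"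
  and j: "j < mdim S"
 shows "tmap S' M s' (g x) (cbasis S' (tchart S' f c) (g x) j) = tmap S M s x (cbasis S c x j)"
proof -
 let ?c = "tchart S' f c"
 have xS: "x \<in> pts S" using chart_subset[OF S c] x by blast
 have sx: "s' (g x) = s x" using e[OF gS[OF xS]] fg[OF xS] by simp
 have "s x \<in> pts M" using s xS by (auto simp: smooth_map_def continuous_map_def)
 then obtain d where d: "d \<in> matlas M" "s x \<in> fst d" using ex_chart[OF M] by blast
 have sc: "continuous_map (mtop S) (mtop M) s" using s by (simp add: smooth_map_def)
 have sg: "s' (g z) = s z" if "z \<in> fst c" for z
 proof -
  have "z \<in> pts S" using that chart_subset[OF S c] by blast
  then show ?thesis using e[OF gS] fg by simp
 qed
 have l: "ldom ?c d s' = ldom c d s"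
  unfolding ldom_eq[OF S' tchart_atlas[OF c]] ldom_eq[OF S c] cim_tchart[OF c]
  using cinv_tchart[OF c] sg cinv_in[OF S c] by auto
 have "ljac ?c d s' (g x) i j = ljac c d s x i j" for i
 proof -
  have "pd (ldom c d s) j (%y. lrep ?c d s' y i) (snd c x) = pd (ldom c d s) j (%y. lrep c d s y i) (snd c x)"
  proof (rule pd_cong[OF ldom_opn[OF S c M d(1) sc] j])
   show "snd c x \<in> ldom c d s" using x d(2) by (auto simp: ldom_def)
   fix y assume "y \<in> ldom c d s"
   then have "y \<in> cim c" by (simp add: ldom_eq[OF S c])
   then show "lrep ?c d s' y i = lrep c d s y i"
    by (simp add: lrep_def cinv_tchart[OF c] sg cinv_in[OF S c])
  qed
  then show ?thesis by (simp add: ljac_def l snd_tchart g_in(2)[OF c x])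
 qed
 moreover have "tmap S' M s' (g x) (cbasis S' ?c (g x) j) = cvec M d (s' (g x)) (%i. ljac ?c d s' (g x) i j)"
  by (rule tmap_cbasis(1)[OF S' tchart_atlas[OF c] M d(1) s' g_in(1)[OF c x]]) (use sx d j dim in auto)
 moreover have "tmap S M s x (cbasis S c x j) = cvec M d (s x) (%i. ljac c d s x i j)"
  by (rule tmap_cbasis(1)[OF S c M d(1) s x d(2) j])
 ultimately show ?thesis by (simp add: sx)
qed

text \<open>Charts and partition of unity are transported along \<open>f\<close>. In corresponding
  charts the two integrands are then the same function on coordinate space, so no substitution takes
  place.\<close>

lemma transport_integral:
 assumes comp: "compact_space (mtop S)" and comp': "compact_space (mtop S')"
  and M: "omfd M"
  and s: "smooth_map S M s" and s': "smooth_map S' M s'" and e: "!!x. x \<in> pts S' ==> s' x = s (f x)"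
  and d: "density S (pullback S M s \<beta>)" and d': "density S' (pullback S' M s' \<beta>)"
 shows "mfd_integral S' (pullback S' M s' \<beta>) = mfd_integral S (pullback S M s \<beta>)"
proof -
 have cov: "pts S <= (\<Union>c\<in>matlas S. fst c)" using S by (simp add: oriented_mfd_def)
 obtain N cs rh where p: "partition_of_unity S N cs rh"
  using partition_of_unity_exists[OF S comp subset_refl cov] by blast
 note P = partition_of_unityD[OF S p]
 have p': "partition_of_unity S' N (%i. tchart S' f (cs i)) (%i x. rh i (f x))"
  unfolding partition_of_unity_def
 proof (intro conjI allI impI ballI)
  fix i assume i: "i < N"
  show "tchart S' f (cs i) \<in> matlas S'" by (rule tchart_atlas[OF P(1)[OF i]])
  show "0 <= rh i (f x)" if "x \<in> pts S'" for x
   using p i fS[OF that] by (simp add: partition_of_unity_def)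
  show "Cinf (mdim S') (cim c) (%y. rh i (f (cinv c y)))" if c: "c \<in> matlas S'" for c
   unfolding Cinf_opn[OF cim_opn[OF S' c]] using msm_Ck[OF msm_compose[OF S' S fsm P(2)[OF i]] c] by blast
  obtain K where K: "closedin (mtop S) K" "K <= fst (cs i)" "\<forall>x\<in>pts S - K. rh i x = 0"
   using P(3)[OF i] by blast
  let ?K = "{x \<in> pts S'. f x \<in> K}"
  have "closedin (mtop S') ?K" by (rule closedin_continuous_map_preimage[OF fcont K(1)])
  moreover have "{x \<in> pts S'. rh i (f x) ~= 0} <= ?K" using K(3) fS by auto
  ultimately have "mtop S' closure_of {x \<in> pts S'. rh i (f x) ~= 0} <= ?K"
   by (intro closure_of_minimal)
  then show "mtop S' closure_of {x \<in> pts S'. rh i (f x) ~= 0} <= fst (tchart S' f (cs i))"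
   using K(2) unfolding fst_tchart by blast
 next
  show "(\<Sum>i<N. rh i (f x)) = 1" if "x \<in> pts S'" for x
   using p fS[OF that] by (simp add: partition_of_unity_def)
 qed
 have "chart_integral S' (tchart S' f c) (%x. ka (f x)) (pullback S' M s' \<beta>) = chart_integral S c ka (pullback S M s \<beta>)"
  if c: "c \<in> matlas S" for c ka
 proof -
  have "cint S' (tchart S' f c) (%x. ka (f x)) (pullback S' M s' \<beta>) y = cint S c ka (pullback S M s \<beta>) y" for y
  proof (cases "y \<in> cim c")
   case True
   define x where "x = cinv c y"
   have x: "x \<in> fst c" using cinv_in[OF S c True] by (simp add: x_def)
   have xS: "x \<in> pts S" using chart_subset[OF S c] x by blast
   have "s' (g x) = s x" using e[OF gS[OF xS]] fg[OF xS] by simp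
   moreover have "map (tmap S' M s' (g x)) (map (cbasis S' (tchart S' f c) (g x)) [0..<mdim S']) =
     map (tmap S M s x) (map (cbasis S c x) [0..<mdim S])"
    using tmap_tchart[OF c x M s s' e] by (simp add: dim)
   ultimately have "cf S' (pullback S' M s' \<beta>) (tchart S' f c) (g x) = cf S (pullback S M s \<beta>) c x"
    unfolding cf_def pullback_def by (simp only:)
   moreover have "cinv (tchart S' f c) y = g x" "cinv c y = x" by (simp_all add: cinv_tchart[OF c True] x_def)
   ultimately show ?thesis using True
    by (simp add: cint_def cim_tchart[OF c] morient_tchart[OF c x] g_in(2)[OF c x])
  qed (simp add: cint_def cim_tchart[OF c])
  then have "cint S' (tchart S' f c) (%x. ka (f x)) (pullback S' M s' \<beta>) = cint S c ka (pullback S M s \<beta>)"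
   by (rule ext)
  then show ?thesis by (simp add: chart_integral_RInt dim)
 qed
 then show ?thesis
  unfolding mfd_integral_eq[OF S comp d p] mfd_integral_eq[OF S' comp' d' p']
  using P(1) by (intro sum.cong refl) simp
qed

end

section \<open>Integrals over points of the Grassmannian\<close>

text \<open>All representatives of a class have the same integral by
  \<open>transport_integral\<close>, so the definite description in \<open>gr_integral\<close> is
  met. The density hypothesis is about every representative, since each has its own definite
  description.\<close>

lemma gr_integral_class:
 fixes S :: "'s smfd"
 assumes S: "compact_oriented Rn (mdim S) S" and M: "omfd M" and s: "embedding S M s"
  and dens: "!!(S' :: 's smfd) s'. omfd S' ==> mdim S' = mdim S ==> smooth_map S' M s' ==>
   density S' (pullback S' M s' \<beta>)"
 shows "gr_integral M \<beta> (gr_class M S s) = mfd_integral S (pullback S M s \<beta>)"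
 unfolding gr_integral_def
proof (rule the_equality)
 have So: "omfd S" "compact_space (mtop S)" using S by (auto simp: compact_oriented_def)
 have ss: "smooth_map S M s" using s by (simp add: embedding_def)
 have inv: "mfd_integral S' (pullback S' M s' \<beta>) = mfd_integral S (pullback S M s \<beta>)"
  if mem: "(S', s') \<in> gr_class M S s" for S' s'
 proof -
  obtain f where f: "compact_oriented Rn (mdim S) S'" "embedding S' M s'" "oriented_diffeo S' S f"
   "\<forall>x\<in>pts S'. s' x = s (f x)" using mem unfolding gr_class_def by blast
  have So': "omfd S'" "compact_space (mtop S')" "mdim S' = mdim S" using f(1) by (auto simp: compact_oriented_def)
  have ss': "smooth_map S' M s'" using f(2) by (simp add: embedding_def)
  interpret diffeo_transport S' S f by unfold_locales (use So So' f in auto)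
  show ?thesis
   by (rule transport_integral[OF So(2) So'(2) M ss ss' _ dens[OF So(1) refl ss] dens[OF So'(1,3) ss']]) (use f in auto)
 qed
 show "\<forall>(S', s')\<in>gr_class M S s. mfd_integral S (pullback S M s \<beta>) = mfd_integral S' (pullback S' M s' \<beta>)"
  using inv by auto
 have "(S, s) \<in> gr_class M S s"
  using S s oriented_diffeo_id[OF So(1)] by (auto simp: gr_class_def)
 then show "r = mfd_integral S (pullback S M s \<beta>)"
  if "\<forall>(S', s')\<in>gr_class M S s. r = mfd_integral S' (pullback S' M s' \<beta>)" for r
  using that by blast
qed

text \<open>This is the well-definedness of \<open>\<eta>\<close>. Equal fundamental fields differ
  along \<open>gm\<close> by the image of a vector \<open>w\<close> tangent to \<open>S\<close>, and
  with \<open>w\<close> inserted all \<open>k + 1\<close> arguments of \<open>\<nu>\<close> come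
  from a space of dimension \<open>k\<close>.\<close>

lemma gr_integral_tangential:
 assumes M: "omfd M" and dim: "mdim M = k + 2" and \<nu>: "diff_form M (mdim M - 1) \<nu>"
  and G: "!!S gm. (S, gm) \<in> G ==> compact_oriented Rn k S & smooth_map S M gm"
  and u: "vector_field M u" and v: "vector_field M v" and e: "fundamental M u G = fundamental M v G"
 shows "gr_integral M (contract u \<nu>) G = gr_integral M (contract v \<nu>) G"
proof -
 have "mfd_integral S (pullback S M gm (contract u \<nu>)) = mfd_integral S (pullback S M gm (contract v \<nu>))"
  if SG: "(S, gm) \<in> G" for S gm
 proof -
  have S: "omfd S" "mdim S = k" and gm: "smooth_map S M gm"
   using G[OF SG] by (auto simp: compact_oriented_def)
  have fu: "field_along S M gm (%x. u (gm x))" by (rule vector_field_along[OF S(1) M gm u])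
  have zero: "\<exists>w\<in>tspace S x. \<forall>d i. (0::real) = 0 + tmap S M gm x w d i" for x
   by (intro bexI[of _ "%_ _. 0"]) (auto simp: tmap_def tspace_def Rn_iff)
  have "equal_mod_tangential S M gm (%x. u (gm x)) (%x. u (gm x))"
   using zero unfolding equal_mod_tangential_def by simp
  then have "(S, gm, %x. u (gm x)) \<in> fundamental M u G" using SG fu by (simp add: fundamental_def)
  then have eq: "equal_mod_tangential S M gm (%x. u (gm x)) (%x. v (gm x))" unfolding e by (simp add: fundamental_def)
  show ?thesis
  proof (rule mfd_integral_cong[OF S(1)])
   fix c x assume c: "c \<in> matlas S" and x: "x \<in> fst c"
   have xS: "x \<in> pts S" using chart_subset[OF S(1) c] x by blast
   have gmx: "gm x \<in> pts M" using gm xS by (auto simp: smooth_map_def continuous_map_def)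
   obtain w where w: "w \<in> tspace S x" "\<forall>d i. u (gm x) d i = v (gm x) d i + tmap S M gm x w d i"
    using eq xS unfolding equal_mod_tangential_def by blast
   have uv: "u (gm x) = (%d i. v (gm x) d i + 1 * tmap S M gm x w d i)" using w(2) by (simp add: fun_eq_iff)
   let ?ws = "map (tmap S M gm x) (map (cbasis S c x) [0..<mdim S])"
   have deg: "mdim M - 1 = Suc (mdim S)" using dim S(2) by simp
   have tf: "tform M (gm x) (Suc (mdim S)) (\<nu> (gm x))" using diff_form_tform[OF \<nu> gmx] unfolding deg .
   have vT: "v (gm x) \<in> tspace M (gm x)" using v gmx by (simp add: vector_field_def field_along_def)
   have wT: "tmap S M gm x z \<in> tspace M (gm x)" for z by (rule tmap_tspace[OF S(1) M gm xS])
   have "\<nu> (gm x) ((v (gm x) # ?ws)[0 := (%d i. v (gm x) d i + 1 * tmap S M gm x w d i)]) =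
     \<nu> (gm x) ((v (gm x) # ?ws)[0 := v (gm x)]) + 1 * \<nu> (gm x) ((v (gm x) # ?ws)[0 := tmap S M gm x w])"
    by (rule tf[unfolded tform_def, rule_format, THEN conjunct1, rule_format]) (use vT wT in auto)
   then have 1: "\<nu> (gm x) (u (gm x) # ?ws) = \<nu> (gm x) (v (gm x) # ?ws) + \<nu> (gm x) (tmap S M gm x w # ?ws)"
    unfolding uv by simp
   have A: "\<nu> (gm x) (map (tmap S M gm x) (map (cvec S c x) (w c # map unitv [0..<mdim S]))) = 0"
   proof (rule altform_zero_degree[OF tform_pull[OF S(1) c M gm x tf]])
    show "set (w c # map unitv [0..<mdim S]) <= Rn (mdim S)"
     using tspaceD(2)[OF w(1) c] unitv_Rn by auto
   qed auto
   have B: "map (tmap S M gm x) (map (cvec S c x) (w c # map unitv [0..<mdim S])) = tmap S M gm x w # ?ws"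
    by (simp add: tspace_cvec[OF S(1) c x w(1)] cbasis_unitv)
   have "\<nu> (gm x) (tmap S M gm x w # ?ws) = 0" using A unfolding B .
   then show "cf S (pullback S M gm (contract u \<nu>)) c x = cf S (pullback S M gm (contract v \<nu>)) c x"
    using 1 by (simp add: cf_def pullback_def contract_def)
  qed
 qed
 \<comment> \<open>The two predicates under the definite description coincide, so the values agree
   without a proof that such a value exists.\<close>
 then have "(%r. \<forall>(S, gm)\<in>G. r = mfd_integral S (pullback S M gm (contract u \<nu>))) =
   (%r. \<forall>(S, gm)\<in>G. r = mfd_integral S (pullback S M gm (contract v \<nu>)))"
  by (intro ext) (simp add: case_prod_beta Ball_def)
 then show ?thesis by (simp add: gr_integral_def)
qed

section \<open>Local criteria for smoothness and openness\<close>

text \<open>\<open>vector_field\<close> speaks about coordinates in one chart as functions on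
  another. Equal charts suffice, because the Jacobi matrix of the transition map supplies the other
  pairs.\<close>

lemma vector_fieldI:
 assumes M: "omfd M" and t: "!!p. p \<in> pts M ==> u p \<in> tspace M p"
  and s: "!!c i r. c \<in> matlas M ==> i < mdim M ==> Ck (mdim M) (cim c) r (%z. u (cinv c z) c i)"
 shows "vector_field M u"
 unfolding vector_field_def field_along_def
proof (intro conjI ballI allI impI t)
 fix c d i assume c: "c \<in> matlas M" and d: "d \<in> matlas M" and i: "i < mdim M"
 let ?A = "ldom c d (%p. p)"
 have o: "opn (mdim M) ?A" by (rule ldom_opn[OF M c M d]) (simp add: continuous_map_id[unfolded id_def])
 show "Cinf (mdim M) ?A (%y. u (cinv c y) d i)" unfolding Cinf_opn[OF o]
 proof
  fix r
  have sub: "?A <= cim c" by (auto simp: ldom_def)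
  have "Ck (mdim M) ?A r (%y. \<Sum>j<mdim M. pd ?A j (%y. lrep c d (%p. p) y i) y * u (cinv c y) c j)"
  proof (intro Ck_sum Ck_mult o)
   fix j assume "j \<in> {..<mdim M}"
   then have j: "j < mdim M" by simp
   show "Ck (mdim M) ?A r (%y. pd ?A j (%y. lrep c d (%p. p) y i) y)"
    using Ck_pd[OF lrep_Ck[OF M c M d smooth_id[OF M], of "Suc r"] j] by simp
   show "Ck (mdim M) ?A r (%y. u (cinv c y) c j)" by (rule Ck_subset[OF s[OF c j] cim_opn[OF M c] o sub])
  qed
  moreover have "(\<Sum>j<mdim M. pd ?A j (%y. lrep c d (%p. p) y i) y * u (cinv c y) c j) = u (cinv c y) d i" if y: "y \<in> ?A" for y
  proof -
   have x: "cinv c y \<in> fst c" "cinv c y \<in> fst d" "y \<in> cim c" using y cinv_in[OF M c] by (auto simp: ldom_eq[OF M c])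
   have "u (cinv c y) \<in> tspace M (cinv c y)" using t x(1) chart_subset[OF M c] by blast
   from tspaceD(3)[OF this c d x(1,2) i] show ?thesis by (simp add: ljac_def snd_cinv[OF M c x(3)])
  qed
  ultimately show "Ck (mdim M) ?A r (%y. u (cinv c y) d i)"
   using Ck_cong[OF o, of "%y. \<Sum>j<mdim M. pd ?A j (%y. lrep c d (%p. p) y i) y * u (cinv c y) c j"
    "%y. u (cinv c y) d i" r] by simp
 qed
qed

text \<open>One pair of charts adapted to \<open>f\<close> around each point is enough; transition
  maps on both sides carry regularity to all other pairs. Continuity is part of the
  conclusion.\<close>

lemma smooth_map_local:
 assumes S: "omfd S" and M: "omfd M"
  and loc: "!!x. x \<in> pts S ==> \<exists>b d. b \<in> matlas S & d \<in> matlas M & x \<in> fst b & f ` fst b <= fst d &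
   (\<forall>i r. Ck (mdim S) (cim b) r (%y. snd d (f (cinv b y)) i))"
 shows "smooth_map S M f"
proof -
 define good where "good b d x \<longleftrightarrow> b \<in> matlas S & d \<in> matlas M & x \<in> fst b & f ` fst b <= fst d &
   (\<forall>i r. Ck (mdim S) (cim b) r (%y. snd d (f (cinv b y)) i))" for b d x
 have ex: "\<exists>b d. good b d x" if "x \<in> pts S" for x
  using loc[OF that] unfolding good_def .
 have fM: "f x \<in> pts M" if x: "x \<in> pts S" for x
 proof -
  obtain b d where g: "good b d x" using ex[OF x] by blast
  have bd: "d \<in> matlas M" "x \<in> fst b" "f ` fst b <= fst d" using g by (simp_all add: good_def)
  then show ?thesis using chart_subset[OF M bd(1)] by blast
 qed
 have cont: "continuous_map (mtop S) (mtop M) f" unfolding continuous_map_def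
 proof (intro conjI allI impI)
  show "f \<in> pts S \<rightarrow> pts M" using fM by auto
  fix X assume X: "openin (mtop M) X"
  show "openin (mtop S) {x \<in> pts S. f x \<in> X}"
  proof (subst openin_subopen, intro ballI)
   fix x assume x: "x \<in> {x \<in> pts S. f x \<in> X}"
   then have "x \<in> pts S" by simp
   from ex[OF this] obtain b d where g: "good b d (x)" by blast
   have b: "b \<in> matlas S" and d: "d \<in> matlas M" and xb: "x \<in> fst b"
    and fb: "f ` fst b <= fst d" and C: "\<forall>i r. Ck (mdim S) (cim b) r (%y. snd d (f (cinv b y)) i)"
    using g by (simp_all add: good_def)
   let ?Z = "{z \<in> cim d. cinv d z \<in> X}" and ?h = "%y. snd d (f (cinv b y))"
   let ?W = "cim b \<inter> ?h -` ?Z"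
   have hd: "f (cinv b y) \<in> fst d" if "y \<in> cim b" for y using fb cinv_in[OF S b that] by blast
   have hR: "?h y \<in> Rn (mdim M)" if "y \<in> cim b" for y by (rule snd_Rn[OF M d hd[OF that]])
   have "opn (mdim S) ?W"
   proof (rule opn_preimage[OF cim_opn[OF S b] _ _ opn_chart_preimage[OF M d X]])
    have "continuous_on (cim b) (%y. ?h y j)" for j using C Ck_continuous by blast
    then show "continuous_on (cim b) ?h" using hR by (intro continuous_on_Rn_valued) auto
   qed (use hR in auto)
   then have o: "openin (mtop S) {x \<in> fst b. snd b x \<in> ?W}" by (rule chart_preimage_open[OF S b]) auto
   have mem: "x' \<in> {x \<in> fst b. snd b x \<in> ?W} \<longleftrightarrow> f x' \<in> X" if "x' \<in> fst b" for x'
   proof -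
    have "f x' \<in> fst d" using that fb by blast
    then show ?thesis using that cinv_snd[OF S b that] cinv_snd[OF M d, of "f x'"] by simp
   qed
   show "\<exists>T. openin (mtop S) T & x \<in> T & T <= {x \<in> pts S. f x \<in> X}"
   proof (intro exI conjI)
    show "openin (mtop S) {x \<in> fst b. snd b x \<in> ?W}" by (rule o)
    show "x \<in> {x \<in> fst b. snd b x \<in> ?W}" using mem[OF xb] x by blast
    show "{x \<in> fst b. snd b x \<in> ?W} <= {x \<in> pts S. f x \<in> X}"
     using mem chart_subset[OF S b] by blast
   qed
  qed
 qed
 have "lsmooth (mdim S) (mdim M) c e f" if c: "c \<in> matlas S" and e: "e \<in> matlas M" for c e
  unfolding lsmooth_def Cinf_opn[OF ldom_opn[OF S c M e cont]]
 proof (intro allI impI)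
  fix i r
  show "Ck (mdim S) (ldom c e f) r (%y. lrep c e f y i)"
  proof (rule Ck_local[OF ldom_opn[OF S c M e cont]])
   fix y assume y: "y \<in> ldom c e f"
   have yc: "y \<in> cim c" using y by (simp add: ldom_eq[OF S c])
   have "cinv c y \<in> pts S" using cinv_in[OF S c yc] chart_subset[OF S c] by blast
   from ex[OF this] obtain b d where g: "good b d (cinv c y)" by blast
   have b: "b \<in> matlas S" and d: "d \<in> matlas M" and xb: "cinv c y \<in> fst b"
    and fb: "f ` fst b <= fst d" and C: "\<forall>i r. Ck (mdim S) (cim b) r (%y. snd d (f (cinv b y)) i)"
    using g by (simp_all add: good_def)
   let ?V = "ldom c e f \<inter> ldom c b (%x. x)"
   let ?h = "%y. snd d (f (cinv b y))"
   have id: "continuous_map (mtop S) (mtop S) (%x. x)" "continuous_map (mtop M) (mtop M) (%x. x)"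
    by (simp_all add: continuous_map_id[unfolded id_def])
   have ob: "opn (mdim S) (ldom c b (%x. x))" by (rule ldom_opn[OF S c S b id(1)])
   have oV: "opn (mdim S) ?V" using ldom_opn[OF S c M e cont] ob by (rule openin_Int)
   have yV: "y \<in> ?V" using y yc xb by (simp add: ldom_eq[OF S c])
   have h1: "Ck (mdim S) ?V r (%y. lrep c b (%x. x) y l)" for l
    by (rule Ck_subset[OF lrep_Ck[OF S c S b smooth_id[OF S]] ob oV]) auto
   have h2: "Ck (mdim S) ?V r (%y. ?h (lrep c b (%x. x) y) l)" for l
    by (rule Ck_compose[where f = "%y. ?h y l" and \<phi> = "lrep c b (%x. x)", OF oV cim_opn[OF S b] _ h1])
     (use C lrep_in[OF S c, of _ b "%x. x"] in \<open>simp_all add: image_subset_iff\<close>)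
   have eq: "?h (lrep c b (%x. x) y) = snd d (f (cinv c y))" if "y \<in> ?V" for y
    using that by (simp add: lrep_def ldom_eq[OF S c] cinv_snd[OF S b])
   have h3: "Ck (mdim S) ?V r (%y. lrep d e (%x. x) (?h (lrep c b (%x. x) y)) i)"
   proof (rule Ck_compose[where f = "%z. lrep d e (%x. x) z i" and \<phi> = "%y. ?h (lrep c b (%x. x) y)",
      OF oV ldom_opn[OF M d M e id(2)] lrep_Ck[OF M d M e smooth_id[OF M]] h2])
    show "(%y. ?h (lrep c b (%x. x) y)) ` ?V <= ldom d e (%x. x)"
    proof
     fix z assume "z \<in> (%y. ?h (lrep c b (%x. x) y)) ` ?V"
     then obtain y' where y': "y' \<in> ?V" "z = snd d (f (cinv c y'))" using eq by auto
     have "f (cinv c y') \<in> fst e" "cinv c y' \<in> fst b" using y'(1) by (auto simp: ldom_eq[OF S c])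
     then show "z \<in> ldom d e (%x. x)" unfolding y'(2) ldom_def using fb by blast
    qed
   qed
   show "\<exists>V g. opn (mdim S) V & y \<in> V & Ck (mdim S) V r g & (\<forall>y\<in>ldom c e f \<inter> V. g y = lrep c e f y i)"
   proof (intro exI conjI ballI)
    show "opn (mdim S) ?V" "y \<in> ?V" by (rule oV, rule yV)
    show "Ck (mdim S) ?V r (%y. lrep d e (%x. x) (?h (lrep c b (%x. x) y)) i)" by (rule h3)
    fix y' assume y': "y' \<in> ldom c e f \<inter> ?V"
    then have "f (cinv c y') \<in> fst d" using fb by (auto simp: ldom_eq[OF S c])
    then show "lrep d e (%x. x) (?h (lrep c b (%x. x) y')) i = lrep c e f y' i"
     using eq[of y'] y' by (simp add: lrep_def cinv_snd[OF M d])
   qed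
  qed
 qed
 then show ?thesis using cont by (simp add: smooth_map_def)
qed

lemma cim_tube_Ck:
 assumes "opn n A" "opn m D" "n <= m" "Ck n A r h" "!!z. z \<in> D ==> (%i. if i < n then z i else 0) \<in> A"
 shows "Ck m D r (%z. h (%i. if i < n then z i else 0))"
 by (rule Ck_compose[where \<phi> = "%z i. if i < n then z i else 0", OF assms(2,1,4)]) (use assms Ck_coord in auto)

lemma pds_linear:
 assumes A: "opn n A" and f: "!!r. Ck n A r f" and g: "!!r. Ck n A r g" and js: "set js <= {..<n}"
 shows "(\<forall>r. Ck n A r (pds A js f)) & (\<forall>y\<in>A. pds A js (%y. f y + t * g y) y = pds A js f y + t * pds A js g y)"
proof -
 have C: "Ck n A r (pds A js h)" if h: "!!r. Ck n A r h" and "set js <= {..<n}" for h js r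
  using that(2)
 proof (induction js arbitrary: r)
  case (Cons j js)
  then show ?case using Ck_pd[of n A r "pds A js h" j] by (simp add: pds_def)
 qed (simp add: pds_def h)
 have "\<forall>y\<in>A. pds A js (%y. f y + t * g y) y = pds A js f y + t * pds A js g y" using js
 proof (induction js)
  case (Cons j js)
  have j: "j < n" using Cons.prems by simp
  show ?case
  proof
   fix y assume y: "y \<in> A"
   have "pds A (j # js) (%y. f y + t * g y) y = pd A j (%y. pds A js f y + t * pds A js g y) y"
    unfolding pds_def foldr.simps o_apply using Cons
    by (intro pd_cong[OF A j y]) (simp add: pds_def)
   also have "\<dots> = pd A j (pds A js f) y + t * pd A j (pds A js g) y"
   proof (rule pd_eq[OF A y j])
    have "hpd (pds A js f) j (pd A j (pds A js f) y) y"
     by (rule Ck_hpd[OF C[OF f] A j y]) (use Cons.prems in auto)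
    moreover have "hpd (pds A js g) j (pd A j (pds A js g) y) y"
     by (rule Ck_hpd[OF C[OF g] A j y]) (use Cons.prems in auto)
    ultimately show "hpd (%y. pds A js f y + t * pds A js g y) j (pd A j (pds A js f) y + t * pd A j (pds A js g) y) y"
     by (intro DERIV_add DERIV_cmult)
   qed
   finally show "pds A (j # js) (%y. f y + t * g y) y = pds A (j # js) f y + t * pds A (j # js) g y"
    by (simp add: pds_def)
  qed
 qed (simp add: pds_def)
 then show ?thesis using C[OF f js] by blast
qed

lemma pds_cong:
 assumes A: "opn n A" and e: "!!y. y \<in> A ==> f y = g y" and js: "set js <= {..<n}" and y: "y \<in> A"
 shows "pds A js f y = pds A js g y"
 using js y
proof (induction js arbitrary: y)
 case (Cons j js)
 then show ?case unfolding pds_def foldr.simps o_apply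
  by (intro pd_cong[OF A]) (auto simp: pds_def)
qed (simp add: pds_def e)

text \<open>The supremum over \<open>K\<close> is attained and hence stays strictly below
  \<open>e\<close>; a bound for \<open>q\<close> on \<open>K\<close> says how far \<open>t\<close>
  may move. Conditions of this type describe when a line of sections lies in a subbasic open
  set.\<close>

lemma open_uniform_less:
 fixes p q :: "'b::metric_space => real"
 assumes K: "compact K" and p: "continuous_on K p" and q: "continuous_on K q" and e: "0 < e"
 shows "open {t::real. \<forall>x\<in>K. \<bar>p x + t * q x\<bar> < e}"
proof (cases "K = {}")
 case False
 have "\<exists>Q. \<forall>x\<in>K. \<bar>q x\<bar> <= Q"
  using compact_imp_bounded[OF compact_continuous_image[OF q K]] by (auto simp: bounded_iff)
 then obtain Q where Q: "!!x. x \<in> K ==> \<bar>q x\<bar> <= Q" by blast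
 then have Q0: "0 <= Q" using False by (metis abs_ge_zero all_not_in_conv order_trans)
 show ?thesis unfolding open_dist
 proof
  fix t assume t: "t \<in> {t. \<forall>x\<in>K. \<bar>p x + t * q x\<bar> < e}"
  have "continuous_on K (%x. \<bar>p x + t * q x\<bar>)" by (intro continuous_intros p q)
  from continuous_attains_sup[OF K False this] obtain x0 where
   x0: "x0 \<in> K" "\<forall>x\<in>K. \<bar>p x + t * q x\<bar> <= \<bar>p x0 + t * q x0\<bar>" by blast
  define d where "d = (e - \<bar>p x0 + t * q x0\<bar>) / (Q + 1)"
  have d: "0 < d" using t x0 Q0 by (simp add: d_def)
  have "\<bar>p x + t' * q x\<bar> < e" if "dist t' t < d" "x \<in> K" for t' x
  proof -
   have "p x + t' * q x = (p x + t * q x) + (t' - t) * q x" by (simp add: algebra_simps)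
   then have "\<bar>p x + t' * q x\<bar> <= \<bar>p x + t * q x\<bar> + \<bar>t' - t\<bar> * \<bar>q x\<bar>" by (metis abs_mult abs_triangle_ineq)
   also have "\<dots> <= \<bar>p x0 + t * q x0\<bar> + \<bar>t' - t\<bar> * Q" using x0 that Q by (intro add_mono mult_left_mono) auto
   also have "\<dots> <= \<bar>p x0 + t * q x0\<bar> + \<bar>t' - t\<bar> * (Q + 1)" by (intro add_left_mono mult_left_mono) auto
   also have "\<dots> < \<bar>p x0 + t * q x0\<bar> + d * (Q + 1)"
    using that(1) Q0 by (intro add_strict_left_mono mult_strict_right_mono) (auto simp: dist_real_def)
   also have "\<dots> = e" using Q0 by (simp add: d_def)
   finally show ?thesis .
  qed
  then show "\<exists>d>0. \<forall>t'. dist t' t < d --> t' \<in> {t. \<forall>x\<in>K. \<bar>p x + t * q x\<bar> < e}" using d by blast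
 qed
qed simp

section \<open>Tubular neighbourhoods and lines of sections\<close>

locale tube =
 fixes M :: "'a smfd" and S :: "'s smfd" and gm :: "'s => 'a" and \<pi> T n m
 assumes M: "omfd M" and S: "omfd S" and comp: "compact_space (mtop S)"
  and n: "mdim S = n" and m: "mdim M = m" and nm: "n <= m"
  and tub: "tubular M S gm \<pi> T"
begin

abbreviation E where "E \<equiv> bundle_sections M S \<pi> T"

lemma T1: "pts S = (\<Union>(b, d)\<in>T. fst b)"
 using tub by (simp add: tubular_def)

lemma T2:
 assumes "(b, d) \<in> T"
 shows "b \<in> matlas S" "d \<in> matlas M" "fst d = {y \<in> (\<Union>(b', d')\<in>T. fst d'). \<pi> y \<in> fst b}"
  "cim d = {z \<in> Rn m. (%i. if i < n then z i else 0) \<in> cim b}"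
  "!!y i. y \<in> fst d ==> i < n ==> snd d y i = snd b (\<pi> y) i"
proof -
 have "\<forall>(b, d)\<in>T. b \<in> matlas S & d \<in> matlas M &
   fst d = {y \<in> (\<Union>(b', d')\<in>T. fst d'). \<pi> y \<in> fst b} &
   cim d = {z \<in> Rn m. (%i. if i < n then z i else 0) \<in> cim b} &
   (\<forall>y\<in>fst d. \<forall>i<n. snd d y i = snd b (\<pi> y) i) &
   (\<forall>x\<in>fst b. gm x \<in> fst d & snd d (gm x) = snd b x)"
  using tub unfolding tubular_def n m by (elim conjE)
 from bspec[OF this assms, unfolded prod.case]
 have *: "b \<in> matlas S & d \<in> matlas M &
   fst d = {y \<in> (\<Union>(b', d')\<in>T. fst d'). \<pi> y \<in> fst b} &
   cim d = {z \<in> Rn m. (%i. if i < n then z i else 0) \<in> cim b} &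
   (\<forall>y\<in>fst d. \<forall>i<n. snd d y i = snd b (\<pi> y) i) &
   (\<forall>x\<in>fst b. gm x \<in> fst d & snd d (gm x) = snd b x)" .
 show "b \<in> matlas S" using * by (elim conjE)
 show "d \<in> matlas M" using * by (elim conjE)
 show "fst d = {y \<in> (\<Union>(b', d')\<in>T. fst d'). \<pi> y \<in> fst b}" using * by (elim conjE)
 show "cim d = {z \<in> Rn m. (%i. if i < n then z i else 0) \<in> cim b}" using * by (elim conjE)
 have "\<forall>y\<in>fst d. \<forall>i<n. snd d y i = snd b (\<pi> y) i" using * by (elim conjE)
 then show "snd d y i = snd b (\<pi> y) i" if "y \<in> fst d" "i < n" for y i using that by simp
qed

lemma T3:
 assumes "(b, d) \<in> T" "(b', d') \<in> T" "x \<in> fst b" "x \<in> fst b'"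
 obtains A :: "nat => nat => real" where "!!y i. y \<in> fst d ==> \<pi> y = x ==> i \<in> {n..<m} ==>
  snd d' y i = (\<Sum>j\<in>{n..<m}. A i j * snd d y j)"
proof -
 have "\<forall>(b, d)\<in>T. \<forall>(b', d')\<in>T. \<forall>x\<in>fst b \<inter> fst b'. \<exists>A :: nat => nat => real.
   \<forall>y\<in>fst d. \<pi> y = x --> (\<forall>i\<in>{n..<m}. snd d' y i = (\<Sum>j\<in>{n..<m}. A i j * snd d y j))"
  using tub unfolding tubular_def n m by (elim conjE)
 from bspec[OF bspec[OF this assms(1), unfolded prod.case] assms(2), unfolded prod.case, THEN bspec, OF IntI[OF assms(3,4)]]
 have "\<exists>A :: nat => nat => real. \<forall>y\<in>fst d. \<pi> y = x --> (\<forall>i\<in>{n..<m}. snd d' y i = (\<Sum>j\<in>{n..<m}. A i j * snd d y j))" .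
 then show ?thesis using that by blast
qed

lemma ex_T: "x \<in> pts S ==> \<exists>b d. (b, d) \<in> T & x \<in> fst b"
 unfolding T1 by blast

lemma bchart_opn: "(b, d) \<in> T ==> opn n (cim b)"
 using cim_opn[OF S T2(1)] n by auto

lemma dchart_opn: "(b, d) \<in> T ==> opn m (cim d)"
 using cim_opn[OF M T2(2)] m by auto

lemma fst_b_subset: "(b, d) \<in> T ==> fst b <= pts S"
 using chart_subset[OF S T2(1)] .

lemma secD:
 assumes "s \<in> E"
 shows "smooth_map S M s" "!!x. x \<in> pts S ==> \<pi> (s x) = x"
  "!!b d x. (b, d) \<in> T ==> x \<in> fst b ==> s x \<in> fst d"
  "!!b d x i. (b, d) \<in> T ==> x \<in> fst b ==> i < n ==> snd d (s x) i = snd b x i"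
proof -
 show "smooth_map S M s" and p: "!!x. x \<in> pts S ==> \<pi> (s x) = x"
  using assms by (auto simp: bundle_sections_def)
 show i: "s x \<in> fst d" if bd: "(b, d) \<in> T" and x: "x \<in> fst b" for b d x
 proof -
  have xS: "x \<in> pts S" using fst_b_subset[OF bd] x by blast
  have "s x \<in> (\<Union>(b, d)\<in>T. fst d)" using assms xS by (simp add: bundle_sections_def)
  then show ?thesis unfolding T2(3)[OF bd] using p[OF xS] x by simp
 qed
 show "snd d (s x) i = snd b x i" if bd: "(b, d) \<in> T" and x: "x \<in> fst b" and i': "i < n" for b d x i
  using T2(5)[OF bd i[OF bd x] i'] p[of x] fst_b_subset[OF bd] x by auto
qed

lemma snd_d_zero: "(b, d) \<in> T ==> y \<in> fst d ==> m <= i ==> snd d y i = 0"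
 using snd_Rn[OF M T2(2)] m by (auto simp: Rn_iff)

lemma snd_b_zero: "(b, d) \<in> T ==> x \<in> fst b ==> n <= i ==> snd b x i = 0"
 using snd_Rn[OF S T2(1)] n by (auto simp: Rn_iff)

text \<open>\<open>line\<close> prescribes its value in all bundle charts around \<open>x\<close> at
  once. The point is constructed in one of them, and the others agree because the transition maps
  are linear in the fibres.\<close>

lemma line_props:
 assumes s: "s \<in> E" and a: "a \<in> E" and x: "x \<in> pts S"
 shows "!!b d. (b, d) \<in> T ==> x \<in> fst b ==> line S T s t a x \<in> fst d &
   snd d (line S T s t a x) = (%i. if i < n then snd b x i else snd d (s x) i + t * snd d (a x) i)"
  and "\<pi> (line S T s t a x) = x"
proof -
 let ?P = "%y. \<forall>(b, d)\<in>T. x \<in> fst b --> y \<in> fst d &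
  snd d y = (%i. if i < n then snd b x i else snd d (s x) i + t * snd d (a x) i)"
 obtain b0 d0 where bd0: "(b0, d0) \<in> T" "x \<in> fst b0" using ex_T[OF x] by blast
 note I0 = secD(3)[OF s bd0] secD(3)[OF a bd0]
 let ?z = "%i. if i < n then snd b0 x i else snd d0 (s x) i + t * snd d0 (a x) i"
 have zR: "?z \<in> Rn m" using snd_d_zero[OF bd0(1)] I0 snd_b_zero[OF bd0] nm by (auto simp: Rn_iff)
 have "(%i. if i < n then ?z i else 0) = snd b0 x" using snd_b_zero[OF bd0] by (auto simp: fun_eq_iff)
 then have "?z \<in> cim d0" unfolding T2(4)[OF bd0(1)] using zR bd0(2) by auto
 then have "\<exists>y0. y0 \<in> fst d0 & snd d0 y0 = ?z" by (elim imageE) metis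
 then obtain y0 where y0: "y0 \<in> fst d0" "snd d0 y0 = ?z" by blast
 have py0: "\<pi> y0 = x"
 proof -
  have pb: "\<pi> y0 \<in> fst b0" using y0(1) T2(3)[OF bd0(1)] by auto
  have "snd b0 (\<pi> y0) i = snd b0 x i" for i
  proof (cases "i < n")
   case True
   then show ?thesis using T2(5)[OF bd0(1) y0(1) True] unfolding y0(2) by simp
  next
   case False
   then show ?thesis using snd_b_zero[OF bd0(1) pb, of i] snd_b_zero[OF bd0, of i] by simp
  qed
  then have "snd b0 (\<pi> y0) = snd b0 x" by auto
  then show ?thesis using inj_onD[OF chart_inj[OF S T2(1)[OF bd0(1)]]] pb bd0(2) by blast
 qed
 have Py0: "?P y0"
 proof (intro ballI, clarify, intro conjI)
  fix b d assume bd: "((b :: 's chart), (d :: 'a chart)) \<in> T" and xb: "x \<in> fst b"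
  have "y0 \<in> (\<Union>(b', d')\<in>T. fst d')" using y0(1) bd0(1) by auto
  then show yd: "y0 \<in> fst d" unfolding T2(3)[OF bd] using py0 xb by simp
  obtain A where A: "!!y i. y \<in> fst d0 ==> \<pi> y = x ==> i \<in> {n..<m} ==>
   snd d y i = (\<Sum>j\<in>{n..<m}. A i j * snd d0 y j)" using T3[OF bd0(1) bd bd0(2) xb] by metis
  show "snd d y0 = (%i. if i < n then snd b x i else snd d (s x) i + t * snd d (a x) i)"
  proof
   fix i
   consider "i < n" | "i \<in> {n..<m}" | "m <= i" by force
   then show "snd d y0 i = (if i < n then snd b x i else snd d (s x) i + t * snd d (a x) i)"
   proof cases
    case 1
    then show ?thesis using T2(5)[OF bd yd 1] py0 by simp
   next
    case 2
    have "snd d y0 i = (\<Sum>j\<in>{n..<m}. A i j * (snd d0 (s x) j + t * snd d0 (a x) j))"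
     using A[OF y0(1) py0 2] by (simp add: y0(2))
    also have "\<dots> = snd d (s x) i + t * snd d (a x) i"
     unfolding A[OF I0(1) secD(2)[OF s x] 2] A[OF I0(2) secD(2)[OF a x] 2]
     by (simp add: distrib_left sum.distrib sum_distrib_left mult.left_commute)
    finally show ?thesis using 2 by simp
   next
    case 3
    then show ?thesis using snd_d_zero[OF bd] yd secD(3)[OF s bd xb] secD(3)[OF a bd xb] nm by simp
   qed
  qed
 qed
 moreover have "y = y0" if "?P y" for y
 proof -
  have "y \<in> fst d0" "snd d0 y = ?z" using that bd0 by auto
  then show ?thesis using inj_onD[OF chart_inj[OF M T2(2)[OF bd0(1)]], of y y0] y0 by simp
 qed
 ultimately have "(THE y. ?P y) = y0" by (rule the_equality)
 then have l: "line S T s t a x = y0" using x by (simp add: line_def n)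
 show "line S T s t a x \<in> fst d &
   snd d (line S T s t a x) = (%i. if i < n then snd b x i else snd d (s x) i + t * snd d (a x) i)"
  if "(b, d) \<in> T" "x \<in> fst b" for b d
  unfolding l using Py0 that by blast
 show "\<pi> (line S T s t a x) = x" unfolding l by (rule py0)
qed

lemma cinv_b: "(b, d) \<in> T ==> y \<in> cim b ==> cinv b y \<in> fst b"
 by (rule cinv_in[OF S T2(1)])

lemma sec_cinv: "s \<in> E ==> (b, d) \<in> T ==> y \<in> cim b ==> s (cinv b y) \<in> fst d"
 by (rule secD(3)[OF _ _ cinv_b])

lemma ldom_sec: "s \<in> E ==> (b, d) \<in> T ==> ldom b d s = cim b"
proof -
 assume s: "s \<in> E" and bd: "(b, d) \<in> T"
 show "ldom b d s = cim b"
  unfolding ldom_eq[OF S T2(1)[OF bd]] using sec_cinv[OF s bd] by blast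
qed

lemma sec_Ck: "s \<in> E ==> (b, d) \<in> T ==> Ck n (cim b) r (%y. lrep b d s y i)"
proof -
 assume s: "s \<in> E" and bd: "(b, d) \<in> T"
 show "Ck n (cim b) r (%y. lrep b d s y i)"
  using lrep_Ck[OF S T2(1)[OF bd] M T2(2)[OF bd] secD(1)[OF s], of r i] unfolding ldom_sec[OF s bd] n .
qed

lemma sec_base: "s \<in> E ==> (b, d) \<in> T ==> y \<in> cim b ==> i < n ==> lrep b d s y i = y i"
 by (simp add: lrep_def secD(4)[OF _ _ cinv_b] snd_cinv[OF S T2(1)])

text \<open>The derivative in \<open>t\<close> of the coordinates of the section
  \<open>s + t a\<close>: base coordinates do not move, and the fibre coordinates of
  \<open>a\<close> remain, whatever \<open>s\<close> is.\<close>

definition dot :: "'s chart => 'a chart => ('s => 'a) => (nat => real) => nat => real"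
 where "dot b d a y = (%i. if i < n then 0 else lrep b d a y i)"

lemma dot_Ck: "a \<in> E ==> (b, d) \<in> T ==> Ck n (cim b) r (%y. dot b d a y i)"
 using sec_Ck[of a b d r i] Ck_const[OF bchart_opn] by (cases "i < n") (auto simp: dot_def)

lemma lrep_Rn: "s \<in> E ==> (b, d) \<in> T ==> y \<in> cim b ==> lrep b d s y \<in> Rn m"
 using snd_Rn[OF M T2(2) sec_cinv] m by (simp add: lrep_def)

lemma dot_Rn: "a \<in> E ==> (b, d) \<in> T ==> y \<in> cim b ==> dot b d a y \<in> Rn m"
 using lrep_Rn[of a b d y] nm by (auto simp: dot_def Rn_iff)

lemma lrep_cim: "s \<in> E ==> (b, d) \<in> T ==> y \<in> cim b ==> lrep b d s y \<in> cim d"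
 unfolding lrep_def by (rule imageI[OF sec_cinv])

lemma line_in_E:
 assumes s: "s \<in> E" and a: "a \<in> E" shows "line S T s t a \<in> E"
proof -
 have ext: "line S T s t a \<in> extensional (pts S)" by (simp add: line_def)
 have "smooth_map S M (line S T s t a)"
 proof (rule smooth_map_local[OF S M])
  fix x assume "x \<in> pts S"
  then obtain b d where bd: "(b, d) \<in> T" "x \<in> fst b" using ex_T by blast
  have L: "line S T s t a x' \<in> fst d &
   snd d (line S T s t a x') = (%i. if i < n then snd b x' i else snd d (s x') i + t * snd d (a x') i)"
   if "x' \<in> fst b" for x'
   using line_props(1)[OF s a _ bd(1) that] fst_b_subset[OF bd(1)] that by blast
  have "Ck (mdim S) (cim b) r (%y. snd d (line S T s t a (cinv b y)) i)" for i r
  proof -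
   have "Ck n (cim b) r (%y. lrep b d s y i + t * dot b d a y i)"
    by (intro Ck_add Ck_mult Ck_const sec_Ck dot_Ck bchart_opn[OF bd(1)] s a bd(1))
   moreover have "lrep b d s y i + t * dot b d a y i = snd d (line S T s t a (cinv b y)) i" if y: "y \<in> cim b" for y
    using L[OF cinv_in[OF S T2(1)[OF bd(1)] y]] secD(4)[OF s bd(1) cinv_in[OF S T2(1)[OF bd(1)] y], of i]
    by (simp add: lrep_def dot_def)
   ultimately show ?thesis unfolding n
    using Ck_cong[OF bchart_opn[OF bd(1)], of "%y. lrep b d s y i + t * dot b d a y i"
     "%y. snd d (line S T s t a (cinv b y)) i" r] by simp
  qed
  then show "\<exists>b d. b \<in> matlas S & d \<in> matlas M & x \<in> fst b & line S T s t a ` fst b <= fst d &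
   (\<forall>i r. Ck (mdim S) (cim b) r (%y. snd d (line S T s t a (cinv b y)) i))"
   using T2(1,2)[OF bd(1)] bd(2) L by (intro exI[of _ b] exI[of _ d]) auto
 qed
 moreover have "line S T s t a x \<in> (\<Union>(b, d)\<in>T. fst d)" if x: "x \<in> pts S" for x
 proof -
  obtain b d where bd: "(b, d) \<in> T" "x \<in> fst b" using ex_T[OF x] by blast
  then show ?thesis using line_props(1)[OF s a x bd] by auto
 qed
 ultimately show ?thesis using ext line_props(2)[OF s a] by (simp add: bundle_sections_def)
qed

lemma lrep_line:
 assumes s: "s \<in> E" and a: "a \<in> E" and bd: "(b, d) \<in> T" and y: "y \<in> cim b"
 shows "lrep b d (line S T s t a) y = (%i. lrep b d s y i + t * dot b d a y i)"
proof -
 have x: "cinv b y \<in> fst b" by (rule cinv_in[OF S T2(1)[OF bd] y])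
 have xS: "cinv b y \<in> pts S" using x fst_b_subset[OF bd] by blast
 show ?thesis
  using line_props(1)[OF s a xS bd x] secD(4)[OF s bd x] by (auto simp: lrep_def dot_def fun_eq_iff)
qed

lemma dot_line:
 assumes s: "s \<in> E" and a: "a \<in> E" and bd: "(b, d) \<in> T" and y: "y \<in> cim b"
 shows "dot b d (line S T s t a) y = (%i. dot b d s y i + t * dot b d a y i)"
 using lrep_line[OF assms] by (auto simp: dot_def fun_eq_iff)

lemma line_0:
 assumes s: "s \<in> E" and a: "a \<in> E" and x: "x \<in> pts S"
 shows "line S T s 0 a x = s x"
proof -
 obtain b d where bd: "(b, d) \<in> T" "x \<in> fst b" using ex_T[OF x] by blast
 have "snd d (line S T s 0 a x) = snd d (s x)"
  using line_props(1)[OF s a x bd, of 0] secD(4)[OF s bd] by (auto simp: fun_eq_iff)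
 then show ?thesis
  using inj_onD[OF chart_inj[OF M T2(2)[OF bd(1)]]] line_props(1)[OF s a x bd] secD(3)[OF s bd] by blast
qed

definition xi :: "('s => 'a) => ('s => 'a) => 's => 'a tvec"
 where "xi s a x = velocity M (%t. line S T s t a x)"

text \<open>In the bundle chart the path is affine with slope \<open>dot b d a\<close>; the chain
  rule along a curve translates its velocity into every other chart.\<close>

lemma xi_cvec:
 assumes s: "s \<in> E" and a: "a \<in> E" and bd: "(b, d) \<in> T" and x: "x \<in> fst b"
 shows "xi s a x = cvec M d (s x) (dot b d a (snd b x))"
proof
 fix e
 have xS: "x \<in> pts S" using fst_b_subset[OF bd] x by blast
 note b = T2(1)[OF bd] and d = T2(2)[OF bd]
 have l0: "line S T s 0 a x = s x" by (rule line_0[OF s a xS])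
 show "xi s a x e = cvec M d (s x) (dot b d a (snd b x)) e"
 proof (cases "e \<in> matlas M & s x \<in> fst e")
  case True
  then have e: "e \<in> matlas M" "s x \<in> fst e" by auto
  have "deriv (%t. snd e (line S T s t a x) i) 0 = (\<Sum>j<mdim M. ljac d e (%p. p) (s x) i j * dot b d a (snd b x) j)" for i
  proof (rule DERIV_imp_deriv)
   define \<sigma> where "\<sigma> t = (%i. lrep b d s (snd b x) i + t * dot b d a (snd b x) i)" for t :: real
   have yb: "snd b x \<in> cim b" using x by simp
   have sd: "snd d (line S T s t a x) = \<sigma> t" for t
    using lrep_line[OF s a bd yb, of t] by (simp add: \<sigma>_def lrep_def cinv_snd[OF S b x])
   have ld: "line S T s t a x \<in> fst d" for t using line_props(1)[OF s a xS bd x] by blast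
   have id: "continuous_map (mtop M) (mtop M) (%p. p)" by (simp add: continuous_map_id[unfolded id_def])
   let ?A = "ldom d e (%p. p)"
   have o: "opn (mdim M) ?A" by (rule ldom_opn[OF M d M e(1) id])
   have "((%t. lrep d e (%p. p) (\<sigma> t) i) has_real_derivative
     (\<Sum>j<mdim M. pd ?A j (%y. lrep d e (%p. p) y i) (\<sigma> 0) * dot b d a (snd b x) j)) (at 0)"
   proof (rule chain_rule_curve[OF o])
    show "hpd (%y. lrep d e (%p. p) y i) j (pd ?A j (%y. lrep d e (%p. p) y i) z) z" if "j < mdim M" "z \<in> ?A" for j z
     by (rule Ck_hpd[OF lrep_Ck[OF M d M e(1) smooth_id[OF M], of "Suc 0"] o that])
    show "continuous_on ?A (pd ?A j (%y. lrep d e (%p. p) y i))" if "j < mdim M" for j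
     by (rule Ck_continuous[OF Ck_pd[OF lrep_Ck[OF M d M e(1) smooth_id[OF M], of "Suc 0"] that]])
    show "\<sigma> 0 \<in> ?A" unfolding sd[symmetric] l0 ldom_def using secD(3)[OF s bd x] e by blast
    show "eventually (%t. \<sigma> t \<in> Rn (mdim M)) (at 0)"
     using snd_Rn[OF M d ld] by (simp add: sd)
    show "((%t. \<sigma> t j) has_real_derivative dot b d a (snd b x) j) (at 0)" for j
     unfolding \<sigma>_def by (auto intro!: derivative_eq_intros)
   qed
   moreover have "lrep d e (%p. p) (\<sigma> t) i = snd e (line S T s t a x) i" for t
    using cinv_snd[OF M d ld[of t]] by (simp add: lrep_def sd)
   moreover have "\<sigma> 0 = snd d (s x)" using sd[of 0] l0 by simp
   ultimately show "((%t. snd e (line S T s t a x) i) has_real_derivative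
     (\<Sum>j<mdim M. ljac d e (%p. p) (s x) i j * dot b d a (snd b x) j)) (at 0)"
    by (simp add: ljac_def)
  qed
  then show ?thesis using True by (simp add: xi_def velocity_def l0 cvec_def)
 next
  case False
  then have "xi s a x e = (%_. 0)" unfolding xi_def velocity_def l0 by auto
  moreover have "cvec M d (s x) (dot b d a (snd b x)) e = (%_. 0)" using False unfolding cvec_def by auto
  ultimately show ?thesis by simp
 qed
qed

lemma xi_tspace:
 assumes s: "s \<in> E" and a: "a \<in> E" and x: "x \<in> pts S"
 shows "xi s a x \<in> tspace M (s x)"
proof -
 obtain b d where bd: "(b, d) \<in> T" "x \<in> fst b" using ex_T[OF x] by blast
 show ?thesis unfolding xi_cvec[OF s a bd] by (rule cvec_tspace[OF M T2(2)[OF bd(1)] secD(3)[OF s bd]])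
qed

text \<open>A continuous map from a compact to a Hausdorff space is closed, and \<open>\<pi>\<close>
  is a left inverse. In bundle charts the first \<open>n\<close> rows of the Jacobi matrix form the
  identity, which gives injectivity on tangent vectors.\<close>

lemma sec_embedding:
 assumes s: "s \<in> E" shows "embedding S M s"
 unfolding embedding_def
proof (intro conjI ballI)
 note sm = secD(1)[OF s]
 have sc: "continuous_map (mtop S) (mtop M) s" using sm by (simp add: smooth_map_def)
 show "smooth_map S M s" by (rule sm)
 have "Hausdorff_space (mtop M)" using M by (simp add: oriented_mfd_def)
 then have "closed_map (mtop S) (mtop M) s"
  by (intro continuous_imp_closed_map_gen comp sc Hausdorff_imp_kc_space)
 moreover have "inj_on s (pts S)" using secD(2)[OF s] by (metis inj_onI)
 ultimately show "embedding_map (mtop S) (mtop M) s" by (rule injective_closed_imp_embedding_map[OF sc])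
 fix x assume x: "x \<in> pts S"
 obtain b d where bd: "(b, d) \<in> T" "x \<in> fst b" using ex_T[OF x] by blast
 note b = T2(1)[OF bd(1)] and d = T2(2)[OF bd(1)]
 have lj: "ljac b d s x i j = (if i = j then 1 else 0)" if "i < n" "j < n" for i j
 proof -
  have yb: "snd b x \<in> cim b" using bd by simp
  have "ljac b d s x i j = pd (cim b) j (%y. y i) (snd b x)" unfolding ljac_def ldom_sec[OF s bd(1)]
   by (rule pd_cong[OF bchart_opn[OF bd(1)] that(2) yb]) (simp add: sec_base[OF s bd(1) _ that(1)])
  also have "\<dots> = (if i = j then 1 else 0)"
   by (rule pd_eq[OF bchart_opn[OF bd(1)] yb that(2)]) (auto intro!: derivative_eq_intros)
  finally show ?thesis .
 qed
 show "inj_on (tmap S M s x) (tspace S x)"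
 proof (rule inj_onI)
  fix v w assume v: "v \<in> tspace S x" and w: "w \<in> tspace S x" and e: "tmap S M s x v = tmap S M s x w"
  have t: "tmap S M s x u d i = u b i" if u: "u \<in> tspace S x" and i: "i < n" for u i
   unfolding tmap_chart[OF S b M d sm bd(2) secD(3)[OF s bd] u] n
  proof -
   have "(\<Sum>j<n. ljac b d s x i j * u b j) = (\<Sum>j<n. (if i = j then 1 else 0) * u b j)"
    by (intro sum.cong refl arg_cong2[of _ _ _ _ "(*)"] lj i) simp
   also have "\<dots> = u b i" by (rule sum_delta_mult(2)) (use i in auto)
   finally show "(\<Sum>j<n. ljac b d s x i j * u b j) = u b i" .
  qed
  show "v = w"
  proof (rule tspace_eqI[OF S b bd(2) v w])
   fix i assume "i < mdim S"
   then show "v b i = w b i" using t[OF v, of i] t[OF w, of i] e n by simp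
  qed
 qed
qed

lemma in_gr_class:
 assumes s: "s \<in> E" shows "(S, s) \<in> gr_class M S s"
 using sec_embedding[OF s] oriented_diffeo_id[OF S] S comp by (auto simp: gr_class_def compact_oriented_def)

lemma topspace_section: "topspace (section_topology M S \<pi> T) = E"
 unfolding section_topology_def topology_generated_by_topspace by auto

text \<open>Every iterated derivative of a fibre coordinate of \<open>s + t a\<close> is affine in
  \<open>t\<close>, so preimages of subbasic sets have the form treated in
  \<open>open_uniform_less\<close>.\<close>

lemma line_path_continuous:
 assumes s: "s \<in> E" and a: "a \<in> E"
 shows "continuous_map euclideanreal (section_topology M S \<pi> T) (%t. line S T s t a)"
 unfolding section_topology_def
proof (rule continuous_on_generated_topo)
 show "(%t. line S T s t a) ` topspace euclideanreal <= \<Union> (insert E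
  {{h \<in> E. \<forall>x\<in>K. \<bar>pds (snd b ` fst b) js (%y. lrep b d h y i) (snd b x)
    - pds (snd b ` fst b) js (%y. lrep b d g y i) (snd b x)\<bar> < \<epsilon>} | g b d K js i \<epsilon>.
   g \<in> E & (b, d) \<in> T & compactin (mtop S) K & K <= fst b &
   set js <= {..<mdim S} & i \<in> {mdim S..<mdim M} & 0 < \<epsilon>})"
  using line_in_E[OF s a] by auto
 fix X assume "X \<in> insert E
  {{h \<in> E. \<forall>x\<in>K. \<bar>pds (snd b ` fst b) js (%y. lrep b d h y i) (snd b x)
    - pds (snd b ` fst b) js (%y. lrep b d g y i) (snd b x)\<bar> < \<epsilon>} | g b d K js i \<epsilon>.
   g \<in> E & (b, d) \<in> T & compactin (mtop S) K & K <= fst b &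
   set js <= {..<mdim S} & i \<in> {mdim S..<mdim M} & 0 < \<epsilon>}"
 then consider "X = E" | g b d K js i \<epsilon> where
  "X = {h \<in> E. \<forall>x\<in>K. \<bar>pds (cim b) js (%y. lrep b d h y i) (snd b x)
    - pds (cim b) js (%y. lrep b d g y i) (snd b x)\<bar> < \<epsilon>}"
  "g \<in> E" "(b, d) \<in> T" "compactin (mtop S) K" "K <= fst b" "set js <= {..<n}" "i \<in> {n..<m}" "0 < \<epsilon>"
  unfolding n m by blast
 then show "openin euclideanreal ((%t. line S T s t a) -` X \<inter> topspace euclideanreal)"
 proof cases
  case 1
  then show ?thesis using line_in_E[OF s a] by (simp add: vimage_def)
 next
  case 2
  let ?B = "cim b"
  have o: "opn n ?B" by (rule bchart_opn[OF 2(3)])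
  have K': "compact (snd b ` K)" by (rule snd_compact[OF S T2(1)[OF 2(3)] 2(4,5)])
  have KB: "snd b ` K <= ?B" using 2(5) by blast
  have C: "continuous_on (snd b ` K) (pds ?B js (%y. lrep b d h y i))" if "h \<in> E" for h
  proof -
   have "Ck n ?B 0 (pds ?B js (%y. lrep b d h y i))"
    using pds_linear[OF o sec_Ck[OF that 2(3)] sec_Ck[OF that 2(3)] 2(6)] by blast
   then show ?thesis using KB by (auto intro: continuous_on_subset)
  qed
  have eq: "pds ?B js (%y. lrep b d (line S T s t a) y i) y = pds ?B js (%y. lrep b d s y i) y + t * pds ?B js (%y. lrep b d a y i) y"
   if y: "y \<in> ?B" for t y
  proof -
   have "pds ?B js (%y. lrep b d (line S T s t a) y i) y = pds ?B js (%y. lrep b d s y i + t * lrep b d a y i) y"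
    by (rule pds_cong[OF o _ 2(6) y]) (use 2(7) in \<open>simp add: lrep_line[OF s a 2(3)] dot_def\<close>)
   also have "\<dots> = pds ?B js (%y. lrep b d s y i) y + t * pds ?B js (%y. lrep b d a y i) y"
    using pds_linear[OF o sec_Ck[OF s 2(3)] sec_Ck[OF a 2(3)] 2(6)] y by blast
   finally show ?thesis .
  qed
  have "open {t. \<forall>y\<in>snd b ` K. \<bar>(pds ?B js (%y. lrep b d s y i) y - pds ?B js (%y. lrep b d g y i) y) + t * pds ?B js (%y. lrep b d a y i) y\<bar> < \<epsilon>}"
   by (rule open_uniform_less[OF K' _ C[OF a] 2(8)]) (intro continuous_on_diff C s 2(2))
  moreover have "(%t. line S T s t a) -` X = {t. \<forall>y\<in>snd b ` K. \<bar>(pds ?B js (%y. lrep b d s y i) y - pds ?B js (%y. lrep b d g y i) y) + t * pds ?B js (%y. lrep b d a y i) y\<bar> < \<epsilon>}"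
  proof -
   have "line S T s t a \<in> X \<longleftrightarrow> (\<forall>x\<in>K. \<bar>(pds ?B js (%y. lrep b d s y i) (snd b x) - pds ?B js (%y. lrep b d g y i) (snd b x)) + t * pds ?B js (%y. lrep b d a y i) (snd b x)\<bar> < \<epsilon>)" for t
    unfolding 2(1) using line_in_E[OF s a, of t] eq KB by (simp add: algebra_simps image_subset_iff cong: ball_cong)
   then show ?thesis by (auto simp: vimage_def)
  qed
  ultimately show ?thesis by simp
 qed
qed

text \<open>A directional derivative at a point of \<open>U\<close> thus only involves values on
  \<open>U\<close>, where the local representatives are known to be integrals.\<close>

lemma eventually_line:
 assumes s: "s \<in> U" and a: "a \<in> E" and U: "openin (section_topology M S \<pi> T) U"
 obtains de where "0 < de" "!!t. \<bar>t\<bar> < de ==> line S T s t a \<in> U"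
proof -
 have UE: "U <= E" using openin_subset[OF U] topspace_section by simp
 then have sE: "s \<in> E" using s by blast
 have "openin euclideanreal {t \<in> topspace euclideanreal. line S T s t a \<in> U}"
  by (rule openin_continuous_map_preimage[OF line_path_continuous[OF sE a] U])
 then have "open {t. line S T s t a \<in> U}" by simp
 moreover have "line S T s 0 a = s"
  using line_0[OF sE a] sE by (intro extensionalityI[of _ "pts S"]) (auto simp: bundle_sections_def line_def)
 ultimately obtain de where "0 < de" "ball 0 de <= {t. line S T s t a \<in> U}"
  using s by (metis mem_Collect_eq open_contains_ball)
 then show ?thesis by (intro that[of de]) (auto simp: subset_iff dist_real_def)
qed

end

section \<open>Vertical fields as restrictions of vector fields on the ambient manifold\<close>

lemma tspace_zero: "(%_ _. 0) \<in> tspace M p"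
 by (simp add: tspace_def Rn_iff)

lemma tspace_sum:
 assumes "!!q. q \<in> C ==> w q \<in> tspace M p"
 shows "(%d i. \<Sum>q\<in>C. w q d i) \<in> tspace M p"
 unfolding tspace_def
proof (intro CollectI conjI allI impI ballI)
 show "(%i. \<Sum>q\<in>C. w q d i) = (%_. 0)" if "d \<notin> matlas M \<or> p \<notin> fst d" for d
  using tspaceD(1)[OF assms that] by simp
 show "(%i. \<Sum>q\<in>C. w q d i) \<in> Rn (mdim M)" if "d \<in> matlas M" for d
  using tspaceD(2)[OF assms that] by (simp add: Rn_iff)
 fix c d i assume cd: "c \<in> matlas M" "d \<in> matlas M" "p \<in> fst c \<inter> fst d" and i: "i < mdim M"
 have "(\<Sum>q\<in>C. w q d i) = (\<Sum>q\<in>C. \<Sum>j<mdim M. ljac c d (%p. p) p i j * w q c j)"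
  using tspaceD(3)[OF assms cd(1,2) _ _ i] cd(3) by (intro sum.cong) auto
 then show "(\<Sum>q\<in>C. w q d i) = (\<Sum>j<mdim M. ljac c d (%p. p) p i j * (\<Sum>q\<in>C. w q c j))"
  by (subst (asm) sum.swap) (simp add: sum_distrib_left)
qed

lemma cvec_scale: "cvec M c p (%i. k * v i) d i = k * cvec M c p v d i"
 by (simp add: cvec_def sum_distrib_left mult.left_commute)

lemma finite_open_subcover:
 assumes "compact_space X" "!!p. p \<in> topspace X ==> openin X (P p) & p \<in> P p"
 shows "\<exists>C. finite C & C <= topspace X & topspace X <= (\<Union>p\<in>C. P p)"
proof -
 have 1: "\<forall>U\<in>P ` topspace X. openin X U" using assms(2) by blast
 have 2: "topspace X <= \<Union>(P ` topspace X)" using assms(2) by blast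
 have "compactin X (topspace X)" using assms(1) by (simp add: compact_space_def)
 with 1 2 obtain F where F: "finite F" "F <= P ` topspace X" "topspace X <= \<Union>F"
  unfolding compactin_def by (metis (no_types, lifting))
 obtain C where "C <= topspace X" "finite C" "F = P ` C" using finite_subset_image[OF F(1,2)] by blast
 then show ?thesis using F(3) by blast
qed

context tube
begin

lemma tube_base_coords:
 assumes bd: "(b, d) \<in> T" and y: "y \<in> fst d"
 shows "(%i. if i < n then snd d y i else 0) = snd b (\<pi> y)" "\<pi> y \<in> fst b"
proof -
 show p: "\<pi> y \<in> fst b" using y unfolding T2(3)[OF bd] by simp
 show "(%i. if i < n then snd d y i else 0) = snd b (\<pi> y)"
  using T2(5)[OF bd y] snd_b_zero[OF bd p] by (auto simp: fun_eq_iff)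
qed

text \<open>The extension of a vertical field along a section is constant in the fibres, cut off by bump functions.\<close>

lemma xi_extend:
 assumes s: "s \<in> E" and a: "a \<in> E"
 shows "\<exists>u. vector_field M u & (\<forall>x\<in>pts S. u (s x) = xi s a x)"
proof -
 define R where "R p b d e K \<longleftrightarrow> (b, d) \<in> T & msm M e & (\<forall>x. 0 <= e x) & 0 < e (s p) &
  compactin (mtop M) K & K <= fst d & (\<forall>x. x \<notin> K --> e x = 0)" for p b d e K
 have "\<exists>b d e K. R p b d e K" if p: "p \<in> pts S" for p
 proof -
  obtain b d where bd: "(b, d) \<in> T" "p \<in> fst b" using ex_T[OF p] by blast
  from bump_function[OF M chart_open[OF M T2(2)[OF bd(1)]] secD(3)[OF s bd]] bd(1)
  show ?thesis unfolding R_def by blast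
 qed
 then obtain B D e K where R: "!!p. p \<in> pts S ==> R p (B p) (D p) (e p) (K p)" by metis
 have bdT: "(B p, D p) \<in> T" and em: "msm M (e p)" and e0: "!!x. 0 <= e p x" and ep: "0 < e p (s p)"
  and Kc: "compactin (mtop M) (K p)" and Kd: "K p <= fst (D p)" and ez: "!!x. x \<notin> K p ==> e p x = 0"
  if "p \<in> pts S" for p
  using R[OF that] by (simp_all add: R_def)
 have es: "msm S (%x. e p (s x))" if "p \<in> pts S" for p
  by (rule msm_compose[OF S M secD(1)[OF s] em[OF that]])
 obtain C where C: "finite C" "C <= pts S"
  "pts S <= (\<Union>p\<in>C. {x \<in> pts S. 0 < e p (s x)})"
  using finite_open_subcover[OF comp, of "%p. {x \<in> pts S. 0 < e p (s x)}"]
   msm_pos_open[OF S es] ep by auto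
 have CT: "p \<in> pts S" if "p \<in> C" for p using C(2) that by blast
 define E0 where "E0 x = (\<Sum>p\<in>C. e p (s x))" for x
 have E0: "0 < E0 x" if x: "x \<in> pts S" for x
 proof -
  obtain p where p: "p \<in> C" "0 < e p (s x)" using subsetD[OF C(3) x] by auto
  show ?thesis unfolding E0_def by (rule sum_pos2[where f = "%p. e p (s x)" and i = p, OF C(1) p]) (use e0 CT in auto)
 qed
 have E0m: "Ck n (cim b) r (%y. E0 (cinv b y))" if "(b, d) \<in> T" for b d r
  unfolding E0_def
  by (intro Ck_sum bchart_opn[OF that]) (use msm_Ck[OF es[OF CT] T2(1)[OF that]] n in auto)
 \<comment> \<open>The fibre coordinates of \<open>a\<close> at the base point of \<open>z\<close>,
   divided by the sum \<open>E0\<close> of all bumps along \<open>s\<close>. Weighted with the bumps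
   these fields therefore add up to the given field exactly on the image of
   \<open>s\<close>.\<close>
 define h where "h p z i = inverse (E0 (cinv (B p) (%i. if i < n then z i else 0))) *
  dot (B p) (D p) a (%i. if i < n then z i else 0) i" for p z i
 have hC: "Ck m (cim (D p)) r (%z. h p z i)" if p: "p \<in> C" for p i r
 proof -
  note bd = bdT[OF CT[OF p]]
  have "Ck n (cim (B p)) r (%y. inverse (E0 (cinv (B p) y)) * dot (B p) (D p) a y i)"
  proof (intro Ck_mult Ck_inverse bchart_opn[OF bd] E0m[OF bd] dot_Ck[OF a bd])
   show "E0 (cinv (B p) y) ~= 0" if y: "y \<in> cim (B p)" for y
    using E0[of "cinv (B p) y"] cinv_b[OF bd y] fst_b_subset[OF bd] by auto
  qed
  from cim_tube_Ck[OF bchart_opn[OF bd] dchart_opn[OF bd] nm this] T2(4)[OF bd]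
  show ?thesis unfolding h_def by simp
 qed
 have hR: "h p z \<in> Rn m" if p: "p \<in> C" and z: "z \<in> cim (D p)" for p z
 proof -
  note bd = bdT[OF CT[OF p]]
  have "(%i. if i < n then z i else 0) \<in> cim (B p)" using z unfolding T2(4)[OF bd] by simp
  then show ?thesis using dot_Rn[OF a bd] by (simp add: h_def[abs_def] Rn_iff)
 qed
 define w where "w p y = (if y \<in> fst (D p) then cvec M (D p) y (%i. e p y * h p (snd (D p) y) i) else (%_ _. 0))" for p y
 define u where "u y = (%d i. \<Sum>p\<in>C. w p y d i)" for y
 have wC: "Ck (mdim M) (cim c) r (%z. w p (cinv c z) c i)" if p: "p \<in> C" and c: "c \<in> matlas M" for p c r i
 proof -
  note bd = bdT[OF CT[OF p]] and pS = CT[OF p]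
  note d = T2(2)[OF bd]
  have id: "continuous_map (mtop M) (mtop M) (%p. p)" by (simp add: continuous_map_id[unfolded id_def])
  let ?A = "ldom c (D p) (%p. p)" and ?l = "lrep c (D p) (%p. p)" and ?A' = "ldom (D p) c (%p. p)"
  have oA: "opn m ?A" and oA': "opn m ?A'" using ldom_opn[OF M c M d id] ldom_opn[OF M d M c id] m by auto
  note tl = ldiffD(3)[OF transition_ldiff[OF M c d]]
  have lr: "Ck m ?A r (%y. f (?l y))" if "opn m B'" "?l ` ?A <= B'" "Ck m B' r f" for f B'
   using Ck_lrep_compose[OF M c M d smooth_id[OF M], of B' r f] that m by simp
  have "Ck m ?A r (%y. \<Sum>j<m. pd ?A' j (%z. lrep (D p) c (%p. p) z i) (?l y) * (e p (cinv c y) * h p (?l y) j))"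
  proof (intro Ck_sum Ck_mult oA)
   fix j assume "j \<in> {..<m}"
   then have j: "j < mdim M" using m by simp
   have "Ck m ?A' r (%z. pd ?A' j (%z. lrep (D p) c (%p. p) z i) z)"
    using Ck_pd[OF lrep_Ck[OF M d M c smooth_id[OF M], of "Suc r"] j] m by simp
   moreover have "?l ` ?A <= ?A'" using tl by (simp add: image_subset_iff)
   ultimately show "Ck m ?A r (%y. pd ?A' j (%z. lrep (D p) c (%p. p) z i) (?l y))" by (intro lr[OF oA'])
   have sub: "?A <= cim c" by (auto simp: ldom_def)
   show "Ck m ?A r (%y. e p (cinv c y))"
    using Ck_subset[OF msm_Ck[OF em[OF pS] c] cim_opn[OF M c] _ sub] oA m by simp
   show "Ck m ?A r (%y. h p (?l y) j)"
    by (rule lr[OF dchart_opn[OF bd] _ hC[OF p]]) (use lrep_in[OF M c, of _ "D p" "%p. p"] in \<open>simp add: image_subset_iff\<close>)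
  qed
  moreover have "(\<Sum>j<m. pd ?A' j (%z. lrep (D p) c (%p. p) z i) (?l y) * (e p (cinv c y) * h p (?l y) j)) = w p (cinv c y) c i"
   if y: "y \<in> ?A" for y
  proof -
   have x: "cinv c y \<in> fst c" "cinv c y \<in> fst (D p)" using y cinv_in[OF M c] by (auto simp: ldom_eq[OF M c])
   then show ?thesis using c by (simp add: w_def cvec_def ljac_def lrep_def m)
  qed
  ultimately have *: "Ck (mdim M) ?A r (%z. w p (cinv c z) c i)"
   using Ck_cong[OF oA, of "%y. \<Sum>j<m. pd ?A' j (%z. lrep (D p) c (%p. p) z i) (?l y) * (e p (cinv c y) * h p (?l y) j)"
    "%z. w p (cinv c z) c i" r] m by simp
  show ?thesis
  proof (rule extend_zero_Ck[OF M c d compact_closed[OF M Kc[OF pS]] Kd[OF pS], where h = "%x. w p x c i"])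
   show "w p x c i = 0" if "x \<in> pts M - K p" for x
    using ez[OF pS, of x] that by (simp add: w_def cvec_def)
   show "Ck (mdim M) {y \<in> cim c. cinv c y \<in> fst (D p)} r (%y. w p (cinv c y) c i)"
    unfolding ldom_id[OF M c] by (rule *)
  qed
 qed
 have "vector_field M u"
 proof (rule vector_fieldI[OF M])
  show "u y \<in> tspace M y" for y
   unfolding u_def
  proof (rule tspace_sum)
   show "w p y \<in> tspace M y" if "p \<in> C" for p
    using cvec_tspace[OF M T2(2)[OF bdT[OF CT[OF that]]]] tspace_zero[of M y] by (simp add: w_def)
  qed
  show "Ck (mdim M) (cim c) r (%z. u (cinv c z) c i)" if "c \<in> matlas M" for c i r
   unfolding u_def by (intro Ck_sum cim_opn[OF M that] wC that)
 qed
 moreover have "u (s x) = xi s a x" if x: "x \<in> pts S" for x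
 proof -
  have "w p (s x) d i = e p (s x) * inverse (E0 x) * xi s a x d i" if p: "p \<in> C" for p d i
  proof (cases "s x \<in> fst (D p)")
   case True
   note bd = bdT[OF CT[OF p]]
   have xb: "x \<in> fst (B p)" using tube_base_coords(2)[OF bd True] secD(2)[OF s x] by simp
   have tr: "(%i. if i < n then snd (D p) (s x) i else 0) = snd (B p) x"
    using tube_base_coords(1)[OF bd True] secD(2)[OF s x] by simp
   have "h p (snd (D p) (s x)) i = inverse (E0 x) * dot (B p) (D p) a (snd (B p) x) i" for i
    unfolding h_def tr cinv_snd[OF S T2(1)[OF bd] xb] by simp
   then have "w p (s x) d i = cvec M (D p) (s x) (%i. (e p (s x) * inverse (E0 x)) * dot (B p) (D p) a (snd (B p) x) i) d i"
    using True by (simp add: w_def mult.assoc)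
   then show ?thesis unfolding cvec_scale xi_cvec[OF s a bd xb] .
  next
   case False
   then have "e p (s x) = 0" using ez[OF CT[OF p]] Kd[OF CT[OF p]] by blast
   then show ?thesis using False by (simp add: w_def)
  qed
  then have "u (s x) d i = xi s a x d i" for d i
   using E0[OF x] by (simp add: u_def E0_def flip: sum_distrib_right)
  then show ?thesis by (simp add: fun_eq_iff)
 qed
 ultimately show ?thesis by blast
qed

text \<open>Both sides are classes modulo tangential fields over the same reparametrisations of
  \<open>s\<close>, and \<open>u\<close> agrees there with the variation field. So values prescribed
  on fundamental fields become values on tangent vectors of a chart.\<close>

lemma chart_tangent_fundamental:
 assumes s: "s \<in> E" and u: "!!x. x \<in> pts S ==> u (s x) = xi s a x"
 shows "chart_tangent M S T s a = fundamental M u (gr_class M S s)"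
proof -
 have eq: "equal_mod_tangential S' M gm' \<xi>' (%x. xi s a (f x)) \<longleftrightarrow> equal_mod_tangential S' M gm' \<xi>' (%x. u (gm' x))"
  if f: "oriented_diffeo S' S f" and g: "\<forall>x\<in>pts S'. gm' x = s (f x)" for S' :: "'s smfd" and gm' \<xi>' f
 proof -
  have "xi s a (f x) = u (gm' x)" if x: "x \<in> pts S'" for x
  proof -
   have "f x \<in> pts S" using f x by (auto simp: oriented_diffeo_def diffeo_def bij_betw_def)
   then show ?thesis using u g x by simp
  qed
  then show ?thesis unfolding equal_mod_tangential_def by (intro ball_cong refl) simp
 qed
 have "(S', gm', \<xi>') \<in> tangent_class M S s (xi s a) \<longleftrightarrow> (S', gm', \<xi>') \<in> fundamental M u (gr_class M S s)" for S' gm' \<xi>'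
  unfolding tangent_class_def fundamental_def gr_class_def using eq by blast
 then show ?thesis unfolding chart_tangent_def xi_def[symmetric, abs_def] by auto
qed

definition dsig :: "'s chart => 'a chart => ('s => 'a) => nat => (nat => real) => nat => real"
 where "dsig b d s j y = (%i. pd (cim b) j (%y. lrep b d s y i) y)"

lemma form_value:
 assumes bd: "(b, d) \<in> T" and y: "y \<in> cim b" and s: "s \<in> E" and as: "set as <= E"
  and js: "set js <= {..<n}" and al: "diff_form M (length as + length js) al"
 shows "al (s (cinv b y)) (map (%a. xi s a (cinv b y)) as @ map (tmap S M s (cinv b y)) (map (cbasis S b (cinv b y)) js)) =
  AM m (length as + length js) (coef M d al (lrep b d s y)) (map (%a. dot b d a y) as @ map (%j. dsig b d s j y) js)"
proof -
 let ?x = "cinv b y" and ?vs = "map (%a. dot b d a y) as @ map (%j. dsig b d s j y) js"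
 note b = T2(1)[OF bd] and d = T2(2)[OF bd]
 have x: "?x \<in> fst b" by (rule cinv_b[OF bd y])
 have sx: "s ?x \<in> fst d" by (rule secD(3)[OF s bd x])
 have sy: "snd b ?x = y" by (rule snd_cinv[OF S b y])
 have lj: "(%i. ljac b d s ?x i j) = dsig b d s j y" for j
  by (simp add: ljac_def ldom_sec[OF s bd] dsig_def sy)
 have "map (%a. xi s a ?x) as = map (cvec M d (s ?x)) (map (%a. dot b d a y) as)"
  using xi_cvec[OF s _ bd x] as by (auto simp: sy)
 moreover have "map (tmap S M s ?x) (map (cbasis S b ?x) js) = map (cvec M d (s ?x)) (map (%j. dsig b d s j y) js)"
  using tmap_cbasis(1)[OF S b M d secD(1)[OF s] x sx] js n by (auto simp: lj)
 ultimately have e1: "map (%a. xi s a ?x) as @ map (tmap S M s ?x) (map (cbasis S b ?x) js) = map (cvec M d (s ?x)) ?vs"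
  by simp
 have "dsig b d s j y \<in> Rn (mdim M)" if "j < n" for j
  using tmap_cbasis(2)[OF S b M d secD(1)[OF s] x sx, of j] that n by (simp add: lj)
 moreover have "dot b d a y \<in> Rn (mdim M)" if "a \<in> set as" for a
  using dot_Rn[OF _ bd y] as that m by auto
 ultimately have e2: "set ?vs <= Rn (mdim M)" using js by auto
 have e3: "length ?vs = length as + length js" by simp
 have e4: "snd d (s ?x) = lrep b d s y" by (simp add: lrep_def)
 show ?thesis using form_AM[OF M d al sx e2 e3] unfolding e1 e4 m .
qed

text \<open>Variation fields in the first slots, pulled back vectors in the others. Integrated over
  \<open>S\<close>, the form \<open>\<nu>\<close> with one direction gives the local representative
  of \<open>\<eta>\<close>, and \<open>\<mu>\<close> with two directions that of the
  Marsden-Weinstein form.\<close>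

definition Tform :: "'a form => ('s => 'a) => ('s => 'a) list => 's form"
 where "Tform al s as = (%x ws. al (s x) (map (%a. xi s a x) as @ map (tmap S M s x) ws))"

text \<open>The extensions serve twice: they make the variation fields smooth fields along
  \<open>s\<close>, and they realise the tangent vectors of a chart as fundamental fields.\<close>

lemma Tform_extension:
 assumes s: "s \<in> E" and as: "set as <= E"
 shows "\<exists>us. length us = length as & (\<forall>u\<in>set us. vector_field M u) &
  (\<forall>i<length as. \<forall>x\<in>pts S. (us ! i) (s x) = xi s (as ! i) x)"
 using as
proof (induction as)
 case (Cons a as)
 then obtain us where us: "length us = length as" "\<forall>u\<in>set us. vector_field M u"
  "\<forall>i<length as. \<forall>x\<in>pts S. (us ! i) (s x) = xi s (as ! i) x" by auto
 obtain u where u: "vector_field M u" "\<forall>x\<in>pts S. u (s x) = xi s a x"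
  using xi_extend[OF s, of a] Cons.prems by auto
 show ?case
 proof (intro exI[of _ "u # us"] conjI allI impI)
  show "\<forall>x\<in>pts S. ((u # us) ! i) (s x) = xi s ((a # as) ! i) x" if "i < length (a # as)" for i
   using us u that by (cases i) auto
 qed (use us u in auto)
qed simp

lemma density_cong:
 assumes e: "!!x. x \<in> pts S ==> al x = \<beta> x" and d: "density S al"
 shows "density S \<beta>"
proof -
 have e': "al x = \<beta> x" if "x \<in> fst c" "c \<in> matlas S" for x c using e chart_subset[OF S that(2)] that by blast
 have "continuous_on (cim c) (%y. cf S \<beta> c (cinv c y))" if c: "c \<in> matlas S" for c
 proof -
  have "continuous_on (cim c) (%y. cf S al c (cinv c y))" using d c by (simp add: density_def)
  then show ?thesis
   by (rule continuous_on_eq) (simp add: cf_def e'[OF cinv_in[OF S c] c])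
 qed
 then show ?thesis using d e' by (simp add: density_def)
qed

lemma Tform_density:
 assumes s: "s \<in> E" and as: "set as <= E" and al: "diff_form M (length as + n) al"
 shows "density S (Tform al s as)"
proof -
 obtain us where us: "length us = length as" "\<forall>u\<in>set us. vector_field M u"
  "\<forall>i<length as. \<forall>x\<in>pts S. (us ! i) (s x) = xi s (as ! i) x" using Tform_extension[OF s as] by blast
 let ?us = "map (%u x. u (s x)) us"
 have "density S (%x ws. al (s x) (map (%u. u x) ?us @ map (tmap S M s x) ws))"
  by (rule density_pull[OF S M secD(1)[OF s]]) (use al us vector_field_along[OF S M secD(1)[OF s]] n in auto)
 then show ?thesis
 proof (rule density_cong[rotated])
  fix x assume x: "x \<in> pts S"
  have "map (%u. u x) ?us = map (%a. xi s a x) as" using us x by (auto intro!: nth_equalityI)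
  then show "(%ws. al (s x) (map (%u. u x) ?us @ map (tmap S M s x) ws)) = Tform al s as x"
   by (simp add: Tform_def)
 qed
qed

end

subsection \<open>Differentiation and continuity of integral functionals\<close>

text \<open>\<open>C\<close> is the volume of a cube around \<open>K\<close>; it is chosen before
  the integrand.\<close>

lemma RInt_bound:
 assumes K: "compact K" "K <= Rn n"
 shows "\<exists>C\<ge>0. \<forall>F B. csupp n F --> (\<forall>y\<in>Rn n - K. F y = 0) --> (\<forall>y\<in>K. \<bar>F y\<bar> <= B) --> 0 <= B --> \<bar>RInt n F\<bar> <= B * C"
proof -
 interpret product_sigma_finite "%_::nat. lborel :: real measure"
  by (simp add: product_sigma_finite_def sigma_finite_lborel)
 obtain R where R: "0 < R" "!!y i. y \<in> K ==> \<bar>y i\<bar> < R" using compact_Rn_bounded[OF K] by metis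
 let ?A = "Pi\<^sub>E {..<n} (%_. {-R..R})"
 have A: "?A \<in> sets (Leb n)" by (intro sets_PiM_I_finite) auto
 have fin: "emeasure (Leb n) ?A < \<infinity>"
  using R(1) by (subst emeasure_PiM) (auto simp: power_less_top_ennreal)
 have "\<bar>RInt n F\<bar> <= B * measure (Leb n) ?A"
  if F: "csupp n F" "\<forall>y\<in>Rn n - K. F y = 0" "\<forall>y\<in>K. \<bar>F y\<bar> <= B" "0 <= B" for F B
 proof -
  have i1: "integrable (Leb n) (%x. F (exn n x))" by (rule integrable_csupp[OF F(1)])
  have i2: "integrable (Leb n) (%x. B * indicat_real ?A x)" using A fin by simp
  have "\<bar>RInt n F\<bar> <= (\<integral>x. \<bar>F (exn n x)\<bar> \<partial>Leb n)"
   unfolding RInt_def using integral_norm_bound[of "Leb n" "%x. F (exn n x)"] by simp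
  also have "\<dots> <= (\<integral>x. B * indicat_real ?A x \<partial>Leb n)"
  proof (rule integral_mono)
   show "integrable (Leb n) (%x. \<bar>F (exn n x)\<bar>)" using i1 by simp
   show "integrable (Leb n) (%x. B * indicat_real ?A x)" by (rule i2)
   fix x assume x: "x \<in> space (Leb n)"
   show "\<bar>F (exn n x)\<bar> <= B * indicat_real ?A x"
   proof (cases "exn n x \<in> K")
    case True
    have "x i \<in> {-R..R}" if "i < n" for i
     using R(2)[OF True, of i] that by (auto simp: exn_def)
    then have "x \<in> ?A" using x by (auto simp: space_PiM PiE_iff)
    then show ?thesis using F(3) True by simp
   next
    case False
    then have "F (exn n x) = 0" using F(2) exn_Rn by blast
    then show ?thesis using F(4) by simp
   qed
  qed
  also have "\<dots> = B * measure (Leb n) ?A" using A by simp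
  finally show ?thesis .
 qed
 then show ?thesis by (intro exI[of _ "measure (Leb n) ?A"]) simp
qed

text \<open>Around each point of \<open>C\<close> the function varies by less than
  \<open>e / 2\<close> on a box of radius \<open>2 * r\<close>. Finitely many boxes of half that
  size cover \<open>C\<close>, and the other half leaves room for the step from \<open>z\<close> to
  \<open>w\<close>.\<close>

lemma compact_uniform_box:
 assumes D: "opn m D" and C: "compact C" "C <= D" and h: "continuous_on D (h :: _ => real)" and e: "0 < e"
 shows "\<exists>de>0. \<forall>z\<in>C. \<forall>w\<in>Rn m. (\<forall>i<m. \<bar>w i - z i\<bar> < de) --> w \<in> D & \<bar>h w - h z\<bar> < e"
proof -
 have "\<exists>r>0. boxn m z (2 * r) <= D & (\<forall>w\<in>boxn m z (2 * r). \<bar>h w - h z\<bar> < e / 2)" if z: "z \<in> C" for z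
 proof -
  have zD: "z \<in> D" using C z by blast
  have "opn m ({w \<in> D. h w < h z + e / 2} \<inter> {w \<in> D. h z - e / 2 < h w})"
   by (intro openin_Int opn_less D h continuous_intros)
  moreover have "z \<in> {w \<in> D. h w < h z + e / 2} \<inter> {w \<in> D. h z - e / 2 < h w}" using zD e by simp
  ultimately obtain r where r: "0 < r" "boxn m z r <= {w \<in> D. h w < h z + e / 2} \<inter> {w \<in> D. h z - e / 2 < h w}"
   by (rule opn_contains_boxn)
  have "\<bar>h w - h z\<bar> < e / 2" if "w \<in> boxn m z r" for w
  proof -
   have "h w < h z + e / 2" "h z - e / 2 < h w" using subsetD[OF r(2) that] by auto
   then show ?thesis by linarith
  qed
  then show ?thesis using r by (intro exI[of _ "r / 2"]) auto
 qed
 then obtain r where r: "!!z. z \<in> C ==> 0 < r z" "!!z. z \<in> C ==> boxn m z (2 * r z) <= D"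
  "!!z w. z \<in> C ==> w \<in> boxn m z (2 * r z) ==> \<bar>h w - h z\<bar> < e / 2" by metis
 define O' where "O' z = (\<Inter>i\<in>{..<m}. {w :: nat => real. \<bar>w i - z i\<bar> < r z})" for z
 have "open (O' z)" for z unfolding O'_def
  by (intro open_INT ballI open_Collect_less continuous_intros continuous_on_apply) auto
 moreover have "C <= (\<Union>z\<in>C. O' z)" using r(1) by (auto simp: O'_def)
 ultimately obtain F where F: "F <= C" "finite F" "C <= (\<Union>z\<in>F. O' z)"
  using compactE_image[OF C(1), of C O'] by metis
 define de where "de = Min (insert 1 (r ` F))"
 have de: "0 < de" using F r(1) by (auto simp: de_def)
 have "w \<in> D & \<bar>h w - h z\<bar> < e" if z: "z \<in> C" and w: "w \<in> Rn m" "\<forall>i<m. \<bar>w i - z i\<bar> < de" for z w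
 proof -
  obtain q where q: "q \<in> F" "z \<in> O' q" using F(3) z by blast
  have qC: "q \<in> C" using q F(1) by blast
  have deq: "de <= r q" using q F(2) by (simp add: de_def)
  have zR: "z \<in> Rn m" using z C(2) opn_subset[OF D] by blast
  have zq: "\<bar>z i - q i\<bar> < r q" if "i < m" for i using q(2) that by (simp add: O'_def)
  have "\<bar>w i - q i\<bar> < 2 * r q" if "i < m" for i
  proof -
   have "\<bar>w i - z i\<bar> < de" using w(2) that by blast
   then show ?thesis using zq[OF that] deq by linarith
  qed
  then have wb: "w \<in> boxn m q (2 * r q)" using w(1) by (simp add: boxn_def)
  have "\<bar>z i - q i\<bar> < 2 * r q" if "i < m" for i using zq[OF that] r(1)[OF qC] by linarith
  then have zb: "z \<in> boxn m q (2 * r q)" using zR by (simp add: boxn_def)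
  have "\<bar>h w - h q\<bar> < e / 2" "\<bar>h z - h q\<bar> < e / 2" using r(3)[OF qC wb] r(3)[OF qC zb] by auto
  then have "\<bar>h w - h z\<bar> < e" by linarith
  then show ?thesis using r(2)[OF qC] wb by blast
 qed
 then show ?thesis using de by blast
qed

lemma mean_value_bound:
 fixes u u' :: "real => real"
 assumes u: "!!t. (u has_real_derivative u' t) (at t)" and e: "!!t. \<bar>t\<bar> <= \<bar>t0\<bar> ==> \<bar>u' t - D\<bar> <= e"
 shows "\<bar>u t0 - u 0 - t0 * D\<bar> <= \<bar>t0\<bar> * e"
proof -
 have "\<exists>z. \<bar>z\<bar> <= \<bar>t0\<bar> & u t0 - u 0 = t0 * u' z"
 proof (cases "0 < t0")
  case True
  obtain z where "0 < z" "z < t0" "u t0 - u 0 = (t0 - 0) * u' z" using MVT2[OF True, of u u'] u by blast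
  then show ?thesis by (intro exI[of _ z]) auto
 next
  case False
  show ?thesis
  proof (cases "t0 = 0")
   case False
   with \<open>\<not> 0 < t0\<close> have t0: "t0 < 0" by simp
   obtain z where "t0 < z" "z < 0" "u 0 - u t0 = (0 - t0) * u' z" using MVT2[OF t0, of u u'] u by blast
   then show ?thesis by (intro exI[of _ z]) auto
  qed simp
 qed
 then obtain z where z: "\<bar>z\<bar> <= \<bar>t0\<bar>" "u t0 - u 0 = t0 * u' z" by blast
 have "u t0 - u 0 - t0 * D = t0 * (u' z - D)" unfolding z(2) by (simp add: algebra_simps)
 then show ?thesis using e[OF z(1)] by (simp add: abs_mult mult_left_mono)
qed

context tube
begin

abbreviation tau where "tau \<equiv> section_topology M S \<pi> T"

lemma limitin_E:
 assumes "limitin tau \<sigma> s0 F" shows "s0 \<in> E" "eventually (%z. \<sigma> z \<in> E) F"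
 using assms openin_topspace[of tau] unfolding limitin_def topspace_section by auto

lemma line_0_eq: "s \<in> E ==> a \<in> E ==> line S T s 0 a = s"
 using line_0[of s a] by (intro extensionalityI[of _ "pts S"]) (auto simp: bundle_sections_def line_def)

lemma limitin_line:
 assumes s: "s \<in> E" and a: "a \<in> E"
 shows "limitin tau (%t. line S T s t a) s (nhds 0)"
 unfolding limitin_def topspace_section
proof (intro conjI allI impI s, elim conjE)
 fix U assume U: "openin tau U" "s \<in> U"
 obtain de where "0 < de" "!!t. \<bar>t\<bar> < de ==> line S T s t a \<in> U" using eventually_line[OF U(2) a U(1)] by blast
 then show "eventually (%t. line S T s t a \<in> U) (nhds 0)"
  unfolding eventually_nhds_metric by (intro exI[of _ de]) (auto simp: dist_real_def)
qed

lemma limitin_const_E: "a \<in> E ==> limitin tau (%z. a) a F"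
 by (simp add: limitin_def topspace_section)

text \<open>For a fibre coordinate the convergence is built into the topology of sections; a base
  coordinate is the same function for all sections.\<close>

lemma pds_uniform_limit:
 assumes bd: "(b, d) \<in> T" and K: "compact K" "K <= cim b" and \<sigma>: "limitin tau \<sigma> s0 F"
  and i: "i < m" and js: "set js <= {..<n}"
 shows "uniform_limit K (%z y. pds (cim b) js (%y. lrep b d (\<sigma> z) y i) y) (%y. pds (cim b) js (%y. lrep b d s0 y i) y) F"
proof (rule uniform_limitI)
 fix e :: real assume e: "0 < e"
 note E = limitin_E[OF \<sigma>]
 show "\<forall>\<^sub>F z in F. \<forall>y\<in>K. dist (pds (cim b) js (%y. lrep b d (\<sigma> z) y i) y) (pds (cim b) js (%y. lrep b d s0 y i) y) < e"
 proof (cases "i < n")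
  case True
  show ?thesis using E(2)
  proof (rule eventually_mono, intro ballI)
   fix z y assume z: "\<sigma> z \<in> E" and y: "y \<in> K"
   have "pds (cim b) js (%y. lrep b d (\<sigma> z) y i) y = pds (cim b) js (%y. lrep b d s0 y i) y"
    by (rule pds_cong[OF bchart_opn[OF bd] _ js]) (use sec_base[OF z bd _ True] sec_base[OF E(1) bd _ True] y K in auto)
   then show "dist (pds (cim b) js (%y. lrep b d (\<sigma> z) y i) y) (pds (cim b) js (%y. lrep b d s0 y i) y) < e"
    using e by simp
  qed
 next
  case False
  let ?K = "cinv b ` K"
  let ?X = "{h \<in> E. \<forall>x\<in>?K. \<bar>pds (snd b ` fst b) js (%y. lrep b d h y i) (snd b x)
    - pds (snd b ` fst b) js (%y. lrep b d s0 y i) (snd b x)\<bar> < e}"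
  have "compactin (mtop S) ?K" by (rule cinv_compact[OF S T2(1)[OF bd] K])
  moreover have "?K <= fst b" using cinv_b[OF bd] K by blast
  moreover have "i \<in> {mdim S..<mdim M}" "set js <= {..<mdim S}" using i False js n m by auto
  ultimately have "openin tau ?X" unfolding section_topology_def
   using E(1) bd e by (intro topology_generated_by_Basis insertI2 CollectI) blast
  moreover have "s0 \<in> ?X" using E(1) e by simp
  ultimately have "eventually (%z. \<sigma> z \<in> ?X) F" using \<sigma> unfolding limitin_def by blast
  then show ?thesis
  proof (rule eventually_mono)
   fix z assume z: "\<sigma> z \<in> ?X"
   show "\<forall>y\<in>K. dist (pds (cim b) js (%y. lrep b d (\<sigma> z) y i) y) (pds (cim b) js (%y. lrep b d s0 y i) y) < e"
   proof
    fix y assume y: "y \<in> K"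
    have "snd b (cinv b y) = y" using snd_cinv[OF S T2(1)[OF bd]] y K by blast
    then show "dist (pds (cim b) js (%y. lrep b d (\<sigma> z) y i) y) (pds (cim b) js (%y. lrep b d s0 y i) y) < e"
     using z y by (auto simp: dist_real_def)
   qed
  qed
 qed
qed

text \<open>The integrands that arise by differentiating local representatives in directions \<open>A 0, A 1, \<dots>\<close>.\<close>

inductive jet :: "'s chart => 'a chart => nat => (('s => 'a) => (nat => 's => 'a) => (nat => real) => real) => bool"
 for b d q where
 jet_const: "jet b d q (%s A y. k)"
| jet_coef: "(!!r. Ck m (cim d) r h) ==> jet b d q (%s A y. h (lrep b d s y))"
| jet_dsig: "j < n ==> i < m ==> jet b d q (%s A y. dsig b d s j y i)"
| jet_dot: "l < q ==> i < m ==> jet b d q (%s A y. dot b d (A l) y i)"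
| jet_ddot: "l < q ==> j < n ==> i < m ==> jet b d q (%s A y. pd (cim b) j (%y. dot b d (A l) y i) y)"
| jet_add: "jet b d q I ==> jet b d q J ==> jet b d q (%s A y. I s A y + J s A y)"
| jet_mult: "jet b d q I ==> jet b d q J ==> jet b d q (%s A y. I s A y * J s A y)"

lemma jet_sum: "(!!i. i \<in> X ==> jet b d q (f i)) ==> jet b d q (%s A y. \<Sum>i\<in>X. f i s A y)"
 by (induction X rule: infinite_finite_induct) (auto intro: jet_const jet_add)

lemma jet_prod: "(!!i. i \<in> X ==> jet b d q (f i)) ==> jet b d q (%s A y. \<Prod>i\<in>X. f i s A y)"
 by (induction X rule: infinite_finite_induct) (auto intro: jet_const jet_mult)

text \<open>A derivative puts its direction in front, so the earlier directions move up by
  one.\<close>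

lemma jet_shift: "jet b d q I ==> jet b d (Suc q) (%s A. I s (A \<circ> Suc))"
proof (induction rule: jet.induct)
 case (jet_dot l i)
 then show ?case using jet.jet_dot[of "Suc l" "Suc q" i b d] by simp
next
 case (jet_ddot l j i)
 then show ?case using jet.jet_ddot[of "Suc l" "Suc q" j i b d] by simp
qed (auto intro: jet.intros)

lemma jet_Ck:
 assumes "jet b d q I" and bd: "(b, d) \<in> T" and s: "s \<in> E" and A: "!!l. l < q ==> A l \<in> E"
 shows "Ck n (cim b) r (I s A)"
 using assms(1)
proof (induction rule: jet.induct)
 case (jet_coef h)
 show ?case
  by (rule Ck_compose[where \<phi> = "lrep b d s", OF bchart_opn[OF bd] dchart_opn[OF bd] jet_coef sec_Ck[OF s bd]])
   (use lrep_cim[OF s bd] in blast)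
next
 case (jet_dsig j i)
 show ?case unfolding dsig_def using Ck_pd[OF sec_Ck[OF s bd, of "Suc r" i] jet_dsig(1)] by simp
next
 case (jet_dot l i)
 show ?case by (rule dot_Ck[OF A[OF jet_dot(1)] bd])
next
 case (jet_ddot l j i)
 show ?case using Ck_pd[OF dot_Ck[OF A[OF jet_ddot(1)] bd, of "Suc r" i] jet_ddot(2)] by simp
next
 case (jet_const k)
 show ?case by (rule Ck_const[OF bchart_opn[OF bd]])
next
 case (jet_add I J)
 then show ?case by (intro Ck_add bchart_opn[OF bd])
next
 case (jet_mult I J)
 then show ?case by (intro Ck_mult bchart_opn[OF bd])
qed

text \<open>The derivative is required along the whole line, not only at \<open>t = 0\<close>,
  because differentiation under the integral sign relies on the mean value theorem in
  \<open>t\<close>. \<open>case_nat a A\<close> prepends \<open>a\<close> to the directions.\<close>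

definition jet_deriv where
 "jet_deriv b q I I' \<longleftrightarrow> (\<forall>s\<in>E. \<forall>a\<in>E. \<forall>A. (\<forall>l<q. A l \<in> E) --> (\<forall>y\<in>cim b. \<forall>t.
  ((%t. I (line S T s t a) A y) has_real_derivative I' (line S T s t a) (case_nat a A) y) (at t)))"

lemma case_nat_Suc: "case_nat a A \<circ> Suc = A"
 by (simp add: fun_eq_iff)

text \<open>The coordinates of \<open>s + t a\<close> are affine in \<open>t\<close> with slope
  \<open>dot\<close>. Hence a coefficient yields its partial derivatives times \<open>dot\<close>,
  \<open>dsig\<close> yields a derivative of \<open>dot\<close>, and factors made of the other
  directions are constant.\<close>

lemma ex_jet_deriv:
 assumes "jet b d q I" and bd: "(b, d) \<in> T"
 shows "\<exists>I'. jet b d (Suc q) I' & jet_deriv b q I I'"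
 using assms(1)
proof (induction rule: jet.induct)
 case (jet_const k)
 show ?case
  by (rule exI[of _ "%s A y. 0"]) (auto simp: jet_deriv_def intro: jet.jet_const)
next
 case (jet_coef h)
 let ?I = "%s A y. \<Sum>i<m. pd (cim d) i h (lrep b d s y) * dot b d (A 0) y i"
 have "jet b d (Suc q) ?I"
 proof (rule jet_sum)
  fix i assume "i \<in> {..<m}"
  then have i: "i < m" by simp
  have "Ck m (cim d) r (pd (cim d) i h)" for r by (rule Ck_pd[OF jet_coef i])
  then show "jet b d (Suc q) (%s A y. pd (cim d) i h (lrep b d s y) * dot b d (A 0) y i)"
   using i by (intro jet.jet_mult jet.jet_coef jet.jet_dot) auto
 qed
 moreover have "((%t. h (lrep b d (line S T s t a) y)) has_real_derivative ?I (line S T s t a) (case_nat a A) y) (at t)"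
  if s: "s \<in> E" and a: "a \<in> E" and y: "y \<in> cim b" for s a A y t
 proof -
  have "((%t. h (lrep b d (line S T s t a) y)) has_real_derivative
    (\<Sum>i<m. pd (cim d) i h (lrep b d (line S T s t a) y) * dot b d a y i)) (at t)"
  proof (rule chain_rule_curve[OF dchart_opn[OF bd]])
   show "hpd h i (pd (cim d) i h x) x" if "i < m" "x \<in> cim d" for i x
    by (rule Ck_hpd[OF jet_coef dchart_opn[OF bd] that])
   show "continuous_on (cim d) (pd (cim d) i h)" if "i < m" for i
    by (rule Ck_continuous[OF Ck_pd[OF jet_coef that]])
   show "lrep b d (line S T s t a) y \<in> cim d" by (rule lrep_cim[OF line_in_E[OF s a] bd y])
   show "eventually (%t. lrep b d (line S T s t a) y \<in> Rn m) (at t)"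
    using lrep_Rn[OF line_in_E[OF s a] bd y] by simp
   show "((%t. lrep b d (line S T s t a) y i) has_real_derivative dot b d a y i) (at t)" for i
    unfolding lrep_line[OF s a bd y] by (auto intro!: derivative_eq_intros)
  qed
  then show ?thesis by simp
 qed
 ultimately show ?case by (intro exI[of _ ?I]) (auto simp: jet_deriv_def)
next
 case (jet_dsig j i)
 let ?I = "%s A y. pd (cim b) j (%y. dot b d (A 0) y i) y"
 have "((%t. dsig b d (line S T s t a) j y i) has_real_derivative ?I (line S T s t a) (case_nat a A) y) (at t)"
  if s: "s \<in> E" and a: "a \<in> E" and y: "y \<in> cim b" for s a A y t
 proof -
  have "dsig b d (line S T s t a) j y i = dsig b d s j y i + t * pd (cim b) j (%y. dot b d a y i) y" for t
   unfolding dsig_def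
  proof (rule pd_eq[OF bchart_opn[OF bd] y jet_dsig(1)])
   have "hpd (%y. lrep b d s y i) j (pd (cim b) j (%y. lrep b d s y i) y) y"
    by (rule Ck_hpd[OF sec_Ck[OF s bd, of "Suc 0"] bchart_opn[OF bd] jet_dsig(1) y])
   moreover have "hpd (%y. dot b d a y i) j (pd (cim b) j (%y. dot b d a y i) y) y"
    by (rule Ck_hpd[OF dot_Ck[OF a bd, of "Suc 0"] bchart_opn[OF bd] jet_dsig(1) y])
   ultimately have h: "hpd (%y. lrep b d s y i + t * dot b d a y i) j
     (pd (cim b) j (%y. lrep b d s y i) y + t * pd (cim b) j (%y. dot b d a y i) y) y"
    by (intro DERIV_add DERIV_cmult)
   show "hpd (%y. lrep b d (line S T s t a) y i) j
     (pd (cim b) j (%y. lrep b d s y i) y + t * pd (cim b) j (%y. dot b d a y i) y) y"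
    by (rule hpd_cong[OF bchart_opn[OF bd] y jet_dsig(1) h]) (simp add: lrep_line[OF s a bd])
  qed
  then show ?thesis by (auto intro!: derivative_eq_intros)
 qed
 then show ?case
  using jet_dsig jet.jet_ddot[of 0 "Suc q" j i b d] by (intro exI[of _ ?I]) (auto simp: jet_deriv_def)
next
 case (jet_dot l i)
 show ?case by (rule exI[of _ "%s A y. 0"]) (auto simp: jet_deriv_def intro: jet.jet_const)
next
 case (jet_ddot l j i)
 show ?case by (rule exI[of _ "%s A y. 0"]) (auto simp: jet_deriv_def intro: jet.jet_const)
next
 case (jet_add I J)
 then obtain I' J' where IJ: "jet b d (Suc q) I'" "jet_deriv b q I I'" "jet b d (Suc q) J'" "jet_deriv b q J J'" by blast
 have "jet_deriv b q (%s A y. I s A y + J s A y) (%s A y. I' s A y + J' s A y)"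
  unfolding jet_deriv_def
 proof (intro ballI allI impI)
  fix s a A y t assume *: "s \<in> E" "a \<in> E" "\<forall>l<q. A l \<in> E" "y \<in> cim b"
  show "((%t. I (line S T s t a) A y + J (line S T s t a) A y) has_real_derivative
    I' (line S T s t a) (case_nat a A) y + J' (line S T s t a) (case_nat a A) y) (at t)"
   using IJ(2,4) * unfolding jet_deriv_def by (intro DERIV_add) blast+
 qed
 then show ?case using jet.jet_add[OF IJ(1,3)] by blast
next
 case (jet_mult I J)
 then obtain I' J' where IJ: "jet b d (Suc q) I'" "jet_deriv b q I I'" "jet b d (Suc q) J'" "jet_deriv b q J J'" by blast
 \<comment> \<open>The factor that is not differentiated still refers to the old directions, which
   now start at index 1.\<close>
 let ?H = "%s A y. I' s A y * J s (A \<circ> Suc) y + J' s A y * I s (A \<circ> Suc) y"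
 have "jet_deriv b q (%s A y. I s A y * J s A y) ?H"
  unfolding jet_deriv_def
 proof (intro ballI allI impI)
  fix s a A y t assume *: "s \<in> E" "a \<in> E" "\<forall>l<q. A l \<in> E" "y \<in> cim b"
  show "((%t. I (line S T s t a) A y * J (line S T s t a) A y) has_real_derivative
    ?H (line S T s t a) (case_nat a A) y) (at t)"
   unfolding case_nat_Suc using IJ(2,4) * unfolding jet_deriv_def by (intro DERIV_mult) blast+
 qed
 moreover have "jet b d (Suc q) ?H"
  using jet.jet_add[OF jet.jet_mult[OF IJ(1) jet_shift[OF jet_mult(2)]] jet.jet_mult[OF IJ(3) jet_shift[OF jet_mult(1)]]] .
 ultimately show ?case by blast
qed

text \<open>Sums and products preserve uniform convergence, jets being bounded on \<open>K\<close>;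
  a coefficient \<open>h\<close> is uniformly continuous near the compact image of \<open>K\<close>.
  A general filter covers both continuity and the limit along a line.\<close>

lemma jet_uniform_limit:
 assumes "jet b d q I" and bd: "(b, d) \<in> T" and K: "compact K" "K <= cim b"
  and \<sigma>: "limitin tau \<sigma> s0 F" and A: "!!l. l < q ==> limitin tau (%z. A z l) (A0 l) F"
 shows "uniform_limit K (%z. I (\<sigma> z) (A z)) (I s0 A0) F"
 using assms(1)
proof (induction rule: jet.induct)
 case (jet_const k)
 show ?case by (rule uniform_limit_const)
next
 case (jet_coef h)
 have s0: "s0 \<in> E" by (rule limitin_E(1)[OF \<sigma>])
 show ?case
 proof (rule uniform_limitI)
  fix e :: real assume e: "0 < e"
  have "continuous_on K (%y. lrep b d s0 y i)" for i
   using Ck_continuous[OF sec_Ck[OF s0 bd]] K(2) by (rule continuous_on_subset)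
  then have "continuous_on K (lrep b d s0)"
   by (intro continuous_on_Rn_valued[of _ _ m]) (use lrep_Rn[OF s0 bd] K in auto)
  then have C: "compact (lrep b d s0 ` K)" by (rule compact_continuous_image[OF _ K(1)])
  have CD: "lrep b d s0 ` K <= cim d" using lrep_cim[OF s0 bd] K by blast
  obtain de where de: "0 < de" "\<forall>z\<in>lrep b d s0 ` K. \<forall>w\<in>Rn m. (\<forall>i<m. \<bar>w i - z i\<bar> < de) --> w \<in> cim d & \<bar>h w - h z\<bar> < e"
   using compact_uniform_box[OF dchart_opn[OF bd] C CD Ck_continuous[OF jet_coef] e] by blast
  have "\<forall>\<^sub>F z in F. \<forall>i\<in>{..<m}. \<forall>y\<in>K. dist (lrep b d (\<sigma> z) y i) (lrep b d s0 y i) < de"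
  proof (rule eventually_ball_finite, simp, rule ballI)
   fix i assume "i \<in> {..<m}"
   then show "\<forall>\<^sub>F z in F. \<forall>y\<in>K. dist (lrep b d (\<sigma> z) y i) (lrep b d s0 y i) < de"
    using uniform_limitD[OF pds_uniform_limit[OF bd K \<sigma>, of i "[]"] de(1)] by (simp add: pds_def)
  qed
  with limitin_E(2)[OF \<sigma>] show "\<forall>\<^sub>F z in F. \<forall>y\<in>K. dist (h (lrep b d (\<sigma> z) y)) (h (lrep b d s0 y)) < e"
  proof eventually_elim
   case (elim z)
   show ?case
   proof
    fix y assume y: "y \<in> K"
    have "lrep b d (\<sigma> z) y \<in> Rn m" using lrep_Rn[OF elim(1) bd] y K by blast
    then show "dist (h (lrep b d (\<sigma> z) y)) (h (lrep b d s0 y)) < e"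
     using de(2)[rule_format, of "lrep b d s0 y" "lrep b d (\<sigma> z) y"] elim(2) y by (auto simp: dist_real_def)
   qed
  qed
 qed
next
 case (jet_dsig j i)
 show ?case using pds_uniform_limit[OF bd K \<sigma> jet_dsig(2), of "[j]"] jet_dsig(1) by (simp add: pds_def dsig_def)
next
 case (jet_dot l i)
 show ?case using pds_uniform_limit[OF bd K A[OF jet_dot(1)] jet_dot(2), of "[]"]
  by (cases "i < n") (simp_all add: pds_def dot_def uniform_limit_const)
next
 case (jet_ddot l j i)
 show ?case using pds_uniform_limit[OF bd K A[OF jet_ddot(1)] jet_ddot(3), of "[j]"] jet_ddot(2)
  by (cases "i < n") (simp_all add: pds_def dot_def uniform_limit_const)
next
 case (jet_add I J)
 then show ?case by (intro uniform_limit_add)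
next
 case (jet_mult I J)
 have "bounded (H s0 A0 ` K)" if H: "jet b d q H" for H
 proof (rule compact_imp_bounded[OF compact_continuous_image[OF continuous_on_subset K(1)]])
  show "continuous_on (cim b) (H s0 A0)"
   by (rule Ck_continuous[OF jet_Ck[OF H bd limitin_E(1)[OF \<sigma>]]]) (use limitin_E(1)[OF A] in blast)
  show "K <= cim b" by (rule K(2))
 qed
 then show ?case using jet_mult by (intro uniform_lim_mult)
qed

text \<open>The part of an integrand that does not depend on the section: the orientation sign times
  a cut-off function.\<close>

definition weight where
 "weight b K w \<longleftrightarrow> continuous_on (cim b) w & compact K & K <= cim b & (\<forall>y\<in>cim b - K. w y = (0::real))"

definition wint :: "'s chart => ((nat => real) => real) => ((nat => real) => real) => real"
 where "wint b w g = RInt n (%y. if y \<in> cim b then w y * g y else 0)"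

lemma csupp_weight:
 assumes "weight b K w" "(b, d) \<in> T" "continuous_on (cim b) g"
 shows "csupp n (%y. if y \<in> cim b then w y * g y else 0)"
 by (rule csupp_extend[OF bchart_opn[OF assms(2)], where K = K])
  (use assms in \<open>auto simp: weight_def intro!: continuous_intros\<close>)

lemma wint_lin:
 assumes w: "weight b K w" and bd: "(b, d) \<in> T" and g: "continuous_on (cim b) g" "continuous_on (cim b) h"
 shows "wint b w (%y. g y + t * h y) = wint b w g + t * wint b w h"
proof -
 let ?e = "%g y. if y \<in> cim b then w y * g y else 0"
 have th: "continuous_on (cim b) (%y. t * h y)" by (intro continuous_intros g)
 have "wint b w (%y. g y + t * h y) = RInt n (%y. ?e g y + ?e (%y. t * h y) y)"
  unfolding wint_def by (rule RInt_cong) (simp add: algebra_simps)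
 also have "\<dots> = RInt n (?e g) + RInt n (?e (%y. t * h y))"
  by (rule RInt_add[OF csupp_weight[OF w bd g(1)] csupp_weight[OF w bd th]])
 also have "?e (%y. t * h y) = (%y. t * ?e h y)" by (auto simp: fun_eq_iff)
 finally show ?thesis unfolding RInt_cmult wint_def .
qed

lemma wint_bound:
 assumes w: "weight b K w" and bd: "(b, d) \<in> T"
 shows "\<exists>C\<ge>0. \<forall>g B. continuous_on (cim b) g --> 0 <= B --> (\<forall>y\<in>K. \<bar>g y\<bar> <= B) --> \<bar>wint b w g\<bar> <= B * C"
proof -
 have K: "compact K" "K <= cim b" "K <= Rn n" and z: "!!y. y \<in> cim b ==> y \<notin> K ==> w y = 0"
  using w opn_subset[OF bchart_opn[OF bd]] by (auto simp: weight_def)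
 obtain C where C: "0 <= C" "\<forall>F B. csupp n F --> (\<forall>y\<in>Rn n - K. F y = 0) --> (\<forall>y\<in>K. \<bar>F y\<bar> <= B) --> 0 <= B --> \<bar>RInt n F\<bar> <= B * C"
  using RInt_bound[OF K(1,3)] by blast
 have "continuous_on K w" using w K(2) by (auto simp: weight_def intro: continuous_on_subset)
 then have "bounded (w ` K)" by (rule compact_imp_bounded[OF compact_continuous_image[OF _ K(1)]])
 then obtain W where W: "0 < W" "\<forall>x\<in>w ` K. \<bar>x\<bar> <= W" unfolding bounded_pos real_norm_def by blast
 have "\<bar>wint b w g\<bar> <= B * (W * C)" if g: "continuous_on (cim b) g" and B: "0 <= B" "\<forall>y\<in>K. \<bar>g y\<bar> <= B" for g B
 proof -
  let ?F = "%y. if y \<in> cim b then w y * g y else 0"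
  have "\<forall>y\<in>K. \<bar>?F y\<bar> <= W * B"
   using W B K(2) by (auto simp: abs_mult intro!: mult_mono)
  moreover have "\<forall>y\<in>Rn n - K. ?F y = 0" using z by auto
  moreover have "0 <= W * B" using W B by simp
  ultimately have "\<bar>RInt n ?F\<bar> <= (W * B) * C" using C(2)[rule_format, OF csupp_weight[OF w bd g], of "W * B"] by blast
  then show ?thesis by (simp add: wint_def mult_ac)
 qed
 then show ?thesis using C W by (intro exI[of _ "W * C"]) auto
qed

lemma wint_tendsto:
 assumes w: "weight b K w" and bd: "(b, d) \<in> T" and I: "jet b d q I"
  and \<sigma>: "limitin tau \<sigma> s0 F" and A: "!!l. l < q ==> limitin tau (%z. A z l) (A0 l) F"
 shows "((%z. wint b w (I (\<sigma> z) (A z))) \<longlongrightarrow> wint b w (I s0 A0)) F"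
proof (rule tendstoI)
 fix e :: real assume e: "0 < e"
 obtain C where C: "0 <= C" "\<forall>g B. continuous_on (cim b) g --> 0 <= B --> (\<forall>y\<in>K. \<bar>g y\<bar> <= B) --> \<bar>wint b w g\<bar> <= B * C"
  using wint_bound[OF w bd] by blast
 have K: "compact K" "K <= cim b" using w by (auto simp: weight_def)
 define e' where "e' = e / (C + 1)"
 have e': "0 < e'" "e' * C < e" using e C(1) by (auto simp: e'_def field_simps)
 have c0: "continuous_on (cim b) (I s0 A0)"
  by (rule Ck_continuous[OF jet_Ck[OF I bd limitin_E(1)[OF \<sigma>]]]) (use limitin_E(1)[OF A] in blast)
 have "\<forall>\<^sub>F z in F. \<forall>l\<in>{..<q}. A z l \<in> E"
  by (rule eventually_ball_finite) (use limitin_E(2)[OF A] in auto)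
 moreover have "uniform_limit K (%z. I (\<sigma> z) (A z)) (I s0 A0) F" by (rule jet_uniform_limit[OF I bd K \<sigma> A])
 note uniform_limitD[OF this e'(1)]
 ultimately
 show "\<forall>\<^sub>F z in F. dist (wint b w (I (\<sigma> z) (A z))) (wint b w (I s0 A0)) < e"
  using limitin_E(2)[OF \<sigma>]
 proof eventually_elim
  case (elim z)
  have cz: "continuous_on (cim b) (I (\<sigma> z) (A z))"
   by (rule Ck_continuous[OF jet_Ck[OF I bd elim(3)]]) (use elim(1) in blast)
  let ?g = "%y. I (\<sigma> z) (A z) y + (-1) * I s0 A0 y"
  have "\<forall>y\<in>K. \<bar>?g y\<bar> <= e'" using elim(2) by (auto simp: dist_real_def intro: less_imp_le)
  moreover have "continuous_on (cim b) ?g" by (intro continuous_intros cz c0)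
  ultimately have "\<bar>wint b w ?g\<bar> <= e' * C" using C(2) e'(1) by (auto intro: less_imp_le)
  then show ?case using e'(2) unfolding wint_lin[OF w bd cz c0] by (simp add: dist_real_def)
 qed
qed

text \<open>On the compact support the derivatives at nearby \<open>t\<close> are uniformly close to
  that at 0. The mean value theorem at each \<open>y\<close> passes this on to difference quotients,
  and \<open>wint_bound\<close> to their integrals.\<close>

lemma wint_deriv:
 assumes w: "weight b K w" and bd: "(b, d) \<in> T" and I: "jet b d q I" and I': "jet b d (Suc q) I'" "jet_deriv b q I I'"
  and s: "s \<in> E" and a: "a \<in> E" and A: "!!l. l < q ==> A l \<in> E"
 shows "((%t. wint b w (I (line S T s t a) A)) has_real_derivative wint b w (I' s (case_nat a A))) (at 0)"
 unfolding DERIV_def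
proof (rule tendstoI)
 fix e :: real assume e: "0 < e"
 obtain C where C: "0 <= C" "\<forall>g B. continuous_on (cim b) g --> 0 <= B --> (\<forall>y\<in>K. \<bar>g y\<bar> <= B) --> \<bar>wint b w g\<bar> <= B * C"
  using wint_bound[OF w bd] by blast
 have K: "compact K" "K <= cim b" using w by (auto simp: weight_def)
 \<comment> \<open>The denominator \<open>C + 1\<close> is positive even if \<open>C\<close> is 0,
   and makes the final estimate strict.\<close>
 define e' where "e' = e / (C + 1)"
 have e': "0 < e'" "e' * C < e" using e C(1) by (auto simp: e'_def field_simps)
 have A': "case_nat a A l \<in> E" if "l < Suc q" for l using that a A by (cases l) auto
 have c0: "continuous_on (cim b) (I s A)" by (rule Ck_continuous[OF jet_Ck[OF I bd s A]])
 have c': "continuous_on (cim b) (I' s (case_nat a A))" by (rule Ck_continuous[OF jet_Ck[OF I'(1) bd s A']])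
 have "uniform_limit K (%t. I' (line S T s t a) (case_nat a A)) (I' s (case_nat a A)) (nhds 0)"
  by (rule jet_uniform_limit[OF I'(1) bd K limitin_line[OF s a] limitin_const_E[OF A']])
 from uniform_limitD[OF this e'(1)] obtain de where de: "0 < de"
  "!!t y. \<bar>t\<bar> < de ==> y \<in> K ==> \<bar>I' (line S T s t a) (case_nat a A) y - I' s (case_nat a A) y\<bar> < e'"
  unfolding eventually_nhds_metric dist_real_def by auto
 let ?f = "%t. wint b w (I (line S T s t a) A)" and ?D = "wint b w (I' s (case_nat a A))"
 have "\<bar>?f t - ?f 0 - t * ?D\<bar> <= (\<bar>t\<bar> * e') * C" if t: "\<bar>t\<bar> < de" for t
 proof -
  have ct: "continuous_on (cim b) (I (line S T s t a) A)" by (rule Ck_continuous[OF jet_Ck[OF I bd line_in_E[OF s a] A]])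
  have cd: "continuous_on (cim b) (%y. I (line S T s t a) A y + (-1) * I s A y)" by (intro continuous_intros ct c0)
  let ?g = "%y. (I (line S T s t a) A y + (-1) * I s A y) + (- t) * I' s (case_nat a A) y"
  have "\<bar>?g y\<bar> <= \<bar>t\<bar> * e'" if y: "y \<in> K" for y
  proof -
   have D: "((%t. I (line S T s t a) A y) has_real_derivative I' (line S T s t' a) (case_nat a A) y) (at t')" for t'
    using I'(2) s a A y K(2) unfolding jet_deriv_def by blast
   have "\<bar>I (line S T s t a) A y - I (line S T s 0 a) A y - t * I' s (case_nat a A) y\<bar> <= \<bar>t\<bar> * e'"
    by (rule mean_value_bound[OF D]) (use de(2)[OF _ y] t in \<open>auto intro!: less_imp_le\<close>)
   then show ?thesis by (simp add: line_0_eq[OF s a] algebra_simps)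
  qed
  moreover have "continuous_on (cim b) ?g" by (intro continuous_intros ct c0 c')
  ultimately have "\<bar>wint b w ?g\<bar> <= (\<bar>t\<bar> * e') * C" using C(2) e'(1) by simp
  then show ?thesis unfolding wint_lin[OF w bd cd c'] wint_lin[OF w bd ct c0] by (simp add: line_0_eq[OF s a])
 qed
 note est = this
 show "\<forall>\<^sub>F h in at 0. dist ((?f (0 + h) - ?f 0) / h) ?D < e"
  unfolding eventually_at
 proof (intro exI[of _ de] conjI de(1) ballI impI)
  fix h :: real assume h: "h ~= 0 & dist h 0 < de"
  then have h0: "h ~= 0" "\<bar>h\<bar> < de" by (auto simp: dist_real_def)
  have "(?f (0 + h) - ?f 0) / h - ?D = (?f h - ?f 0 - h * ?D) / h" using h0(1) by (simp add: field_simps)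
  then have "\<bar>(?f (0 + h) - ?f 0) / h - ?D\<bar> = \<bar>?f h - ?f 0 - h * ?D\<bar> / \<bar>h\<bar>" by (simp add: abs_divide)
  also have "\<dots> <= e' * C" using est[OF h0(2)] h0(1) by (simp add: divide_le_eq mult_ac)
  finally show "dist ((?f (0 + h) - ?f 0) / h) ?D < e" using e'(2) by (simp add: dist_real_def)
 qed
qed

text \<open>The value is a polynomial in the coefficients of the form along \<open>s\<close>, the
  directions and the first derivatives of \<open>s\<close>, so the rules of \<open>jet\<close> build
  it.\<close>

lemma jet_form:
 assumes bd: "(b, d) \<in> T" and al: "diff_form M (k + n) al"
 shows "jet b d k (%s A y. AM m (k + n) (coef M d al (lrep b d s y))
  (map (%l. dot b d (A l) y) [0..<k] @ map (%j. dsig b d s j y) [0..<n]))"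
 unfolding AM_def
proof (intro jet_sum jet_mult jet_prod)
 fix js assume js: "js \<in> idx m (k + n)"
 have js': "js \<in> idx (mdim M) (k + n)" using js m by simp
 show "jet b d k (%s A y. coef M d al (lrep b d s y) js)"
 proof (rule jet_coef[where h = "%z. coef M d al z js"])
  show "Ck m (cim d) r (%z. coef M d al z js)" for r
   using coef_Ck[OF M T2(2)[OF bd] al js', of r] m by simp
 qed
 fix i assume "i \<in> {..<k + n}"
 then have i: "i < k + n" by simp
 then have "js ! i \<in> set js" using js by (simp add: idx_def)
 then have ji: "js ! i < m" using js by (auto simp: idx_def)
 show "jet b d k (%s A y. ((map (%l. dot b d (A l) y) [0..<k] @ map (%j. dsig b d s j y) [0..<n]) ! i) (js ! i))"
 proof (cases "i < k")
  case True
  then show ?thesis using jet_dot[OF True ji] by (simp add: nth_append)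
 next
  case False
  then have ik: "i - k < n" using i by simp
  show ?thesis using jet_dsig[OF ik ji] False i ik by (simp add: nth_append)
 qed
qed

lemma wint_cong: "(!!y. y \<in> cim b ==> g y = h y) ==> wint b w g = wint b w h"
 unfolding wint_def by (rule RInt_cong) simp

definition pw :: "'s chart => ('s => real) => (nat => real) => real"
 where "pw b rh y = morient S b (cinv b y) * rh (cinv b y)"

lemma chart_integral_wint: "chart_integral S b rh al = wint b (pw b rh) (%y. cf S al b (cinv b y))"
 unfolding chart_integral_RInt cint_def[abs_def] wint_def pw_def n ..

lemma weight_pw:
 assumes p: "partition_of_unity S N b rh" and i: "i < N"
 shows "\<exists>K. weight (b i) K (pw (b i) (rh i))"
proof -
 note P = partition_of_unityD[OF S p i]
 obtain K where K: "closedin (mtop S) K" "K <= fst (b i)" "\<forall>x\<in>pts S - K. rh i x = 0" using P(3) by blast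
 have "continuous_on (cim (b i)) (%y. rh i (cinv (b i) y))" by (rule Ck_continuous[OF msm_Ck[OF P(2,1)]])
 then have "continuous_on (cim (b i)) (pw (b i) (rh i))"
  unfolding pw_def[abs_def] by (intro continuous_on_mult morient_cont[OF S P(1)])
 moreover have "compact (snd (b i) ` K)" by (rule snd_compact[OF S P(1) closedin_compact_space[OF comp K(1)] K(2)])
 moreover have "pw (b i) (rh i) y = 0" if y: "y \<in> cim (b i) - snd (b i) ` K" for y
 proof -
  have x: "cinv (b i) y \<in> fst (b i)" "snd (b i) (cinv (b i) y) = y"
   using y cinv_in[OF S P(1)] snd_cinv[OF S P(1)] by auto
  then have "cinv (b i) y \<notin> K" using y by (metis DiffD2 imageI)
  then show ?thesis using K(3) x(1) chart_subset[OF S P(1)] unfolding pw_def by auto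
 qed
 ultimately show ?thesis unfolding weight_def using K(2) by (intro exI[of _ "snd (b i) ` K"]) auto
qed

lemma ex_pou:
 shows "\<exists>N b d rh. partition_of_unity S N b rh & (\<forall>i<N. (b i, d i) \<in> T)"
proof -
 have "fst ` T <= matlas S" using T2(1) by auto
 moreover have "pts S <= (\<Union>c\<in>fst ` T. fst c)" unfolding T1 by force
 ultimately obtain N b rh where p: "partition_of_unity S N b rh" "\<forall>i<N. b i \<in> fst ` T"
  using partition_of_unity_exists[OF S comp] by blast
 have "\<forall>i. \<exists>d. i < N --> (b i, d) \<in> T" using p(2) by force
 then obtain d where "\<forall>i. i < N --> (b i, d i) \<in> T" using choice[of "%i d. i < N --> (b i, d) \<in> T"] by blast
 then show ?thesis using p(1) by blast
qed

definition jform :: "'s chart => 'a chart => nat => 'a form => ('s => 'a) => (nat => 's => 'a) => (nat => real) => real"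
 where "jform b d k al s A y = AM m (k + n) (coef M d al (lrep b d s y))
  (map (%l. dot b d (A l) y) [0..<k] @ map (%j. dsig b d s j y) [0..<n])"

lemma Tform_cf:
 assumes bd: "(b, d) \<in> T" and s: "s \<in> E" and as: "set as <= E" and al: "diff_form M (length as + n) al" and y: "y \<in> cim b"
 shows "cf S (Tform al s as) b (cinv b y) = jform b d (length as) al s ((!) as) y"
proof -
 have "map (%l. dot b d (as ! l) y) [0..<length as] = map (%a. dot b d a y) as"
  by (rule nth_equalityI) auto
 moreover have "set [0..<n] <= {..<n}" by auto
 note form_value[OF bd y s as this]
 ultimately show ?thesis unfolding jform_def using al by (simp add: cf_def Tform_def n)
qed

lemma Tform_integral:
 assumes p: "partition_of_unity S N b rh" "!!i. i < N ==> (b i, d i) \<in> T"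
  and s: "s \<in> E" and as: "set as <= E" and al: "diff_form M (length as + n) al"
 shows "mfd_integral S (Tform al s as) = (\<Sum>i<N. wint (b i) (pw (b i) (rh i)) (jform (b i) (d i) (length as) al s ((!) as)))"
 unfolding mfd_integral_eq[OF S comp Tform_density[OF s as al] p(1)] chart_integral_wint
 by (intro sum.cong refl wint_cong Tform_cf[OF p(2) s as al]) auto

text \<open>A sum of integrals of jets over charts and weights that stay fixed. A directional
  derivative changes the integrands only and raises \<open>q\<close> by one, so derivatives of all
  orders are reached by induction.\<close>

definition rep where
 "rep U N b d w q \<theta> I \<longleftrightarrow> (\<forall>i<N::nat. jet (b i) (d i) q (I i)) &
  (\<forall>s\<in>U. \<forall>as. set as <= E & length as = q --> \<theta> s as = (\<Sum>i<N. wint (b i) (w i) (I i s ((!) as))))"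

lemma rep_deriv:
 assumes U: "openin tau U" and bd: "!!i. i < N ==> (b i, d i) \<in> T" and w: "!!i. i < N ==> \<exists>K. weight (b i) K (w i)"
  and r: "rep U N b d w q \<theta> I"
 shows "\<exists>I'. rep U N b d w (Suc q) (dirderiv S T \<theta>) I' & (\<forall>i<N. jet_deriv (b i) q (I i) (I' i)) & (\<forall>s\<in>U. \<forall>a\<in>E. \<forall>as. set as <= E & length as = q -->
  ((%t. \<theta> (line S T s t a) as) has_real_derivative dirderiv S T \<theta> s (a # as)) (at 0))"
proof -
 have UE: "U <= E" using openin_subset[OF U] topspace_section by simp
 have I: "jet (b i) (d i) q (I i)" if "i < N" for i using r that by (simp add: rep_def)
 have \<theta>: "\<theta> s as = (\<Sum>i<N. wint (b i) (w i) (I i s ((!) as)))" if "s \<in> U" "set as <= E" "length as = q" for s as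
  using r that by (simp add: rep_def)
 define R where "R i I' \<longleftrightarrow> jet (b i) (d i) (Suc q) I' & jet_deriv (b i) q (I i) I'" for i I'
 have "\<forall>i. \<exists>I'. i < N --> R i I'" using ex_jet_deriv[OF I bd] unfolding R_def by blast
 from choice[OF this] obtain I' where R: "\<forall>i. i < N --> R i (I' i)" by blast
 have I': "jet (b i) (d i) (Suc q) (I' i)" "jet_deriv (b i) q (I i) (I' i)" if "i < N" for i
  using R that by (simp_all add: R_def)
 have D: "((%t. \<theta> (line S T s t a) as) has_real_derivative (\<Sum>i<N. wint (b i) (w i) (I' i s ((!) (a # as))))) (at 0)"
  if s: "s \<in> U" and a: "a \<in> E" and as: "set as <= E" "length as = q" for s a as
 proof -
  have sE: "s \<in> E" using s UE by blast
  obtain de where de: "0 < de" "!!t. \<bar>t\<bar> < de ==> line S T s t a \<in> U" using eventually_line[OF s a U] by blast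
  have e: "(!) (a # as) = case_nat a ((!) as)" by (auto simp: fun_eq_iff split: nat.split)
  have A: "as ! l \<in> E" if "l < q" for l using as that nth_mem by blast
  have "((%t. \<Sum>i<N. wint (b i) (w i) (I i (line S T s t a) ((!) as))) has_real_derivative
    (\<Sum>i<N. wint (b i) (w i) (I' i s ((!) (a # as))))) (at 0)"
  proof (rule DERIV_sum)
   fix i assume "i \<in> {..<N}"
   then have i: "i < N" by simp
   obtain K where K: "weight (b i) K (w i)" using w[OF i] by blast
   show "((%t. wint (b i) (w i) (I i (line S T s t a) ((!) as))) has_real_derivative
     wint (b i) (w i) (I' i s ((!) (a # as)))) (at 0)"
    unfolding e by (rule wint_deriv[OF K bd[OF i] I[OF i] I'[OF i] sE a A])
  qed
  then show ?thesis
   by (rule has_field_derivative_transform_within[where d = de])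
    (use de \<theta>[OF _ as] in \<open>auto simp: dist_real_def\<close>)
 qed
 have dd: "dirderiv S T \<theta> s (a # as) = (\<Sum>i<N. wint (b i) (w i) (I' i s ((!) (a # as))))"
  if "s \<in> U" "a \<in> E" "set as <= E" "length as = q" for s a as
  using DERIV_imp_deriv[OF D[OF that]] by (simp add: dirderiv_def)
 have "rep U N b d w (Suc q) (dirderiv S T \<theta>) I'"
  unfolding rep_def
 proof (intro conjI allI impI ballI)
  show "jet (b i) (d i) (Suc q) (I' i)" if "i < N" for i by (rule I'(1)[OF that])
  fix s as assume s: "s \<in> U" and as: "set as <= E & length as = Suc q"
  then obtain a bs where ab: "as = a # bs" by (cases as) auto
  show "dirderiv S T \<theta> s as = (\<Sum>i<N. wint (b i) (w i) (I' i s ((!) as)))"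
   unfolding ab by (rule dd[OF s]) (use as ab in auto)
 qed
 then show ?thesis using D dd I'(2) by (intro exI[of _ I']) auto
qed

lemma rep_funpow:
 assumes U: "openin tau U" and bd: "!!i. i < N ==> (b i, d i) \<in> T" and w: "!!i. i < N ==> \<exists>K. weight (b i) K (w i)"
  and r: "rep U N b d w k \<theta> I"
 shows "\<exists>I. rep U N b d w (r + k) ((dirderiv S T ^^ r) \<theta>) I"
proof (induction r)
 case 0
 then show ?case using r by auto
next
 case (Suc r)
 then obtain I where "rep U N b d w (r + k) ((dirderiv S T ^^ r) \<theta>) I" by blast
 from rep_deriv[OF U bd w this] obtain I' where
  "rep U N b d w (Suc (r + k)) (dirderiv S T ((dirderiv S T ^^ r) \<theta>)) I'" by blast
 then show ?case by auto
qed

lemma rep_continuous: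
 assumes U: "openin tau U" and bd: "!!i. i < N ==> (b i, d i) \<in> T" and w: "!!i. i < N ==> \<exists>K. weight (b i) K (w i)"
  and r: "rep U N b d w q \<theta> I"
 shows "continuous_map (prod_topology (subtopology tau U) (product_topology (%_. tau) {..<q})) euclideanreal
  (%(s, x). \<theta> s (map x [0..<q]))"
proof -
 let ?X = "prod_topology (subtopology tau U) (product_topology (%_. tau) {..<q})"
 let ?g = "%z. \<Sum>i<N. wint (b i) (w i) (I i (fst z) ((!) (map (snd z) [0..<q])))"
 have I: "jet (b i) (d i) q (I i)" if "i < N" for i using r that by (simp add: rep_def)
 have c1: "continuous_map ?X tau fst"
  using continuous_map_fst[of "subtopology tau U" "product_topology (%_. tau) {..<q}"]
  by (simp add: continuous_map_in_subtopology)
 have c2: "continuous_map ?X tau (%z. snd z l)" if "l < q" for l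
 proof -
  have "continuous_map ?X tau ((%x. x l) \<circ> snd)"
   by (rule continuous_map_compose[OF continuous_map_snd]) (use that in \<open>auto intro: continuous_map_product_projection\<close>)
  then show ?thesis by (simp add: o_def)
 qed
 have "continuous_map ?X euclideanreal ?g"
  unfolding continuous_map_atin limitin_canonical_iff
 proof (intro ballI tendsto_sum)
  fix z0 i assume z0: "z0 \<in> topspace ?X" and "i \<in> {..<N}"
  then have i: "i < N" by simp
  obtain K where K: "weight (b i) K (w i)" using w[OF i] by blast
  show "((%z. wint (b i) (w i) (I i (fst z) ((!) (map (snd z) [0..<q])))) \<longlongrightarrow>
    wint (b i) (w i) (I i (fst z0) ((!) (map (snd z0) [0..<q])))) (atin ?X z0)"
  proof (rule wint_tendsto[OF K bd[OF i] I[OF i]])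
   show "limitin tau fst (fst z0) (atin ?X z0)" using c1 z0 unfolding continuous_map_atin by blast
   show "limitin tau (%z. map (snd z) [0..<q] ! l) (map (snd z0) [0..<q] ! l) (atin ?X z0)" if l: "l < q" for l
   proof -
    have "limitin tau (%z. snd z l) (snd z0 l) (atin ?X z0)" using c2[OF l] z0 unfolding continuous_map_atin by blast
    then show ?thesis using l by simp
   qed
  qed
 qed
 then show ?thesis
 proof (rule continuous_map_eq)
  fix z assume z: "z \<in> topspace ?X"
  obtain s x where sx: "z = (s, x)" by (cases z)
  have s: "s \<in> U" using z sx by simp
  have x: "set (map x [0..<q]) <= E" using z sx by (auto simp: topspace_section PiE_iff)
  show "?g z = (%(s, x). \<theta> s (map x [0..<q])) z"
   using r s x unfolding rep_def sx by simp
 qed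
qed

text \<open>These are the two analytic clauses of \<open>gr_diff_form\<close>: differentiability at
  order \<open>r\<close> is the existence of the next representation, and continuity holds for every
  representation.\<close>

lemma Tform_rep:
 assumes U: "openin tau U" and al: "diff_form M (k + n) al"
  and \<theta>: "!!s as. s \<in> U ==> set as <= E ==> length as = k ==> \<theta> s as = mfd_integral S (Tform al s as)"
 shows "(\<forall>s\<in>U. \<forall>a\<in>E. \<forall>as. set as <= E & length as = r + k -->
      (%t. (dirderiv S T ^^ r) \<theta> (line S T s t a) as) differentiable (at 0)) &
     continuous_map
      (prod_topology (subtopology tau U) (product_topology (%_. tau) {..<r + k})) euclideanreal
      (%(s, x). (dirderiv S T ^^ r) \<theta> s (map x [0..<r + k]))"
proof -
 obtain N b d rh where p: "partition_of_unity S N b rh" "\<forall>i<N. (b i, d i) \<in> T" using ex_pou by blast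
 have bd: "(b i, d i) \<in> T" if "i < N" for i using p(2) that by blast
 note w = weight_pw[OF p(1)]
 have UE: "U <= E" using openin_subset[OF U] topspace_section by simp
 have "rep U N b d (%i. pw (b i) (rh i)) k \<theta> (%i. jform (b i) (d i) k al)"
  unfolding rep_def
 proof (intro conjI allI impI ballI)
  show "jet (b i) (d i) k (jform (b i) (d i) k al)" if "i < N" for i
   using jet_form[OF bd[OF that] al] by (simp add: jform_def[abs_def])
  fix s as assume s: "s \<in> U" and as: "set as <= E & length as = k"
  have sE: "s \<in> E" using s UE by blast
  show "\<theta> s as = (\<Sum>i<N. wint (b i) (pw (b i) (rh i)) (jform (b i) (d i) k al s ((!) as)))"
   using \<theta>[OF s] Tform_integral[OF p(1) bd sE, of as al] as al by auto
 qed
 from rep_funpow[OF U bd w this] obtain I where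
  I: "rep U N b d (%i. pw (b i) (rh i)) (r + k) ((dirderiv S T ^^ r) \<theta>) I" by blast
 have "(%t. (dirderiv S T ^^ r) \<theta> (line S T s t a) as) differentiable (at 0)"
  if "s \<in> U" "a \<in> E" "set as <= E" "length as = r + k" for s a as
  using rep_deriv[OF U bd w I] that real_differentiable_def by blast
 then show ?thesis using rep_continuous[OF U bd w I] by blast
qed

end

section \<open>Exterior derivatives and pullbacks in coordinates\<close>

definition dvec :: "(nat => real) set => ((nat => real) => nat => real) => nat => (nat => real) => nat => real"
 where "dvec Q \<Phi> i w = (%l. pd Q i (%w. \<Phi> w l) w)"

lemma dvec_Rn:
 assumes Q: "opn q Q" and \<Phi>: "!!w. w \<in> Q ==> \<Phi> w \<in> Rn m" and i: "i < q" and w: "w \<in> Q"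
 shows "dvec Q \<Phi> i w \<in> Rn m"
 unfolding Rn_iff dvec_def
proof (intro allI impI)
 fix l assume l: "m <= l"
 show "pd Q i (%w. \<Phi> w l) w = 0"
 proof (rule pd_eq[OF Q w i])
  show "hpd (%w. \<Phi> w l) i 0 w"
   by (rule hpd_cong[where f = "%w. 0", OF Q w i]) (use \<Phi> l in \<open>auto simp: Rn_iff\<close>)
 qed
qed

text \<open>The second derivatives of \<open>\<Phi>\<close> cancel, so pulling back commutes with the exterior derivative.\<close>

lemma pullback_exterior_derivative:
 assumes Q: "opn (Suc k) Q" and C: "opn m C"
  and N: "!!js r. js \<in> idx m k ==> Ck m C r (%z. N z js)" and alt: "!!z. z \<in> C ==> altform m k (AM m k (N z))"
  and \<Phi>: "!!r l. Ck (Suc k) Q r (%w. \<Phi> w l)" "\<Phi> ` Q <= C" and w: "w \<in> Q"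
 shows "(\<Sum>i<Suc k. (-1) ^ i * pd Q i (%w. AM m k (N (\<Phi> w)) (omit i (map (%j. dvec Q \<Phi> j w) [0..<Suc k]))) w) =
  (\<Sum>i<Suc k. (-1) ^ i * (\<Sum>l<m. dvec Q \<Phi> i w l *
   AM m k (%js. pd C l (%z. N z js) (\<Phi> w)) (omit i (map (%j. dvec Q \<Phi> j w) [0..<Suc k]))))"
proof -
 let ?P = "%w. map (%j. dvec Q \<Phi> j w) [0..<Suc k]" and ?f = "%i l::nat. if l < i then l else Suc l"
 define B where "B i j = dvec Q (dvec Q \<Phi> j) i w" for i j
 have \<Phi>R: "\<Phi> w \<in> Rn m" if "w \<in> Q" for w using \<Phi>(2) opn_subset[OF C] that by blast
 have dR: "dvec Q \<Phi> j w \<in> Rn m" if "j < Suc k" "w \<in> Q" for j w by (rule dvec_Rn[OF Q \<Phi>R that])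
 have BR: "B i j \<in> Rn m" if "i < Suc k" "j < Suc k" for i j
  unfolding B_def by (rule dvec_Rn[OF Q dR[OF that(2)] that(1) w])
 have Bs: "B i j = B j i" if "i < Suc k" "j < Suc k" for i j
  unfolding B_def dvec_def using pd_commute[OF Q \<Phi>(1) that w] by auto
 have nth: "omit i (?P v) ! l = dvec Q \<Phi> (?f i l) v" "?f i l < Suc k" if "i < Suc k" "l < k" for i l v
 proof -
  show f: "?f i l < Suc k" using that by auto
  have "omit i (?P v) ! l = ?P v ! ?f i l" by (rule nth_omit) (use that in auto)
  also have "\<dots> = dvec Q \<Phi> (?f i l) v" using f by (simp del: upt_Suc)
  finally show "omit i (?P v) ! l = dvec Q \<Phi> (?f i l) v" .
 qed
 have "pd Q i (%w. AM m k (N (\<Phi> w)) (omit i (?P w))) w =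
   (\<Sum>l<m. dvec Q \<Phi> i w l * AM m k (%js. pd C l (%z. N z js) (\<Phi> w)) (omit i (?P w))) +
   (\<Sum>l<k. AM m k (N (\<Phi> w)) ((omit i (?P w))[l := B i (?f i l)]))" if i: "i < Suc k" for i
 proof (rule pd_eq[OF Q w i])
  have "((%t. AM m k (N (\<Phi> (w(i := t)))) (omit i (?P (w(i := t))))) has_real_derivative
    AM m k (%js. \<Sum>l<m. dvec Q \<Phi> i w l * pd C l (%z. N z js) (\<Phi> w)) (omit i (?P (w(i := w i)))) +
    (\<Sum>l<k. AM m k (N (\<Phi> (w(i := w i)))) ((omit i (?P (w(i := w i))))[l := B i (?f i l)]))) (at (w i))"
  proof (rule DERIV_AM[where V = "%t. omit i (?P (w(i := t)))" and N = "%t. N (\<Phi> (w(i := t)))"])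
   show "((%t. N (\<Phi> (w(i := t))) js) has_real_derivative
     (\<Sum>l<m. dvec Q \<Phi> i w l * pd C l (%z. N z js) (\<Phi> w))) (at (w i))" if "js \<in> idx m k" for js
    using hpd_compose[OF Q C N[OF that] \<Phi> i w] by (simp add: dvec_def mult.commute)
   show "((%t. (omit i (?P (w(i := t))) ! l) a) has_real_derivative B i (?f i l) a) (at (w i))" if l: "l < k" for l a
   proof -
    have "Ck (Suc k) Q (Suc 0) (%v. dvec Q \<Phi> (?f i l) v a)"
     unfolding dvec_def using Ck_pd[OF \<Phi>(1), of "?f i l" "Suc 0" a] nth(2)[OF i l] by simp
    from Ck_hpd[OF this Q i w] show ?thesis unfolding nth(1)[OF i l] unfolding B_def dvec_def[of Q "dvec Q \<Phi> (?f i l)"] .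
   qed
   show "length (omit i (?P (w(i := w i)))) = k" using i by (simp add: length_omit del: upt_Suc)
  qed
  then show "hpd (%w. AM m k (N (\<Phi> w)) (omit i (?P w))) i
    ((\<Sum>l<m. dvec Q \<Phi> i w l * AM m k (%js. pd C l (%z. N z js) (\<Phi> w)) (omit i (?P w))) +
    (\<Sum>l<k. AM m k (N (\<Phi> w)) ((omit i (?P w))[l := B i (?f i l)]))) w"
   unfolding fun_upd_triv AM_sum .
 qed
 moreover have "(\<Sum>i<Suc k. (-1) ^ i * (\<Sum>l<k. AM m k (N (\<Phi> w)) ((omit i (?P w))[l := B i (?f i l)]))) = 0"
 proof (rule altform_symmetric_cancel[OF alt])
  show "\<Phi> w \<in> C" using \<Phi>(2) w by blast
  show "set (?P w) <= Rn m" using dR w by auto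
  show "length (?P w) = Suc k" by simp
 qed (use BR Bs in blast)+
 ultimately show ?thesis by (simp add: distrib_left sum.distrib del: sum.lessThan_Suc upt_Suc)
qed

lemma omit_map: "omit i (map f xs) = map f (omit i xs)"
 by (simp add: omit_def take_map drop_map)

text \<open>The formula is stated for the selected chart only, which is the one
  \<open>ext_deriv\<close> is computed in. Other charts are dealt with by moving the map to be
  pulled back into this chart.\<close>

lemma ext_deriv_AM:
 assumes M: "omfd M" and \<nu>: "diff_form M k \<nu>" and p: "p \<in> pts M"
  and c: "c = chart_at M p" and vs: "set vs <= Rn (mdim M)" "length vs = Suc k"
 shows "ext_deriv M \<nu> p (map (cvec M c p) vs) = (\<Sum>i<Suc k. (-1) ^ i * (\<Sum>l<mdim M. (vs ! i) l *
  AM (mdim M) k (%js. pd (cim c) l (%z. coef M c \<nu> z js) (snd c p)) (omit i vs)))"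
proof -
 have cM: "c \<in> matlas M" "p \<in> fst c" using chart_at[OF M p] c by auto
 have cv: "cvec M c p v c = v" if "v \<in> set vs" for v using cvec_chart[OF M cM] vs that by blast
 have ov: "set (omit i vs) <= Rn (mdim M)" for i using order_trans[OF set_omit vs(1)] .
 have ol: "length (omit i vs) = k" if "i < Suc k" for i using length_omit[of i vs] vs(2) that by simp
 have pC: "snd c p \<in> cim c" using cM(2) by (rule imageI)
 note o = cim_opn[OF M cM(1)]
 have e: "pd (cim c) l (%y. \<nu> (cinv c y) (map (%v. cvec M c (cinv c y) (v c)) (omit i (map (cvec M c p) vs)))) (snd c p)
   = AM (mdim M) k (%js. pd (cim c) l (%z. coef M c \<nu> z js) (snd c p)) (omit i vs)"
  if i: "i < Suc k" and l: "l < mdim M" for i l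
 proof -
  have "pd (cim c) l (%y. \<nu> (cinv c y) (map (%v. cvec M c (cinv c y) (v c)) (omit i (map (cvec M c p) vs)))) (snd c p)
   = pd (cim c) l (%y. AM (mdim M) k (coef M c \<nu> y) (omit i vs)) (snd c p)"
  proof (rule pd_cong[OF o l pC])
   fix y assume y: "y \<in> cim c"
   have "map (%v. cvec M c (cinv c y) (v c)) (omit i (map (cvec M c p) vs)) = map (cvec M c (cinv c y)) (omit i vs)"
    unfolding omit_map using cv set_omit[of i vs] by auto
   then show "\<nu> (cinv c y) (map (%v. cvec M c (cinv c y) (v c)) (omit i (map (cvec M c p) vs))) =
     AM (mdim M) k (coef M c \<nu> y) (omit i vs)"
    using form_AM[OF M cM(1) \<nu> cinv_in[OF M cM(1) y] ov[of i] ol[OF i]] by (simp add: snd_cinv[OF M cM(1) y])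
  qed
  also have "\<dots> = AM (mdim M) k (%js. pd (cim c) l (%z. coef M c \<nu> z js) (snd c p)) (omit i vs)"
  proof (rule pd_eq[OF o pC l])
   show "hpd (%y. AM (mdim M) k (coef M c \<nu> y) (omit i vs)) l
     (AM (mdim M) k (%js. pd (cim c) l (%z. coef M c \<nu> z js) (snd c p)) (omit i vs)) (snd c p)"
    unfolding AM_def
   proof (intro DERIV_sum DERIV_cmult)
    fix js assume "js \<in> idx (mdim M) k"
    from Ck_hpd[OF coef_Ck[OF M cM(1) \<nu> this, of "Suc 0"] o l pC]
    show "hpd (%y. coef M c \<nu> y js) l (pd (cim c) l (%z. coef M c \<nu> z js) (snd c p)) (snd c p)" .
   qed
  qed
  finally show ?thesis .
 qed
 have "ext_deriv M \<nu> p (map (cvec M c p) vs) = (\<Sum>i<Suc k. (-1) ^ i * (\<Sum>l<mdim M. (map (cvec M c p) vs ! i) c l *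
   pd (cim c) l (%y. \<nu> (cinv c y) (map (%v. cvec M c (cinv c y) (v c)) (omit i (map (cvec M c p) vs)))) (snd c p)))"
  unfolding ext_deriv_def Let_def c[symmetric] length_map vs(2) ..
 also have "\<dots> = (\<Sum>i<Suc k. (-1) ^ i * (\<Sum>l<mdim M. (vs ! i) l *
  AM (mdim M) k (%js. pd (cim c) l (%z. coef M c \<nu> z js) (snd c p)) (omit i vs)))"
 proof (intro sum.cong refl arg_cong2[of _ _ _ _ "(*)"])
  fix i l assume "i \<in> {..<Suc k}" "l \<in> {..<mdim M}"
  then have i: "i < Suc k" and l: "l < mdim M" by auto
  show "(map (cvec M c p) vs ! i) c l = (vs ! i) l" using cv[of "vs ! i"] i vs(2) by simp
  show "pd (cim c) l (%y. \<nu> (cinv c y) (map (%v. cvec M c (cinv c y) (v c)) (omit i (map (cvec M c p) vs)))) (snd c p) =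
   AM (mdim M) k (%js. pd (cim c) l (%z. coef M c \<nu> z js) (snd c p)) (omit i vs)" by (rule e[OF i l])
 qed
 finally show ?thesis .
qed

lemma altform_cong:
 assumes A: "altform n k A" and e: "!!vs. set vs <= Rn n ==> length vs = k ==> A vs = A' vs"
 shows "altform n k A'"
 unfolding altform_def
proof (intro allI impI conjI ballI, elim conjE)
 fix vs i v w t assume vs: "set vs <= Rn n" "length vs = k" and i: "i < k" and vw: "v \<in> Rn n" "w \<in> Rn n"
 have u: "A (vs[i := x]) = A' (vs[i := x])" if "x \<in> Rn n" for x
  by (rule e) (use set_list_update_subset[OF vs(1) that] vs(2) in auto)
 show "A' (vs[i := %l. v l + t * w l]) = A' (vs[i := v]) + t * A' (vs[i := w])"
  using altform_lin[OF A vs i vw, of t] u[OF Rn_lin[OF vw]] u[OF vw(1)] u[OF vw(2)] by simp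
next
 fix vs i j assume vs: "set vs <= Rn n & length vs = k" and ij: "i < k" "j < k" "i ~= j & vs ! i = vs ! j"
 then show "A' vs = 0" using altform_eq[OF A, of vs i j] e[of vs] by simp
qed

text \<open>The parameters of a deformation in two directions occupy indices 0 and 1; the
  coordinates on \<open>S\<close> follow and are recovered by \<open>tail2\<close>.\<close>

definition tail2 :: "(nat => real) => nat => real"
 where "tail2 w = (%i. w (Suc (Suc i)))"

lemma tail2_upd: "tail2 (w(Suc (Suc j) := t)) = (tail2 w)(j := t)" "tail2 (w(0 := t)) = tail2 w" "tail2 (w(Suc 0 := t)) = tail2 w"
 by (auto simp: tail2_def fun_eq_iff)

context tube
begin

text \<open>The pullback of \<open>\<nu>\<close> with \<open>a1\<close> and \<open>a2\<close> in its
  first two slots is a form of degree \<open>n - 1\<close> on \<open>S\<close>; this is its value on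
  the coordinate frame without vector \<open>j\<close>. The alternating sum of the
  \<open>j\<close>-th partial derivatives is the coefficient of its exterior derivative.\<close>

definition bcoef where
 "bcoef b d \<nu> s a1 a2 j y = AM m (Suc n) (coef M d \<nu> (lrep b d s y))
  (dot b d a1 y # dot b d a2 y # omit j (map (%j. dsig b d s j y) [0..<n]))"

lemma bcoef_Ck:
 assumes bd: "(b, d) \<in> T" and \<nu>: "diff_form M (Suc n) \<nu>" and s: "s \<in> E" and a: "a1 \<in> E" "a2 \<in> E" and j: "j < n"
 shows "Ck n (cim b) r (bcoef b d \<nu> s a1 a2 j)"
 unfolding bcoef_def[abs_def]
proof (rule AM_Ck[OF bchart_opn[OF bd]])
 fix js assume js: "js \<in> idx m (Suc n)"
 then have js': "js \<in> idx (mdim M) (Suc n)" by (simp add: m)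
 show "Ck n (cim b) r (%y. coef M d \<nu> (lrep b d s y) js)"
  by (rule Ck_compose[where f = "%z. coef M d \<nu> z js" and \<phi> = "lrep b d s",
    OF bchart_opn[OF bd] dchart_opn[OF bd] coef_Ck[OF M T2(2)[OF bd] \<nu> js', unfolded m] sec_Ck[OF s bd]])
   (use lrep_cim[OF s bd] in blast)
next
 fix i l assume i: "i < Suc n"
 have dC: "Ck n (cim b) r (%y. dsig b d s j y l)" if "j < n" for j
  unfolding dsig_def using Ck_pd[OF sec_Ck[OF s bd, of "Suc r" l] that] by simp
 consider "i = 0" | "i = Suc 0" | i' where "i = Suc (Suc i')" "i' < n - 1"
  using i by (metis Suc_less_eq less_diff_conv Suc_eq_plus1 not0_implies_Suc)
 then show "Ck n (cim b) r (%y. ((dot b d a1 y # dot b d a2 y # omit j (map (%j. dsig b d s j y) [0..<n])) ! i) l)"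
 proof cases
  case 3
  have "omit j (map (%j. dsig b d s j y) [0..<n]) ! i' = dsig b d s (if i' < j then i' else Suc i') y" for y
   using 3(2) j by (subst nth_omit) auto
  moreover have "(if i' < j then i' else Suc i') < n" using 3(2) j by auto
  ultimately show ?thesis using dC[of "if i' < j then i' else Suc i'"] 3(1) by simp
 qed (use dot_Ck[OF a(1) bd] dot_Ck[OF a(2) bd] in auto)
qed

text \<open>The deformation has \<open>n + 2\<close> parameters, as many as \<open>\<mu>\<close> has
  arguments. In the alternating sum for the pulled back form, differentiation in the two deformation
  parameters produces \<open>D1\<close> and \<open>- D2\<close>, and the coordinates of
  \<open>S\<close> produce the divergence.\<close>

lemma form_derivative_identity:
 assumes mn: "m = Suc (Suc n)" and \<nu>: "diff_form M (Suc n) \<nu>" and \<mu>: "diff_form M (Suc (Suc n)) \<mu>"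
  and d\<nu>: "!!p vs. p \<in> pts M ==> set vs <= tspace M p ==> length vs = Suc (Suc n) ==> ext_deriv M \<nu> p vs = \<mu> p vs"
  and bd: "(b, d) \<in> T" and y: "y \<in> cim b" and s: "s \<in> E" and a: "a1 \<in> E" "a2 \<in> E"
  and A1: "A1 0 = a2" "A2 0 = a1" "A 0 = a1" "A (Suc 0) = a2"
  and D1: "((%t. jform b d (Suc 0) \<nu> (line S T s t a1) A1 y) has_real_derivative D1) (at 0)"
  and D2: "((%t. jform b d (Suc 0) \<nu> (line S T s t a2) A2 y) has_real_derivative D2) (at 0)"
 shows "jform b d (Suc (Suc 0)) \<mu> s A y = D1 - D2 + (\<Sum>j<n. (-1) ^ j * pd (cim b) j (bcoef b d \<nu> s a1 a2 j) y)"
proof -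
 note dM = T2(2)[OF bd] and bS = T2(1)[OF bd] and oB = bchart_opn[OF bd] and oD = dchart_opn[OF bd]
 let ?p = "s (cinv b y)"
 \<comment> \<open>The bundle chart \<open>d\<close> describes the deformation, but
   \<open>ext_deriv\<close> is evaluated in \<open>c\<close>. Hence the deformation is followed
   through the transition map from \<open>d\<close> to \<open>c\<close>, on the set where both are
   defined.\<close>
 define c where "c = chart_at M ?p"
 have pd: "?p \<in> fst d" by (rule sec_cinv[OF s bd y])
 then have pM: "?p \<in> pts M" using chart_subset[OF M dM] by blast
 have cM: "c \<in> matlas M" and pc: "?p \<in> fst c" using chart_at[OF M pM] by (auto simp: c_def)
 define sw where "sw w = line S T (line S T s (w 0) a1) (w (Suc 0)) a2" for w :: "nat => real"
 have swE: "sw w \<in> E" for w unfolding sw_def by (intro line_in_E s a)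
 define Sig where "Sig w = (%l. lrep b d s (tail2 w) l + w 0 * dot b d a1 (tail2 w) l + w (Suc 0) * dot b d a2 (tail2 w) l)" for w
 have Sig: "Sig w = lrep b d (sw w) (tail2 w)" if "tail2 w \<in> cim b" for w
  unfolding sw_def lrep_line[OF line_in_E[OF s a(1)] a(2) bd that] lrep_line[OF s a(1) bd that] Sig_def ..
 define D where "D = ldom d c (%p. p)"
 have id: "continuous_map (mtop M) (mtop M) (%p. p)" by (simp add: continuous_map_id[unfolded id_def])
 have D: "opn m D" unfolding D_def using ldom_opn[OF M dM M cM id] m by simp
 have Rm: "opn m (Rn m)" by simp
 define Q0 where "Q0 = Rn m \<inter> tail2 -` cim b"
 have Q0: "opn m Q0" unfolding Q0_def
 proof (rule opn_preimage[OF Rm _ _ oB])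
  show "tail2 ` Rn m <= Rn n" by (auto simp: tail2_def Rn_iff mn)
  show "continuous_on (Rn m) tail2"
   by (rule continuous_on_Rn_valued[of _ _ n]) (auto simp: tail2_def Rn_iff mn intro: continuous_on_apply)
 qed
 have comp_tail: "Ck m Q0 r (%w. h (tail2 w))" if "Ck n (cim b) r h" for h r
  by (rule Ck_compose[where \<phi> = tail2, OF Q0 oB that]) (use Ck_coord[OF Q0] in \<open>auto simp: tail2_def Q0_def\<close>)
 have SigC0: "Ck m Q0 r (%w. Sig w l)" for r l
  unfolding Sig_def by (intro Ck_add Ck_mult Q0 Ck_coord comp_tail sec_Ck[OF s bd] dot_Ck[OF _ bd] a)
 have Sigd: "Sig w \<in> cim d" if "w \<in> Q0" for w
  using that Sig[of w] lrep_cim[OF swE bd] by (simp add: Q0_def)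
 define Q where "Q = Q0 \<inter> Sig -` D"
 have Q: "opn m Q" unfolding Q_def
 proof (rule opn_preimage[OF Q0 _ _ D])
  show "Sig ` Q0 <= Rn m" using Sigd opn_subset[OF oD] by blast
  then show "continuous_on Q0 Sig"
   by (intro continuous_on_Rn_valued[of _ _ m] Ck_continuous[OF SigC0]) auto
 qed
 have QD: "Sig ` Q <= D" and Qb: "!!w. w \<in> Q ==> tail2 w \<in> cim b" by (auto simp: Q_def Q0_def)
 have SigC: "Ck m Q r (%w. Sig w l)" for r l by (rule Ck_subset[OF SigC0 Q0 Q]) (auto simp: Q_def)
 define \<Phi> where "\<Phi> w = lrep d c (%p. p) (Sig w)" for w
 have tC: "Ck m D r (%z. lrep d c (%p. p) z l)" for r l
  unfolding D_def using lrep_Ck[OF M dM M cM smooth_id[OF M]] m by simp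
 have \<Phi>C: "Ck m Q r (%w. \<Phi> w l)" for r l
  unfolding \<Phi>_def by (rule Ck_compose[where f = "%z. lrep d c (%p. p) z l" and \<phi> = Sig, OF Q D tC SigC QD])
 have \<Phi>c: "\<Phi> ` Q <= cim c" using QD lrep_in[OF M dM] unfolding \<Phi>_def D_def by blast
 have oC: "opn m (cim c)" using cim_opn[OF M cM] m by simp
 define pt where "pt w = cinv d (Sig w)" for w
 have pt: "pt w \<in> fst d" "pt w \<in> fst c" "snd d (pt w) = Sig w" "snd c (pt w) = \<Phi> w" if "w \<in> Q" for w
 proof -
  have SD: "Sig w \<in> D" using QD that by blast
  then have Sd: "Sig w \<in> cim d" "cinv d (Sig w) \<in> fst c" unfolding D_def ldom_eq[OF M dM] by auto
  show "pt w \<in> fst d" "pt w \<in> fst c" "snd d (pt w) = Sig w" "snd c (pt w) = \<Phi> w"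
   using Sd cinv_in[OF M dM] snd_cinv[OF M dM] by (auto simp: pt_def \<Phi>_def lrep_def)
 qed
 have SR: "Sig w \<in> Rn m" if "w \<in> Q" for w using QD opn_subset[OF D] that by blast
 have PR: "\<Phi> w \<in> Rn m" if "w \<in> Q" for w using \<Phi>c opn_subset[OF oC] that by blast
 have dS: "dvec Q Sig i w \<in> Rn m" and dP: "dvec Q \<Phi> i w \<in> Rn m" if "i < m" "w \<in> Q" for i w
  by (rule dvec_Rn[OF Q SR that], assumption) (rule dvec_Rn[OF Q PR that], assumption)
 \<comment> \<open>The coordinate derivatives in \<open>c\<close> and in \<open>d\<close> describe
   the same tangent vectors of \<open>M\<close>, so \<open>\<nu>\<close> may be expanded in either
   chart; in \<open>d\<close> the vectors are explicit.\<close>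
 have cv: "cvec M c (pt w) (dvec Q \<Phi> i w) = cvec M d (pt w) (dvec Q Sig i w)" if w: "w \<in> Q" and i: "i < m" for w i
 proof -
  have "dvec Q \<Phi> i w = cvec M d (pt w) (dvec Q Sig i w) c"
  proof
   fix l
   have "dvec Q \<Phi> i w l = (\<Sum>j<m. pd D j (%z. lrep d c (%p. p) z l) (Sig w) * dvec Q Sig i w j)"
    unfolding dvec_def \<Phi>_def
    by (rule pd_compose[where f = "%z. lrep d c (%p. p) z l" and \<phi> = Sig, OF Q D tC SigC QD i w])
   also have "\<dots> = cvec M d (pt w) (dvec Q Sig i w) c l"
    using cM pt[OF w] by (simp add: cvec_def ljac_def D_def m)
   finally show "dvec Q \<Phi> i w l = cvec M d (pt w) (dvec Q Sig i w) c l" .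
  qed
  then show ?thesis using tspace_cvec[OF M cM pt(2)[OF w] cvec_tspace[OF M dM pt(1)[OF w]]] by simp
 qed
 let ?PP = "%w. map (%j. dvec Q \<Phi> j w) [0..<m]" and ?PS = "%w. map (%j. dvec Q Sig j w) [0..<m]"
 have mapcv: "map (cvec M c (pt w)) (?PP w) = map (cvec M d (pt w)) (?PS w)" if "w \<in> Q" for w
  using cv[OF that] by simp
 define H where "H i w = AM m (Suc n) (coef M d \<nu> (Sig w)) (omit i (?PS w))" for i w
 have Heq: "AM m (Suc n) (coef M c \<nu> (\<Phi> w)) (omit i (?PP w)) = H i w" if w: "w \<in> Q" and i: "i < m" for w i
 proof -
  have lp: "length (omit i (?PP w)) = Suc n" "length (omit i (?PS w)) = Suc n" using i mn by (auto simp: length_omit)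
  have sp: "set (omit i (?PP w)) <= Rn m" "set (omit i (?PS w)) <= Rn m"
   using set_omit[of i "?PP w"] set_omit[of i "?PS w"] dP[OF _ w] dS[OF _ w] by auto
  have "\<nu> (pt w) (map (cvec M c (pt w)) (omit i (?PP w))) = AM m (Suc n) (coef M c \<nu> (\<Phi> w)) (omit i (?PP w))"
   using form_AM[OF M cM \<nu> pt(2)[OF w], unfolded m, OF sp(1) lp(1)] pt(4)[OF w] by simp
  moreover have "\<nu> (pt w) (map (cvec M d (pt w)) (omit i (?PS w))) = H i w"
   unfolding H_def using form_AM[OF M dM \<nu> pt(1)[OF w], unfolded m, OF sp(2) lp(2)] pt(3)[OF w] by simp
  ultimately show ?thesis unfolding omit_map[symmetric] mapcv[OF w] by simp
 qed
 \<comment> \<open>The base point of the computation: both deformation parameters are 0 and the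
   coordinates on \<open>S\<close> are those of \<open>y\<close>.\<close>
 define w0 :: "nat => real" where "w0 = (%i. case i of 0 => 0 | Suc 0 => 0 | Suc (Suc i) => y i)"
 have w00: "w0 0 = 0" "w0 (Suc 0) = 0" "tail2 w0 = y" by (auto simp: w0_def tail2_def)
 have "w0 \<in> Rn m" using opn_subset[OF oB] y unfolding mn by (auto simp: w0_def Rn_iff split: nat.split)
 then have w0Q0: "w0 \<in> Q0" using w00 y by (simp add: Q0_def)
 have Sw0: "Sig w0 = lrep b d s y" by (simp add: Sig_def w00)
 have pt0: "pt w0 = ?p" unfolding pt_def Sw0 lrep_def by (rule cinv_snd[OF M dM pd])
 have "Sig w0 \<in> D" unfolding Sw0 D_def lrep_def by (rule snd_in_ldom[where f = "%p. p", OF pd pc])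
 then have w0: "w0 \<in> Q" using w0Q0 by (simp add: Q_def)
 have PS: "?PS w = dot b d a1 (tail2 w) # dot b d a2 (tail2 w) # map (%j. dsig b d (sw w) j (tail2 w)) [0..<n]"
  if w: "w \<in> Q" for w
 proof -
  have d0: "dvec Q Sig 0 w = dot b d a1 (tail2 w)"
  proof
   fix l show "dvec Q Sig 0 w l = dot b d a1 (tail2 w) l" unfolding dvec_def
    by (rule pd_eq[OF Q w]) (auto simp: mn Sig_def tail2_upd intro!: derivative_eq_intros)
  qed
  have d1: "dvec Q Sig (Suc 0) w = dot b d a2 (tail2 w)"
  proof
   fix l show "dvec Q Sig (Suc 0) w l = dot b d a2 (tail2 w) l" unfolding dvec_def
    by (rule pd_eq[OF Q w]) (auto simp: mn Sig_def tail2_upd intro!: derivative_eq_intros)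
  qed
  have d2: "dvec Q Sig (Suc (Suc j)) w = dsig b d (sw w) j (tail2 w)" if j: "j < n" for j
  proof
   fix l
   let ?D = "pd (cim b) j (%y. lrep b d (sw w) y l) (tail2 w)"
   have e: "Sig w' = lrep b d (sw w) (tail2 w')" if "tail2 w' \<in> cim b" "w' 0 = w 0" "w' (Suc 0) = w (Suc 0)" for w'
    using Sig[OF that(1)] that(2,3) by (simp add: sw_def)
   have "hpd (%y. lrep b d (sw w) y l) j ?D (tail2 w)"
    by (rule Ck_hpd[OF sec_Ck[OF swE bd, of "Suc 0"] oB j Qb[OF w]])
   then have h: "((%t. lrep b d (sw w) (tail2 (w(Suc (Suc j) := t))) l) has_real_derivative ?D) (at (w (Suc (Suc j))))"
    by (simp add: tail2_upd) (simp add: tail2_def)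
   have "dvec Q Sig (Suc (Suc j)) w l = ?D" unfolding dvec_def
   proof (rule pd_eq[OF Q w])
    show "Suc (Suc j) < m" using j mn by simp
    show "hpd (%w. Sig w l) (Suc (Suc j)) ?D w"
    proof (rule has_field_derivative_transform_within_open[OF h])
     show "open {t. w(Suc (Suc j) := t) \<in> Q}"             using open_slice[OF Q] w opn_subset[OF Q] j mn by blast
     show "w (Suc (Suc j)) \<in> {t. w(Suc (Suc j) := t) \<in> Q}" using w by simp
     fix t assume "t \<in> {t. w(Suc (Suc j) := t) \<in> Q}"
     then have "tail2 (w(Suc (Suc j) := t)) \<in> cim b" using Qb by blast
     from e[OF this] show "lrep b d (sw w) (tail2 (w(Suc (Suc j) := t))) l = Sig (w(Suc (Suc j) := t)) l" by simp
    qed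
   qed
   then show "dvec Q Sig (Suc (Suc j)) w l = dsig b d (sw w) j (tail2 w) l" by (simp add: dsig_def)
  qed
  have "[0..<m] = 0 # Suc 0 # map (%j. Suc (Suc j)) [0..<n]"
   unfolding mn by (simp add: upt_conv_Cons map_Suc_upt[symmetric] del: upt_Suc)
  then show ?thesis using d0 d1 d2 by simp
 qed
 have slice: "open {t. w0(i := t) \<in> Q}" if "i < m" for i using open_slice[OF Q that] w0 opn_subset[OF Q] by blast
 have m0: "0 < m" "Suc 0 < m" using mn by auto
 \<comment> \<open>Without its first argument the pulled back form has \<open>a2\<close> and the
   frame of \<open>S\<close> left, and index 0 differentiates in direction \<open>a1\<close>. The
   step for index 1 exchanges the two directions and enters with sign -1.\<close>
 have t0: "pd Q 0 (H 0) w0 = D1"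
 proof (rule pd_eq[OF Q w0 m0(1)])
  have D1': "((%t. jform b d (Suc 0) \<nu> (line S T s t a1) A1 y) has_real_derivative D1) (at (w0 0))"
   unfolding w00 by (rule D1)
  show "hpd (H 0) 0 D1 w0"
  proof (rule has_field_derivative_transform_within_open[OF D1' slice[OF m0(1)]])
   show "w0 0 \<in> {t. w0(0 := t) \<in> Q}" using w0 by simp
   fix t assume "t \<in> {t. w0(0 := t) \<in> Q}"
   then have t: "w0(0 := t) \<in> Q" by simp
   have sw: "sw (w0(0 := t)) = line S T s t a1"
    using line_0_eq[OF line_in_E[OF s a(1)] a(2)] w00 by (simp add: sw_def)
   have Si: "Sig (w0(0 := t)) = lrep b d (line S T s t a1) y"
    using Sig[OF Qb[OF t]] by (simp add: sw tail2_upd w00)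
   show "jform b d (Suc 0) \<nu> (line S T s t a1) A1 y = H 0 (w0(0 := t))"
    unfolding H_def jform_def PS[OF t] Si sw by (simp add: omit_def tail2_upd w00 A1)
  qed
 qed
 have t1: "pd Q (Suc 0) (H (Suc 0)) w0 = D2"
 proof (rule pd_eq[OF Q w0 m0(2)])
  have D2': "((%t. jform b d (Suc 0) \<nu> (line S T s t a2) A2 y) has_real_derivative D2) (at (w0 (Suc 0)))"
   unfolding w00 by (rule D2)
  show "hpd (H (Suc 0)) (Suc 0) D2 w0"
  proof (rule has_field_derivative_transform_within_open[OF D2' slice[OF m0(2)]])
   show "w0 (Suc 0) \<in> {t. w0(Suc 0 := t) \<in> Q}" using w0 by simp
   fix t assume "t \<in> {t. w0(Suc 0 := t) \<in> Q}"
   then have t: "w0(Suc 0 := t) \<in> Q" by simp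
   have sw: "sw (w0(Suc 0 := t)) = line S T s t a2"
    using line_0_eq[OF s a(1)] w00 by (simp add: sw_def)
   have Si: "Sig (w0(Suc 0 := t)) = lrep b d (line S T s t a2) y"
    using Sig[OF Qb[OF t]] by (simp add: sw tail2_upd w00)
   show "jform b d (Suc 0) \<nu> (line S T s t a2) A2 y = H (Suc 0) (w0(Suc 0 := t))"
    unfolding H_def jform_def PS[OF t] Si sw by (simp add: omit_def tail2_upd w00 A1)
  qed
 qed
 have t2: "pd Q (Suc (Suc j)) (H (Suc (Suc j))) w0 = pd (cim b) j (bcoef b d \<nu> s a1 a2 j) y" if j: "j < n" for j
 proof (rule pd_eq[OF Q w0])
  show jm: "Suc (Suc j) < m" using j mn by simp
  have "hpd (bcoef b d \<nu> s a1 a2 j) j (pd (cim b) j (bcoef b d \<nu> s a1 a2 j) y) y"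
   by (rule Ck_hpd[OF bcoef_Ck[OF bd \<nu> s a j, of "Suc 0"] oB j y])
  then have h: "((%t. bcoef b d \<nu> s a1 a2 j (y(j := t))) has_real_derivative pd (cim b) j (bcoef b d \<nu> s a1 a2 j) y) (at (w0 (Suc (Suc j))))"
   by (simp add: w0_def)
  show "hpd (H (Suc (Suc j))) (Suc (Suc j)) (pd (cim b) j (bcoef b d \<nu> s a1 a2 j) y) w0"
  proof (rule has_field_derivative_transform_within_open[OF h slice[OF jm]])
   show "w0 (Suc (Suc j)) \<in> {t. w0(Suc (Suc j) := t) \<in> Q}" using w0 by simp
   fix t assume "t \<in> {t. w0(Suc (Suc j) := t) \<in> Q}"
   then have t: "w0(Suc (Suc j) := t) \<in> Q" by simp
   have sw: "sw (w0(Suc (Suc j) := t)) = s"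
    using line_0_eq[OF s a(1)] line_0_eq[OF s a(2)] w00 by (simp add: sw_def)
   have Si: "Sig (w0(Suc (Suc j) := t)) = lrep b d s (y(j := t))"
    using Sig[OF Qb[OF t]] by (simp add: sw tail2_upd w00)
   show "bcoef b d \<nu> s a1 a2 j (y(j := t)) = H (Suc (Suc j)) (w0(Suc (Suc j) := t))"
    unfolding H_def bcoef_def PS[OF t] Si sw by (simp add: omit_def tail2_upd w00)
  qed
 qed
 have alt: "altform m (Suc n) (AM m (Suc n) (coef M c \<nu> z))" if z: "z \<in> cim c" for z
 proof -
  have zc: "cinv c z \<in> fst c" by (rule cinv_in[OF M cM z])
  then have zM: "cinv c z \<in> pts M" using chart_subset[OF M cM] by blast
  have 1: "altform m (Suc n) (%vs. \<nu> (cinv c z) (map (cvec M c (cinv c z)) vs))"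
   using tform_cvec[OF M cM zc diff_form_tform[OF \<nu> zM]] m by simp
  have 2: "\<nu> (cinv c z) (map (cvec M c (cinv c z)) vs) = AM m (Suc n) (coef M c \<nu> z) vs"
   if "set vs <= Rn m" "length vs = Suc n" for vs
   using form_AM[OF M cM \<nu> zc] that m snd_cinv[OF M cM z] by simp
  show ?thesis by (rule altform_cong[OF 1 2])
 qed
 have NC: "Ck m (cim c) r (%z. coef M c \<nu> z js)" if "js \<in> idx m (Suc n)" for js r
  using coef_Ck[OF M cM \<nu>] that m by simp
 have PPR: "set (?PP w0) <= Rn (mdim M)" "length (?PP w0) = Suc (Suc n)" using dP[OF _ w0] m mn by auto
 have PSR: "set (?PS w0) <= Rn (mdim M)" "length (?PS w0) = Suc (Suc n)" using dS[OF _ w0] m mn by auto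
 have "(\<Sum>i<Suc (Suc n). (-1) ^ i * pd Q i (H i) w0) =
   (\<Sum>i<Suc (Suc n). (-1) ^ i * pd Q i (%w. AM m (Suc n) (coef M c \<nu> (\<Phi> w)) (omit i (?PP w))) w0)"
  by (intro sum.cong refl arg_cong2[of _ _ _ _ "(*)"] pd_cong[OF Q _ w0]) (use Heq mn in auto)
 also have "\<dots> = (\<Sum>i<Suc (Suc n). (-1) ^ i * (\<Sum>l<m. dvec Q \<Phi> i w0 l *
   AM m (Suc n) (%js. pd (cim c) l (%z. coef M c \<nu> z js) (\<Phi> w0)) (omit i (?PP w0))))"
  using pullback_exterior_derivative[of "Suc n" Q m "cim c" "coef M c \<nu>" \<Phi> w0, OF Q[unfolded mn] oC NC alt \<Phi>C[unfolded mn] \<Phi>c w0]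
  unfolding mn .
 also have "\<dots> = (\<Sum>i<Suc (Suc n). (-1) ^ i * (\<Sum>l<m. (?PP w0 ! i) l *
   AM m (Suc n) (%js. pd (cim c) l (%z. coef M c \<nu> z js) (\<Phi> w0)) (omit i (?PP w0))))"
  by (intro sum.cong refl) (auto simp: mn simp del: upt_Suc)
 also have "\<dots> = ext_deriv M \<nu> ?p (map (cvec M c ?p) (?PP w0))"
  using ext_deriv_AM[OF M \<nu> pM c_def PPR] pt(4)[OF w0] unfolding pt0 m by simp
 also have "\<dots> = ext_deriv M \<nu> ?p (map (cvec M d ?p) (?PS w0))" by (simp only: mapcv[OF w0, unfolded pt0])
 also have "\<dots> = \<mu> ?p (map (cvec M d ?p) (?PS w0))"
  by (rule d\<nu>[OF pM]) (use cvec_tspace[OF M dM pd] mn in auto)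
 also have "\<dots> = AM m (Suc (Suc n)) (coef M d \<mu> (lrep b d s y)) (?PS w0)"
  using form_AM[OF M dM \<mu> pd PSR] m by (simp add: lrep_def)
 also have "\<dots> = jform b d (Suc (Suc 0)) \<mu> s A y"
 proof -
  have "sw w0 = s" using line_0_eq[OF s a(1)] line_0_eq[OF s a(2)] w00 by (simp add: sw_def)
  then show ?thesis unfolding PS[OF w0] jform_def by (simp add: w00 A1)
 qed
 finally have fin: "jform b d (Suc (Suc 0)) \<mu> s A y = (\<Sum>i<Suc (Suc n). (-1) ^ i * pd Q i (H i) w0)" ..
 show ?thesis unfolding fin sum.lessThan_Suc_shift[of _ "Suc n"] sum.lessThan_Suc_shift[of _ n]
  using t0 t1 t2 by simp
qed

end

section \<open>Integration by parts and Stokes' theorem on a closed manifold\<close>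

text \<open>The differential of \<open>rh\<close> as a function on tangent vectors, read in the
  selected chart; by \<open>dfun_cvec\<close> every other chart gives the same value.\<close>

definition dfun :: "'s smfd => ('s => real) => 's => 's tvec => real"
 where "dfun S rh x w = (let b = chart_at S x in
  \<Sum>j<mdim S. w b j * pd (cim b) j (%y. rh (cinv b y)) (snd b x))"

lemma dfun_lin: "dfun S rh x (%d l. v d l + t * w d l) = dfun S rh x v + t * dfun S rh x w"
 by (simp add: dfun_def Let_def algebra_simps sum.distrib sum_distrib_left)

lemma dfun_cvec:
 assumes S: "omfd S" and rh: "msm S rh" and c: "c \<in> matlas S" and x: "x \<in> fst c"
 shows "dfun S rh x (cvec S c x v) = (\<Sum>l<mdim S. v l * pd (cim c) l (%y. rh (cinv c y)) (snd c x))"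
proof -
 define b where "b = chart_at S x"
 have "x \<in> pts S" using chart_subset[OF S c] x by blast
 then have b: "b \<in> matlas S" and xb: "x \<in> fst b" using chart_at[OF S] by (auto simp: b_def)
 let ?n = "mdim S" and ?r = "%c y. rh (cinv c y)" and ?t = "lrep c b (%p. p)"
 define D where "D = ldom c b (%p. p)"
 have id: "continuous_map (mtop S) (mtop S) (%p. p)" by (simp add: continuous_map_id[unfolded id_def])
 have D: "opn ?n D" unfolding D_def by (rule ldom_opn[OF S c S b id])
 have xD: "snd c x \<in> D" unfolding D_def by (rule snd_in_ldom[where f = "%p. p", OF x xb])
 have xc: "snd c x \<in> cim c" using x by (rule imageI)
 have pdl: "pd (cim c) l (?r c) (snd c x) = (\<Sum>j<?n. pd (cim b) j (?r b) (snd b x) * ljac c b (%p. p) x j l)"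
  if l: "l < ?n" for l
 proof -
  have "pd (cim c) l (?r c) (snd c x) = pd D l (?r c) (snd c x)"
   by (rule pd_opn_subset[OF cim_opn[OF S c] D xc xD l])
  also have "\<dots> = pd D l (%y. ?r b (?t y)) (snd c x)"
   by (rule pd_cong[OF D l xD]) (use cinv_snd[OF S b] in \<open>auto simp: D_def ldom_eq[OF S c] lrep_def\<close>)
  also have "\<dots> = (\<Sum>j<?n. pd (cim b) j (?r b) (?t (snd c x)) * pd D l (%y. ?t y j) (snd c x))"
   by (rule pd_compose[where f = "?r b" and \<phi> = ?t, OF D cim_opn[OF S b] msm_Ck[OF rh b] _ _ l xD])
    (use lrep_Ck[OF S c S b smooth_id[OF S]] lrep_in[OF S c, of _ b "%p. p"] in \<open>simp_all add: D_def image_subset_iff\<close>)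
  finally show ?thesis by (simp add: lrep_snd[OF S c x] ljac_def D_def)
 qed
 have "dfun S rh x (cvec S c x v) = (\<Sum>j<?n. (\<Sum>l<?n. ljac c b (%p. p) x j l * v l) * pd (cim b) j (?r b) (snd b x))"
  using b xb by (simp add: dfun_def b_def[symmetric] cvec_def)
 also have "\<dots> = (\<Sum>l<?n. v l * (\<Sum>j<?n. pd (cim b) j (?r b) (snd b x) * ljac c b (%p. p) x j l))"
  by (simp add: sum_distrib_left sum_distrib_right mult_ac) (rule sum.swap)
 also have "\<dots> = (\<Sum>l<?n. v l * pd (cim c) l (?r c) (snd c x))"
  by (intro sum.cong refl) (simp add: pdl)
 finally show ?thesis .
qed

lemma dfun_cbasis:
 assumes "omfd S" "msm S rh" "c \<in> matlas S" "x \<in> fst c" "j < mdim S"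
 shows "dfun S rh x (cbasis S c x j) = pd (cim c) j (%y. rh (cinv c y)) (snd c x)"
 unfolding cbasis_unitv dfun_cvec[OF assms(1-4)] unitv_def by (rule sum_delta_mult(1)) (use assms(5) in auto)

lemma pd_zero:
 assumes S: "omfd S" and K: "closedin (mtop S) K" "!!x. x \<in> pts S - K ==> rh x = 0"
  and e: "e \<in> matlas S" "y \<in> cim e" "cinv e y \<notin> K" and j: "j < mdim S"
 shows "pd (cim e) j (%y. rh (cinv e y)) y = 0"
proof (rule pd_eq[OF cim_opn[OF S e(1)] e(2) j])
 let ?A = "{y \<in> cim e. cinv e y \<in> pts S - K}"
 have A: "opn (mdim S) ?A" by (rule opn_chart_preimage[OF S e(1)]) (use K(1) in blast)
 have "cinv e y \<in> pts S" using cinv_in[OF S e(1,2)] chart_subset[OF S e(1)] by blast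
 then have yA: "y \<in> ?A" using e by simp
 show "hpd (%y. rh (cinv e y)) j 0 y"
  by (rule hpd_cong[where f = "%y. 0", OF A yA j]) (use K(2) in auto)
qed

text \<open>The wedge product of a 1-form \<open>L\<close> with a form \<open>B\<close> of degree
  \<open>q\<close>. It is used with \<open>L\<close> the differential of a member of a partition of
  unity.\<close>

definition wedge1 :: "nat => ('s => 's tvec => real) => 's form => 's form"
 where "wedge1 q L B = (%x ws. \<Sum>i<Suc q. (-1) ^ i * (L x (ws ! i) * B x (omit i ws)))"

context tube
begin

lemma Tform_altform:
 assumes s: "s \<in> E" and as: "set as <= E" and al: "diff_form M (length as + q) al" and c: "c \<in> matlas S" and x: "x \<in> fst c"
 shows "altform n q (%vs. Tform al s as x (map (cvec S c x) vs))"
proof -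
 have xS: "x \<in> pts S" using chart_subset[OF S c] x by blast
 have sm: "smooth_map S M s" by (rule secD(1)[OF s])
 have sx: "s x \<in> pts M" using sm xS by (auto simp: smooth_map_def continuous_map_def)
 have "tform M (s x) (length (map (%a. xi s a x) as) + q) (al (s x))" using diff_form_tform[OF al sx] by simp
 moreover have "set (map (%a. xi s a x) as) <= tspace M (s x)" using xi_tspace[OF s _ xS] as by auto
 ultimately have "tform M (s x) q (%ws. al (s x) (map (%a. xi s a x) as @ ws))" by (rule tform_append)
 from tform_pull[OF S c M sm x this] show ?thesis unfolding n Tform_def .
qed

lemma Tform_coef_Ck:
 assumes s: "s \<in> E" and as: "set as <= E" and al: "diff_form M (length as + q) al" and c: "c \<in> matlas S" and js: "js \<in> idx n q"
 shows "Ck n (cim c) r (%y. Tform al s as (cinv c y) (map (cbasis S c (cinv c y)) js))"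
proof -
 obtain us where us: "length us = length as" "\<forall>u\<in>set us. vector_field M u"
  "\<forall>i<length as. \<forall>x\<in>pts S. (us ! i) (s x) = xi s (as ! i) x" using Tform_extension[OF s as] by blast
 let ?us = "map (%u x. u (s x)) us"
 let ?f = "%y. al (s (cinv c y)) (map (%u. u (cinv c y)) ?us @ map (tmap S M s (cinv c y)) (map (cbasis S c (cinv c y)) js))"
 have "Ck (mdim S) (cim c) r ?f"
  by (rule pull_coef_Ck[OF S c M secD(1)[OF s]])
   (use al us vector_field_along[OF S M secD(1)[OF s]] js n in auto)
 moreover have "?f y = Tform al s as (cinv c y) (map (cbasis S c (cinv c y)) js)" if y: "y \<in> cim c" for y
 proof -
  have "cinv c y \<in> pts S" using cinv_in[OF S c y] chart_subset[OF S c] by blast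
  then have "map (%u. u (cinv c y)) ?us = map (%a. xi s a (cinv c y)) as" using us by (auto intro!: nth_equalityI)
  then show ?thesis by (simp add: Tform_def)
 qed
 ultimately show ?thesis
  using Ck_cong[OF cim_opn[OF S c], of ?f "%y. Tform al s as (cinv c y) (map (cbasis S c (cinv c y)) js)" r] n by simp
qed

lemma cf_wedge:
 assumes nq: "n = Suc q" and rh: "msm S rh" and c: "c \<in> matlas S" and x: "x \<in> fst c"
 shows "cf S (wedge1 q (dfun S rh) B) c x =
  (\<Sum>i<n. (-1) ^ i * (pd (cim c) i (%y. rh (cinv c y)) (snd c x) * B x (map (cbasis S c x) (omit i [0..<n]))))"
 unfolding cf_def wedge1_def nq[symmetric] omit_map n
proof (intro sum.cong refl)
 fix i assume "i \<in> {..<n}"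
 then have i: "i < n" by simp
 show "(-1) ^ i * (dfun S rh x (map (cbasis S c x) [0..<n] ! i) * B x (map (cbasis S c x) (omit i [0..<n]))) =
   (-1) ^ i * (pd (cim c) i (%y. rh (cinv c y)) (snd c x) * B x (map (cbasis S c x) (omit i [0..<n])))"
  using dfun_cbasis[OF S rh c x] i n by simp
qed

lemma omit_idx: "i < Suc q ==> omit i [0..<Suc q] \<in> idx (Suc q) q"
 using set_omit[of i "[0..<Suc q]"] by (auto simp: idx_def length_omit simp del: upt_Suc)

text \<open>Being a density makes the integral of d(rh) \<and> \<open>B\<close> independent of the
  chart, which is what the proof of Stokes' theorem exploits.\<close>

lemma density_wedge:
 assumes nq: "n = Suc q" and rh: "msm S rh" and s: "s \<in> E" and as: "set as <= E" and al: "diff_form M (length as + q) al"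
 shows "density S (wedge1 q (dfun S rh) (Tform al s as))"
 unfolding density_def n
proof (intro ballI conjI)
 fix c assume c: "c \<in> matlas S"
 show "altform n n (%vs. wedge1 q (dfun S rh) (Tform al s as) x (map (cvec S c x) vs))" if x: "x \<in> fst c" for x
  unfolding nq
 proof (rule altform_cong[OF altform_wedge[where L = "%v. dfun S rh x (cvec S c x v)"]])
  show "altform (Suc q) q (%vs. Tform al s as x (map (cvec S c x) vs))"
   using Tform_altform[OF s as al c x] nq by simp
  show "dfun S rh x (cvec S c x (%l. v l + t * w l)) = dfun S rh x (cvec S c x v) + t * dfun S rh x (cvec S c x w)" for v w t
   unfolding cvec_lin dfun_lin ..
  show "(\<Sum>i<Suc q. (-1) ^ i * (dfun S rh x (cvec S c x (vs ! i)) * Tform al s as x (map (cvec S c x) (omit i vs)))) =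
    wedge1 q (dfun S rh) (Tform al s as) x (map (cvec S c x) vs)" if "length vs = Suc q" for vs
   unfolding wedge1_def omit_map using that by (intro sum.cong refl) simp
 qed
 let ?g = "%y. \<Sum>i<n. (-1) ^ i * (pd (cim c) i (%y. rh (cinv c y)) y *
   Tform al s as (cinv c y) (map (cbasis S c (cinv c y)) (omit i [0..<n])))"
 have "Ck n (cim c) 0 ?g"
 proof (intro Ck_sum Ck_mult Ck_const)
  show o: "opn n (cim c)" using cim_opn[OF S c] n by simp
  fix i assume "i \<in> {..<n}"
  then have i: "i < n" by simp
  show "Ck n (cim c) 0 (pd (cim c) i (%y. rh (cinv c y)))"
   using Ck_pd[OF msm_Ck[OF rh c, of "Suc 0"], of i] i n by simp
  show "Ck n (cim c) 0 (%y. Tform al s as (cinv c y) (map (cbasis S c (cinv c y)) (omit i [0..<n])))"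
   by (rule Tform_coef_Ck[OF s as al c]) (use omit_idx[of i q] i nq in simp)
 qed (use cim_opn[OF S c] n in auto)
 then have "continuous_on (cim c) ?g" by (rule Ck_continuous)
 then show "continuous_on (cim c) (%y. cf S (wedge1 q (dfun S rh) (Tform al s as)) c (cinv c y))"
  by (rule continuous_on_eq) (simp add: cf_wedge[OF nq rh c cinv_in[OF S c]] snd_cinv[OF S c])
qed

lemma bcoef_Tform:
 assumes nq: "n = Suc q" and bd: "(b, d) \<in> T" and y: "y \<in> cim b" and s: "s \<in> E" and a: "a1 \<in> E" "a2 \<in> E" and j: "j < n"
  and \<nu>: "diff_form M (Suc n) \<nu>"
 shows "Tform \<nu> s [a1, a2] (cinv b y) (map (cbasis S b (cinv b y)) (omit j [0..<n])) = bcoef b d \<nu> s a1 a2 j y"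
proof -
 have js: "set (omit j [0..<n]) <= {..<n}" "length (omit j [0..<n]) = q"
  using omit_idx[of j q] j nq by (auto simp: idx_def simp del: upt_Suc)
 have as: "set [a1, a2] <= E" using a by simp
 have e: "length [a1, a2] + length (omit j [0..<n]) = Suc n" using js(2) nq by simp
 from form_value[OF bd y s as js(1), unfolded e, OF \<nu>] show ?thesis
  unfolding bcoef_def omit_map Tform_def by simp
qed

text \<open>Integration by parts in one chart: \<open>rh\<close> times the components has compact
  support, so the derivatives of the products integrate to 0. What remains of the divergence is the
  integral of d(rh) \<and> \<open>\<nu>(a1, a2, ...)\<close> with the opposite sign, and that
  integrand is a density on all of \<open>S\<close>.\<close>

lemma divergence_integral:
 assumes nq: "n = Suc q" and bd: "(b, d) \<in> T" and \<nu>: "diff_form M (Suc n) \<nu>" and s: "s \<in> E" and a: "a1 \<in> E" "a2 \<in> E"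
  and rh: "msm S rh" and K: "closedin (mtop S) K" "K <= fst b" "!!x. x \<in> pts S - K ==> rh x = 0"
 shows "wint b (pw b rh) (%y. \<Sum>j<n. (-1) ^ j * pd (cim b) j (bcoef b d \<nu> s a1 a2 j) y) =
  - chart_integral S b (%x. 1) (wedge1 q (dfun S rh) (Tform \<nu> s [a1, a2]))"
proof -
 note bS = T2(1)[OF bd] and oB = bchart_opn[OF bd]
 define o' where "o' y = morient S b (cinv b y)" for y
 define r where "r y = rh (cinv b y)" for y
 let ?\<beta> = "%j. bcoef b d \<nu> s a1 a2 j" and ?B = "cim b"
 let ?K = "snd b ` K"
 have K': "compact ?K" by (rule snd_compact[OF S bS closedin_compact_space[OF comp K(1)] K(2)])
 have KB: "?K <= ?B" using K(2) by blast
 then have KR: "?K <= Rn n" using opn_subset[OF oB] by blast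
 have nK: "cinv b y \<notin> K" if "y \<in> ?B - ?K" for y
  using that snd_cinv[OF S bS, of y] by (metis DiffD1 DiffD2 imageI)
 have bT: "cinv b y \<in> pts S" if "y \<in> ?B" for y using cinv_b[OF bd that] fst_b_subset[OF bd] by blast
 have r0: "r y = 0" if "y \<in> ?B - ?K" for y using K(3) nK[OF that] bT that by (simp add: r_def)
 have dr0: "pd ?B j r y = 0" if y: "y \<in> ?B - ?K" and j: "j < n" for y j
  unfolding r_def[abs_def] by (rule pd_zero[OF S K(1) K(3) bS _ nK[OF y]]) (use y j n in auto)
 have rC: "Ck n ?B k r" for k unfolding r_def[abs_def] using msm_Ck[OF rh bS] n by simp
 have bC: "Ck n ?B k (?\<beta> j)" if "j < n" for j k by (rule bcoef_Ck[OF bd \<nu> s a that])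
 have oc: "continuous_on ?B o'" unfolding o'_def[abs_def] by (rule morient_cont[OF S bS])
 have o1: "o' y = 1 \<or> o' y = -1" if "y \<in> ?B" for y
  using S bS cinv_b[OF bd that] unfolding oriented_mfd_def o'_def by blast
 define F where "F j y = (if y \<in> ?B then o' y * (r y * ?\<beta> j y) else 0)" for j y
 define F' where "F' j y = (if y \<in> ?B then o' y * (pd ?B j r y * ?\<beta> j y + pd ?B j (?\<beta> j) y * r y) else 0)" for j y
 define g where "g y = (\<Sum>j<n. (-1) ^ j * (pd ?B j r y * ?\<beta> j y))" for y
 have cpr: "continuous_on ?B (pd ?B j r)" if "j < n" for j by (rule Ck_continuous[OF Ck_pd[OF rC that]])
 have cpb: "continuous_on ?B (pd ?B j (?\<beta> j))" if "j < n" for j by (rule Ck_continuous[OF Ck_pd[OF bC[OF that] that]])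
 have cr: "continuous_on ?B r" and cb: "!!j. j < n ==> continuous_on ?B (?\<beta> j)"
  by (rule Ck_continuous[OF rC], rule Ck_continuous[OF bC])
 have csF': "csupp n (F' j)" if j: "j < n" for j unfolding F'_def[abs_def]
  by (rule csupp_extend[OF oB _ K' KB]) (use j r0 dr0 in \<open>auto intro!: continuous_intros oc cpr cpb cr cb\<close>)
 have "RInt n (F' j) = 0" if j: "j < n" for j
 proof (rule RInt_partial_derivative[OF K' KR])
  show "F j y = 0" if "y \<in> Rn n - ?K" for y using r0[of y] that by (simp add: F_def)
  show "F' j y = 0" if "y \<in> Rn n - ?K" for y using r0[of y] dr0[of y j] that j by (simp add: F'_def)
  show "continuous_on (Rn n) (F' j)" using csF'[OF j] by (simp add: csupp_def)
  show "j < n" by (rule j)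
  fix z assume z: "z \<in> Rn n"
  show "hpd (F j) j (F' j z) z"
  proof (cases "z \<in> ?B")
   case True
   \<comment> \<open>The orientation sign takes only the values 1 and -1 and is continuous, hence
     constant near \<open>z\<close>; there it can be taken out of the derivative.\<close>
   let ?A = "{y \<in> ?B. \<bar>o' y - o' z\<bar> < 1}"
   have A: "opn n ?A" by (rule opn_less[OF oB]) (intro continuous_intros oc)+
   have zA: "z \<in> ?A" using True by simp
   have oA: "o' y = o' z" if "y \<in> ?A" for y using o1[of y] o1[OF True] that by auto
   have "hpd (%y. o' z * (r y * ?\<beta> j y)) j (o' z * (pd ?B j r z * ?\<beta> j z + pd ?B j (?\<beta> j) z * r z)) z"
   proof (intro DERIV_cmult)
    have 1: "hpd r j (pd ?B j r z) z" by (rule Ck_hpd[OF rC oB j True])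
    have 2: "hpd (?\<beta> j) j (pd ?B j (?\<beta> j) z) z" by (rule Ck_hpd[OF bC[OF j] oB j True])
    show "hpd (%y. r y * ?\<beta> j y) j (pd ?B j r z * ?\<beta> j z + pd ?B j (?\<beta> j) z * r z) z"
     using DERIV_mult[OF 1 2] by simp
   qed
   then have h: "hpd (%y. o' z * (r y * ?\<beta> j y)) j (F' j z) z" using True by (simp add: F'_def)
   have FA: "o' z * (r y * ?\<beta> j y) = F j y" if "y \<in> ?A" for y
    unfolding F_def oA[OF that, symmetric] using that by simp
   show ?thesis by (rule hpd_cong[OF A zA j h FA])
  next
   case False
   have A: "opn n (Rn n - ?K)"
    by (intro openin_diff closed_subset KR compact_imp_closed K') simp
   have zA: "z \<in> Rn n - ?K" using z False KB by blast
   have F0: "F' j z = 0" using False by (simp add: F'_def)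
   show ?thesis unfolding F0
    by (rule hpd_cong[where f = "%y. 0", OF A zA j]) (use r0 in \<open>auto simp: F_def\<close>)
  qed
 qed
 then have "RInt n (%y. \<Sum>j<n. (-1) ^ j * F' j y) = 0"
  using csF' by (subst RInt_sum) (auto simp: RInt_cmult csupp_def intro!: continuous_intros)
 moreover have csG: "csupp n (%y. if y \<in> ?B then o' y * g y else 0)"
  by (rule csupp_extend[OF oB _ K' KB]) (use dr0 in \<open>auto simp: g_def[abs_def] intro!: continuous_intros oc cpr cb\<close>)
 moreover have "csupp n (%y. if y \<in> ?B then pw b rh y * (\<Sum>j<n. (-1) ^ j * pd ?B j (?\<beta> j) y) else 0)" (is "csupp n ?H")
  by (rule csupp_extend[OF oB _ K' KB])
   (use r0 in \<open>auto simp: pw_def o'_def[symmetric] r_def[symmetric] intro!: continuous_intros oc cr cpb\<close>)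
 moreover have "(%y. \<Sum>j<n. (-1) ^ j * F' j y) = (%y. ?H y + (if y \<in> ?B then o' y * g y else 0))"
  by (auto simp: fun_eq_iff F'_def g_def pw_def o'_def[symmetric] r_def[symmetric] sum_distrib_left
    simp flip: sum.distrib intro!: sum.cong) (simp add: algebra_simps)
 ultimately have z: "RInt n ?H + RInt n (%y. if y \<in> ?B then o' y * g y else 0) = 0"
  using RInt_add[of n ?H "%y. if y \<in> ?B then o' y * g y else 0"] by simp
 have "cf S (wedge1 q (dfun S rh) (Tform \<nu> s [a1, a2])) b (cinv b y) = g y" if y: "y \<in> ?B" for y
  unfolding cf_wedge[OF nq rh bS cinv_b[OF bd y]] g_def snd_cinv[OF S bS y] r_def[abs_def]
  by (intro sum.cong refl) (simp add: bcoef_Tform[OF nq bd y s a _ \<nu>])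
 then have "chart_integral S b (%x. 1) (wedge1 q (dfun S rh) (Tform \<nu> s [a1, a2])) = RInt n (%y. if y \<in> ?B then o' y * g y else 0)"
  unfolding chart_integral_RInt n by (intro RInt_cong) (simp add: cint_def o'_def)
 then show ?thesis using z by (simp add: wint_def)
qed

text \<open>By \<open>divergence_integral\<close> each summand is minus the integral of the density
  d(rh i) \<and> \<open>\<nu>(a1, a2, ...)\<close>, supported in the domain of \<open>b i\<close>.
  Each integral is redistributed over all charts of the partition, and in a fixed chart the sum over
  \<open>i\<close> contains the differential of the constant 1.\<close>

lemma stokes:
 assumes nq: "n = Suc q" and p: "partition_of_unity S N b rh" and bd: "!!i. i < N ==> (b i, d i) \<in> T"
  and \<nu>: "diff_form M (Suc n) \<nu>" and s: "s \<in> E" and a: "a1 \<in> E" "a2 \<in> E"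
 shows "(\<Sum>i<N. wint (b i) (pw (b i) (rh i)) (%y. \<Sum>j<n. (-1) ^ j * pd (cim (b i)) j (bcoef (b i) (d i) \<nu> s a1 a2 j) y)) = 0"
proof -
 define W where "W i = wedge1 q (dfun S (rh i)) (Tform \<nu> s [a1, a2])" for i
 note P = partition_of_unityD[OF S p]
 have "\<forall>i. \<exists>K. i < N --> closedin (mtop S) K & K <= fst (b i) & (\<forall>x\<in>pts S - K. rh i x = 0)"
  using P(3) by blast
 from choice[OF this] obtain K where K: "\<forall>i. i < N --> closedin (mtop S) (K i) & K i <= fst (b i) & (\<forall>x\<in>pts S - K i. rh i x = 0)"
  by blast
 have K1: "closedin (mtop S) (K i)" and K2: "K i <= fst (b i)" and K3: "!!x. x \<in> pts S - K i ==> rh i x = 0" if "i < N" for i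
  using K that by auto
 have \<nu>': "diff_form M (length [a1, a2] + q) \<nu>" using \<nu> nq by simp
 have as: "set [a1, a2] <= E" using a by simp
 have Wd: "density S (W i)" if "i < N" for i unfolding W_def by (rule density_wedge[OF nq P(2)[OF that] s as \<nu>'])
 have Wv: "vanish S (W i) ka (K i)" if i: "i < N" for i ka
  unfolding vanish_def
 proof (intro ballI impI)
  fix x e assume x: "x \<in> pts S - K i" and e: "e \<in> matlas S" "x \<in> fst e"
  have xe: "snd e x \<in> cim e" "cinv e (snd e x) = x" using e cinv_snd[OF S e] by auto
  have "pd (cim e) j (%y. rh i (cinv e y)) (snd e x) = 0" if "j < n" for j
   by (rule pd_zero[OF S K1[OF i] K3[OF i] e(1) xe(1)]) (use xe x that n in auto)
  then show "ka x * cf S (W i) e x = 0" unfolding W_def cf_wedge[OF nq P(2)[OF i] e] by simp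
 qed
 have one: "mcont S (%x. 1)" by (simp add: mcont_def)
 have rc: "mcont S (rh j)" if "j < N" for j by (rule msm_mcont[OF P(2)[OF that]])
 have rs: "(\<Sum>j<N. rh j x) = 1" if "x \<in> pts S" for x using p that by (simp add: partition_of_unity_def)
 \<comment> \<open>The constant weight is admissible because \<open>W i\<close> itself vanishes
   outside a closed subset of the domain of \<open>b i\<close>.\<close>
 have "chart_integral S (b i) (%x. 1) (W i) = (\<Sum>j<N. chart_integral S (b j) (rh j) (W i))" if i: "i < N" for i
 proof -
  have "chart_integral S (b i) (%x. 1) (W i) = (\<Sum>j<N. chart_integral S (b i) (%x. 1 * rh j x) (W i))"
   by (rule chart_integral_split[OF S P(1)[OF i] comp Wd[OF i] one K1[OF i] K2[OF i] Wv[OF i] rc rs])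
  also have "\<dots> = (\<Sum>j<N. chart_integral S (b j) (rh j) (W i))"
  proof (intro sum.cong refl)
   fix j assume "j \<in> {..<N}"
   then have j: "j < N" by simp
   have "vanish S (W i) (rh j) (K i \<inter> K j)"
    using Wv[OF i, of "rh j"] K3[OF j] unfolding vanish_def by auto
   from chart_integral_independent[OF S comp Wd[OF i] rc[OF j] P(1)[OF i] P(1)[OF j] _ _ _ this]
   show "chart_integral S (b i) (%x. 1 * rh j x) (W i) = chart_integral S (b j) (rh j) (W i)"
    using K1[OF i] K1[OF j] K2[OF i] K2[OF j] by (simp add: closedin_Int le_infI1 le_infI2)
  qed
  finally show ?thesis .
 qed
 then have "(\<Sum>i<N. chart_integral S (b i) (%x. 1) (W i)) = (\<Sum>i<N. \<Sum>j<N. chart_integral S (b j) (rh j) (W i))"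
  by (intro sum.cong refl) simp
 also have "\<dots> = (\<Sum>j<N. \<Sum>i<N. chart_integral S (b j) (rh j) (W i))" by (rule sum.swap)
 also have "\<dots> = 0"
 proof (rule sum.neutral, rule ballI)
  fix j assume "j \<in> {..<N}"
  then have j: "j < N" by simp
  obtain K where w: "weight (b j) K (pw (b j) (rh j))" using weight_pw[OF p j] by blast
  let ?F = "%i y. if y \<in> cim (b j) then pw (b j) (rh j) y * cf S (W i) (b j) (cinv (b j) y) else 0"
  have cs: "csupp n (?F i)" if "i < N" for i
   by (rule csupp_weight[OF w bd[OF j]]) (use Wd[OF that] P(1)[OF j] in \<open>simp add: density_def\<close>)
  have "(\<Sum>i<N. ?F i y) = 0" for y
  proof (cases "y \<in> cim (b j)")
   case True
   have x: "cinv (b j) y \<in> fst (b j)" by (rule cinv_b[OF bd[OF j] True])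
   \<comment> \<open>The derivatives of the members of a partition of unity add up to the derivative
     of 1.\<close>
   have pz: "(\<Sum>i<N. pd (cim (b j)) l (%y. rh i (cinv (b j) y)) y) = 0" if l: "l < n" for l
   proof -
    note o = bchart_opn[OF bd[OF j]]
    have "hpd (%y. rh i (cinv (b j) y)) l (pd (cim (b j)) l (%y. rh i (cinv (b j) y)) y) y" if "i < N" for i
     by (rule Ck_hpd[OF msm_Ck[OF P(2)[OF that] P(1)[OF j], of "Suc 0", unfolded n] o l True])
    then have "hpd (%y. \<Sum>i<N. rh i (cinv (b j) y)) l (\<Sum>i<N. pd (cim (b j)) l (%y. rh i (cinv (b j) y)) y) y"
     by (intro DERIV_sum) simp
    from pd_eq[OF o True l this] have "(\<Sum>i<N. pd (cim (b j)) l (%y. rh i (cinv (b j) y)) y) = pd (cim (b j)) l (%y. \<Sum>i<N. rh i (cinv (b j) y)) y" by simp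
    also have "\<dots> = 0"
    proof (rule pd_eq[OF o True l])
     have e: "1 = (\<Sum>i<N. rh i (cinv (b j) y))" if "y \<in> cim (b j)" for y
      using rs cinv_b[OF bd[OF j] that] fst_b_subset[OF bd[OF j]] by auto
     show "hpd (%y. \<Sum>i<N. rh i (cinv (b j) y)) l 0 y"
      by (rule hpd_cong[where f = "%y. 1", OF o True l _ e]) simp
    qed
    finally show ?thesis .
   qed
   have "(\<Sum>i<N. cf S (W i) (b j) (cinv (b j) y)) = (\<Sum>i<N. \<Sum>l<n. pd (cim (b j)) l (%y. rh i (cinv (b j) y)) y *
     ((-1) ^ l * Tform \<nu> s [a1, a2] (cinv (b j) y) (map (cbasis S (b j) (cinv (b j) y)) (omit l [0..<n]))))"
    unfolding W_def
    by (intro sum.cong refl) (simp add: cf_wedge[OF nq P(2) P(1)[OF j] x] snd_cinv[OF S P(1)[OF j] True] mult_ac)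
   also have "\<dots> = (\<Sum>l<n. (\<Sum>i<N. pd (cim (b j)) l (%y. rh i (cinv (b j) y)) y) *
     ((-1) ^ l * Tform \<nu> s [a1, a2] (cinv (b j) y) (map (cbasis S (b j) (cinv (b j) y)) (omit l [0..<n]))))"
    by (subst sum.swap) (simp only: sum_distrib_right)
   also have "\<dots> = 0" by (simp add: pz)
   finally show ?thesis using True by (simp flip: sum_distrib_left)
  qed simp
  then show "(\<Sum>i<N. chart_integral S (b j) (rh j) (W i)) = 0"
   unfolding chart_integral_wint wint_def using RInt_sum[of "{..<N}" n ?F] cs by (simp add: RInt_zero)
 qed
 finally have z: "(\<Sum>i<N. chart_integral S (b i) (%x. 1) (W i)) = 0" .
 have "(\<Sum>i<N. wint (b i) (pw (b i) (rh i)) (%y. \<Sum>j<n. (-1) ^ j * pd (cim (b i)) j (bcoef (b i) (d i) \<nu> s a1 a2 j) y)) =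
   (\<Sum>i<N. - chart_integral S (b i) (%x. 1) (W i))"
  unfolding W_def by (intro sum.cong refl divergence_integral[OF nq bd \<nu> s a P(2) K1 K2 K3]) auto
 then show ?thesis using z by (simp add: sum_negf)
qed

end

section \<open>Local representatives of the forms on the Grassmannian\<close>

context tube
begin

lemma gr_integral_Tform:
 assumes s: "s \<in> E"
  and us: "length us = length as" "\<forall>u\<in>set us. vector_field M u" "\<forall>i<length as. \<forall>x\<in>pts S. (us ! i) (s x) = xi s (as ! i) x"
  and al: "diff_form M (length as + n) al"
 shows "gr_integral M (%p vs. al p (map (%u. u p) us @ vs)) (gr_class M S s) = mfd_integral S (Tform al s as)"
proof -
 let ?\<beta> = "%p vs. al p (map (%u. u p) us @ vs)"
 have co: "compact_oriented Rn (mdim S) S" using S comp by (simp add: compact_oriented_def)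
 have dens: "density S' (pullback S' M s' ?\<beta>)"
  if S': "omfd S'" and d': "mdim S' = mdim S" and s': "smooth_map S' M s'" for S' :: "'s smfd" and s'
 proof -
  have "density S' (%x ws. al (s' x) (map (%u. u x) (map (%u x. u (s' x)) us) @ map (tmap S' M s' x) ws))"
   by (rule density_pull[OF S' M s']) (use al us d' n vector_field_along[OF S' M s'] in auto)
  then show ?thesis by (simp add: pullback_def[abs_def] o_def)
 qed
 have "gr_integral M ?\<beta> (gr_class M S s) = mfd_integral S (pullback S M s ?\<beta>)"
  by (rule gr_integral_class[OF co M sec_embedding[OF s] dens])
 also have "\<dots> = mfd_integral S (Tform al s as)"
 proof (rule mfd_integral_cong[OF S])
  fix c x assume "c \<in> matlas S" "x \<in> fst c"
  then have "x \<in> pts S" using chart_subset[OF S] by blast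
  then have "map (%u. u (s x)) us = map (%a. xi s a x) as" using us by (auto intro!: nth_equalityI)
  then show "cf S (pullback S M s ?\<beta>) c x = cf S (Tform al s as) c x"
   by (simp add: cf_def pullback_def Tform_def)
 qed
 finally show ?thesis .
qed

text \<open>\<open>\<Theta>\<close> is known on fundamental fields only. Extending the variation
  fields turns the tangent vectors of the chart into such fields, and a suitable choice of
  \<open>\<Theta>\<close> and \<open>al\<close> covers both \<open>\<eta>\<close> and
  \<open>\<omega>\<close>.\<close>

lemma chart_rep_Tform:
 assumes s: "s \<in> E" and as: "set as <= E" and al: "diff_form M (length as + n) al"
  and \<Theta>: "!!us. length us = length as ==> \<forall>u\<in>set us. vector_field M u ==>
   \<Theta> (gr_class M S s) (map (%u. fundamental M u (gr_class M S s)) us) =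
    gr_integral M (%p vs. al p (map (%u. u p) us @ vs)) (gr_class M S s)"
 shows "chart_rep M S T \<Theta> s as = mfd_integral S (Tform al s as)"
proof -
 obtain us where us: "length us = length as" "\<forall>u\<in>set us. vector_field M u"
  "\<forall>i<length as. \<forall>x\<in>pts S. (us ! i) (s x) = xi s (as ! i) x" using Tform_extension[OF s as] by blast
 have "map (chart_tangent M S T s) as = map (%u. fundamental M u (gr_class M S s)) us"
 proof (rule nth_equalityI)
  fix i assume "i < length (map (chart_tangent M S T s) as)"
  then have i: "i < length as" by simp
  have "chart_tangent M S T s (as ! i) = fundamental M (us ! i) (gr_class M S s)"
   by (rule chart_tangent_fundamental[OF s]) (use us(3) i in blast)
  then show "map (chart_tangent M S T s) as ! i = map (%u. fundamental M u (gr_class M S s)) us ! i"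
   using i us(1) by simp
 qed (simp add: us(1))
 then show ?thesis unfolding chart_rep_def using \<Theta>[OF us(1,2)] gr_integral_Tform[OF s us al] by simp
qed

text \<open>Addition in the model space is fibrewise, so the variation field depends linearly on the
  direction and the integrand inherits this in its first slot.\<close>

lemma Tform_integral_line:
 assumes s: "s \<in> E" and a: "a \<in> E" "b \<in> E" and al: "diff_form M (Suc n) al"
 shows "mfd_integral S (Tform al s [line S T a t b]) = mfd_integral S (Tform al s [a]) + t * mfd_integral S (Tform al s [b])"
proof -
 obtain N \<beta> d rh where p: "partition_of_unity S N \<beta> rh" "\<forall>i<N. (\<beta> i, d i) \<in> T" using ex_pou by blast
 have l: "line S T a t b \<in> E" by (rule line_in_E[OF a])
 have dens: "density S (Tform al s [x])" if "x \<in> E" for x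
  by (rule Tform_density[OF s]) (use that al in auto)
 have "wint (\<beta> i) (pw (\<beta> i) (rh i)) (%y. cf S (Tform al s [line S T a t b]) (\<beta> i) (cinv (\<beta> i) y)) =
   wint (\<beta> i) (pw (\<beta> i) (rh i)) (%y. cf S (Tform al s [a]) (\<beta> i) (cinv (\<beta> i) y)) +
   t * wint (\<beta> i) (pw (\<beta> i) (rh i)) (%y. cf S (Tform al s [b]) (\<beta> i) (cinv (\<beta> i) y))" if i: "i < N" for i
 proof -
  have bd: "(\<beta> i, d i) \<in> T" using p(2) i by blast
  obtain K where w: "weight (\<beta> i) K (pw (\<beta> i) (rh i))" using weight_pw[OF p(1) i] by blast
  have c: "continuous_on (cim (\<beta> i)) (%y. cf S (Tform al s [x]) (\<beta> i) (cinv (\<beta> i) y))" if "x \<in> E" for x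
   using dens[OF that] T2(1)[OF bd] by (simp add: density_def)
  show ?thesis unfolding wint_lin[OF w bd c[OF a(1)] c[OF a(2)], symmetric]
  proof (rule wint_cong)
   fix y assume y: "y \<in> cim (\<beta> i)"
   define x where "x = cinv (\<beta> i) y"
   have x: "x \<in> fst (\<beta> i)" "snd (\<beta> i) x = y"
    using cinv_b[OF bd y] snd_cinv[OF S T2(1)[OF bd] y] by (auto simp: x_def)
   have xS: "x \<in> pts S" using fst_b_subset[OF bd] x by blast
   have sm: "smooth_map S M s" by (rule secD(1)[OF s])
   have sx: "s x \<in> pts M" using sm xS by (auto simp: smooth_map_def continuous_map_def)
   have xl: "xi s (line S T a t b) x = (%e j. xi s a x e j + t * xi s b x e j)"
    unfolding xi_cvec[OF s l bd x(1)] xi_cvec[OF s a(1) bd x(1)] xi_cvec[OF s a(2) bd x(1)] x(2)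
     dot_line[OF a bd y] cvec_lin ..
   let ?ws = "map (tmap S M s x) (map (cbasis S (\<beta> i) x) [0..<mdim S])"
   have tf: "tform M (s x) (Suc n) (al (s x))" by (rule diff_form_tform[OF al sx])
   have "al (s x) ((xi s a x # ?ws)[0 := (%e j. xi s a x e j + t * xi s b x e j)]) =
     al (s x) ((xi s a x # ?ws)[0 := xi s a x]) + t * al (s x) ((xi s a x # ?ws)[0 := xi s b x])"
    by (rule tf[unfolded tform_def, rule_format, THEN conjunct1, rule_format])
     (use xi_tspace[OF s a(1) xS] xi_tspace[OF s a(2) xS] tmap_tspace[OF S M sm xS] n in auto)
   then show "cf S (Tform al s [line S T a t b]) (\<beta> i) (cinv (\<beta> i) y) =
     cf S (Tform al s [a]) (\<beta> i) (cinv (\<beta> i) y) + t * cf S (Tform al s [b]) (\<beta> i) (cinv (\<beta> i) y)"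
    unfolding x_def[symmetric] by (simp add: cf_def Tform_def xl)
  qed
 qed
 then show ?thesis
  unfolding mfd_integral_eq[OF S comp dens[OF l] p(1)] mfd_integral_eq[OF S comp dens[OF a(1)] p(1)]
   mfd_integral_eq[OF S comp dens[OF a(2)] p(1)] chart_integral_wint
  by (simp add: sum.distrib sum_distrib_left)
qed

text \<open>The pointwise identity is integrated over a partition of unity subordinate to bundle
  charts. The same derivative integrands \<open>I'\<close> represent both directional derivatives,
  evaluated at the two orders of the directions.\<close>

lemma exterior_derivative_transgression:
 assumes mn: "m = Suc (Suc n)" and \<nu>: "diff_form M (Suc n) \<nu>" and \<mu>: "diff_form M (Suc (Suc n)) \<mu>"
  and d\<nu>: "!!p vs. p \<in> pts M ==> set vs <= tspace M p ==> length vs = Suc (Suc n) ==> ext_deriv M \<nu> p vs = \<mu> p vs"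
  and U: "openin tau U" and s: "s \<in> U" and a: "a1 \<in> E" "a2 \<in> E"
  and \<theta>: "!!s a. s \<in> U ==> a \<in> E ==> \<theta> s [a] = mfd_integral S (Tform \<nu> s [a])"
 shows "mfd_integral S (Tform \<mu> s [a1, a2]) = dirderiv S T \<theta> s [a1, a2] - dirderiv S T \<theta> s [a2, a1]"
proof -
 obtain N b d rh where p: "partition_of_unity S N b rh" "\<forall>i<N. (b i, d i) \<in> T" using ex_pou by blast
 have bd: "(b i, d i) \<in> T" if "i < N" for i using p(2) that by blast
 note w = weight_pw[OF p(1)]
 have UE: "U <= E" using openin_subset[OF U] topspace_section by simp
 have sE: "s \<in> E" using s UE by blast
 let ?w = "%i. pw (b i) (rh i)"
 have \<nu>1: "diff_form M (Suc 0 + n) \<nu>" using \<nu> by simp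
 have J: "jet (b i) (d i) (Suc 0) (jform (b i) (d i) (Suc 0) \<nu>)" if "i < N" for i
  using jet_form[OF bd[OF that] \<nu>1] by (simp add: jform_def[abs_def])
 have "rep U N b d ?w (Suc 0) \<theta> (%i. jform (b i) (d i) (Suc 0) \<nu>)"
  unfolding rep_def
 proof (intro conjI allI impI ballI)
  show "jet (b i) (d i) (Suc 0) (jform (b i) (d i) (Suc 0) \<nu>)" if "i < N" for i by (rule J[OF that])
  fix s as assume s: "s \<in> U" and as: "set as <= E & length as = Suc 0"
  then obtain x where x: "as = [x]" "x \<in> E" by (cases as) auto
  have "s \<in> E" using s UE by blast
  from Tform_integral[OF p(1) bd this, of as \<nu>]
  show "\<theta> s as = (\<Sum>i<N. wint (b i) (?w i) (jform (b i) (d i) (Suc 0) \<nu> s ((!) as)))"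
   using \<theta>[OF s x(2)] x \<nu> by simp
 qed
 from rep_deriv[OF U bd w this] obtain I' where I': "rep U N b d ?w (Suc (Suc 0)) (dirderiv S T \<theta>) I'"
  "\<forall>i<N. jet_deriv (b i) (Suc 0) (jform (b i) (d i) (Suc 0) \<nu>) (I' i)" by blast
 have dd: "dirderiv S T \<theta> s [x, y] = (\<Sum>i<N. wint (b i) (?w i) (I' i s ((!) [x, y])))" if "x \<in> E" "y \<in> E" for x y
  using I'(1) s that by (simp add: rep_def)
 have jI: "jet (b i) (d i) (Suc (Suc 0)) (I' i)" if "i < N" for i using I'(1) that by (simp add: rep_def)
 have cI: "continuous_on (cim (b i)) (I' i s ((!) [x, y]))" if "i < N" "x \<in> E" "y \<in> E" for i x y
  by (rule Ck_continuous[OF jet_Ck[OF jI[OF that(1)] bd[OF that(1)] sE]])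
   (use that(2,3) in \<open>auto simp: less_Suc_eq\<close>)
 let ?div = "%i y. \<Sum>j<n. (-1) ^ j * pd (cim (b i)) j (bcoef (b i) (d i) \<nu> s a1 a2 j) y"
 have cd: "continuous_on (cim (b i)) (?div i)" if "i < N" for i
  by (intro continuous_intros) (use Ck_continuous[OF Ck_pd[OF bcoef_Ck[OF bd[OF that] \<nu> sE a]]] in auto)
 have D: "((%t. jform (b i) (d i) (Suc 0) \<nu> (line S T s t x) ((!) [z]) y) has_real_derivative I' i s ((!) [x, z]) y) (at 0)"
  if i: "i < N" and x: "x \<in> E" and z: "z \<in> E" and y: "y \<in> cim (b i)" for i x z y
 proof -
  have e: "(!) [x, z] = case_nat x ((!) [z])" by (auto simp: fun_eq_iff split: nat.split)
  have "\<forall>l<Suc 0. [z] ! l \<in> E" using z by simp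
  then show ?thesis
   using I'(2)[rule_format, OF i, unfolded jet_deriv_def, rule_format, OF sE x, of "(!) [z]" y 0] y
   unfolding e line_0_eq[OF sE x] by blast
 qed
 have id: "jform (b i) (d i) (Suc (Suc 0)) \<mu> s ((!) [a1, a2]) y =
   (I' i s ((!) [a1, a2]) y + (-1) * I' i s ((!) [a2, a1]) y) + 1 * ?div i y" if i: "i < N" and y: "y \<in> cim (b i)" for i y
 proof -
  have "jform (b i) (d i) (Suc (Suc 0)) \<mu> s ((!) [a1, a2]) y =
    I' i s ((!) [a1, a2]) y - I' i s ((!) [a2, a1]) y + ?div i y"
  proof (rule form_derivative_identity[where A = "(!) [a1, a2]" and ?A1.0 = "(!) [a2]" and ?A2.0 = "(!) [a1]"
     and b = "b i" and d = "d i" and \<nu> = \<nu> and \<mu> = \<mu> and s = s and ?a1.0 = a1 and ?a2.0 = a2 and y = y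
     and ?D1.0 = "I' i s ((!) [a1, a2]) y" and ?D2.0 = "I' i s ((!) [a2, a1]) y"])
   show "m = Suc (Suc n)" by (rule mn)
   show "diff_form M (Suc n) \<nu>" by (rule \<nu>)
   show "diff_form M (Suc (Suc n)) \<mu>" by (rule \<mu>)
   show "ext_deriv M \<nu> p vs = \<mu> p vs"
    if "p \<in> pts M" "set vs <= tspace M p" "length vs = Suc (Suc n)" for p vs
    by (rule d\<nu>[OF that])
   show "(b i, d i) \<in> T" by (rule bd[OF i])
   show "y \<in> cim (b i)" by (rule y)
   show "s \<in> E" by (rule sE)
   show "a1 \<in> E" by (rule a(1))
   show "a2 \<in> E" by (rule a(2))
   show "((%t. jform (b i) (d i) (Suc 0) \<nu> (line S T s t a1) ((!) [a2]) y) has_real_derivative I' i s ((!) [a1, a2]) y) (at 0)"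
    by (rule D[OF i a y])
   show "((%t. jform (b i) (d i) (Suc 0) \<nu> (line S T s t a2) ((!) [a1]) y) has_real_derivative I' i s ((!) [a2, a1]) y) (at 0)"
    by (rule D[OF i a(2) a(1) y])
   show "[a2] ! 0 = a2" by (rule nth_Cons_0)
   show "[a1] ! 0 = a1" by (rule nth_Cons_0)
   show "[a1, a2] ! 0 = a1" by (rule nth_Cons_0)
   show "[a1, a2] ! Suc 0 = a2" by simp
  qed
  also have "\<dots> = (I' i s ((!) [a1, a2]) y + (-1) * I' i s ((!) [a2, a1]) y) + 1 * ?div i y"
  proof -
   have "p - q + r = (p + (-1) * q) + 1 * r" for p q r :: real by simp
   then show ?thesis .
  qed
  finally show ?thesis .
 qed
 have "mfd_integral S (Tform \<mu> s [a1, a2]) = (\<Sum>i<N. wint (b i) (?w i) (jform (b i) (d i) (Suc (Suc 0)) \<mu> s ((!) [a1, a2])))"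
  using Tform_integral[OF p(1) bd sE, of "[a1, a2]" \<mu>] a \<mu> by simp
 also have "\<dots> = (\<Sum>i<N. wint (b i) (?w i) (I' i s ((!) [a1, a2])) - wint (b i) (?w i) (I' i s ((!) [a2, a1])) + wint (b i) (?w i) (?div i))"
 proof (intro sum.cong refl)
  fix i assume "i \<in> {..<N}"
  then have i: "i < N" by simp
  obtain K where K: "weight (b i) K (?w i)" using w[OF i] by blast
  have c2: "continuous_on (cim (b i)) (%y. I' i s ((!) [a1, a2]) y + (-1) * I' i s ((!) [a2, a1]) y)"
   by (intro continuous_intros cI i a)
  have "wint (b i) (?w i) (jform (b i) (d i) (Suc (Suc 0)) \<mu> s ((!) [a1, a2])) =
    wint (b i) (?w i) (%y. (I' i s ((!) [a1, a2]) y + (-1) * I' i s ((!) [a2, a1]) y) + 1 * ?div i y)"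
   by (rule wint_cong[OF id[OF i]])
  also have "\<dots> = wint (b i) (?w i) (I' i s ((!) [a1, a2])) - wint (b i) (?w i) (I' i s ((!) [a2, a1])) + wint (b i) (?w i) (?div i)"
   unfolding wint_lin[OF K bd[OF i] c2 cd[OF i]] wint_lin[OF K bd[OF i] cI[OF i a] cI[OF i a(2,1)]] by simp
  finally show "wint (b i) (?w i) (jform (b i) (d i) (Suc (Suc 0)) \<mu> s ((!) [a1, a2])) = \<dots>" .
 qed
 also have "\<dots> = dirderiv S T \<theta> s [a1, a2] - dirderiv S T \<theta> s [a2, a1] + (\<Sum>i<N. wint (b i) (?w i) (?div i))"
  by (simp add: dd a sum.distrib sum_subtractf)
 also have "(\<Sum>i<N. wint (b i) (?w i) (?div i)) = 0"
 \<comment> \<open>For \<open>n = 0\<close> the divergence is an empty sum. For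
   \<open>n = Suc q\<close> it comes from a form of degree \<open>q\<close>, and
   \<open>stokes\<close> applies.\<close>
 proof (cases n)
  case 0
  then have e: "{..<n} = {}" by simp
  have "wint (b i) (?w i) (%y. 0) = 0" for i unfolding wint_def mult_zero_right if_cancel by (rule RInt_zero)
  then show ?thesis unfolding e by simp
 next
  case (Suc q)
  show ?thesis by (rule stokes[OF Suc p(1) bd \<nu> sE a])
 qed
 finally show ?thesis by simp
qed

end

section \<open>The charts of the orbit and the exterior derivative of \<open>\<eta>\<close>\<close>

text \<open>In the charts of a tubular neighbourhood the zero section has the coordinates of
  \<open>S\<close>, so an open subset of \<open>Rn (mdim S)\<close> consists of points whose
  coordinate \<open>mdim M\<close> is 0. A small shift of that coordinate contradicts a larger
  \<open>mdim S\<close>.\<close>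

lemma tubular_dim:
 assumes M: "omfd M" and S: "omfd S" and tub: "tubular M S gm \<pi> T" and ne: "pts S ~= {}"
 shows "mdim S <= mdim M"
proof (rule ccontr)
 assume "\<not> mdim S <= mdim M"
 then have lt: "mdim M < mdim S" by simp
 obtain x where x: "x \<in> pts S" using ne by blast
 have "pts S = (\<Union>(b, d)\<in>T. fst b)" using tub by (simp add: tubular_def)
 then obtain b d where bd: "(b, d) \<in> T" "x \<in> fst b" using x by blast
 have "\<forall>(b, d)\<in>T. b \<in> matlas S & d \<in> matlas M & (\<forall>x\<in>fst b. gm x \<in> fst d & snd d (gm x) = snd b x)"
  using tub unfolding tubular_def by fast
 from bspec[OF this bd(1), unfolded prod.case]
 have b: "b \<in> matlas S" and d: "d \<in> matlas M" and g: "\<forall>x\<in>fst b. gm x \<in> fst d & snd d (gm x) = snd b x" by auto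
 have z: "z (mdim M) = 0" if zb: "z \<in> cim b" for z
 proof -
  obtain x' where x': "x' \<in> fst b" "z = snd b x'" using zb by blast
  then have "z = snd d (gm x')" "gm x' \<in> fst d" using g by auto
  then show ?thesis using snd_Rn[OF M d] by (auto simp: Rn_iff)
 qed
 have xb: "snd b x \<in> cim b" using bd(2) by (rule imageI)
 obtain de where de: "0 < de" "boxn (mdim S) (snd b x) de <= cim b"
  by (rule opn_contains_boxn[OF cim_opn[OF S b] xb])
 have "(snd b x)(mdim M := de / 2) \<in> boxn (mdim S) (snd b x) de"
  using z[OF xb] de(1) lt snd_Rn[OF S b bd(2)] by (auto simp: boxn_def Rn_iff)
 then have "((snd b x)(mdim M := de / 2)) (mdim M) = 0" using z de(2) by blast
 then show False using de(1) by simp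
qed

text \<open>Elements of \<open>Diff0 M\<close> are diffeomorphisms, because a connected component
  lies inside the underlying space of the topology. The dimension drops by one for the hypersurface
  and by one more for its boundary.\<close>

lemma orbit_member:
 assumes M: "omfd M" and G: "G \<in> Gr_ex M" and H: "H \<in> Diff0_orbit M G" and SH: "(S, gm) \<in> H"
 shows "compact_oriented Rn (mdim M - 2) S & smooth_map S M gm"
proof -
 obtain W F where W: "G = gr_class M (boundary_mfd W) F" "compact_oriented Hn (mdim M - 1) W"
  using G unfolding Gr_ex_def by blast
 obtain f where f: "f \<in> Diff0 M" "H = act f G" using H unfolding Diff0_orbit_def by blast
 have "Diff0 M <= topspace (Diff_topology M)" unfolding Diff0_def by (rule connected_component_of_subset_topspace)
 also have "\<dots> <= Diff M" unfolding Diff_topology_def topology_generated_by_topspace by blast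
 finally have fs: "smooth_map M M f" using f(1) by (auto simp: Diff_def diffeo_def)
 obtain gm0 where g: "(S, gm0) \<in> G" "\<forall>x\<in>pts S. gm x = f (gm0 x)"
  using SH unfolding f(2) act_def by blast
 have "mdim (boundary_mfd W) = mdim M - 2" using W(2) by (simp add: boundary_mfd_def compact_oriented_def)
 then have S: "compact_oriented Rn (mdim M - 2) S" and e: "embedding S M gm0"
  using g(1) unfolding W(1) gr_class_def by auto
 have So: "omfd S" using S by (simp add: compact_oriented_def)
 have "smooth_map S M gm0" using e by (simp add: embedding_def)
 from smooth_map_compose[OF So M M this fs] have "smooth_map S M gm"
  by (rule smooth_map_cong[OF So]) (use g(2) in auto)
 then show ?thesis using S by simp
qed

text \<open>The dimension of \<open>S\<close> is read off from a representative of the class of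
  \<open>s\<close> in \<open>\<O>\<close>. If \<open>S\<close> has points, \<open>s\<close> is an
  embedding and represents its own class; if \<open>S\<close> is empty, \<open>gm\<close> represents
  it, as all conditions on points are void.\<close>

lemma frechet_chart_tube:
 assumes M: "omfd M" "2 <= mdim M"
  and mem: "!!H S gm. H \<in> \<O> ==> (S, gm) \<in> H ==> compact_oriented Rn (mdim M - 2) S"
  and fc: "frechet_chart M \<O> S gm \<pi> T U" and s: "s \<in> U"
 shows "tube M S gm \<pi> T (mdim M - 2) (mdim M)"
proof -
 have S: "omfd S" "compact_space (mtop S)" and e: "embedding S M gm" and tub: "tubular M S gm \<pi> T"
  and U: "openin (section_topology M S \<pi> T) U" and gO: "gr_class M S s \<in> \<O>"
  using fc s by (auto simp: frechet_chart_def compact_oriented_def)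
 have "\<exists>gm'. (S, gm') \<in> gr_class M S s"
 proof (cases "pts S = {}")
  case True
  then have "(S, gm) \<in> gr_class M S s"
   using S e oriented_diffeo_id[OF S(1)] by (auto simp: gr_class_def compact_oriented_def)
  then show ?thesis by blast
 next
  case False
  interpret tube M S gm \<pi> T "mdim S" "mdim M"
   using M S tub tubular_dim[OF M(1) S(1) tub False] by unfold_locales auto
  have "s \<in> E" using openin_subset[OF U] s topspace_section by blast
  then show ?thesis using in_gr_class by blast
 qed
 then have "mdim S = mdim M - 2" using mem[OF gO] by (auto simp: compact_oriented_def)
 then show ?thesis using M S tub by unfold_locales auto
qed

theorem theorem2p4:
  fixes M :: "'a smfd" and \<mu> \<nu> :: "'a form"
    and \<O> :: "('s, 'a) gr_point set" and \<omega> :: "('s, 'a) gr_form"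
  assumes M: "oriented_mfd Rn M" "2 \<le> mdim M"
    and \<mu>: "volume_form M \<mu>"
    and \<nu>: "diff_form M (mdim M - 1) \<nu>"
    and d\<nu>: "\<forall>p\<in>topspace (mtop M). \<forall>vs. set vs \<subseteq> tspace M p \<and> length vs = mdim M \<longrightarrow>
               ext_deriv M \<nu> p vs = \<mu> p vs"
    and \<O>: "\<exists>G\<in>Gr_ex M. \<O> = Diff0_orbit M G"
    and \<omega>: "gr_diff_form M \<O> 2 \<omega>"
    and MW: "\<forall>G\<in>\<O>. \<forall>u v. vector_field M u \<and> vector_field M v \<longrightarrow>
               \<omega> G [fundamental M u G, fundamental M v G] =
                 gr_integral M (contract v (contract u \<mu>)) G"
  shows "let defines_\<eta> = (\<lambda>\<eta> :: ('s, 'a) gr_form. \<forall>G\<in>\<O>. \<forall>u. vector_field M u \<longrightarrow>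
               \<eta> G [fundamental M u G] = gr_integral M (contract u \<nu>) G)
         in (\<exists>\<eta>. defines_\<eta> \<eta>) \<and>
            (\<forall>\<eta>. defines_\<eta> \<eta> \<longrightarrow> gr_diff_form M \<O> 1 \<eta> \<and> gr_ext_deriv M \<O> 1 \<eta> \<omega>)"
proof -
 define n where "n = mdim M - 2"
 have mn: "mdim M = Suc (Suc n)" using M(2) by (simp add: n_def)
 have \<nu>n: "diff_form M (Suc n) \<nu>" using \<nu> mn by simp
 have \<mu>n: "diff_form M (Suc (Suc n)) \<mu>" using \<mu> mn by (simp add: volume_form_def)
 have mem: "compact_oriented Rn n S & smooth_map S M gm" if "H \<in> \<O>" "(S, gm) \<in> H" for H :: "('s, 'a) gr_point" and S gm
  using orbit_member[OF M(1)] \<O> that unfolding n_def by blast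
 have tube: "tube M S gm \<pi> T n (mdim M)" if "frechet_chart M \<O> S gm \<pi> T U" "s \<in> U" for S gm \<pi> T U s
  unfolding n_def by (rule frechet_chart_tube[OF M _ that]) (use mem n_def in blast)
 define P where "P \<eta> \<longleftrightarrow> (\<forall>G\<in>\<O>. \<forall>u. vector_field M u -->
  \<eta> G [fundamental M u G] = gr_integral M (contract u \<nu>) G)" for \<eta> :: "('s, 'a) gr_form"
 \<comment> \<open>A 1-form receives a one-element list, so its argument is \<open>hd Xs\<close>.
   Any field inducing this tangent vector may be chosen, by
   \<open>gr_integral_tangential\<close>.\<close>
 define \<eta>0 :: "('s, 'a) gr_form" where
  "\<eta>0 G Xs = gr_integral M (contract (SOME u. vector_field M u & hd Xs = fundamental M u G) \<nu>) G" for G Xs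
 have "P \<eta>0" unfolding P_def
 proof (intro ballI allI impI)
  fix G :: "('s, 'a) gr_point" and u assume G: "G \<in> \<O>" and u: "vector_field M u"
  define v where "v = (SOME v. vector_field M v & fundamental M u G = fundamental M v G)"
  have v: "vector_field M v & fundamental M u G = fundamental M v G"
   unfolding v_def by (rule someI[of _ u]) (simp add: u)
  have "gr_integral M (contract u \<nu>) G = gr_integral M (contract v \<nu>) G"
   by (rule gr_integral_tangential[of M n]) (use M(1) mn \<nu> mem[OF G] u v in auto)
  then show "\<eta>0 G [fundamental M u G] = gr_integral M (contract u \<nu>) G" by (simp add: \<eta>0_def v_def)
 qed
 moreover have "gr_diff_form M \<O> 1 \<eta> & gr_ext_deriv M \<O> 1 \<eta> \<omega>" if \<eta>: "P \<eta>" for \<eta>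
 proof
  have rep: "chart_rep M S T \<eta> s [a] = mfd_integral S (tube.Tform M S T \<nu> s [a])"
   if fc: "frechet_chart M \<O> S gm \<pi> T U" and s: "s \<in> U" and a: "a \<in> bundle_sections M S \<pi> T" for S gm \<pi> T U s a
  proof -
   interpret tube M S gm \<pi> T n "mdim M" by (rule tube[OF fc s])
   have U: "openin tau U" and gO: "gr_class M S s \<in> \<O>" using fc s by (auto simp: frechet_chart_def)
   have sE: "s \<in> E" using openin_subset[OF U] s topspace_section by blast
   show ?thesis
   proof (rule chart_rep_Tform[OF sE])
    fix us :: "('a => 'a tvec) list" assume us: "length us = length [a]" "\<forall>u\<in>set us. vector_field M u"
    then obtain u where u: "us = [u]" "vector_field M u" by (cases us) auto
    show "\<eta> (gr_class M S s) (map (%u. fundamental M u (gr_class M S s)) us) =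
     gr_integral M (%p vs. \<nu> p (map (%u. u p) us @ vs)) (gr_class M S s)"
     using \<eta> gO u by (simp add: P_def contract_def[abs_def])
   qed (use a \<nu>n in auto)
  qed
  show "gr_diff_form M \<O> 1 \<eta>"
   unfolding gr_diff_form_def Let_def
  proof (intro allI impI)
   fix S :: "'s smfd" and gm \<pi> T U assume fc: "frechet_chart M \<O> S gm \<pi> T U"
   let ?E = "bundle_sections M S \<pi> T" and ?tau = "section_topology M S \<pi> T"
   have U: "openin ?tau U" using fc by (simp add: frechet_chart_def)
   show "(\<forall>s\<in>U. \<forall>as. set as <= ?E & length as = 1 -->
     (\<forall>i<1. \<forall>a\<in>?E. \<forall>b\<in>?E. \<forall>t.
      chart_rep M S T \<eta> s (as[i := line S T a t b]) = chart_rep M S T \<eta> s (as[i := a]) + t * chart_rep M S T \<eta> s (as[i := b])) &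
     (\<forall>i<1. \<forall>j<1. i ~= j & as ! i = as ! j --> chart_rep M S T \<eta> s as = 0)) &
   (\<forall>r.
     (\<forall>s\<in>U. \<forall>a\<in>?E. \<forall>as. set as <= ?E & length as = r + 1 -->
      (%t. (dirderiv S T ^^ r) (chart_rep M S T \<eta>) (line S T s t a) as) differentiable (at 0)) &
     continuous_map
      (prod_topology (subtopology ?tau U) (product_topology (%_. ?tau) {..<r + 1})) euclideanreal
      (%(s, x). (dirderiv S T ^^ r) (chart_rep M S T \<eta>) s (map x [0..<r + 1])))" (is "?A & (\<forall>r. ?B r)")
   \<comment> \<open>Without a point of \<open>U\<close> nothing ties the dimension of
     \<open>S\<close> to \<open>n\<close>, but then all clauses are trivial.\<close>
   proof (cases "U = {}")
    case True
    then show ?thesis by (simp add: continuous_map_def)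
   next
    case False
    then obtain s0 where s0: "s0 \<in> U" by blast
    interpret tube M S gm \<pi> T n "mdim M" by (rule tube[OF fc s0])
    have UE: "U <= E" using openin_subset[OF U] topspace_section by simp
    note rep = rep[OF fc]
    have "chart_rep M S T \<eta> s as = mfd_integral S (Tform \<nu> s as)"
     if s: "s \<in> U" and as: "set as <= E" "length as = 1" for s as
    proof -
     obtain a where "as = [a]" "a \<in> E" using as by (cases as) auto
     then show ?thesis using rep[OF s] by simp
    qed
    note \<theta> = this
    have \<nu>1: "diff_form M (1 + n) \<nu>" using \<nu>n by simp
    have sm: "?B r" for r by (rule Tform_rep[OF U \<nu>1]) (rule \<theta>)
    have "chart_rep M S T \<eta> s (as[i := line S T a t b]) = chart_rep M S T \<eta> s (as[i := a]) + t * chart_rep M S T \<eta> s (as[i := b])"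
     if s: "s \<in> U" and as: "length as = 1" "i < 1" and a: "a \<in> E" "b \<in> E" for s as i a b t
    proof -
     obtain x where x: "as = [x]" "i = 0" using as by (cases as) auto
     have "s \<in> E" using s UE by blast
     from Tform_integral_line[OF this a \<nu>n] show ?thesis
      unfolding x using rep[OF s] a line_in_E[OF a] by simp
    qed
    then have ?A by auto
    then show ?thesis using sm by blast
   qed
  qed
  show "gr_ext_deriv M \<O> 1 \<eta> \<omega>"
   unfolding gr_ext_deriv_def
  proof (intro allI impI ballI)
   fix S :: "'s smfd" and gm \<pi> T U s as assume fc: "frechet_chart M \<O> S gm \<pi> T U" and s: "s \<in> U"
    and as: "set as <= bundle_sections M S \<pi> T & length as = Suc 1"
   interpret tube M S gm \<pi> T n "mdim M" by (rule tube[OF fc s])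
   have U: "openin tau U" and gO: "gr_class M S s \<in> \<O>" using fc s by (auto simp: frechet_chart_def)
   have sE: "s \<in> E" using openin_subset[OF U] s topspace_section by blast
   have "length as = Suc (Suc 0)" using as by simp
   then obtain a1 a2 where a: "as = [a1, a2]" by (cases as; cases "tl as") auto
   have aE: "a1 \<in> E" "a2 \<in> E" using as a by auto
   have "chart_rep M S T \<omega> s [a1, a2] = mfd_integral S (Tform \<mu> s [a1, a2])"
   proof (rule chart_rep_Tform[OF sE])
    fix us :: "('a => 'a tvec) list" assume us: "length us = length [a1, a2]" "\<forall>u\<in>set us. vector_field M u"
    then obtain u v where u: "us = [u, v]" "vector_field M u" "vector_field M v" by (cases us; cases "tl us") auto
    \<comment> \<open>Contraction with \<open>u\<close> comes first, so \<open>u\<close> is the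
      first argument of \<open>\<mu>\<close> and \<open>v\<close> the second; this is the order in
      which \<open>Tform\<close> lists the directions.\<close>
    show "\<omega> (gr_class M S s) (map (%u. fundamental M u (gr_class M S s)) us) =
     gr_integral M (%p vs. \<mu> p (map (%u. u p) us @ vs)) (gr_class M S s)"
     using MW gO u by (simp add: contract_def[abs_def])
   qed (use aE \<mu>n in auto)
   also have "\<dots> = dirderiv S T (chart_rep M S T \<eta>) s [a1, a2] - dirderiv S T (chart_rep M S T \<eta>) s [a2, a1]"
    by (rule exterior_derivative_transgression[OF mn \<nu>n \<mu>n _ U s aE rep[OF fc]]) (use d\<nu> mn in auto)
   finally show "chart_rep M S T \<omega> s as =
     (\<Sum>i<Suc 1. (-1) ^ i * dirderiv S T (chart_rep M S T \<eta>) s (as ! i # omit i as))"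
    unfolding a by (simp add: omit_def)
  qed
 qed
 ultimately show ?thesis unfolding Let_def P_def[symmetric] by blast
qed

end
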